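(* Let $D=\Gamma_1\times\dots\times\Gamma_n$ be a direct product of groups and let $H\le D$ be a virtually-full, virtually-coabelian subgroup of corank $r$. (1) Suppose each $\Gamma_i$ is finitely generated and $n\ge 2$. Then $H$ is finitely generated and the distortion function $\Delta$ of $H$ in $D$ satisfies $\Delta(l)\preccurlyeq l^2$. (2) Suppose each $\Gamma_i$ is finitely presented and $n\ge 3$. Then $H$ is finitely presented. (3) Suppose each $\Gamma_i$ is finitely presented and $n\ge 3$. For each $i$, let $(\alpha_i,\rho_i)$ be an area-radius pair for some finite presentation of $\Gamma_i$. Define $\alpha(l)=\max(\{l^2\}\cup\{\alpha_i(l):1\le i\le n\})$ and $\rho(l)=\max(\{l\}\cup\{\rho_i(l):1\le i\le n\})$. Then the function $l\mapsto\rho(l)^{2r}\alpha(l)$ is an isoperimetric function for $H$. (4) Suppose each $\Gamma_i$ is finitely presented and $n\ge\max\{3,2r\}$. Let $\beta_1$ and $\beta_2$ be the Dehn functions of some finite presentations of $\Gamma_1\times\dots\times\Gamma_{n-r}$ and $\Gamma_{n-r+1}\times\dots\times\Gamma_n$ respectively. Then the function $\beta$ defined by $\beta(l)=l\,\beta_1(l^2)+\beta_2(l)$ is an isoperimetric function for $H$.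
   Context: A subgroup $H\le G$ is virtually-coabelian in $G$ if there is a finite index subgroup $G'\le G$ with $[G',G']\le H$; its corank is then $\dim_{\mathbb Q}\left(\frac{G'}{G'\cap H}\otimes\mathbb Q\right)$, which is independent of the choice of $G'$. A subgroup $H$ of $D=\Gamma_1\times\dots\times\Gamma_n$ is virtually-full in $D$ if $[D:\Gamma_iH]<\infty$ for each $i$ (regarding $\Gamma_i$ as a subgroup of $D$). For a set $\mathcal X$, $\mathcal X^{\pm *}$ denotes the free monoid on $\mathcal X\sqcup\mathcal X^{-1}$ (words), and $|w|$ is word length. Let $\mathcal P=\langle\mathcal X\mid\mathcal R\rangle$ be a presentation with $\mathcal X$ finite. A word is null-homotopic if it represents the identity of the group. A $\mathcal P$-expression for a word $w$ is a finite sequence $(x_i,r_i)_{i=1}^m$ with $x_i\in\mathcal X^{\pm *}$, $r_i\in\mathcal R^{\pm1}$ such that $w$ is freely equal to $\prod_{i=1}^m x_ir_ix_i^{-1}$; its area is $m$ and its radius is $\max_i|x_i|$ (both are $0$ for the empty sequence). The area of a null-homotopic word is the minimal area of a $\mathcal P$-expression for it, and the Dehn function of $\mathcal P$ is $\delta_{\mathcal P}(l)=\max\{\mathrm{Area}(w): w \text{ null-homotopic},\ |w|\le l\}$. A pair $(\alpha,\rho)$ of functions $\mathbb N\to\mathbb N$ is an area-radius pair for $\mathcal P$ if every null-homotopic word $w$ with $|w|\le l$ has a $\mathcal P$-expression of area $\le\alpha(l)$ and radius $\le\rho(l)$. For $f,g:\mathbb N\to\mathbb N$: $f\preceq g$ means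 there is $C\in\mathbb N$ with $f(l)\le Cg(Cl+C)+Cl+C$ for all $l$. A function $\alpha$ is an isoperimetric function for a finitely presented group $G$ if $\delta_{\mathcal P}\preceq\alpha$ for some (equivalently any) finite presentation $\mathcal P$ of $G$. If $H\le G$ have finite generating sets $\mathcal Y,\mathcal X$, the distortion function of $H$ in $G$ is $\Delta(l)=\max\{d_{\mathcal Y}(1,h): h\in H,\ d_{\mathcal X}(1,h)\le l\}$, where $d$ denotes word metrics. $f\preccurlyeq g$ means there is $C\in\mathbb N$ with $f(l)\le Cg(Cl)$ for all $l$; the distortion function is well defined up to the induced equivalence under change of finite generating sets. *)

theory Defs
  imports "HOL-Algebra.Generated_Groups" "HOL-Algebra.Product_Groups" "HOL-Algebra.Free_Abelian_Groups"
    "Jordan_Normal_Form.VS_Connect"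
begin

section \<open>Words and presentations\<close>

text \<open>The letter \<open>(x, True)\<close> stands for the generator \<open>x\<close> and \<open>(x, False)\<close> for its formal inverse.\<close>

type_synonym 'x gword = "('x \<times> bool) list"

definition words :: "'x set \<Rightarrow> 'x gword set" where
  "words S = lists (S \<times> UNIV)"

definition word_inv :: "'x gword \<Rightarrow> 'x gword" where
  "word_inv w = rev (map (\<lambda>(x, b). (x, \<not> b)) w)"

text \<open>A presentation is a pair consisting of the generators and the relators.\<close>

type_synonym 'x presentation = "'x set \<times> 'x gword set"

definition finite_presentation :: "'x presentation \<Rightarrow> bool" where
  "finite_presentation P \<longleftrightarrow> finite (fst P) \<and> finite (snd P) \<and> snd P \<subseteq> words (fst P)"

inductive pres_eq :: "'x presentation \<Rightarrow> 'x gword \<Rightarrow> 'x gword \<Rightarrow> bool" for P where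
  refl: "w \<in> words (fst P) \<Longrightarrow> pres_eq P w w"
| sym: "pres_eq P v w \<Longrightarrow> pres_eq P w v"
| trans: "pres_eq P u v \<Longrightarrow> pres_eq P v w \<Longrightarrow> pres_eq P u w"
| cancel: "\<lbrakk>u \<in> words (fst P); v \<in> words (fst P); x \<in> fst P\<rbrakk>
    \<Longrightarrow> pres_eq P (u @ [(x, b), (x, \<not> b)] @ v) (u @ v)"
| relator: "\<lbrakk>u \<in> words (fst P); v \<in> words (fst P); r \<in> snd P\<rbrakk>
    \<Longrightarrow> pres_eq P (u @ r @ v) (u @ v)"

definition pres_rel :: "'x presentation \<Rightarrow> ('x gword \<times> 'x gword) set" where
  "pres_rel P = {(u, v). pres_eq P u v}"

text \<open>Without relators, the congruence is free equality of words.\<close>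

definition freely_equal :: "'x set \<Rightarrow> 'x gword \<Rightarrow> 'x gword \<Rightarrow> bool" where
  "freely_equal S u v \<longleftrightarrow> pres_eq (S, {}) u v"

definition presented_group :: "'x presentation \<Rightarrow> 'x gword set monoid" where
  "presented_group P =
    \<lparr>carrier = words (fst P) // pres_rel P,
     monoid.mult = (\<lambda>A B. \<Union>u\<in>A. \<Union>v\<in>B. pres_rel P `` {u @ v}),
     one = pres_rel P `` {[]}\<rparr>"

lemma pres_eq_words:
  assumes "snd P \<subseteq> words (fst P)" "pres_eq P u v"
  shows "u \<in> words (fst P)" "v \<in> words (fst P)"
  using assms(2,1) by (induction rule: pres_eq.induct) (auto simp: words_def)

lemma pres_eq_append:
  assumes "snd P \<subseteq> words (fst P)" "pres_eq P u v" "s \<in> words (fst P)" "t \<in> words (fst P)"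
  shows "pres_eq P (s @ u @ t) (s @ v @ t)"
  using assms(2,1,3,4)
proof (induction rule: pres_eq.induct)
  case (refl w) then show ?case by (auto intro!: pres_eq.refl simp: words_def)
next
  case (sym v w) then show ?case using pres_eq.sym by metis
next
  case (trans u v w) then show ?case using pres_eq.trans by metis
next
  case (cancel u v x b) then show ?case
    using pres_eq.cancel[of "s @ u" P "v @ t" x b] by (auto simp: words_def)
next
  case (relator u v r) then show ?case
    using pres_eq.relator[of "s @ u" P "v @ t" r] by (auto simp: words_def)
qed

lemma equiv_pres_rel:
  assumes "snd P \<subseteq> words (fst P)"
  shows "equiv (words (fst P)) (pres_rel P)"
proof (rule equivI)
  show "pres_rel P \<subseteq> words (fst P) \<times> words (fst P)"
    using pres_eq_words[OF assms] by (auto simp: pres_rel_def)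
  show "refl_on (words (fst P)) (pres_rel P)"
    by (auto simp: refl_on_def pres_rel_def intro: pres_eq.refl)
  show "Relation.sym (pres_rel P)" by (auto simp: pres_rel_def intro: symI pres_eq.sym)
  show "Relation.trans (pres_rel P)" by (auto simp: pres_rel_def intro: transI pres_eq.trans)
qed

lemma mult_presented_group:
  assumes P: "snd P \<subseteq> words (fst P)" and u: "u \<in> words (fst P)" "v \<in> words (fst P)"
  shows "pres_rel P `` {u} \<otimes>\<^bsub>presented_group P\<^esub> pres_rel P `` {v} = pres_rel P `` {u @ v}"
proof -
  have "(\<Union>u\<in>pres_rel P `` {u}. \<Union>v\<in>pres_rel P `` {v}. pres_rel P `` {u @ v}) = pres_rel P `` {u @ v}"
  proof (rule UN_equiv_class2[OF equiv_pres_rel[OF P] equiv_pres_rel[OF P] congruent2I'])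
    fix y1 z1 y2 z2 assume "(y1, z1) \<in> pres_rel P" "(y2, z2) \<in> pres_rel P"
    then have *: "pres_eq P y1 z1" "pres_eq P y2 z2" by (auto simp: pres_rel_def)
    have "[] \<in> words (fst P)" by (simp add: words_def)
    then have "pres_eq P (y1 @ y2) (z1 @ z2)"
      using pres_eq_append[OF P *(1), of "[]" y2] pres_eq_append[OF P *(2), of z1 "[]"]
        pres_eq_words[OF P *(1)] pres_eq_words[OF P *(2)] by (auto intro: pres_eq.trans)
    then show "pres_rel P `` {y1 @ y2} = pres_rel P `` {z1 @ z2}"
      using equiv_class_eq[OF equiv_pres_rel[OF P]] by (auto simp: pres_rel_def)
  qed (use u in auto)
  then show ?thesis by (simp add: presented_group_def)
qed

lemma pres_eq_word_inv:
  assumes "u \<in> words (fst P)"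
  shows "pres_eq P (word_inv u @ u) []"
  using assms
proof (induction u)
  case Nil then show ?case by (auto simp: word_inv_def words_def intro: pres_eq.refl)
next
  case (Cons a u)
  obtain x b where a: "a = (x, b)" by (cases a)
  have "pres_eq P (word_inv u @ [(x, \<not> b), (x, \<not> \<not> b)] @ u) (word_inv u @ u)"
    using Cons.prems by (intro pres_eq.cancel) (auto simp: words_def word_inv_def a)
  with Cons show ?case
    by (auto simp: word_inv_def a words_def intro: pres_eq.trans)
qed

theorem group_presented_group:
  assumes P: "snd P \<subseteq> words (fst P)"
  shows "group (presented_group P)"
proof (rule groupI)
  let ?G = "presented_group P"
  let ?c = "\<lambda>w. pres_rel P `` {w}"
  have car: "carrier ?G = ?c ` words (fst P)"
    by (auto simp: presented_group_def quotient_def)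
  have app: "u @ v \<in> words (fst P)" if "u \<in> words (fst P)" "v \<in> words (fst P)" for u v
    using that by (auto simp: words_def)
  have nil: "[] \<in> words (fst P)" by (simp add: words_def)
  have one: "\<one>\<^bsub>?G\<^esub> = ?c []" by (simp add: presented_group_def)
  note m = mult_presented_group[OF P]
  show "x \<otimes>\<^bsub>?G\<^esub> y \<in> carrier ?G" if "x \<in> carrier ?G" "y \<in> carrier ?G" for x y
    using that by (auto simp: car m app)
  show "\<one>\<^bsub>?G\<^esub> \<in> carrier ?G" by (auto simp: car one nil)
  show "x \<otimes>\<^bsub>?G\<^esub> y \<otimes>\<^bsub>?G\<^esub> z = x \<otimes>\<^bsub>?G\<^esub> (y \<otimes>\<^bsub>?G\<^esub> z)"
    if "x \<in> carrier ?G" "y \<in> carrier ?G" "z \<in> carrier ?G" for x y z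
    using that by (auto simp: car m app)
  show "\<one>\<^bsub>?G\<^esub> \<otimes>\<^bsub>?G\<^esub> x = x" if "x \<in> carrier ?G" for x
    using that by (auto simp: car one m nil)
  show "\<exists>y\<in>carrier ?G. y \<otimes>\<^bsub>?G\<^esub> x = \<one>\<^bsub>?G\<^esub>" if x: "x \<in> carrier ?G" for x
  proof -
    from x obtain u where u: "u \<in> words (fst P)" "x = ?c u" by (auto simp: car)
    have i: "word_inv u \<in> words (fst P)" using u by (auto simp: words_def word_inv_def)
    have "?c (word_inv u @ u) = ?c []"
      using equiv_class_eq[OF equiv_pres_rel[OF P]] pres_eq_word_inv[OF u(1)] by (auto simp: pres_rel_def)
    then show ?thesis using u i by (auto simp: car one m intro!: bexI[of _ "word_inv u"])
  qed
qed

definition finite_presentation_of :: "'x presentation \<Rightarrow> ('a, 'b) monoid_scheme \<Rightarrow> bool" where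
  "finite_presentation_of P G \<longleftrightarrow> finite_presentation P \<and> presented_group P \<cong> G"

text \<open>A finite set of generators may always be taken to consist of natural numbers.\<close>

definition finitely_presented :: "('a, 'b) monoid_scheme \<Rightarrow> bool" where
  "finitely_presented G \<longleftrightarrow> (\<exists>P :: nat presentation. finite_presentation_of P G)"

definition finite_generating_set :: "('a, 'b) monoid_scheme \<Rightarrow> 'a set \<Rightarrow> bool" where
  "finite_generating_set G S \<longleftrightarrow> finite S \<and> S \<subseteq> carrier G \<and> generate G S = carrier G"

definition finitely_generated :: "('a, 'b) monoid_scheme \<Rightarrow> bool" where
  "finitely_generated G \<longleftrightarrow> (\<exists>S. finite_generating_set G S)"

section \<open>Area, radius and Dehn functions\<close>

definition null_homotopic :: "'x presentation \<Rightarrow> 'x gword \<Rightarrow> bool" where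
  "null_homotopic P w \<longleftrightarrow>
    w \<in> words (fst P) \<and> pres_rel P `` {w} = \<one>\<^bsub>presented_group P\<^esub>"

definition expression_for :: "'x presentation \<Rightarrow> ('x gword \<times> 'x gword) list \<Rightarrow> 'x gword \<Rightarrow> bool" where
  "expression_for P E w \<longleftrightarrow>
    set E \<subseteq> words (fst P) \<times> (snd P \<union> word_inv ` snd P) \<and>
    freely_equal (fst P) w (concat (map (\<lambda>(x, r). x @ r @ word_inv x) E))"

definition expr_area :: "('x gword \<times> 'x gword) list \<Rightarrow> nat" where
  "expr_area E = length E"

definition expr_radius :: "('x gword \<times> 'x gword) list \<Rightarrow> nat" where
  "expr_radius E = Max (insert 0 ((\<lambda>(x, r). length x) ` set E))"

definition word_area :: "'x presentation \<Rightarrow> 'x gword \<Rightarrow> nat" where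
  "word_area P w = (LEAST m. \<exists>E. expression_for P E w \<and> expr_area E = m)"

definition dehn_function :: "'x presentation \<Rightarrow> nat \<Rightarrow> nat" where
  "dehn_function P l = Max {word_area P w |w. null_homotopic P w \<and> length w \<le> l}"

definition area_radius_pair :: "'x presentation \<Rightarrow> (nat \<Rightarrow> nat) \<Rightarrow> (nat \<Rightarrow> nat) \<Rightarrow> bool" where
  "area_radius_pair P \<alpha> \<rho> \<longleftrightarrow>
    (\<forall>l w. null_homotopic P w \<and> length w \<le> l \<longrightarrow>
      (\<exists>E. expression_for P E w \<and> expr_area E \<le> \<alpha> l \<and> expr_radius E \<le> \<rho> l))"

definition dehn_le :: "(nat \<Rightarrow> nat) \<Rightarrow> (nat \<Rightarrow> nat) \<Rightarrow> bool" where
  "dehn_le f g \<longleftrightarrow> (\<exists>C. \<forall>l. f l \<le> C * g (C * l + C) + C * l + C)"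

definition isoperimetric_function :: "('a, 'b) monoid_scheme \<Rightarrow> (nat \<Rightarrow> nat) \<Rightarrow> bool" where
  "isoperimetric_function G \<alpha> \<longleftrightarrow>
    (\<exists>P :: nat presentation. finite_presentation_of P G \<and> dehn_le (dehn_function P) \<alpha>)"

section \<open>Distortion\<close>

definition eval_word :: "('a, 'b) monoid_scheme \<Rightarrow> 'a gword \<Rightarrow> 'a" where
  "eval_word G w = foldr (\<lambda>(x, b) y. (if b then x else inv\<^bsub>G\<^esub> x) \<otimes>\<^bsub>G\<^esub> y) w \<one>\<^bsub>G\<^esub>"

definition word_metric :: "('a, 'b) monoid_scheme \<Rightarrow> 'a set \<Rightarrow> 'a \<Rightarrow> 'a \<Rightarrow> nat" where
  "word_metric G S g h =
    (LEAST k. \<exists>w\<in>words S. length w = k \<and> eval_word G w = inv\<^bsub>G\<^esub> g \<otimes>\<^bsub>G\<^esub> h)"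

definition distortion ::
  "('a, 'b) monoid_scheme \<Rightarrow> 'a set \<Rightarrow> 'a set \<Rightarrow> 'a set \<Rightarrow> nat \<Rightarrow> nat" where
  "distortion G S H T l =
    Max {word_metric (G\<lparr>carrier := H\<rparr>) T \<one>\<^bsub>G\<^esub> h |h. h \<in> H \<and> word_metric G S \<one>\<^bsub>G\<^esub> h \<le> l}"

definition distortion_le :: "(nat \<Rightarrow> nat) \<Rightarrow> (nat \<Rightarrow> nat) \<Rightarrow> bool" where
  "distortion_le f g \<longleftrightarrow> (\<exists>C. \<forall>l. f l \<le> C * g (C * l))"

section \<open>Rationalisation of abelian groups\<close>

text \<open>For an abelian group \<open>A\<close> (written multiplicatively), the subgroup of the free abelian group on
  \<open>A \<times> \<rat>\<close> generated by the relations making the pairing \<open>(a, q) \<mapsto> a \<otimes> q\<close> biadditive.\<close>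

definition tensor_relations :: "('a, 'b) monoid_scheme \<Rightarrow> (('a \<times> rat) \<Rightarrow>\<^sub>0 int) set" where
  "tensor_relations A =
    generate (free_Abelian_group (carrier A \<times> (UNIV :: rat set)))
      ({frag_of (a \<otimes>\<^bsub>A\<^esub> a', q) - frag_of (a, q) - frag_of (a', q) |a a' q.
          a \<in> carrier A \<and> a' \<in> carrier A} \<union>
       {frag_of (a, q + q') - frag_of (a, q) - frag_of (a, q') |a q q'. a \<in> carrier A})"

text \<open>The rational vector space \<open>A \<otimes> \<rat>\<close>. The scalar \<open>q\<close> acts by \<open>a \<otimes> p \<mapsto> a \<otimes> (q * p)\<close>; the image
  of a coset under the lift of this map is contained in a unique coset, which is then filled up.
  The ring multiplication and unit fields of the module record play no role.\<close>

definition rat_tensor :: "('a, 'b) monoid_scheme \<Rightarrow> (rat, (('a \<times> rat) \<Rightarrow>\<^sub>0 int) set) module" where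
  "rat_tensor A =
    (let F = free_Abelian_group (carrier A \<times> (UNIV :: rat set)); K = tensor_relations A in
     \<lparr>carrier = carrier (F Mod K),
      monoid.mult = undefined,
      one = undefined,
      zero = \<one>\<^bsub>F Mod K\<^esub>,
      add = (\<lambda>U V. U \<otimes>\<^bsub>F Mod K\<^esub> V),
      smult = (\<lambda>q U. K <#>\<^bsub>F\<^esub> frag_extend (\<lambda>(a, p). frag_of (a, q * p)) ` U)\<rparr>)"

lemma subgroup_tensor_relations:
  assumes "comm_group A"
  shows "subgroup (tensor_relations A) (free_Abelian_group (carrier A \<times> (UNIV :: rat set)))"
proof -
  interpret A: comm_group A by fact
  let ?F = "free_Abelian_group (carrier A \<times> (UNIV :: rat set))"
  show ?thesis
    unfolding tensor_relations_def
  proof (rule group.generate_is_subgroup[OF group_free_Abelian_group], safe)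
    fix a a' q assume "a \<in> carrier A" "a' \<in> carrier A"
    then show "frag_of (a \<otimes>\<^bsub>A\<^esub> a', q) - frag_of (a, q) - frag_of (a', q) \<in> carrier ?F"
      by (auto dest!: subsetD[OF keys_diff] split: if_splits)
  next
    fix a :: 'a and q q' :: rat assume "a \<in> carrier A"
    then show "frag_of (a, q + q') - frag_of (a, q) - frag_of (a, q') \<in> carrier ?F"
      by (auto dest!: subsetD[OF keys_diff] split: if_splits)
  qed
qed

theorem vectorspace_rat_tensor:
  assumes "comm_group A"
  shows "vectorspace (class_ring :: rat ring) (rat_tensor A)"
proof -
  interpret A: comm_group A by fact
  define F where "F = free_Abelian_group (carrier A \<times> (UNIV :: rat set))"
  define K where "K = tensor_relations A"
  define m where "m q = frag_extend (\<lambda>(a :: 'a, p). frag_of (a, q * p))" for q :: rat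
  interpret F: comm_group F unfolding F_def by (rule abelian_free_Abelian_group)
  have K: "subgroup K F" unfolding K_def F_def by (rule subgroup_tensor_relations) fact
  interpret K: normal K F using F.subgroup_imp_normal K by blast
  interpret Q: comm_group "F Mod K" using F.abelian_FactGroup[OF K] .
  have Fc: "carrier F = {c. Poly_Mapping.keys c \<subseteq> carrier A \<times> UNIV}"
    and Fm: "x \<otimes>\<^bsub>F\<^esub> y = x + y" and F1: "\<one>\<^bsub>F\<^esub> = 0" for x y
    by (auto simp: F_def)
  have Fi: "inv\<^bsub>F\<^esub> x = - x" if "x \<in> carrier F" for x using that by (auto simp: F_def)
  have K0: "0 \<in> K" using K.one_closed F1 by simp
  have Kd: "x - y \<in> K" if "x \<in> K" "y \<in> K" for x y
    using K.m_closed[OF that(1) K.m_inv_closed[OF that(2)]] that Fi[of y] K.subset by (auto simp: Fm)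
  have Ka: "x + y \<in> K" if "x \<in> K" "y \<in> K" for x y
    using K.m_closed[OF that] by (simp add: Fm)
  have add: "m q (x + y) = m q x + m q y" and diff: "m q (x - y) = m q x - m q y"
    and m0: "m q 0 = 0" and mneg: "m q (- x) = - m q x" for q x y
    by (simp_all add: m_def frag_extend_add frag_extend_diff frag_extend_minus)
  have mof: "m q (frag_of (a, p)) = frag_of (a, q * p)" for q a p by (simp add: m_def)
  have mF: "m q x \<in> carrier F" if "x \<in> carrier F" for q x
    using that unfolding Fc mem_Collect_eq
  proof (induction x rule: frag_induction)
    case (diff a b) then show ?case using keys_diff[of "m q a" "m q b"] by (auto simp: \<open>\<And>q x y. m q (x - y) = _\<close>)
  qed (auto simp: m0 mof)
  have gen: "frag_of (a \<otimes>\<^bsub>A\<^esub> a', q) - frag_of (a, q) - frag_of (a', q) \<in> K"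
    if "a \<in> carrier A" "a' \<in> carrier A" for a a' q
    unfolding K_def tensor_relations_def using that by (blast intro: generate.incl)
  have gen2: "frag_of (a, q + q') - frag_of (a, q) - frag_of (a, q') \<in> K"
    if "a \<in> carrier A" for a q q'
    unfolding K_def tensor_relations_def using that by (blast intro: generate.incl)
  have mK: "m q x \<in> K" if "x \<in> K" for q x
  proof -
    have "x \<in> carrier F \<and> m q x \<in> K"
      using that[unfolded K_def tensor_relations_def]
    proof (induction x rule: generate.induct)
      case one then show ?case by (simp add: m0 K0 Fc)
    next
      case (incl h)
      then show ?case
      proof
        assume "h \<in> {frag_of (a \<otimes>\<^bsub>A\<^esub> a', q) - frag_of (a, q) - frag_of (a', q) |a a' q. a \<in> carrier A \<and> a' \<in> carrier A}"
        then obtain a a' p where h: "h = frag_of (a \<otimes>\<^bsub>A\<^esub> a', p) - frag_of (a, p) - frag_of (a', p)" "a \<in> carrier A" "a' \<in> carrier A" by blast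
        then have "h \<in> K" "m q h \<in> K" using gen by (auto simp: diff mof)
        then show ?thesis using K.subset by auto
      next
        assume "h \<in> {frag_of (a, q + q') - frag_of (a, q) - frag_of (a, q') |a q q'. a \<in> carrier A}"
        then obtain a p p' where h: "h = frag_of (a, p + p') - frag_of (a, p) - frag_of (a, p')" "a \<in> carrier A" by blast
        then have "h \<in> K" "m q h \<in> K" using gen2 by (auto simp: diff mof distrib_left)
        then show ?thesis using K.subset by auto
      qed
    next
      case (inv h)
      then have "h \<in> K" unfolding K_def tensor_relations_def by (blast intro: generate.incl)
      then have hF: "h \<in> carrier F" using K.subset by auto
      from inv have "m q h \<in> K"
      proof
        assume "h \<in> {frag_of (a \<otimes>\<^bsub>A\<^esub> a', q) - frag_of (a, q) - frag_of (a', q) |a a' q. a \<in> carrier A \<and> a' \<in> carrier A}"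
        then obtain a a' p where h: "h = frag_of (a \<otimes>\<^bsub>A\<^esub> a', p) - frag_of (a, p) - frag_of (a', p)" "a \<in> carrier A" "a' \<in> carrier A" by blast
        then show "m q h \<in> K" using gen by (auto simp: diff mof)
      next
        assume "h \<in> {frag_of (a, q + q') - frag_of (a, q) - frag_of (a, q') |a q q'. a \<in> carrier A}"
        then obtain a p p' where h: "h = frag_of (a, p + p') - frag_of (a, p) - frag_of (a, p')" "a \<in> carrier A" by blast
        then show "m q h \<in> K" using gen2 by (auto simp: diff mof distrib_left)
      qed
      then have "- m q h \<in> K" using Kd[OF K0] by force
      then show ?case using hF Fi[OF hF] F.inv_closed[OF hF]
        by (simp add: F_def mneg)
    next
      case (eng h1 h2)
      then show ?case using Ka F.m_closed[of h1 h2] by (auto simp: add Fm)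
    qed
    then show ?thesis by simp
  qed
  have cos: "K #>\<^bsub>F\<^esub> x = {k + x |k. k \<in> K}" for x by (auto simp: r_coset_def Fm)
  have smult: "K <#>\<^bsub>F\<^esub> m q ` (K #>\<^bsub>F\<^esub> x) = K #>\<^bsub>F\<^esub> m q x" if "x \<in> carrier F" for q x
    unfolding cos set_mult_def
  proof (safe, goal_cases)
    case (1 _ k _ k')
    then show ?case using Ka mK by (auto simp: Fm add add.assoc[symmetric] intro!: exI[of _ "k + m q k'"])
  next
    case (2 _ k)
    have "x \<in> {k + x |k. k \<in> K}" using K0 by (auto intro!: exI[of _ 0])
    with 2 show ?case unfolding Fm by blast
  qed
  have mult: "(K #>\<^bsub>F\<^esub> x) \<otimes>\<^bsub>F Mod K\<^esub> (K #>\<^bsub>F\<^esub> y) = K #>\<^bsub>F\<^esub> (x + y)" if "x \<in> carrier F" "y \<in> carrier F" for x y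
    using K.rcos_sum[OF that] by (simp add: FactGroup_def Fm)
  have eq: "K #>\<^bsub>F\<^esub> x = K #>\<^bsub>F\<^esub> y" if "x - y \<in> K" for x y
  proof -
    have "\<exists>k'. k + x = k' + y \<and> k' \<in> K" if "k \<in> K" for k
      using Ka[OF that \<open>x - y \<in> K\<close>] by (intro exI[of _ "k + (x - y)"]) simp
    moreover have "\<exists>k'. k + y = k' + x \<and> k' \<in> K" if "k \<in> K" for k
      using Kd[OF that \<open>x - y \<in> K\<close>] by (intro exI[of _ "k - (x - y)"]) simp
    ultimately show ?thesis unfolding cos by blast
  qed
  have V: "rat_tensor A = \<lparr>carrier = carrier (F Mod K), monoid.mult = undefined, one = undefined,
      zero = \<one>\<^bsub>F Mod K\<^esub>, add = (\<lambda>U V. U \<otimes>\<^bsub>F Mod K\<^esub> V),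
      smult = (\<lambda>q U. K <#>\<^bsub>F\<^esub> m q ` U)\<rparr>"
    unfolding rat_tensor_def Let_def F_def K_def m_def ..
  have ab: "abelian_group (rat_tensor A)"
    by (rule abelian_groupI) (simp_all add: V Q.m_ac Q.l_inv_ex del: one_FactGroup mult_FactGroup)
  have car: "\<exists>x\<in>carrier F. U = K #>\<^bsub>F\<^esub> x" if "U \<in> carrier (rat_tensor A)" for U
    using that by (auto simp: V carrier_FactGroup)
  have carI: "K #>\<^bsub>F\<^esub> x \<in> carrier (rat_tensor A)" if "x \<in> carrier F" for x
    using that by (auto simp: V carrier_FactGroup)
  have sm: "q \<odot>\<^bsub>rat_tensor A\<^esub> (K #>\<^bsub>F\<^esub> x) = K #>\<^bsub>F\<^esub> m q x" if "x \<in> carrier F" for q x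
    using smult[OF that] by (simp add: V)
  have ad: "(K #>\<^bsub>F\<^esub> x) \<oplus>\<^bsub>rat_tensor A\<^esub> (K #>\<^bsub>F\<^esub> y) = K #>\<^bsub>F\<^esub> (x + y)" if "x \<in> carrier F" "y \<in> carrier F" for x y
    using mult[OF that] by (simp add: V)
  have ldistr: "m (q + q') x - (m q x + m q' x) \<in> K" if "x \<in> carrier F" for q q' x
    using that unfolding Fc mem_Collect_eq
  proof (induction x rule: frag_induction)
    case zero then show ?case by (simp add: m0 K0)
  next
    case (one x)
    then show ?case using gen2[of "fst x" "q * snd x" "q' * snd x"]
      by (cases x) (auto simp: mof distrib_right diff_diff_eq)
  next
    case (diff a b)
    from Kd[OF this] show ?case by (simp add: \<open>\<And>q x y. m q (x - y) = _\<close> algebra_simps)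
  qed
  have assoc: "m (q * q') x = m q (m q' x)" for q q' x
    using subset_UNIV
    by (induction x rule: frag_induction) (auto simp: m0 mof diff mult.assoc)
  have one: "m 1 x = x" for x
    using subset_UNIV by (induction x rule: frag_induction) (auto simp: m0 mof diff)
  have "module (class_ring :: rat ring) (rat_tensor A)"
  proof (rule moduleI)
    show "cring (class_ring :: rat ring)" by (rule class_cring.is_cring)
    show "abelian_group (rat_tensor A)" by (rule ab)
  next
    fix q :: rat and U assume "U \<in> carrier (rat_tensor A)"
    then show "q \<odot>\<^bsub>rat_tensor A\<^esub> U \<in> carrier (rat_tensor A)"
      using car sm carI mF by metis
  next
    fix q q' :: rat and U assume "U \<in> carrier (rat_tensor A)"
    then obtain x where x: "x \<in> carrier F" "U = K #>\<^bsub>F\<^esub> x" using car by blast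
    show "(q \<oplus>\<^bsub>class_ring\<^esub> q') \<odot>\<^bsub>rat_tensor A\<^esub> U = q \<odot>\<^bsub>rat_tensor A\<^esub> U \<oplus>\<^bsub>rat_tensor A\<^esub> q' \<odot>\<^bsub>rat_tensor A\<^esub> U"
      using eq[OF ldistr[OF x(1), of q q']] by (simp add: x sm ad mF)
    show "(q \<otimes>\<^bsub>class_ring\<^esub> q') \<odot>\<^bsub>rat_tensor A\<^esub> U = q \<odot>\<^bsub>rat_tensor A\<^esub> (q' \<odot>\<^bsub>rat_tensor A\<^esub> U)"
      by (simp add: x sm assoc mF)
  next
    fix q :: rat and U V assume "U \<in> carrier (rat_tensor A)" "V \<in> carrier (rat_tensor A)"
    then obtain x y where x: "x \<in> carrier F" "U = K #>\<^bsub>F\<^esub> x" "y \<in> carrier F" "V = K #>\<^bsub>F\<^esub> y" using car by meson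
    then have "x + y \<in> carrier F" using F.m_closed Fm by metis
    then show "q \<odot>\<^bsub>rat_tensor A\<^esub> (U \<oplus>\<^bsub>rat_tensor A\<^esub> V) = q \<odot>\<^bsub>rat_tensor A\<^esub> U \<oplus>\<^bsub>rat_tensor A\<^esub> q \<odot>\<^bsub>rat_tensor A\<^esub> V"
      by (simp add: x sm ad mF add)
  next
    fix U assume "U \<in> carrier (rat_tensor A)"
    then obtain x where x: "x \<in> carrier F" "U = K #>\<^bsub>F\<^esub> x" using car by blast
    show "\<one>\<^bsub>class_ring :: rat ring\<^esub> \<odot>\<^bsub>rat_tensor A\<^esub> U = U" by (simp add: x sm one)
  qed
  then show ?thesis unfolding vectorspace_def using class_field.field_axioms by blast
qed

definition has_rational_dim :: "('a, 'b) monoid_scheme \<Rightarrow> nat \<Rightarrow> bool" where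
  "has_rational_dim A r \<longleftrightarrow>
    vectorspace.fin_dim (class_ring :: rat ring) (rat_tensor A) \<and>
    vectorspace.dim (class_ring :: rat ring) (rat_tensor A) = r"

section \<open>Subgroups of direct products\<close>

definition finite_index :: "('a, 'b) monoid_scheme \<Rightarrow> 'a set \<Rightarrow> bool" where
  "finite_index G H \<longleftrightarrow> subgroup H G \<and> finite (rcosets\<^bsub>G\<^esub> H)"

definition virtually_coabelian_of_corank ::
  "('a, 'b) monoid_scheme \<Rightarrow> 'a set \<Rightarrow> nat \<Rightarrow> bool" where
  "virtually_coabelian_of_corank G H r \<longleftrightarrow> subgroup H G \<and>
    (\<exists>G'. finite_index G G' \<and> derived G G' \<subseteq> H \<and>
      has_rational_dim (G\<lparr>carrier := G'\<rparr> Mod (G' \<inter> H)) r)"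

definition factor_subgroup :: "'i set \<Rightarrow> ('i \<Rightarrow> ('a, 'b) monoid_scheme) \<Rightarrow> 'i \<Rightarrow> ('i \<Rightarrow> 'a) set" where
  "factor_subgroup I \<Gamma> i =
    {g \<in> carrier (product_group I \<Gamma>). \<forall>j\<in>I - {i}. g j = \<one>\<^bsub>\<Gamma> j\<^esub>}"

definition virtually_full :: "'i set \<Rightarrow> ('i \<Rightarrow> ('a, 'b) monoid_scheme) \<Rightarrow> ('i \<Rightarrow> 'a) set \<Rightarrow> bool" where
  "virtually_full I \<Gamma> H \<longleftrightarrow> subgroup H (product_group I \<Gamma>) \<and>
    (\<forall>i\<in>I. finite_index (product_group I \<Gamma>)
      (factor_subgroup I \<Gamma> i <#>\<^bsub>product_group I \<Gamma>\<^esub> H))"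

end

theory Submission imports Defs begin

section \<open>Words, letter maps and their evaluation in a group\<close>

section \<open>Words\<close>

text \<open>The subgroup \<open>H\<close> is replaced by a kernel commensurable with it. The
  quotient of \<open>G'\<close> by \<open>G' \<inter> H\<close> is abelian of rational rank
  \<open>r\<close>, and since every \<open>\<Gamma> i\<close> times \<open>H\<close> has finite
  index, suitable multiples of \<open>r\<close> independent elements of the quotient are represented
  in each single factor. This yields (\<open>coab_exists\<close>) a finite index subgroup
  \<open>M0\<close> of the product, homomorphisms \<open>\<tau> j\<close> from \<open>M0\<close> to
  the integers for \<open>j < r\<close>, and in every factor \<open>i\<close> elements
  \<open>t i j\<close> dual to the \<open>\<tau> j\<close>. The common kernel \<open>level r\<close>
  is \<open>M0 \<inter> H\<close> and has finite index in \<open>H\<close>. Reidemeister-Schreier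
  arguments carry all bounds across finite index.

  Area is measured coarsely: \<open>fill\<close> counts loops of bounded length in a Cayley graph
  and records the vertices where they are based, so that neither generators nor presentations
  matter. \<open>isop_of_presentation\<close> and \<open>isop_imp_presentation\<close> translate
  from and to expressions over finite presentations.

  Distortion rests on two factors. A conjugate of \<open>t i1 j\<close> times the inverse of
  \<open>t i2 j\<close> lies in the kernel, and since the two factors commute, the commutator of a
  kernel letter with a word of length \<open>l\<close> in the \<open>t i1 j\<close> is a word of
  length \<open>2 * l\<close> in such letters. Every generator is a kernel element times a word in
  the \<open>t i1 j\<close>; collecting these words on the right costs linearly many letters at each
  step, hence quadratic length in total. A last word with all exponent sums zero is a product of
  linearly many commutators (\<open>level_word_length\<close>, \<open>zero_sum_word\<close>).

  Area rests on three factors. One coordinate is killed at a time (\<open>isop_step\<close>). A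
  vertex \<open>g\<close> of \<open>level k\<close> is moved to
  \<open>bar g = g u^(-\<tau> k g)\<close> with \<open>u = t i1 k\<close>. An edge at height
  \<open>m\<close> becomes an edge conjugated by \<open>u^m\<close>, spelled by a word
  \<open>\<omega> m x\<close> of length linear in \<open>m\<close> in which powers of
  \<open>v = t i2 k\<close> correct the height. Exchanging \<open>v\<close> for an element
  \<open>s\<close> of a third factor shows that \<open>\<omega> m\<close> is multiplicative up to
  area quadratic in \<open>m\<close>, so a loop based at height \<open>m\<close> is pushed to a loop
  of area \<open>O(m^2)\<close>. Heights are bounded by the radius, and each of the \<open>r\<close>
  steps multiplies the area by the square of the radius; this gives
  \<open>\<rho>^(2 r) \<alpha>\<close>. The quadratic term in \<open>\<alpha>\<close> comes from
  sorting commuting letters of different factors. Finite presentability follows, because expressions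
  of minimal area always provide some area-radius pair.

  For the last bound the product is split into the first \<open>n - r\<close> and the last
  \<open>r\<close> factors. Up to finite index, \<open>H\<close> is the fibre product of subgroups
  \<open>A\<close> and \<open>B\<close> of the two parts over \<open>Z^r\<close>. As
  \<open>2 * r <= n\<close>, the coordinates have homomorphic sections supported in the first
  \<open>r\<close> and in the last \<open>r\<close> factors; they define homomorphisms
  \<open>Th q\<close> on \<open>A\<close> and \<open>Th 0\<close> on \<open>B\<close> into the fibre
  product, whose images generate it. A null word of length \<open>l\<close> is sorted with area
  \<open>O(l^4)\<close> (\<open>F_sort\<close>) into a word of length \<open>O(l^2)\<close> from the
  image of \<open>A\<close> followed by a word of length \<open>O(l)\<close> from the image of
  \<open>B\<close>. Projection shows that both come from null words of \<open>A\<close> and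
  \<open>B\<close>, and fillings found there are mapped back (\<open>isop_H1\<close>). Since
  \<open>A\<close> contains a free abelian group of rank two detected by homomorphisms to
  \<open>Z\<close>, a Heisenberg group argument (\<open>quadratic_lower_bound\<close>) makes its
  area at least quadratic, and \<open>l^4\<close> is absorbed by the area of words of length
  \<open>l^2\<close> in \<open>A\<close>.\<close>

lemma words_Nil [simp]: "[] \<in> words S"
 and words_Cons [simp]: "l # w \<in> words S \<longleftrightarrow> fst l \<in> S & w \<in> words S"
 and words_append [simp]: "u @ v \<in> words S \<longleftrightarrow> u \<in> words S & v \<in> words S"
 by (auto simp: words_def mem_Times_iff)

lemma words_iff: "w \<in> words S \<longleftrightarrow> fst ` set w <= S"
 by (auto simp: words_def lists_eq_set)

lemma words_mono: "S <= T ==> w \<in> words S ==> w \<in> words T"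
 by (auto simp: words_iff)

definition map_letters :: "('x => 'y) => 'x gword => 'y gword" where
 "map_letters f = map (%l. (f (fst l), snd l))"

lemma map_letters_Nil [simp]: "map_letters f [] = []"
 and map_letters_Cons [simp]: "map_letters f (l # w) = (f (fst l), snd l) # map_letters f w"
 and map_letters_append [simp]: "map_letters f (u @ v) = map_letters f u @ map_letters f v"
 and length_map_letters [simp]: "length (map_letters f w) = length w"
 by (simp_all add: map_letters_def)

lemma words_map_letters: "w \<in> words S ==> f ` S <= T ==> map_letters f w \<in> words T"
 by (induction w) auto

lemma word_inv_Nil [simp]: "word_inv [] = []"
 and word_inv_Cons [simp]: "word_inv ((x, b) # w) = word_inv w @ [(x, \<not> b)]"
 and word_inv_append [simp]: "word_inv (u @ v) = word_inv v @ word_inv u"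
 and length_word_inv [simp]: "length (word_inv w) = length w"
 and word_inv_word_inv [simp]: "word_inv (word_inv w) = w"
 and words_word_inv [simp]: "word_inv w \<in> words S \<longleftrightarrow> w \<in> words S"
proof -
 show "word_inv (word_inv w) = w"
  by (simp add: word_inv_def rev_map comp_def case_prod_unfold)
 show "word_inv w \<in> words S \<longleftrightarrow> w \<in> words S"
  by (auto simp: word_inv_def words_iff image_image case_prod_unfold)
qed (simp_all add: word_inv_def)

lemma word_inv_map_letters: "word_inv (map_letters f w) = map_letters f (word_inv w)"
 by (auto simp: word_inv_def rev_map map_letters_def)

lemma finite_words_bounded: "finite S ==> finite {w \<in> words S. length w <= N}"
 using finite_lists_length_le[of "S \<times> (UNIV :: bool set)" N]
 by (simp add: words_def lists_eq_set)

definition letter_val :: "('a, 'b) monoid_scheme => 'a \<times> bool => 'a" where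
 "letter_val G l = (if snd l then fst l else inv\<^bsub>G\<^esub> (fst l))"

lemma eval_word_Nil [simp]: "eval_word G [] = \<one>\<^bsub>G\<^esub>"
 and eval_word_Cons: "eval_word G (l # w) = letter_val G l \<otimes>\<^bsub>G\<^esub> eval_word G w"
 by (auto simp: eval_word_def letter_val_def split: prod.splits)

context group
begin

abbreviation ev :: "'a gword => 'a" where "ev \<equiv> eval_word G"

lemma letter_val_closed [simp]: "fst l \<in> carrier G ==> letter_val G l \<in> carrier G"
 by (simp add: letter_val_def)

lemma ev_closed [simp]: "w \<in> words (carrier G) ==> ev w \<in> carrier G"
 by (induction w) (auto simp: eval_word_Cons)

lemma ev_singleton [simp]: "x \<in> carrier G ==> ev [(x, b)] = (if b then x else inv x)"
 by (simp add: eval_word_Cons letter_val_def)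

lemma ev_append [simp]:
 "u \<in> words (carrier G) ==> v \<in> words (carrier G) ==> ev (u @ v) = ev u \<otimes> ev v"
 by (induction u) (auto simp: eval_word_Cons m_assoc)

lemma ev_Cons: "fst l \<in> carrier G ==> w \<in> words (carrier G) ==> ev (l # w) = ev [l] \<otimes> ev w"
 using ev_append[of "[l]" w] by simp

lemma ev_word_inv [simp]: "w \<in> words (carrier G) ==> ev (word_inv w) = inv (ev w)"
proof (induction w)
 case (Cons l w)
 then show ?case by (cases l) (auto simp: ev_Cons[of "(_, _)" w] inv_mult_group)
qed simp

lemma ev_in_subgroup: "subgroup K G ==> w \<in> words K ==> ev w \<in> K"
 by (induction w)
  (auto simp: eval_word_Cons letter_val_def subgroup.one_closed subgroup.m_closed subgroup.m_inv_closed)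

lemma words_carrier: "S <= carrier G ==> w \<in> words S ==> w \<in> words (carrier G)"
 by (rule words_mono)

lemma generate_eq_ev:
 assumes "S <= carrier G"
 shows "generate G S = ev ` words S"
proof (rule subset_antisym; rule subsetI)
 fix x assume "x \<in> generate G S"
 then show "x \<in> ev ` words S"
 proof (induction rule: generate.induct)
  case (incl h)
  then show ?case using assms by (intro image_eqI[of _ _ "[(h, True)]"]) auto
 next
  case (inv h)
  then show ?case using assms by (intro image_eqI[of _ _ "[(h, False)]"]) auto
 next
  case (eng h1 h2)
  then obtain u v where "u \<in> words S" "v \<in> words S" "h1 = ev u" "h2 = ev v" by blast
  then show ?case using assms by (intro image_eqI[of _ _ "u @ v"]) (auto simp: words_carrier)
 qed (auto intro!: image_eqI[of _ _ "[]"])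
next
 fix x assume "x \<in> ev ` words S"
 then obtain w where "w \<in> words S" "x = ev w" by blast
 moreover have "subgroup (generate G S) G" by (rule generate_is_subgroup[OF assms])
 moreover have "w \<in> words S ==> w \<in> words (generate G S)" for w
  by (rule words_mono) (auto intro: generate.incl)
 ultimately show "x \<in> generate G S" using ev_in_subgroup by auto
qed

end

section \<open>Coarse fillings of null words in a Cayley graph\<close>

section \<open>Coarse fillings\<close>

text \<open>\<open>fill G S N V g m u v\<close>: the paths \<open>u\<close> and \<open>v\<close> starting at the vertex \<open>g\<close> of the Cayley graph are
 homotopic across \<open>m\<close> loops of length at most \<open>N\<close>, each of them based at a vertex in \<open>V\<close>. Free
 reductions cost nothing and may happen anywhere.\<close>

inductive fill :: "('a, 'b) monoid_scheme => 'a set => nat => 'a set => 'a => nat =>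
  'a gword => 'a gword => bool" for G S N V g where
 refl: "w \<in> words S ==> fill G S N V g m w w"
| sym: "fill G S N V g m u v ==> fill G S N V g m v u"
| trans: "fill G S N V g m u v ==> fill G S N V g n v w ==> fill G S N V g (m + n) u w"
| cancel: "[|u \<in> words S; v \<in> words S; x \<in> S|]
  ==> fill G S N V g 0 (u @ [(x, b), (x, \<not> b)] @ v) (u @ v)"
| relator: "[|u \<in> words S; v \<in> words S; r \<in> words S; length r <= N; eval_word G r = \<one>\<^bsub>G\<^esub>;
   g \<otimes>\<^bsub>G\<^esub> eval_word G u \<in> V|] ==> fill G S N V g 1 (u @ r @ v) (u @ v)"

lemma fill_words:
 assumes "fill G S N V g m u v"
 shows "u \<in> words S" "v \<in> words S"
 using assms by (induction rule: fill.induct) auto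

text \<open>Reflexivity carries every area bound, so a trivial homotopy appended to a given one pads
  its area.\<close>

lemma fill_weaken:
 assumes "fill G S N V g m u v" "m <= n"
 shows "fill G S N V g n u v"
 using fill.trans[OF assms(1) fill.refl[OF fill_words(2)[OF assms(1)], where m = "n - m"]] assms(2)
 by simp

lemma fill_transI:
 assumes "fill G S N V g m u v" "fill G S N V g n v w" "m + n <= k"
 shows "fill G S N V g k u w"
 using fill_weaken[OF fill.trans[OF assms(1,2)] assms(3)] .

lemma fill_mono:
 assumes "fill G S N V g m u v" "S <= S'" "N <= N'" "V <= V'" "m <= m'"
 shows "fill G S' N' V' g m' u v"
proof -
 have "fill G S' N' V' g m u v"
  using assms(1)
 proof (induction rule: fill.induct)
  case (cancel u v x b)
  show ?case
   by (rule fill.cancel) (use cancel assms words_mono[OF assms(2)] in auto)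
 next
  case (relator u v r)
  show ?case
   by (rule fill.relator) (use relator assms words_mono[OF assms(2)] in auto)
 next
  case (refl w)
  then show ?case using words_mono[OF assms(2)] by (simp add: fill.refl)
 next
  case (sym m u v)
  show ?case by (rule fill.sym[OF sym(2)])
 next
  case (trans m u v n w)
  show ?case by (rule fill.trans[OF trans(3,4)])
 qed
 then show ?thesis using assms(5) by (rule fill_weaken)
qed

context group
begin

lemma fill_ev:
 assumes "fill G S N V g m u v" "S <= carrier G"
 shows "ev u = ev v"
 using assms(1)
proof (induction rule: fill.induct)
 case (cancel u v x b)
 have *: "u \<in> words (carrier G)" "v \<in> words (carrier G)" "x \<in> carrier G"
  using cancel assms(2) words_carrier by auto
 have "ev ([(x, b), (x, \<not> b)] @ v) = ev v"
  using * by (cases b) (auto simp: eval_word_Cons letter_val_def m_assoc[symmetric])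
 then show ?case using * by simp
next
 case (relator u v r)
 have "u \<in> words (carrier G)" "v \<in> words (carrier G)" "r \<in> words (carrier G)"
  using relator assms(2) words_carrier by auto
 then show ?case using relator by simp
qed auto

text \<open>The prefix \<open>s\<close> leads from \<open>g\<close> to
  \<open>g \<otimes> ev s\<close>, so the loops of the inner homotopy keep their base vertices and
  the set \<open>V\<close> is unchanged.\<close>

lemma fill_ctx:
 assumes "fill G S N V (g \<otimes> ev s) m u v" "S <= carrier G" "g \<in> carrier G" "s \<in> words S" "t \<in> words S"
 shows "fill G S N V g m (s @ u @ t) (s @ v @ t)"
 using assms(1)
proof (induction rule: fill.induct)
 case (cancel u v x b)
 then show ?case using fill.cancel[where G = G and u = "s @ u" and v = "v @ t" and b = b and x = x] assms by simp
next
 case (relator u v r)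
 have "u \<in> words (carrier G)" "s \<in> words (carrier G)"
  using relator assms words_carrier by auto
 then have "g \<otimes> ev (s @ u) \<in> V" using relator assms by (simp add: m_assoc)
 then show ?case using fill.relator[where G = G and u = "s @ u" and v = "v @ t" and r = r] relator assms by simp
next
 case (refl w)
 then show ?case using assms by (simp add: fill.refl)
next
 case (sym m u v)
 show ?case by (rule fill.sym[OF sym(2)])
next
 case (trans m u v n w)
 show ?case by (rule fill.trans[OF trans(3,4)])
qed

lemma fill_append:
 assumes u: "fill G S N V g m u u'" and v: "fill G S N V (g \<otimes> ev u) n v v'"
  and S: "S <= carrier G" "g \<in> carrier G" and k: "m + n <= k"
 shows "fill G S N V g k (u @ v) (u' @ v')"
proof -
 note w = fill_words[OF u] fill_words[OF v]
 have "fill G S N V (g \<otimes> ev []) m u u'" using u S by simp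
 from fill_ctx[OF this S, of v] have 1: "fill G S N V g m (u @ v) (u' @ v)" using w by simp
 have "fill G S N V (g \<otimes> ev u') n v v'" using v fill_ev[OF u S(1)] by simp
 from fill_ctx[OF this S, of "[]"] have 2: "fill G S N V g n (u' @ v) (u' @ v')" using w by simp
 show ?thesis by (rule fill_transI[OF 1 2 k])
qed

lemma fill_append1:
 assumes "fill G S N V g m u u'" "v \<in> words S" "S <= carrier G" "g \<in> carrier G"
 shows "fill G S N V g m (u @ v) (u' @ v)"
 by (rule fill_append[OF assms(1) fill.refl[OF assms(2), where m = 0]]) (use assms in auto)

lemma fill_append2:
 assumes "fill G S N V (g \<otimes> ev u) m v v'" "u \<in> words S" "S <= carrier G" "g \<in> carrier G"
 shows "fill G S N V g m (u @ v) (u @ v')"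
 by (rule fill_append[OF fill.refl[OF assms(2), where m = 0] assms(1)]) (use assms in auto)

lemma fill_inv_right: "u \<in> words S ==> fill G S N V g 0 (u @ word_inv u @ v) v" if "v \<in> words S"
proof (induction u rule: rev_induct)
 case Nil
 then show ?case using that by (simp add: fill.refl)
next
 case (snoc l u)
 have "fill G S N V g 0 (u @ [(fst l, snd l), (fst l, \<not> snd l)] @ word_inv u @ v) (u @ word_inv u @ v)"
  by (rule fill.cancel) (use snoc that in auto)
 moreover have "fill G S N V g 0 (u @ word_inv u @ v) v" using snoc by simp
 ultimately show ?case using fill.trans[where m = 0 and n = 0] by (cases l) fastforce
qed

lemma fill_inv_left: "u \<in> words S ==> v \<in> words S ==> fill G S N V g 0 (word_inv u @ u @ v) v"
 using fill_inv_right[of v S "word_inv u" N V g] by simp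

text \<open>The basic move of all later fillings: \<open>word_inv v @ v\<close> is inserted freely
  after \<open>u\<close>, and the closed path \<open>u @ word_inv v\<close> based at
  \<open>g\<close> is then a single loop.\<close>

lemma fill_repl:
 assumes "u \<in> words S" "v \<in> words S" "ev u = ev v" "length u + length v <= N" "g \<in> V"
  "S <= carrier G" "g \<in> carrier G"
 shows "fill G S N V g 1 u v"
proof -
 have c: "u \<in> words (carrier G)" "v \<in> words (carrier G)" using assms words_carrier by auto
 have "fill G S N V (g \<otimes> ev u) 0 [] (word_inv v @ v)"
  using fill.sym[OF fill_inv_left[of v S "[]"]] assms by simp
 from fill_append2[OF this assms(1) assms(6,7)] have 1: "fill G S N V g 0 u (u @ word_inv v @ v)" by simp
 have 2: "fill G S N V g 1 ([] @ (u @ word_inv v) @ v) ([] @ v)"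
  by (rule fill.relator) (use assms c in auto)
 have 3: "fill G S N V g 1 (u @ word_inv v @ v) v" using 2 by simp
 show ?thesis by (rule fill_transI[OF 1 3]) simp
qed

text \<open>Moving the whole word to the other side turns a homotopy of paths into one of inverse paths.\<close>

lemma fill_cancel_left:
 assumes "fill G S N V g m (u @ v) (u' @ v')" "fill G S N V g n u u'"
  "u \<in> words S" "S <= carrier G" "g \<in> carrier G" "v \<in> words S" "v' \<in> words S"
 shows "fill G S N V (g \<otimes> ev u) (m + n) v v'"
proof -
 have c: "u \<in> words (carrier G)" using assms words_carrier by auto
 have ge: "g \<otimes> ev u \<otimes> ev (word_inv u) = g" using c assms by (simp add: m_assoc)
 have "fill G S N V g m (u @ v) (u' @ v')" by fact
 moreover have "fill G S N V g n (u' @ v') (u @ v')"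
  by (rule fill_append1[OF fill.sym[OF assms(2)]]) (use assms in auto)
 ultimately have "fill G S N V (g \<otimes> ev u \<otimes> ev (word_inv u)) (m + n) (u @ v) (u @ v')"
  unfolding ge by (rule fill.trans)
 from fill_append2[OF this] have "fill G S N V (g \<otimes> ev u) (m + n) (word_inv u @ u @ v) (word_inv u @ u @ v')"
  using assms c by simp
 with fill_inv_left[of u S v N V "g \<otimes> ev u"] fill_inv_left[of u S v' N V "g \<otimes> ev u"] assms
 show ?thesis by (metis fill.sym fill.trans add.left_neutral add.right_neutral)
qed

text \<open>Transports fillings along letter maps that come from homomorphisms, such as
  \<open>Th q\<close> on \<open>A\<close>. The base vertices of the image loops are not tracked,
  hence \<open>UNIV\<close> and the arbitrary \<open>g'\<close> in the conclusion.\<close>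

lemma fill_map:
 assumes "fill G S N V g m u v" "f ` S <= S'"
  "!!r. r \<in> words S ==> ev r = \<one> ==> ev (map_letters f r) = \<one>"
 shows "fill G S' N UNIV g' m (map_letters f u) (map_letters f v)"
 using assms(1)
proof (induction rule: fill.induct)
 case (cancel u v x b)
 then show ?case using fill.cancel[where G = G and u = "map_letters f u" and v = "map_letters f v" and x = "f x" and b = b]
  words_map_letters[OF _ assms(2)] assms(2) by auto
next
 case (relator u v r)
 then show ?case using fill.relator[where G = G and u = "map_letters f u" and v = "map_letters f v" and r = "map_letters f r"]
  words_map_letters[OF _ assms(2)] assms by auto
next
 case (refl w)
 then show ?case using words_map_letters[OF _ assms(2)] by (simp add: fill.refl)
next
 case (sym m u v)
 show ?case by (rule fill.sym[OF sym(2)])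
next
 case (trans m u v n w)
 show ?case by (rule fill.trans[OF trans(3,4)])
qed

section \<open>Pushing paths along a map of vertices\<close>

section \<open>Pushing paths\<close>

text \<open>The vertex \<open>g\<close> is moved to some \<open>p g\<close>, and
  \<open>\<sigma> g x\<close> spells a path from \<open>p g\<close> to
  \<open>p (g \<otimes> x)\<close>. A letter read backwards traverses the edge that starts at
  \<open>g \<otimes> inv x\<close>, so the word chosen for that edge is inverted.\<close>

fun push :: "('a => 'a => 'a gword) => 'a => 'a gword => 'a gword" where
 "push \<sigma> g [] = []"
| "push \<sigma> g ((x, True) # w) = \<sigma> g x @ push \<sigma> (g \<otimes> x) w"
| "push \<sigma> g ((x, False) # w) = word_inv (\<sigma> (g \<otimes> inv x) x) @ push \<sigma> (g \<otimes> inv x) w"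

definition pushes :: "('a => 'a => 'a gword) => ('a => 'a) => 'a set => 'a set => 'a set => bool" where
 "pushes \<sigma> p M S T \<longleftrightarrow> subgroup M G & S <= M & T <= carrier G & (\<forall>g\<in>M. p g \<in> carrier G) &
  (\<forall>g\<in>M. \<forall>x\<in>S. \<sigma> g x \<in> words T & ev (\<sigma> g x) = inv (p g) \<otimes> p (g \<otimes> x))"

lemma push_append:
 assumes "u \<in> words S" "S <= carrier G" "v \<in> words (carrier G)" "g \<in> carrier G"
 shows "push \<sigma> g (u @ v) = push \<sigma> g u @ push \<sigma> (g \<otimes> ev u) v"
 using assms
proof (induction u arbitrary: g)
 case (Cons l u)
 obtain x b where l: "l = (x, b)" by (cases l)
 have c: "x \<in> carrier G" "u \<in> words (carrier G)" using Cons l words_carrier by auto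
 then show ?case using Cons by (cases b) (auto simp: l ev_Cons[of "(x, _)" u] m_assoc)
qed simp

lemma push_closed:
 assumes "pushes \<sigma> p M S T" "w \<in> words S" "g \<in> M"
 shows "push \<sigma> g w \<in> words T" "ev (push \<sigma> g w) = inv (p g) \<otimes> p (g \<otimes> ev w)"
proof -
 have M: "subgroup M G" "S <= M" and T: "T <= carrier G"
  and p: "!!g. g \<in> M ==> p g \<in> carrier G"
  and s: "!!g x. g \<in> M ==> x \<in> S ==> \<sigma> g x \<in> words T & ev (\<sigma> g x) = inv (p g) \<otimes> p (g \<otimes> x)"
  using assms(1) by (auto simp: pushes_def)
 have Mc: "M <= carrier G" using M(1) by (rule subgroup.subset)
 have Sc: "S <= carrier G" using M Mc by auto
 have can: "inv a \<otimes> b \<otimes> (inv b \<otimes> c) = inv a \<otimes> c" if "a \<in> carrier G" "b \<in> carrier G" "c \<in> carrier G" for a b c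
  using that by (simp add: m_assoc[symmetric]) (simp add: m_assoc)
 have "push \<sigma> g w \<in> words T & ev (push \<sigma> g w) = inv (p g) \<otimes> p (g \<otimes> ev w)"
  using assms(2,3)
 proof (induction w arbitrary: g)
  case Nil
  then show ?case using p Mc by auto
 next
  case (Cons l w)
  obtain x b where l: "l = (x, b)" by (cases l)
  have xS: "x \<in> S" and wS: "w \<in> words S" using Cons l by auto
  have xM: "x \<in> M" using xS M by auto
  have c: "x \<in> carrier G" "w \<in> words (carrier G)" "g \<in> carrier G"
   using xM Mc wS Sc words_carrier Cons by auto
  show ?case
  proof (cases b)
   case True
   have gx: "g \<otimes> x \<in> M" using Cons.prems xM M subgroup.m_closed by metis
   note IH = Cons.IH[OF wS gx] and S1 = s[OF Cons.prems(2) xS]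
   have wc: "\<sigma> g x \<in> words (carrier G)" "push \<sigma> (g \<otimes> x) w \<in> words (carrier G)"
    using IH S1 words_carrier[OF T] by auto
   have gw: "g \<otimes> x \<otimes> ev w \<in> M" using gx ev_in_subgroup[OF M(1) words_mono[OF M(2) wS]] M subgroup.m_closed by metis
   show ?thesis using IH S1 wc c can[OF p[OF Cons.prems(2)] p[OF gx] p[OF gw]]
    by (simp add: l True ev_Cons[of "(x, _)" w] m_assoc)
  next
   case False
   have gx: "g \<otimes> inv x \<in> M" using Cons.prems xM M subgroup.m_closed subgroup.m_inv_closed by metis
   note IH = Cons.IH[OF wS gx] and S1 = s[OF gx xS]
   have wc: "\<sigma> (g \<otimes> inv x) x \<in> words (carrier G)" "push \<sigma> (g \<otimes> inv x) w \<in> words (carrier G)"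
    using IH S1 words_carrier[OF T] by auto
   have gw: "g \<otimes> inv x \<otimes> ev w \<in> M" using gx ev_in_subgroup[OF M(1) words_mono[OF M(2) wS]] M subgroup.m_closed by metis
   have "g \<otimes> inv x \<otimes> x = g" using c by (simp add: m_assoc)
   then show ?thesis using IH S1 wc c can[OF p[OF Cons.prems(2)] p[OF gx] p[OF gw]] p[OF gx] p[OF Cons.prems(2)]
    by (simp add: l False ev_Cons[of "(x, _)" w] m_assoc inv_mult_group)
  qed
 qed
 then show "push \<sigma> g w \<in> words T" "ev (push \<sigma> g w) = inv (p g) \<otimes> p (g \<otimes> ev w)" by auto
qed

lemma push_length:
 assumes "!!g x. g \<in> M ==> x \<in> S ==> length (\<sigma> g x) <= c" "subgroup M G" "S <= M" "w \<in> words S" "g \<in> M"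
 shows "length (push \<sigma> g w) <= c * length w"
 using assms(4,5)
proof (induction w arbitrary: g)
 case (Cons l w)
 obtain x b where l: "l = (x, b)" by (cases l)
 have xS: "x \<in> S" and wS: "w \<in> words S" using Cons l by auto
 have M: "g \<otimes> x \<in> M" "g \<otimes> inv x \<in> M"
  using xS assms Cons.prems subgroup.m_closed[OF assms(2)] subgroup.m_inv_closed[OF assms(2)] by auto
 show ?case using Cons.IH[OF wS M(1)] Cons.IH[OF wS M(2)] assms(1)[OF Cons.prems(2) xS] assms(1)[OF M(2) xS]
  by (cases b) (auto simp: l)
qed simp

text \<open>The homotopy is pushed move by move. An edge and its reverse push to a word and its
  formal inverse, so free cancellations stay free; a relator loop becomes the pushed loop, which has
  area at most \<open>c\<close> by hypothesis.\<close>

lemma fill_push: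
 assumes P: "pushes \<sigma> p M S T" and g: "g \<in> M"
  and f: "fill G S N V g m u v"
  and rel: "!!h r. h \<in> V ==> h \<in> M ==> r \<in> words S ==> length r <= N ==> ev r = \<one> ==>
   fill G T N' V' (p h) c (push \<sigma> h r) []"
 shows "fill G T N' V' (p g) (c * m) (push \<sigma> g u) (push \<sigma> g v)"
proof -
 have M: "subgroup M G" "S <= M" and T: "T <= carrier G"
  and p: "!!g. g \<in> M ==> p g \<in> carrier G"
  and s: "!!g x. g \<in> M ==> x \<in> S ==> \<sigma> g x \<in> words T"
  using P by (auto simp: pushes_def)
 have Mc: "M <= carrier G" using M(1) by (rule subgroup.subset)
 have Sc: "S <= carrier G" using M Mc by auto
 have gc: "g \<in> carrier G" using g Mc by auto
 have pos: "g \<otimes> ev u \<in> M" if "u \<in> words S" for u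
  using g ev_in_subgroup[OF M(1) words_mono[OF M(2) that]] M subgroup.m_closed by metis
 have pp: "p g \<otimes> ev (push \<sigma> g u) = p (g \<otimes> ev u)" if "u \<in> words S" for u
  using push_closed(2)[OF P that g] p[OF g] p[OF pos[OF that]] by (simp add: m_assoc[symmetric])
 note cl = push_closed(1)[OF P]
 show ?thesis
  using f
 proof (induction rule: fill.induct)
  case (refl w)
  then show ?case using cl g by (auto intro: fill.refl)
 next
  case (sym m u v)
  show ?case by (rule fill.sym[OF sym(2)])
 next
  case (trans m u v n w)
  show ?case unfolding distrib_left by (rule fill.trans[OF trans(3,4)])
 next
  case (cancel u v x b)
  have c: "u \<in> words (carrier G)" "v \<in> words (carrier G)" "x \<in> carrier G"
   using cancel Sc words_carrier by auto
  let ?h = "g \<otimes> ev u"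
  have hM: "?h \<in> M" by (rule pos[OF cancel(1)])
  have hc: "?h \<in> carrier G" using hM Mc by auto
  have hx: "?h \<otimes> inv x \<in> M" "?h \<otimes> x \<in> M"
   using hM cancel M subgroup.m_closed[OF M(1)] subgroup.m_inv_closed[OF M(1)] by auto
  have e: "?h \<otimes> x \<otimes> inv x = ?h" "?h \<otimes> inv x \<otimes> x = ?h" using c hc by (auto simp: m_assoc)
  have 1: "push \<sigma> g (u @ [(x, b), (x, \<not> b)] @ v) =
   push \<sigma> g u @ (if b then \<sigma> ?h x @ word_inv (\<sigma> ?h x) @ push \<sigma> ?h v
    else word_inv (\<sigma> (?h \<otimes> inv x) x) @ \<sigma> (?h \<otimes> inv x) x @ push \<sigma> ?h v)"
   using c e by (subst push_append[OF cancel(1) Sc _ gc]) (cases b; simp)+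
  have 2: "push \<sigma> g (u @ v) = push \<sigma> g u @ push \<sigma> ?h v"
   using push_append[OF cancel(1) Sc _ gc] c by auto
  have 3: "fill G T N' V' (p g \<otimes> ev (push \<sigma> g u)) 0 (if b then \<sigma> ?h x @ word_inv (\<sigma> ?h x) @ push \<sigma> ?h v
    else word_inv (\<sigma> (?h \<otimes> inv x) x) @ \<sigma> (?h \<otimes> inv x) x @ push \<sigma> ?h v) (push \<sigma> ?h v)"
   using fill_inv_right[OF cl[OF cancel(2) hM] s[OF hM cancel(3)]]
    fill_inv_left[OF s[OF hx(1) cancel(3)] cl[OF cancel(2) hM]] by simp
  show ?case unfolding 1 2 mult_0_right
   by (rule fill_append2[OF 3 cl[OF cancel(1) g] T p[OF g]])
 next
  case (relator u v r)
  have c: "u \<in> words (carrier G)" "v \<in> words (carrier G)" "r \<in> words (carrier G)"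
   using relator Sc words_carrier by auto
  let ?h = "g \<otimes> ev u"
  have hM: "?h \<in> M" by (rule pos[OF relator(1)])
  have hc: "?h \<in> carrier G" using hM Mc by auto
  have 1: "push \<sigma> g (u @ r @ v) = push \<sigma> g u @ push \<sigma> ?h r @ push \<sigma> ?h v"
   using push_append[OF relator(1) Sc _ gc, of "r @ v"] push_append[OF relator(3) Sc _ hc, of v] relator c hc
   by simp
  have 2: "push \<sigma> g (u @ v) = push \<sigma> g u @ [] @ push \<sigma> ?h v"
   using push_append[OF relator(1) Sc _ gc] c by auto
  have 3: "fill G T N' V' (p g \<otimes> ev (push \<sigma> g u)) c (push \<sigma> ?h r) []"
   unfolding pp[OF relator(1)] by (rule rel[OF relator(6) hM relator(3-5)])
  show ?case unfolding 1 2 mult_1_right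
   by (rule fill_ctx[OF 3 T p[OF g] cl[OF relator(1) g] cl[OF relator(2) hM]])
 qed
qed

end

section \<open>Isoperimetric pairs of subgroups and their transfer\<close>

section \<open>Isoperimetric pairs of subgroups\<close>

context group
begin

lemma push_word_inv:
 assumes "u \<in> words (carrier G)" "g \<in> carrier G"
 shows "push \<sigma> g (word_inv u) = word_inv (push \<sigma> (g \<otimes> inv (ev u)) u)"
 using assms
proof (induction u)
 case (Cons l u)
 obtain x b where l: "l = (x, b)" by (cases l)
 have c: "x \<in> carrier G" "u \<in> words (carrier G)" "g \<in> carrier G" using Cons l by auto
 have 1: "push \<sigma> g (word_inv (l # u)) = word_inv (push \<sigma> (g \<otimes> inv (ev u)) u) @ push \<sigma> (g \<otimes> inv (ev u)) [(x, \<not> b)]"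
  using c Cons.IH push_append[where S = "carrier G" and u = "word_inv u" and v = "[(x, \<not> b)]" and g = g] by (simp add: l)
 show ?case
 proof (cases b)
  case True
  have "g \<otimes> inv (x \<otimes> ev u) = g \<otimes> inv (ev u) \<otimes> inv x" using c by (simp add: inv_mult_group m_assoc)
  moreover have "g \<otimes> inv (ev u) \<otimes> inv x \<otimes> x = g \<otimes> inv (ev u)" using c by (simp add: m_assoc)
  ultimately show ?thesis unfolding 1 using True c by (simp add: l ev_Cons[of "(x, True)" u])
 next
  case False
  have "g \<otimes> inv (inv x \<otimes> ev u) = g \<otimes> inv (ev u) \<otimes> x" using c by (simp add: inv_mult_group m_assoc)
  moreover have "g \<otimes> inv (ev u) \<otimes> x \<otimes> inv x = g \<otimes> inv (ev u)" using c by (simp add: m_assoc)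
  ultimately show ?thesis unfolding 1 using False c by (simp add: l ev_Cons[of "(x, False)" u])
 qed
qed simp

text \<open>Since \<open>p\<close> fixes \<open>K\<close>, rewriting a letter in \<open>S\<close>
  and pushing the result back gives a word with the value of that letter. Each rung is therefore one
  loop of length at most \<open>N\<close>, based at a vertex on the path \<open>w\<close>.\<close>

lemma fill_ladder:
 assumes P: "pushes \<sigma> p M S T" and T: "T <= K" "K <= M" "subgroup K G" and pK: "!!k. k \<in> K ==> p k = k"
  and \<iota>: "!!x. x \<in> T ==> \<iota> x \<in> words S & ev (\<iota> x) = x"
  and bnd: "!!k x. k \<in> K ==> x \<in> T ==> length (push \<sigma> k (\<iota> x)) < N"
 shows "[|w \<in> words T; k \<in> K; !!u v. w = u @ v ==> k \<otimes> ev u \<in> V|]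
  ==> fill G T N V k (length w) w (push \<sigma> k (push (%_. \<iota>) g w))"
proof (induction w arbitrary: k g)
 case Nil
 then show ?case by (simp add: fill.refl)
next
 case (Cons l w)
 have M: "subgroup M G" "S <= M" using P by (auto simp: pushes_def)
 have Mc: "M <= carrier G" using M(1) by (rule subgroup.subset)
 have Sc: "S <= carrier G" and Tc: "T <= carrier G" and Kc: "K <= carrier G" using M Mc T by auto
 obtain x b where l: "l = (x, b)" by (cases l)
 have xw: "x \<in> T" "w \<in> words T" using Cons.prems l by auto
 have xK: "x \<in> K" using xw T by auto
 have kM: "k \<in> M" and kc: "k \<in> carrier G" and xc: "x \<in> carrier G" using Cons.prems T Mc xK Kc by auto
 define i where "i = (if b then \<iota> x else word_inv (\<iota> x))"
 have i: "i \<in> words S" "ev i = ev [(x, b)]" using \<iota>[OF xw(1)] xc words_carrier[OF Sc] by (auto simp: i_def)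
 have ic: "i \<in> words (carrier G)" using i words_carrier[OF Sc] by auto
 have wP: "push (%_. \<iota>) h w \<in> words S" for h
  using xw(2)
 proof (induction w arbitrary: h)
  case (Cons l w)
  then show ?case using \<iota> by (cases l; cases "snd l") simp_all
 qed simp
 have lx: "ev [(x, b)] \<in> K" using xK T(3) by (auto simp: xc subgroup.m_inv_closed)
 have kx: "k \<otimes> ev [(x, b)] \<in> K" using Cons.prems lx T(3) subgroup.m_closed by metis
 have len: "length (push \<sigma> k i) < N"
 proof (cases b)
  case True
  then show ?thesis using bnd[OF Cons.prems(2) xw(1)] by (simp add: i_def)
 next
  case False
  have "ev (\<iota> x) = x" "\<iota> x \<in> words (carrier G)" using \<iota>[OF xw(1)] words_carrier[OF Sc] by auto
  then have "push \<sigma> k i = word_inv (push \<sigma> (k \<otimes> inv x) (\<iota> x))"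
   using False push_word_inv[of "\<iota> x" k \<sigma>] kc by (simp add: i_def)
  moreover have "k \<otimes> inv x \<in> K" using kx False xc by simp
  ultimately show ?thesis using bnd xw(1) by simp
 qed
 have pi: "push \<sigma> k i \<in> words T" "ev (push \<sigma> k i) = inv k \<otimes> (k \<otimes> ev [(x, b)])"
  using push_closed[OF P i(1) kM] pK[OF Cons.prems(2)] pK[OF kx] i(2) by auto
 have 1: "fill G T N V k 1 [(x, b)] (push \<sigma> k i)"
  by (rule fill_repl) (use pi xw Cons.prems(3)[of "[]" "l # w"] kc xc len Tc in \<open>auto simp: m_assoc[symmetric]\<close>)
 define g' where "g' = (if b then g \<otimes> x else g \<otimes> inv x)"
 have 2: "fill G T N V (k \<otimes> ev [(x, b)]) (length w) w (push \<sigma> (k \<otimes> ev [(x, b)]) (push (%_. \<iota>) g' w))"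
 proof (rule Cons.IH[OF xw(2) kx])
  fix u v assume uv: "w = u @ v"
  then have uc: "u \<in> words (carrier G)" using xw words_carrier[OF Tc] by auto
  have "k \<otimes> ev (l # u) \<in> V" using Cons.prems(3)[of "l # u" v] uv by simp
  then show "k \<otimes> ev [(x, b)] \<otimes> ev u \<in> V"
   using kc uc xc by (simp add: l ev_Cons[of "(x, b)" u] m_assoc del: ev_singleton)
 qed
 have "fill G T N V k (1 + length w) ([(x, b)] @ w) (push \<sigma> k i @ push \<sigma> (k \<otimes> ev [(x, b)]) (push (%_. \<iota>) g' w))"
  by (rule fill_append[OF 1 2 Tc kc order_refl])
 moreover have "push \<sigma> k i @ push \<sigma> (k \<otimes> ev [(x, b)]) (push (%_. \<iota>) g' w) = push \<sigma> k (push (%_. \<iota>) g (l # w))"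
  using push_append[OF i(1) Sc words_carrier[OF Sc wP] kc, of \<sigma> g'] i(2)
  by (cases b) (auto simp: l i_def g'_def)
 ultimately show ?case by (simp add: l)
qed

text \<open>With a position-independent \<open>\<sigma>\<close>, pushing is the substitution of
  words for letters.\<close>

lemma push_const_closed:
 assumes "!!x. x \<in> T ==> \<iota> x \<in> words S & ev (\<iota> x) = x & length (\<iota> x) <= c" "w \<in> words T" "S <= carrier G" "T <= carrier G"
 shows "push (%_. \<iota>) g w \<in> words S" "ev (push (%_. \<iota>) g w) = ev w" "length (push (%_. \<iota>) g w) <= c * length w"
proof -
 have "push (%_. \<iota>) g w \<in> words S & ev (push (%_. \<iota>) g w) = ev w & length (push (%_. \<iota>) g w) <= c * length w"
  using assms(2)
 proof (induction w arbitrary: g)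
  case (Cons l w)
  obtain x b where l: "l = (x, b)" by (cases l)
  note IH = Cons.IH[of "g \<otimes> x"] Cons.IH[of "g \<otimes> inv x"]
  have x: "x \<in> T" "w \<in> words T" using Cons l by auto
  note i = assms(1)[OF x(1)]
  have c: "\<iota> x \<in> words (carrier G)" "x \<in> carrier G"
   "push (%_. \<iota>) (g \<otimes> x) w \<in> words (carrier G)" "push (%_. \<iota>) (g \<otimes> inv x) w \<in> words (carrier G)"
   using i IH words_carrier[OF assms(3)] x assms(4) by auto
  show ?case using IH i x c by (cases b) (auto simp: l eval_word_Cons letter_val_def)
 qed simp
 then show "push (%_. \<iota>) g w \<in> words S" "ev (push (%_. \<iota>) g w) = ev w" "length (push (%_. \<iota>) g w) <= c * length w"
  by auto
qed

text \<open>The common pattern behind change of generators, passage to finite index subgroups and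
  passage to a kernel: a null word is translated into the alphabet \<open>S\<close> and filled
  there, the filling is pushed back, and the ladder compares the pushed translation with the
  original word.\<close>

lemma fill_transfer:
 assumes P: "pushes \<sigma> p M S T" and T: "T <= K" "K <= M" "subgroup K G" and pK: "!!k. k \<in> K ==> p k = k"
  and \<iota>: "!!x. x \<in> T ==> \<iota> x \<in> words S & ev (\<iota> x) = x"
  and bnd: "!!k x. k \<in> K ==> x \<in> T ==> length (push \<sigma> k (\<iota> x)) < N'"
  and rel: "!!h r. h \<in> V ==> h \<in> M ==> r \<in> words S ==> length r <= N ==> ev r = \<one> ==>
   fill G T N' V' (p h) c (push \<sigma> h r) []"
  and w: "w \<in> words T" and f: "fill G S N V \<one> m (push (%_. \<iota>) \<one> w) []"
  and V': "!!u. u \<in> words T ==> length u <= length w ==> ev u \<in> V'"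
 shows "fill G T N' V' \<one> (length w + c * m) w []"
proof -
 have one: "\<one> \<in> K" "\<one> \<in> M" using T subgroup.one_closed by auto
 have Tc: "T <= carrier G" using T subgroup.subset by blast
 have 1: "fill G T N' V' \<one> (length w) w (push \<sigma> \<one> (push (%_. \<iota>) \<one> w))"
 proof (rule fill_ladder[OF P T pK \<iota> bnd w one(1)])
  fix u v assume uv: "w = u @ v"
  then have u: "u \<in> words T" using w by auto
  with V'[OF u] words_carrier[OF Tc u] show "\<one> \<otimes> ev u \<in> V'" using uv by auto
 qed
 have "fill G T N' V' (p \<one>) (c * m) (push \<sigma> \<one> (push (%_. \<iota>) \<one> w)) (push \<sigma> \<one> [])"
  by (rule fill_push[OF P one(2) f rel])
 then have 2: "fill G T N' V' \<one> (c * m) (push \<sigma> \<one> (push (%_. \<iota>) \<one> w)) []" using pK[OF one(1)] by simp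
 show ?thesis by (rule fill.trans[OF 1 2])
qed

definition gens :: "'a set => 'a set => bool" where
 "gens K S \<longleftrightarrow> finite S & S <= K & subgroup K G & (\<forall>k\<in>K. \<exists>w\<in>words S. ev w = k)"

text \<open>\<open>isop K V a b\<close>: null words of length \<open>l\<close> in \<open>K\<close> have coarse fillings of area \<open>O(a L)\<close>, based at
 vertices of the sublevel set \<open>V (O(b L))\<close>, for every sufficiently large \<open>L \<ge> C * l + C\<close>. Leaving \<open>L\<close>
 free makes monotonicity of \<open>a\<close> and \<open>b\<close> unnecessary.\<close>

definition isop_at :: "'a set => (nat => 'a set) => (nat => nat) => (nat => nat) => nat => nat => bool" where
 "isop_at S V a b N C \<longleftrightarrow> (\<forall>L w. w \<in> words S --> ev w = \<one> --> C * length w + C <= L -->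
  fill G S N (V (C * b L)) \<one> (C * a L) w [])"

definition isop_wrt :: "'a set => (nat => 'a set) => (nat => nat) => (nat => nat) => bool" where
 "isop_wrt S V a b \<longleftrightarrow> (\<exists>N C. isop_at S V a b N C)"

lemmas isop_atD = isop_at_def[THEN iffD1, rule_format]

lemma isop_wrtI:
 assumes "!!L w. w \<in> words S ==> ev w = \<one> ==> C * length w + C <= L ==>
  fill G S N (V (C * b L)) \<one> (C * a L) w []"
 shows "isop_wrt S V a b"
 unfolding isop_wrt_def by (rule exI[of _ N], rule exI[of _ C]) (simp add: assms isop_at_def)

text \<open>The sublevel family receives the generating set, so that word balls, which depend on it,
  and heights, which do not, are both instances. Requiring some generating set keeps the statement
  from being vacuous.\<close>

definition isop :: "'a set => ('a set => nat => 'a set) => (nat => nat) => (nat => nat) => bool" where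
 "isop K V a b \<longleftrightarrow> (\<exists>S. gens K S) & (\<forall>S. gens K S --> isop_wrt S (V S) a b)"

definition word_ball :: "'a set => nat => 'a set" where
 "word_ball S B = {ev u |u. u \<in> words S & length u <= B}"

definition fin_idx :: "'a set => 'a set => bool" where
 "fin_idx K M \<longleftrightarrow> subgroup K G & subgroup M G & K <= M & finite ((%g. K #> g) ` M)"

lemma gens_carrier: "gens K S ==> S <= carrier G"
 using subgroup.subset by (auto simp: gens_def)

lemma gens_words: "gens K S ==> w \<in> words S ==> w \<in> words (carrier G)"
 using gens_carrier words_carrier by blast

lemma gens_ev: "gens K S ==> w \<in> words S ==> ev w \<in> K"
 unfolding gens_def using ev_in_subgroup words_mono by metis

lemma finite_bound: "finite F ==> \<exists>c. \<forall>f\<in>F. h f <= (c :: nat)"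
 by (rule exI[of _ "\<Sum>f\<in>F. h f"]) (auto intro: member_le_sum)

lemma gens_bounded:
 assumes "gens K T" "finite F" "F <= K"
 obtains \<phi> c where "!!f. f \<in> F ==> \<phi> f \<in> words T & ev (\<phi> f) = f & length (\<phi> f) <= c"
proof -
 have "\<forall>f\<in>F. \<exists>w. w \<in> words T & ev w = f" using assms by (auto simp: gens_def)
 then obtain \<phi> where \<phi>: "\<forall>f\<in>F. \<phi> f \<in> words T & ev (\<phi> f) = f" by metis
 obtain c where "\<forall>f\<in>F. length (\<phi> f) <= c" using finite_bound[OF assms(2), of "%f. length (\<phi> f)"] by blast
 with \<phi> show ?thesis using that by blast
qed

text \<open>Representatives of right cosets, with \<open>\<one>\<close> chosen for \<open>K\<close>
  itself. This normalisation makes the retraction of \<open>M\<close> to \<open>K\<close> that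
  multiplies \<open>g\<close> by \<open>inv (c g)\<close> fix \<open>K\<close> pointwise.\<close>

lemma fin_idx_reps:
 assumes "fin_idx K M"
 obtains c where "finite (c ` M)" "!!g. g \<in> M ==> c g \<in> M & g \<otimes> inv (c g) \<in> K"
  "!!k. k \<in> K ==> c k = \<one>" "!!k g. k \<in> K ==> g \<in> M ==> c (k \<otimes> g) = c g"
proof -
 have K: "subgroup K G" and M: "subgroup M G" and KM: "K <= M" and fin: "finite ((%g. K #> g) ` M)"
  using assms by (auto simp: fin_idx_def)
 have Mc: "M <= carrier G" and Kc: "K <= carrier G" using M K subgroup.subset by auto
 define c where "c g = (if g \<in> K then \<one> else (SOME y. y \<in> K #> g))" for g
 have c1: "c g \<in> K #> g" if "g \<in> M" for g
 proof (cases "g \<in> K")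
  case True
  then have "K #> g = K" using coset_join2 K Kc by blast
  then show ?thesis using True K subgroup.one_closed by (auto simp: c_def)
 next
  case False
  have "g \<in> K #> g" using that Mc rcos_self K by auto
  then show ?thesis using False by (auto simp: c_def intro: someI)
 qed
 have "c ` M <= insert \<one> ((%X. SOME y. y \<in> X) ` ((%g. K #> g) ` M))" by (auto simp: c_def)
 then have 1: "finite (c ` M)" using fin finite_subset by blast
 have 2: "c g \<in> M & g \<otimes> inv (c g) \<in> K" if "g \<in> M" for g
 proof -
  from c1[OF that] obtain k where k: "k \<in> K" "c g = k \<otimes> g" by (auto simp: r_coset_def)
  then have "g \<otimes> inv (c g) = inv k" using that Mc Kc by (auto simp: inv_mult_group m_assoc[symmetric] subsetD)
  then show ?thesis using k K KM M that by (auto simp: subgroup.m_inv_closed subgroup.m_closed subsetD)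
 qed
 have 3: "c (k \<otimes> g) = c g" if "k \<in> K" "g \<in> M" for k g
 proof -
  have kg: "k \<in> carrier G" "g \<in> carrier G" using that Kc Mc by auto
  have "k \<otimes> g \<in> K \<longleftrightarrow> g \<in> K"
   using that kg K subgroup.m_closed[OF K] subgroup.m_inv_closed[OF K, of k]
    subgroup.m_closed[OF K, of "inv k" "k \<otimes> g"] by (auto simp: m_assoc[symmetric])
  moreover have "K #> (k \<otimes> g) = K #> g"
   using coset_mult_assoc[OF Kc kg] coset_join2[OF kg(1) K that(1)] by simp
  ultimately show ?thesis by (simp add: c_def)
 qed
 show thesis by (rule that[OF 1 2 _ 3]) (auto simp: c_def)
qed

text \<open>Schreier's retraction \<open>p g = g \<otimes> inv (c g)\<close>. The displacement along
  an edge depends only on the representative \<open>c g\<close> and on the letter, so it takes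
  finitely many values and can be spelled by words of bounded length.\<close>

lemma fin_idx_push:
 assumes KM: "fin_idx K M" and S: "finite S" "S <= M" and T: "gens K T"
 shows "\<exists>\<sigma> p c R. pushes \<sigma> p M S T & (\<forall>k\<in>K. p k = k) & (\<forall>g\<in>M. \<forall>x\<in>S. length (\<sigma> g x) <= c) &
  finite R & R <= M & (\<forall>g\<in>M. p g \<in> K & (\<exists>y\<in>R. p g = g \<otimes> y))"
proof -
 have K: "subgroup K G" and M: "subgroup M G" and KsM: "K <= M"
  using KM by (auto simp: fin_idx_def)
 have Mc: "M <= carrier G" and Kc: "K <= carrier G" using M K subgroup.subset by auto
 obtain c where c: "finite (c ` M)" "!!g. g \<in> M ==> c g \<in> M & g \<otimes> inv (c g) \<in> K"
  "!!k. k \<in> K ==> c k = \<one>" "!!k g. k \<in> K ==> g \<in> M ==> c (k \<otimes> g) = c g"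
  using fin_idx_reps[OF KM] by metis
 define p where "p g = g \<otimes> inv (c g)" for g
 have pK: "p g \<in> K" if "g \<in> M" for g using c(2)[OF that] by (simp add: p_def)
 define d where "d g x = inv (p g) \<otimes> p (g \<otimes> x)" for g x
 have d: "d g x = c g \<otimes> x \<otimes> inv (c (c g \<otimes> x))" if "g \<in> M" "x \<in> S" for g x
 proof -
  have m: "c g \<in> M" "x \<in> M" "c g \<otimes> x \<in> M" "g \<otimes> x \<in> M"
   using c(2)[OF that(1)] that S subgroup.m_closed[OF M] by auto
  have gc: "g \<in> carrier G" "x \<in> carrier G" "c g \<in> carrier G" "c (g \<otimes> x) \<in> carrier G" using that S Mc m c(2)[OF m(4)] by auto
  have "p g \<otimes> (c g \<otimes> x) = g \<otimes> x" using gc by (simp add: p_def m_assoc[symmetric]) (simp add: m_assoc)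
  then have "c (g \<otimes> x) = c (c g \<otimes> x)" using c(4)[OF pK[OF that(1)] m(3)] by simp
  moreover have "d g x = c g \<otimes> x \<otimes> inv (c (g \<otimes> x))"
   using gc by (simp add: d_def p_def inv_mult_group m_assoc) (simp add: m_assoc[symmetric])
  ultimately show ?thesis by simp
 qed
 define F where "F = (%(y, x). y \<otimes> x \<otimes> inv (c (y \<otimes> x))) ` (c ` M \<times> S)"
 have F: "finite F" using c(1) S by (simp add: F_def)
 have FK: "F <= K" using c(2) S M by (auto simp: F_def subgroup.m_closed subsetD)
 obtain \<phi> b where \<phi>: "!!f. f \<in> F ==> \<phi> f \<in> words T & ev (\<phi> f) = f & length (\<phi> f) <= b"
  using gens_bounded[OF T F FK] by metis
 have dF: "d g x \<in> F" if "g \<in> M" "x \<in> S" for g x using that d[OF that] by (auto simp: F_def)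
 have "pushes (%g x. \<phi> (d g x)) p M S T"
  using M S pK Kc \<phi>[OF dF] gens_carrier[OF T] by (auto simp: pushes_def d_def)
 moreover have "\<forall>k\<in>K. p k = k" using c(3) Kc by (auto simp: p_def)
 moreover have "\<forall>g\<in>M. \<forall>x\<in>S. length (\<phi> (d g x)) <= b" using \<phi>[OF dF] by auto
 moreover have "finite ((%y. inv y) ` c ` M)" using c(1) by auto
 moreover have "(%y. inv y) ` c ` M <= M" using c(2) M by (auto simp: subgroup.m_inv_closed)
 moreover have "\<forall>g\<in>M. p g \<in> K & (\<exists>y\<in>(%y. inv y) ` c ` M. p g = g \<otimes> y)"
  using pK by (auto simp: p_def)
 ultimately show ?thesis by blast
qed

end

section \<open>Change of generators, finite index subgroups and overgroups\<close>

context group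
begin

lemma left_cancel: "x \<in> carrier G ==> y \<in> carrier G ==> z \<in> carrier G ==> x \<otimes> y = x \<otimes> z \<longleftrightarrow> y = z"
 using Units_eq Units_l_cancel by blast

lemma ball_mono: "B <= B' ==> word_ball S B <= word_ball S B'"
 by (fastforce simp: word_ball_def)

lemma fin_idx_refl: "subgroup K G ==> fin_idx K K"
proof -
 assume K: "subgroup K G"
 then have "(%g. K #> g) ` K <= {K}" using coset_join2 subgroup.subset by blast
 then show ?thesis using K by (auto simp: fin_idx_def intro: finite_subset)
qed

text \<open>The Reidemeister--Schreier argument: a path in \<open>M\<close> is pushed to the finite index subgroup \<open>K\<close> by
 moving each vertex to a nearby point of \<open>K\<close>. The case \<open>K = M\<close> is a change of generators.\<close>

lemma isop_wrt_fin_idx: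
 assumes KM: "fin_idx K M" and S: "gens M S" and T: "gens K T"
  and iso: "isop_wrt S V a b"
  and ab: "!!L. L <= a L & L <= b L"
  and mono: "!!B B'. B <= B' ==> V' B <= V' B'"
  and V1: "!!R. finite R ==> R <= M ==> \<exists>c. \<forall>B g y. g \<in> V B & g \<in> M & y \<in> R & g \<otimes> y \<in> K --> g \<otimes> y \<in> V' (c * B + c)"
  and V2: "\<exists>c. \<forall>w\<in>words T. ev w \<in> V' (c * length w + c)"
 shows "isop_wrt T V' a b"
proof -
 have K: "subgroup K G" and M: "subgroup M G" and KsM: "K <= M"
  using KM by (auto simp: fin_idx_def)
 have fS: "finite S" and SM: "S <= M" and fT: "finite T" and TK: "T <= K" using S T by (auto simp: gens_def)
 have Sc: "S <= carrier G" and Tc: "T <= carrier G" using gens_carrier S T by auto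
 obtain N C where "isop_at S V a b N C" using iso by (auto simp: isop_wrt_def)
 note NC = isop_atD[OF this]
 obtain \<sigma> p c1 R where P: "pushes \<sigma> p M S T" and pK0: "\<forall>k\<in>K. p k = k"
  and c10: "\<forall>g\<in>M. \<forall>x\<in>S. length (\<sigma> g x) <= c1"
  and R0: "finite R" "R <= M" "\<forall>g\<in>M. p g \<in> K & (\<exists>y\<in>R. p g = g \<otimes> y)"
  using fin_idx_push[OF KM fS SM T] by blast
 note pK = pK0[rule_format] and c1 = c10[rule_format] and R = R0(1,2) R0(3)[rule_format]
 obtain \<iota> c2 where \<iota>: "!!x. x \<in> T ==> \<iota> x \<in> words S & ev (\<iota> x) = x & length (\<iota> x) <= c2"
  using gens_bounded[OF S fT] TK KsM by (metis subset_trans)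
 obtain c3 where c3: "!!B g y. g \<in> V B ==> g \<in> M ==> y \<in> R ==> g \<otimes> y \<in> K ==> g \<otimes> y \<in> V' (c3 * B + c3)"
  using V1[OF R(1,2)] by blast
 obtain c4 where c4: "!!w. w \<in> words T ==> ev w \<in> V' (c4 * length w + c4)" using V2 by blast
 \<comment> \<open>\<open>c1 * c2\<close> bounds the pushed translation of a letter of
   \<open>T\<close> in the ladder, \<open>c1 * N\<close> a pushed relator.\<close>
 define N' where "N' = c1 * c2 + c1 * N + 1"
 \<comment> \<open>\<open>C * c2 + C\<close> makes the translated word short enough for the given
   filling, 1 pays for the ladder, \<open>c3 * C + c3\<close> covers base vertices displaced by
   \<open>p\<close>, and \<open>2 * c4\<close> those on the word itself.\<close>
 define C' where "C' = C * c2 + C + 1 + c3 * C + c3 + 2 * c4"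
 have len: "length (push \<sigma> h r) <= c1 * length r" if "h \<in> M" "r \<in> words S" for h r
  by (rule push_length[OF c1 M SM that(2,1)])
 have "fill G T N' (V' (C' * b L)) \<one> (C' * a L) w []"
  if w: "w \<in> words T" "ev w = \<one>" and L: "C' * length w + C' <= L" for L w
 proof -
  have L1: "1 <= L" "length w <= L" using L by (auto simp: C'_def)
  have bL: "L <= b L" "1 <= b L" using ab[of L] L1 by auto
  let ?u = "push (%_. \<iota>) \<one> w"
  note u = push_const_closed[OF \<iota> w(1) Sc Tc, of \<one>]
  have "C * length ?u <= C * (c2 * length w)" using u(3) by (rule mult_le_mono2)
  also have "C * (c2 * length w) <= C' * length w" by (simp add: C'_def distrib_right)
  finally have "C * length ?u + C <= L" using L by (simp add: C'_def)
  then have f: "fill G S N (V (C * b L)) \<one> (C * a L) ?u []" using NC u w by auto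
  have "fill G T N' (V' (C' * b L)) \<one> (length w + 1 * (C * a L)) w []"
  proof (rule fill_transfer[OF P TK KsM K pK _ _ _ w(1) f])
   show "\<iota> x \<in> words S & ev (\<iota> x) = x" if "x \<in> T" for x using \<iota>[OF that] by simp
   show "length (push \<sigma> k (\<iota> x)) < N'" if "k \<in> K" "x \<in> T" for k x
   proof -
    have "length (push \<sigma> k (\<iota> x)) <= c1 * length (\<iota> x)" using len that KsM \<iota> by blast
    also have "... <= c1 * c2" using \<iota>[OF that(2)] by simp
    finally show ?thesis by (simp add: N'_def)
   qed
   show "fill G T N' (V' (C' * b L)) (p h) 1 (push \<sigma> h r) []"
    if h: "h \<in> V (C * b L)" "h \<in> M" and r: "r \<in> words S" "length r <= N" "ev r = \<one>" for h r
   proof -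
    have hc: "h \<in> carrier G" using h M subgroup.subset by blast
    have pc: "p h \<in> K" "p h \<in> carrier G" using R(3)[OF h(2)] K subgroup.subset by blast+
    have pV3: "p h \<in> V' (c3 * (C * b L) + c3)" using R(3)[OF h(2)] c3[OF h] by auto
    have "c3 <= c3 * b L" using bL(2) by (cases "b L") auto
    moreover have "C' * b L = c3 * (C * b L) + c3 * b L + (C * c2 + C + 1 + 2 * c4) * b L"
     by (simp add: C'_def algebra_simps)
    ultimately have "c3 * (C * b L) + c3 <= C' * b L" by linarith
    then have pV: "p h \<in> V' (C' * b L)" using mono pV3 by blast
    have "length (push \<sigma> h r) <= c1 * N" using len[OF h(2) r(1)] r(2) mult_le_mono2 order_trans by blast
    then show ?thesis
     by (intro fill_repl)
      (use push_closed[OF P r(1) h(2)] r(3) hc pc pV Tc in \<open>auto simp: N'_def\<close>)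
   qed
   show "ev u \<in> V' (C' * b L)" if "u \<in> words T" "length u <= length w" for u
   proof -
    have "c4 * length u <= c4 * b L" using that(2) L1 bL by (intro mult_le_mono) auto
    moreover have "c4 <= c4 * b L" using bL(2) by (cases "b L") auto
    moreover have "C' * b L = c4 * b L + c4 * b L + (C * c2 + C + 1 + c3 * C + c3) * b L"
     by (simp add: C'_def algebra_simps)
    ultimately have "c4 * length u + c4 <= C' * b L" by linarith
    then show ?thesis using c4[OF that(1)] mono by blast
   qed
  qed
  moreover have "length w + 1 * (C * a L) <= C' * a L"
  proof -
   have "length w <= a L" using L1 ab[of L] by auto
   then show ?thesis by (simp add: C'_def algebra_simps)
  qed
  ultimately show ?thesis by (rule fill_weaken)
 qed
 then show ?thesis by (rule isop_wrtI)
qed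

text \<open>\<open>T\<close> consists of Schreier's generators; pushing a word for \<open>k\<close>
  from \<open>\<one>\<close> spells \<open>k\<close> in them.\<close>

lemma gens_fin_idx:
 assumes KM: "fin_idx K M" and S: "gens M S"
 shows "\<exists>T. gens K T"
proof -
 have K: "subgroup K G" and M: "subgroup M G" and KsM: "K <= M"
  using KM by (auto simp: fin_idx_def)
 have SM: "finite S" "S <= M" using S by (auto simp: gens_def)
 have Mc: "M <= carrier G" and Kc: "K <= carrier G" using M K subgroup.subset by auto
 obtain c where c: "finite (c ` M)" "!!g. g \<in> M ==> c g \<in> M & g \<otimes> inv (c g) \<in> K"
  "!!k. k \<in> K ==> c k = \<one>" "!!k g. k \<in> K ==> g \<in> M ==> c (k \<otimes> g) = c g"
  using fin_idx_reps[OF KM] by metis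
 define T where "T = (%(y, x). y \<otimes> x \<otimes> inv (c (y \<otimes> x))) ` (c ` M \<times> S)"
 have T: "finite T" "T <= K"
  using c(1,2) SM M by (auto simp: T_def subgroup.m_closed subsetD)
 have Tc: "T <= carrier G" using T Kc by auto
 define d where "d g x = c g \<otimes> x \<otimes> inv (c (g \<otimes> x))" for g x
 have dT: "d g x \<in> T" if "g \<in> M" "x \<in> S" for g x
 proof -
  have m: "c g \<in> M" "x \<in> M" "c g \<otimes> x \<in> M" "g \<otimes> x \<in> M"
   using c(2)[OF that(1)] that SM subgroup.m_closed[OF M] by auto
  have gc: "g \<in> carrier G" "x \<in> carrier G" "c g \<in> carrier G" using that SM Mc m by auto
  have "g \<otimes> inv (c g) \<otimes> (c g \<otimes> x) = g \<otimes> x" using gc by (simp add: m_assoc[symmetric]) (simp add: m_assoc)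
  then have "c (g \<otimes> x) = c (c g \<otimes> x)" using c(4)[of "g \<otimes> inv (c g)" "c g \<otimes> x"] c(2)[OF that(1)] m by simp
  then show ?thesis using that by (auto simp: T_def d_def)
 qed
 have "pushes (%g x. [(d g x, True)]) (%g. g \<otimes> inv (c g)) M S T"
  unfolding pushes_def
 proof (intro conjI ballI)
  fix g x assume gx: "g \<in> M" "x \<in> S"
  have m: "c g \<in> M" "x \<in> M" "g \<otimes> x \<in> M"
   using c(2)[OF gx(1)] gx SM subgroup.m_closed[OF M] by auto
  have gc: "g \<in> carrier G" "x \<in> carrier G" "c g \<in> carrier G" "c (g \<otimes> x) \<in> carrier G"
   using gx Mc m c(2)[OF m(3)] by auto
  have "d g x = inv (g \<otimes> inv (c g)) \<otimes> (g \<otimes> x \<otimes> inv (c (g \<otimes> x)))"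
   using gc by (simp add: d_def inv_mult_group m_assoc) (simp add: m_assoc[symmetric])
  then show "ev [(d g x, True)] = inv (g \<otimes> inv (c g)) \<otimes> (g \<otimes> x \<otimes> inv (c (g \<otimes> x)))"
   using gc by (simp add: d_def)
  show "[(d g x, True)] \<in> words T" using dT[OF gx] by simp
 next
  fix g assume "g \<in> M" then show "g \<otimes> inv (c g) \<in> carrier G" using c(2) Kc by auto
 qed (use M SM Tc in auto)
 note P = this
 have one: "\<one> \<in> M" "\<one> \<in> K" using M K subgroup.one_closed by auto
 have "\<exists>w\<in>words T. ev w = k" if "k \<in> K" for k
 proof -
  have "k \<in> M" using that KsM by auto
  then obtain w where w: "w \<in> words S" "ev w = k" using S unfolding gens_def by blast
  have kc: "k \<in> carrier G" using that Kc by auto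
  note q = push_closed[OF P w(1) one(1)]
  have "ev (push (%g x. [(d g x, True)]) \<one> w) = k" using q(2) w(2) c(3)[OF that] c(3)[OF one(2)] kc by simp
  then show ?thesis using q(1) by blast
 qed
 then show ?thesis using T K by (auto simp: gens_def)
qed

text \<open>The case \<open>K = M\<close> of the transfer makes one generating set sufficient. The
  last two hypotheses say that sublevel sets grow linearly under bounded displacements and contain
  the values of words at a level linear in the length.\<close>

lemma isopI:
 assumes S: "gens K S" "isop_wrt S V a b" and ab: "!!L. L <= a L & L <= b L"
  and mono: "!!B B'. B <= B' ==> V B <= V B'"
  and V1: "!!R. finite R ==> R <= K ==> \<exists>c. \<forall>B g y. g \<in> V B & g \<in> K & y \<in> R --> g \<otimes> y \<in> V (c * B + c)"
  and V2: "!!T. gens K T ==> \<exists>c. \<forall>w\<in>words T. ev w \<in> V (c * length w + c)"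
 shows "isop K (%_. V) a b"
 unfolding isop_def
proof (intro conjI allI impI)
 show "\<exists>S. gens K S" using S by blast
 fix T assume T: "gens K T"
 have "fin_idx K K" using fin_idx_refl S by (simp add: gens_def)
 then show "isop_wrt T V a b"
 proof (rule isop_wrt_fin_idx[OF _ S(1) T S(2) ab mono _ V2[OF T]])
  fix R assume R: "finite R" "R <= K"
  from V1[OF R] show "\<exists>c. \<forall>B g y. g \<in> V B & g \<in> K & y \<in> R & g \<otimes> y \<in> K --> g \<otimes> y \<in> V (c * B + c)"
   by (elim ex_forward) simp
 qed
qed

lemma isop_UNIVI:
 assumes "gens K S" "isop_wrt S (%_. UNIV) a b" "!!L. L <= a L & L <= b L"
 shows "isop K (%_ _. UNIV) a b"
 by (rule isopI[OF assms(1,2,3)]) auto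

lemma isop_UNIV_weaken:
 assumes "isop K V a b"
 shows "isop K (%_ _. UNIV) a b'"
proof -
 have "isop_wrt S (%_. UNIV) a b'" if S: "isop_wrt S V' a b" for S V'
 proof -
  obtain N C where "isop_at S V' a b N C" using S by (auto simp: isop_wrt_def)
 note NC = isop_atD[OF this]
  show ?thesis
  proof (rule isop_wrtI)
   fix L w assume "w \<in> words S" "ev w = \<one>" "C * length w + C <= L"
   then have "fill G S N (V' (C * b L)) \<one> (C * a L) w []" by (rule NC)
   then show "fill G S N UNIV \<one> (C * a L) w []" by (rule fill_mono) simp_all
  qed
 qed
 then show ?thesis using assms by (auto simp: isop_def)
qed

text \<open>The word metrics of \<open>K\<close> and \<open>M\<close> are comparable on
  \<open>K\<close>: a word for \<open>g\<close> is pushed into \<open>K\<close> and then corrected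
  by \<open>inv (p g) \<otimes> (g \<otimes> y)\<close>, which ranges over the finite set
  \<open>F\<close>.\<close>

lemma ball_V1:
 assumes KM: "fin_idx K M" and S: "gens M S" and T: "gens K T" and R: "finite R" "R <= M"
 shows "\<exists>c. \<forall>B g y. g \<in> word_ball S B & g \<in> M & y \<in> R & g \<otimes> y \<in> K --> g \<otimes> y \<in> word_ball T (c * B + c)"
proof -
 have K: "subgroup K G" and M: "subgroup M G" and KsM: "K <= M"
  using KM by (auto simp: fin_idx_def)
 have Mc: "M <= carrier G" and Kc: "K <= carrier G" using M K subgroup.subset by auto
 have Tc: "T <= carrier G" using gens_carrier T by auto
 have fS: "finite S" "S <= M" using S by (auto simp: gens_def)
 obtain \<sigma> p c1 R' where P: "pushes \<sigma> p M S T" and pK0: "\<forall>k\<in>K. p k = k"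
  and c10: "\<forall>g\<in>M. \<forall>x\<in>S. length (\<sigma> g x) <= c1"
  and R0: "finite R'" "R' <= M" "\<forall>g\<in>M. p g \<in> K & (\<exists>y\<in>R'. p g = g \<otimes> y)"
  using fin_idx_push[OF KM fS T] by blast
 note pK = pK0[rule_format] and c1 = c10[rule_format] and R' = R0(1,2) R0(3)[rule_format]
 define F where "F = (%(z, y). inv z \<otimes> y) ` (R' \<times> R) \<inter> K"
 have F: "finite F" "F <= K" using R R' by (auto simp: F_def)
 obtain \<phi> c2 where \<phi>: "!!f. f \<in> F ==> \<phi> f \<in> words T & ev (\<phi> f) = f & length (\<phi> f) <= c2"
  using gens_bounded[OF T F] by metis
 have "g \<otimes> y \<in> word_ball T ((c1 + c2) * B + (c1 + c2))"
  if g: "g \<in> word_ball S B" "g \<in> M" and y: "y \<in> R" "g \<otimes> y \<in> K" for B g y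
 proof -
  obtain u where u: "u \<in> words S" "ev u = g" "length u <= B" using g by (auto simp: word_ball_def)
  have one: "\<one> \<in> M" "\<one> \<in> K" using M K subgroup.one_closed by auto
  have pg: "p g \<in> K" "p g \<in> carrier G" using R'(3)[OF g(2)] Kc by auto
  from R'(3)[OF g(2)] obtain z where z: "z \<in> R'" "p g = g \<otimes> z" by auto
  have cc: "g \<in> carrier G" "y \<in> carrier G" "z \<in> carrier G" using g y z R R' Mc by auto
  have e: "ev (push \<sigma> \<one> u) = p g" using push_closed(2)[OF P u(1) one(1)] pK[OF one(2)] u(2) cc pg by simp
  have "length (push \<sigma> \<one> u) <= c1 * length u" by (rule push_length[OF c1 M fS(2) u(1) one(1)])
  also have "... <= c1 * B" using u(3) by simp
  finally have l: "length (push \<sigma> \<one> u) <= c1 * B" .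
  have f: "inv (p g) \<otimes> (g \<otimes> y) = inv z \<otimes> y" using z cc by (simp add: inv_mult_group m_assoc) (simp add: m_assoc[symmetric])
  have "inv (p g) \<otimes> (g \<otimes> y) \<in> K" using pg y K by (simp add: subgroup.m_closed subgroup.m_inv_closed)
  then have fF: "inv z \<otimes> y \<in> F" using f z y by (auto simp: F_def)
  let ?w = "push \<sigma> \<one> u @ \<phi> (inv z \<otimes> y)"
  have w: "?w \<in> words T" using push_closed(1)[OF P u(1) one(1)] \<phi>[OF fF] by auto
  moreover have "ev ?w = g \<otimes> y"
  proof -
   have wc: "push \<sigma> \<one> u \<in> words (carrier G)" "\<phi> (inv z \<otimes> y) \<in> words (carrier G)"
    using w words_carrier[OF Tc] by auto
   have "ev ?w = p g \<otimes> (inv (p g) \<otimes> (g \<otimes> y))" using ev_append[OF wc] e \<phi>[OF fF] f by simp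
   also have "... = g \<otimes> y" using pg(2) cc by (simp add: m_assoc[symmetric])
   finally show ?thesis .
  qed
  moreover have "length ?w <= (c1 + c2) * B + (c1 + c2)" using l \<phi>[OF fF] by (simp add: algebra_simps)
  ultimately show ?thesis unfolding word_ball_def by (intro CollectI exI[of _ ?w] conjI) (rule HOL.sym)
 qed
 then show ?thesis by blast
qed

lemma ball_V2: "\<exists>c. \<forall>w\<in>words T. ev w \<in> word_ball T (c * length w + c)"
 by (rule exI[of _ 1]) (auto simp: word_ball_def)

lemma isop_ball_fin_idx:
 assumes iso: "isop M word_ball a b" and KM: "fin_idx K M" and ab: "!!L. L <= a L & L <= b L"
 shows "isop K word_ball a b"
proof -
 obtain S where S: "gens M S" "isop_wrt S (word_ball S) a b" using iso by (auto simp: isop_def)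
 show ?thesis unfolding isop_def
 proof (intro conjI allI impI)
  show "\<exists>T. gens K T" by (rule gens_fin_idx[OF KM S(1)])
  fix T assume T: "gens K T"
  show "isop_wrt T (word_ball T) a b"
   by (rule isop_wrt_fin_idx[OF KM S(1) T S(2) ab ball_mono ball_V1[OF KM S(1) T] ball_V2])
 qed
qed

lemma isop_ballI:
 assumes S: "gens K S" "isop_wrt S (word_ball S) a b" and ab: "!!L. L <= a L & L <= b L"
 shows "isop K word_ball a b"
 unfolding isop_def
proof (intro conjI allI impI)
 show "\<exists>T. gens K T" using S by blast
 fix T assume T: "gens K T"
 have KK: "fin_idx K K" using fin_idx_refl S by (simp add: gens_def)
 show "isop_wrt T (word_ball T) a b"
  by (rule isop_wrt_fin_idx[OF KK S(1) T S(2) ab ball_mono ball_V1[OF KK S(1) T] ball_V2])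
qed

text \<open>Passing to a finite index overgroup: the prefix of a word is tracked by its coset representative.\<close>

lemma isop_overgroup:
 assumes iso: "isop K V a b" and KM: "fin_idx K M" and ab: "!!L. L <= a L & L <= b L"
 shows "isop M (%_ _. UNIV) a b"
proof -
 have K: "subgroup K G" and M: "subgroup M G" and KsM: "K <= M"
  using KM by (auto simp: fin_idx_def)
 have Mc: "M <= carrier G" and Kc: "K <= carrier G" using M K subgroup.subset by auto
 have one: "\<one> \<in> M" "\<one> \<in> K" using M K subgroup.one_closed by auto
 obtain T where T: "gens K T" "isop_wrt T (%_. UNIV) a b"
  using isop_UNIV_weaken[OF iso] by (auto simp: isop_def)
 then obtain N C where "isop_at T (%_. UNIV) a b N C" using T(2) by (auto simp: isop_wrt_def)
 note NC = isop_atD[OF this]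
 obtain c where c: "finite (c ` M)" "!!g. g \<in> M ==> c g \<in> M & g \<otimes> inv (c g) \<in> K"
  "!!k. k \<in> K ==> c k = \<one>" "!!k g. k \<in> K ==> g \<in> M ==> c (k \<otimes> g) = c g"
  using fin_idx_reps[OF KM] by metis
 define S where "S = T \<union> c ` M"
 have TS: "T <= S" by (auto simp: S_def)
 have fS: "finite S" "S <= M" using T c KsM by (auto simp: S_def gens_def)
 have Sc: "S <= carrier G" using fS Mc by auto
 have cS: "c g \<in> S" "c g \<in> carrier G" if "g \<in> M" for g using that c(2) Mc by (auto simp: S_def)
 have gS: "gens M S"
  unfolding gens_def
 proof (intro conjI ballI)
  fix g assume g: "g \<in> M"
  obtain w where w: "w \<in> words T" "ev w = g \<otimes> inv (c g)" using T(1) c(2)[OF g] by (auto simp: gens_def)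
  have "ev (w @ [(c g, True)]) = g"
   using w g gens_words[OF T(1) w(1)] cS(2)[OF g] Mc by (simp add: m_assoc subsetD)
  moreover have "w @ [(c g, True)] \<in> words S" using words_mono[OF TS w(1)] cS[OF g] by simp
  ultimately show "\<exists>w\<in>words S. ev w = g" by blast
 qed (use fS M in auto)
 obtain \<sigma> p c1 R where P: "pushes \<sigma> p M S T" and pK0: "\<forall>k\<in>K. p k = k"
  and c10: "\<forall>g\<in>M. \<forall>x\<in>S. length (\<sigma> g x) <= c1"
  and R0: "finite R" "R <= M" "\<forall>g\<in>M. p g \<in> K & (\<exists>y\<in>R. p g = g \<otimes> y)"
  using fin_idx_push[OF KM fS T(1)] by blast
 note pK = pK0[rule_format] and c1 = c10[rule_format] and R = R0(1,2) R0(3)[rule_format]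
 define R1 where "R1 = (%y. inv y) ` R"
 have R1: "finite R1" "R1 <= M" using R M by (auto simp: R1_def subgroup.m_inv_closed)
 \<comment> \<open>The bounded remainder in \<open>g = p g \<otimes> q g\<close>.\<close>
 define q where "q g = inv (p g) \<otimes> g" for g
 have q: "q g \<in> R1 & p g \<otimes> q g = g" if "g \<in> M" for g
 proof -
  from R(3)[OF that] obtain y where y: "y \<in> R" "p g = g \<otimes> y" by auto
  have cc: "g \<in> carrier G" "y \<in> carrier G" using that y R Mc by auto
  have "q g = inv y" using y cc by (simp add: q_def inv_mult_group m_assoc)
  then show ?thesis using y cc by (auto simp: R1_def m_assoc)
 qed
 obtain h c2 where h: "!!f. f \<in> R1 ==> h f \<in> words S & ev (h f) = f & length (h f) <= c2"
  using gens_bounded[OF gS R1] by metis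
 \<comment> \<open>A rung of the ladder consists of two remainders of length at most
   \<open>c2\<close>, one letter, and one pushed letter of length at most \<open>c1\<close>.\<close>
 define N' where "N' = N + c1 + 2 * c2 + 1"
 have pc: "p g \<in> carrier G" if "g \<in> M" for g using R(3)[OF that] Kc by auto
 \<comment> \<open>Carrying the remainder through \<open>w\<close> from left to right turns
   \<open>w\<close> into its push, a word in the generators of \<open>K\<close>, at the cost of one
   loop per letter.\<close>
 have lad: "fill G S N' UNIV (p g) (length w) (h (q g) @ w) (push \<sigma> g w @ h (q (g \<otimes> ev w)))"
  if "w \<in> words S" "g \<in> M" for g w
  using that
 proof (induction w arbitrary: g)
  case Nil
  then have "g \<otimes> \<one> = g" "h (q g) \<in> words S" using h q Mc by auto
  then show ?case by (simp add: fill.refl)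
 next
  case (Cons l w)
  obtain x b where l: "l = (x, b)" by (cases l)
  have x: "x \<in> S" "x \<in> M" "x \<in> carrier G" "w \<in> words S" "w \<in> words (carrier G)"
   using Cons.prems l fS Sc words_carrier[OF Sc] by auto
  let ?y = "ev [(x, b)]"
  have yM: "?y \<in> M" using x M by (auto simp: subgroup.m_inv_closed)
  have gy: "g \<otimes> ?y \<in> M" using Cons.prems yM M subgroup.m_closed by metis
  have gc: "g \<in> carrier G" "?y \<in> carrier G" using Cons.prems yM Mc by auto
  let ?s = "push \<sigma> g [(x, b)]"
  have s: "?s \<in> words T" "ev ?s = inv (p g) \<otimes> p (g \<otimes> ?y)"
   using push_closed[OF P _ Cons.prems(2), where w = "[(x, b)]"] x by auto
  have sl: "length ?s <= c1" using push_length[OF c1 M fS(2) _ Cons.prems(2), where w = "[(x, b)]"] x by auto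
  have sS: "?s \<in> words S" using words_mono[OF TS s(1)] .
  have psh: "push \<sigma> g ((x, b) # w) = ?s @ push \<sigma> (g \<otimes> ?y) w"
   using push_append[where u = "[(x, b)]" and S = S and v = w and g = g and \<sigma> = \<sigma>] x Sc gc by simp
  have hw: "h (q g) \<in> words S" "h (q (g \<otimes> ?y)) \<in> words S" "h (q g) \<in> words (carrier G)" "h (q (g \<otimes> ?y)) \<in> words (carrier G)"
   using h q gy Cons.prems(2) words_carrier[OF Sc] by auto
  have e: "ev (h (q g) @ [(x, b)]) = ev (?s @ h (q (g \<otimes> ?y)))"
  proof -
   have "p g \<otimes> (ev (h (q g)) \<otimes> ?y) = g \<otimes> ?y"
    using h[of "q g"] q[OF Cons.prems(2)] gc pc[OF Cons.prems(2)] hw by (metis ev_closed m_assoc)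
   moreover have "p g \<otimes> (ev ?s \<otimes> ev (h (q (g \<otimes> ?y)))) = g \<otimes> ?y"
   proof -
    have "p g \<otimes> ev ?s = p (g \<otimes> ?y)" using s(2) pc[OF gy] pc[OF Cons.prems(2)] by (simp add: m_assoc[symmetric])
    then show ?thesis using h[of "q (g \<otimes> ?y)"] q[OF gy] pc[OF Cons.prems(2)] hw words_carrier[OF Sc sS]
     by (metis ev_closed m_assoc)
   qed
   ultimately have "p g \<otimes> (ev (h (q g)) \<otimes> ?y) = p g \<otimes> (ev ?s \<otimes> ev (h (q (g \<otimes> ?y))))" by simp
   then have "ev (h (q g)) \<otimes> ?y = ev ?s \<otimes> ev (h (q (g \<otimes> ?y)))"
    using hw words_carrier[OF Sc sS] gc pc[OF Cons.prems(2)] by (metis ev_closed left_cancel m_closed)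
   then show ?thesis using hw words_carrier[OF Sc sS] x by (simp del: ev_singleton)
  qed
  have 1: "fill G S N' UNIV (p g) 1 (h (q g) @ [(x, b)]) (?s @ h (q (g \<otimes> ?y)))"
   by (rule fill_repl)
    (use hw sS x sl e Sc pc[OF Cons.prems(2)] h[of "q g"] h[of "q (g \<otimes> ?y)"] q[OF gy] q[OF Cons.prems(2)] in \<open>auto simp: N'_def\<close>)
  have 2: "fill G S N' UNIV (p g) 1 ((h (q g) @ [(x, b)]) @ w) ((?s @ h (q (g \<otimes> ?y))) @ w)"
   by (rule fill_append1[OF 1 x(4) Sc pc[OF Cons.prems(2)]])
  have "p g \<otimes> ev ?s = p (g \<otimes> ?y)" using s(2) pc[OF gy] pc[OF Cons.prems(2)] by (simp add: m_assoc[symmetric])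
  then have 3: "fill G S N' UNIV (p g \<otimes> ev ?s) (length w) (h (q (g \<otimes> ?y)) @ w) (push \<sigma> (g \<otimes> ?y) w @ h (q (g \<otimes> ?y \<otimes> ev w)))"
   using Cons.IH[OF x(4) gy] by simp
  have 4: "fill G S N' UNIV (p g) (length w) (?s @ h (q (g \<otimes> ?y)) @ w) (?s @ push \<sigma> (g \<otimes> ?y) w @ h (q (g \<otimes> ?y \<otimes> ev w)))"
   by (rule fill_append2[OF 3 sS Sc pc[OF Cons.prems(2)]])
  have a: "g \<otimes> ev (l # w) = g \<otimes> ?y \<otimes> ev w" unfolding l by (subst ev_Cons) (use x gc in \<open>auto simp: m_assoc simp del: ev_singleton\<close>)
  have "fill G S N' UNIV (p g) (1 + length w) (h (q g) @ [(x, b)] @ w) (?s @ push \<sigma> (g \<otimes> ?y) w @ h (q (g \<otimes> ?y \<otimes> ev w)))"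
   using fill.trans[OF 2[unfolded append_assoc] 4] .
  then show ?case unfolding a unfolding l psh by simp
 qed
 define C' where "C' = C * c1 + C + 4"
 have "fill G S N' UNIV \<one> (C' * a L) w []"
  if w: "w \<in> words S" "ev w = \<one>" and L: "C' * length w + C' <= L" for L w
 proof -
  \<comment> \<open>At \<open>\<one>\<close> the remainder is trivial, but the word chosen for it
    may be non-empty; one loop at either end removes it.\<close>
  let ?h = "h (q \<one>)" and ?u = "push \<sigma> \<one> w"
  have qo: "q \<one> = \<one>" using pK[OF one(2)] by (simp add: q_def)
  have hh: "?h \<in> words S" "ev ?h = \<one>" "length ?h <= c2" using h[of "q \<one>"] q[OF one(1)] qo by auto
  have h1: "fill G S N' UNIV \<one> 1 ?h []" by (rule fill_repl) (use hh Sc in \<open>auto simp: N'_def\<close>)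
  have u: "?u \<in> words T" "ev ?u = \<one>" using push_closed[OF P w(1) one(1)] w(2) pK[OF one(2)] by auto
  have "C * length ?u <= C * (c1 * length w)" using push_length[OF c1 M fS(2) w(1) one(1)] by (rule mult_le_mono2)
  also have "C * (c1 * length w) <= C' * length w" by (simp add: C'_def distrib_right)
  finally have "C * length ?u + C <= L" using L by (simp add: C'_def)
  then have f: "fill G S N' UNIV \<one> (C * a L) ?u []"
   using fill_mono[OF NC[OF u] TS _ subset_UNIV order_refl] by (auto simp: N'_def)
  have 1: "fill G S N' UNIV \<one> 1 (?h @ w) ([] @ w)" by (rule fill_append1[OF h1 w(1) Sc]) auto
  have 2: "fill G S N' UNIV \<one> (length w) (?h @ w) (?u @ ?h)" using lad[OF w(1) one(1)] w(2) pK[OF one(2)] by simp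
  have 3: "fill G S N' UNIV \<one> (C * a L + 1) (?u @ ?h) ([] @ [])"
   by (rule fill_append[OF f _ Sc]) (use u(2) h1 in auto)
  have "fill G S N' UNIV \<one> (1 + length w + (C * a L + 1)) w []"
   using fill.trans[OF fill.trans[OF fill.sym[OF 1] 2] 3] by simp
  moreover have "1 + length w + (C * a L + 1) <= C' * a L"
  proof -
   have "length w <= C' * length w" "1 <= C'" by (simp_all add: C'_def)
   then have "length w <= a L" "1 <= a L" using L ab[of L] by linarith+
   then show ?thesis by (simp add: C'_def algebra_simps)
  qed
  ultimately show ?thesis by (rule fill_weaken)
 qed
 then have "isop_wrt S (%_. UNIV) a b" by (rule isop_wrtI)
 then show ?thesis by (rule isop_UNIVI[OF gS _ ab])
qed

end

section \<open>Expressions over presentations versus coarse fillings\<close>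

section \<open>Presentations and coarse fillings\<close>

lemma freely_equal_refl: "u \<in> words S ==> freely_equal S u u"
 and freely_equal_sym: "freely_equal S u v ==> freely_equal S v u"
 and freely_equal_trans: "freely_equal S u v ==> freely_equal S v w ==> freely_equal S u w"
 by (auto simp: freely_equal_def intro: pres_eq.refl pres_eq.sym elim: pres_eq.trans)

lemma freely_equal_words: "freely_equal S u v ==> u \<in> words S & v \<in> words S"
 unfolding freely_equal_def using pres_eq_words[of "(S, {})" u v] by auto

lemma freely_equal_ctx:
 "freely_equal S u v ==> s \<in> words S ==> t \<in> words S ==> freely_equal S (s @ u @ t) (s @ v @ t)"
 unfolding freely_equal_def by (rule pres_eq_append) auto

lemma freely_equal_inv_left: "u \<in> words S ==> freely_equal S (word_inv u @ u) []"
 unfolding freely_equal_def by (rule pres_eq_word_inv) simp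

lemma freely_equal_inv_right: "u \<in> words S ==> freely_equal S (u @ word_inv u) []"
 using freely_equal_inv_left[of "word_inv u" S] by simp

definition conj_product :: "('x gword \<times> 'x gword) list => 'x gword" where
 "conj_product E = concat (map (%(x, r). x @ r @ word_inv x) E)"

lemma conj_product_simps [simp]:
 "conj_product [] = []" "conj_product ((x, r) # E) = x @ r @ word_inv x @ conj_product E"
 "conj_product (E @ F) = conj_product E @ conj_product F"
 by (simp_all add: conj_product_def)

lemma word_inv_conj_product:
 "word_inv (conj_product E) = conj_product (rev (map (%(x, r). (x, word_inv r)) E))"
 by (induction E) auto

lemma conj_product_words:
 "set E <= words S \<times> R ==> R <= words S ==> conj_product E \<in> words S"
 by (induction E) auto

text \<open>Over a finite alphabet this is a finite set of relators, with respect to which coarse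
  fillings become expressions.\<close>

definition coarse_relators :: "('a, 'b) monoid_scheme => 'a set => nat => 'a gword set" where
 "coarse_relators G S N = {r \<in> words S. length r <= N & eval_word G r = \<one>\<^bsub>G\<^esub>}"

text \<open>\<open>u\<close> is freely equal to \<open>v\<close> multiplied by at most \<open>m\<close> conjugates of relators.\<close>

definition area_le :: "'x set => 'x gword set => nat => 'x gword => 'x gword => bool" where
 "area_le S R m u v \<longleftrightarrow> (\<exists>E. set E <= words S \<times> (R \<union> word_inv ` R) & length E <= m &
  freely_equal S u (conj_product E @ v))"

lemma area_le_free: "freely_equal S u v ==> area_le S R m u v"
 unfolding area_le_def by (rule exI[of _ "[]"]) simp

lemma area_le_sym:
 assumes "area_le S R m u v"
 shows "area_le S R m v u"
proof -
 obtain E where E: "set E <= words S \<times> (R \<union> word_inv ` R)" "length E <= m" "freely_equal S u (conj_product E @ v)"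
  using assms by (auto simp: area_le_def)
 let ?E = "rev (map (%(x, r). (x, word_inv r)) E)"
 have c: "conj_product E \<in> words S" "v \<in> words S" using freely_equal_words[OF E(3)] by auto
 have "freely_equal S (word_inv (conj_product E) @ u) (word_inv (conj_product E) @ conj_product E @ v)"
  using freely_equal_ctx[OF E(3), of "word_inv (conj_product E)" "[]"] c by simp
 moreover have "freely_equal S (word_inv (conj_product E) @ conj_product E @ v) v"
  using freely_equal_ctx[OF freely_equal_inv_left[OF c(1)], of "[]" v] c by simp
 ultimately have 1: "freely_equal S v (conj_product ?E @ u)"
  unfolding word_inv_conj_product[symmetric] using freely_equal_sym freely_equal_trans by metis
 have 2: "set ?E <= words S \<times> (R \<union> word_inv ` R)"
 proof
  fix y assume "y \<in> set ?E"
  then obtain x r where y: "y = (x, word_inv r)" "(x, r) \<in> set E" by auto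
  then have "x \<in> words S" "r \<in> R \<union> word_inv ` R" using E(1) by auto
  then show "y \<in> words S \<times> (R \<union> word_inv ` R)" using y(1) by auto
 qed
 show ?thesis unfolding area_le_def using 1 2 E(2) by (intro exI[of _ ?E]) simp
qed

lemma area_le_trans:
 assumes "area_le S R m u v" "area_le S R n v w"
 shows "area_le S R (m + n) u w"
proof -
 obtain E where E: "set E <= words S \<times> (R \<union> word_inv ` R)" "length E <= m" "freely_equal S u (conj_product E @ v)"
  using assms(1) by (auto simp: area_le_def)
 obtain F where F: "set F <= words S \<times> (R \<union> word_inv ` R)" "length F <= n" "freely_equal S v (conj_product F @ w)"
  using assms(2) by (auto simp: area_le_def)
 have "conj_product E \<in> words S" using freely_equal_words[OF E(3)] by auto
 then have "freely_equal S (conj_product E @ v) (conj_product E @ conj_product F @ w)"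
  using freely_equal_ctx[OF F(3), of "conj_product E" "[]"] by simp
 then have "freely_equal S u (conj_product (E @ F) @ w)" using freely_equal_trans[OF E(3)] by simp
 then show ?thesis unfolding area_le_def using E F by (intro exI[of _ "E @ F"]) simp
qed

text \<open>Inserting \<open>r\<close> after \<open>u\<close> amounts, freely, to multiplying on the
  left by the conjugate of \<open>r\<close> by \<open>u\<close>.\<close>

lemma area_le_relator:
 assumes "u \<in> words S" "v \<in> words S" "r \<in> R" "r \<in> words S"
 shows "area_le S R 1 (u @ r @ v) (u @ v)"
proof -
 have "freely_equal S ((u @ r) @ (word_inv u @ u) @ v) ((u @ r) @ [] @ v)"
  by (rule freely_equal_ctx[OF freely_equal_inv_left]) (use assms in auto)
 then have "freely_equal S (u @ r @ v) (conj_product [(u, r)] @ u @ v)"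
  using freely_equal_sym by fastforce
 then show ?thesis unfolding area_le_def using assms by (intro exI[of _ "[(u, r)]"]) auto
qed

lemma fill_imp_area_le:
 assumes "fill G S N V g m u v"
 shows "area_le S (coarse_relators G S N) m u v"
 using assms
proof (induction rule: fill.induct)
 case (refl w)
 then show ?case by (intro area_le_free freely_equal_refl)
next
 case (sym m u v)
 show ?case by (rule area_le_sym[OF sym(2)])
next
 case (trans m u v n w)
 show ?case by (rule area_le_trans[OF trans(3,4)])
next
 case (cancel u v x b)
 then show ?case unfolding freely_equal_def by (intro area_le_free[unfolded freely_equal_def] pres_eq.cancel) auto
next
 case (relator u v r)
 then show ?case by (intro area_le_relator) (auto simp: coarse_relators_def)
qed

text \<open>Supplies an expression for every null-homotopic word, so that the minimum in
  \<open>word_area\<close> is attained.\<close>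

lemma pres_eq_imp_area_le:
 assumes "pres_eq P u v" "snd P <= words (fst P)"
 shows "\<exists>m. area_le (fst P) (snd P) m u v"
 using assms(1)
proof (induction rule: pres_eq.induct)
 case (refl w)
 then show ?case by (blast intro: area_le_free freely_equal_refl)
next
 case (sym u v)
 then show ?case using area_le_sym by blast
next
 case (trans u v w)
 then show ?case using area_le_trans by blast
next
 case (cancel u v x b)
 then have "freely_equal (fst P) (u @ [(x, b), (x, \<not> b)] @ v) (u @ v)"
  unfolding freely_equal_def by (intro pres_eq.cancel) auto
 then show ?case by (blast intro: area_le_free)
next
 case (relator u v r)
 then show ?case using area_le_relator assms(2) by blast
qed

lemma pres_eq_map_letters:
 assumes "pres_eq (S, R) u v"
 shows "pres_eq (f ` S, map_letters f ` R) (map_letters f u) (map_letters f v)"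
 using assms
proof (induction rule: pres_eq.induct)
 case (refl w)
 then show ?case by (intro pres_eq.refl) (auto intro: words_map_letters)
next
 case (sym v w)
 show ?case by (rule pres_eq.sym[OF sym(2)])
next
 case (trans u v w)
 show ?case by (rule pres_eq.trans[OF trans(3,4)])
next
 case (cancel u v x b)
 then show ?case using pres_eq.cancel[where P = "(f ` S, map_letters f ` R)" and u = "map_letters f u" and v = "map_letters f v" and x = "f x" and b = b]
  by (auto intro: words_map_letters)
next
 case (relator u v r)
 then show ?case using pres_eq.relator[where P = "(f ` S, map_letters f ` R)" and u = "map_letters f u" and v = "map_letters f v" and r = "map_letters f r"]
  by (auto intro: words_map_letters)
qed

lemma map_letters_conj_product:
 "map_letters f (conj_product E) = conj_product (map (%(x, r). (map_letters f x, map_letters f r)) E)"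
 by (induction E) (auto simp: word_inv_map_letters)

lemma map_letters_cong: "w \<in> words S ==> (!!x. x \<in> S ==> f x = g x) ==> map_letters f w = map_letters g w"
 by (induction w) auto

lemma map_letters_comp [simp]: "map_letters f (map_letters g w) = map_letters (f \<circ> g) w"
 by (simp add: map_letters_def)

lemma map_letters_id: "map_letters id w = w" "map_letters (%x. x) w = w"
 by (simp_all add: map_letters_def)

context group
begin

lemma fill_imp_pres_eq:
 assumes "fill G S N V g m u v" shows "pres_eq (S, coarse_relators G S N) u v"
 using assms
proof (induction rule: fill.induct)
 case (refl w m)
 then show ?case by (intro pres_eq.refl) auto
next
 case (sym m u v)
 show ?case by (rule pres_eq.sym[OF sym(2)])
next
 case (trans m u v n w)
 show ?case by (rule pres_eq.trans[OF trans(3,4)])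
next
 case (cancel u v x b)
 then show ?case by (intro pres_eq.cancel) auto
next
 case (relator u v r)
 then show ?case by (intro pres_eq.relator) (auto simp: coarse_relators_def)
qed

lemma pres_eq_imp_ev:
 assumes "pres_eq (S, R) u v" "S <= carrier G" "R <= words S" "!!r. r \<in> R ==> ev r = \<one>"
 shows "ev u = ev v"
 using assms(1)
proof (induction rule: pres_eq.induct)
 case (cancel u v x b)
 have "fill G S 0 UNIV \<one> 0 (u @ [(x, b), (x, \<not> b)] @ v) (u @ v)"
  by (rule fill.cancel) (use cancel in auto)
 then show ?case using fill_ev assms(2) by blast
next
 case (relator u v r)
 then have "fill G S (length r) UNIV \<one> 1 (u @ r @ v) (u @ v)"
  by (intro fill.relator) (use relator assms in auto)
 then show ?case using fill_ev assms(2) by blast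
qed auto

lemma eval_word_subgroup:
 assumes "subgroup H G" "w \<in> words H"
 shows "eval_word (G\<lparr>carrier := H\<rparr>) w = ev w"
 using assms(2)
 by (induction w) (auto simp: eval_word_Cons letter_val_def m_inv_consistent[OF assms(1)])

text \<open>The letters are renamed to natural numbers only at this point.\<close>

lemma isop_imp_presentation:
 assumes iso: "isop H (%_ _. UNIV) a b"
 shows "\<exists>P :: nat presentation. finite_presentation_of P (G\<lparr>carrier := H\<rparr>) &
  (\<exists>C. \<forall>l. dehn_function P l <= C * a (C * l + C))"
proof -
 obtain S where S: "gens H S" and Siso: "isop_wrt S (%_. UNIV) a b" using iso by (auto simp: isop_def)
 then obtain N C where "isop_at S (%_. UNIV) a b N C" by (auto simp: isop_wrt_def)
 note NC = isop_atD[OF this]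
 have H: "subgroup H G" and fS: "finite S" "S <= H" using S by (auto simp: gens_def)
 have Sc: "S <= carrier G" using gens_carrier[OF S] .
 obtain f :: "'a => nat" where f: "inj_on f S" using fS(1) finite_imp_inj_to_nat_seg by metis
 define k where "k = inv_into S f"
 have kf: "k (f x) = x" if "x \<in> S" for x using f that by (simp add: k_def)
 have fk: "f (k y) = y" if "y \<in> f ` S" for y using that kf by auto
 define R where "R = map_letters f ` coarse_relators G S N"
 define P where "P = (f ` S, R)"
 have cr: "coarse_relators G S N <= words S" by (auto simp: coarse_relators_def)
 have fP: "finite_presentation P"
  using fS finite_words_bounded[OF fS(1), of N] words_map_letters[OF _ subset_refl]
  by (auto simp: finite_presentation_def P_def R_def coarse_relators_def elim!: rev_finite_subset)
 have sP: "snd P <= words (fst P)" using fP by (simp add: finite_presentation_def)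
 define e where "e w = ev (map_letters k w)" for w
 have kS: "k ` f ` S = S" using kf by force
 have kw: "map_letters k w \<in> words S" if "w \<in> words (fst P)" for w
  using that words_map_letters[of w "fst P" k S] kS by (simp add: P_def)
 have kfw: "map_letters k (map_letters f w) = w" if "w \<in> words S" for w
  using map_letters_cong[OF that, of "k \<circ> f" id] kf by (simp add: map_letters_id)
 have fkw: "map_letters f (map_letters k w) = w" if "w \<in> words (fst P)" for w
  using map_letters_cong[OF that, of "f \<circ> k" id] fk by (simp add: map_letters_id P_def)
 have e_hom: "e (u @ v) = e u \<otimes> e v" if "u \<in> words (fst P)" "v \<in> words (fst P)" for u v
  using kw[OF that(1)] kw[OF that(2)] words_carrier[OF Sc] by (simp add: e_def)
 have eH: "e w \<in> H" if "w \<in> words (fst P)" for w using gens_ev[OF S kw[OF that]] by (simp add: e_def)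
 have Hc: "H <= carrier G" using H subgroup.subset by blast
 have e_inv: "e (word_inv w) = inv (e w)" if "w \<in> words (fst P)" for w
  using kw[OF that] words_carrier[OF Sc] by (simp add: e_def word_inv_map_letters[symmetric])
 have pe1: "e u = e v" if "pres_eq P u v" for u v
 proof -
  have "map_letters k ` R = coarse_relators G S N"
   using kfw cr by (force simp: R_def image_iff subset_iff)
  then have "pres_eq (S, coarse_relators G S N) (map_letters k u) (map_letters k v)"
   using pres_eq_map_letters[of "f ` S" R u v k] that kS by (simp add: P_def)
  then show ?thesis unfolding e_def by (rule pres_eq_imp_ev[OF _ Sc cr]) (auto simp: coarse_relators_def)
 qed
 have null: "fill G S N UNIV \<one> (C * a L) (map_letters k w) []"
  if "w \<in> words (fst P)" "e w = \<one>" "C * length w + C <= L" for w L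
  using NC[OF kw[OF that(1)]] that by (simp add: e_def)
 \<comment> \<open>Injectivity of the evaluation: a word with trivial value has a coarse filling,
   taken at the least admissible \<open>L\<close>, and each of its moves is a relation of
   \<open>P\<close>.\<close>
 have pe0: "pres_eq P w []" if "w \<in> words (fst P)" "e w = \<one>" for w
 proof -
  have "pres_eq (S, coarse_relators G S N) (map_letters k w) []"
   using fill_imp_pres_eq[OF null[OF that order_refl]] .
  from pres_eq_map_letters[OF this, of f] show ?thesis using fkw[OF that(1)] by (simp add: P_def R_def)
 qed
 have pe2: "pres_eq P u v" if uv: "u \<in> words (fst P)" "v \<in> words (fst P)" "e u = e v" for u v
 proof -
  have "e (u @ word_inv v) = \<one>" using uv e_hom e_inv eH Hc by (auto simp: subsetD)
  then have "pres_eq P (u @ word_inv v) []" using pe0 uv by simp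
  from pres_eq_append[OF sP this, of "[]" v] have 1: "pres_eq P (u @ word_inv v @ v) v" using uv by simp
  from pres_eq_append[OF sP pres_eq_word_inv[OF uv(2)], of u "[]"] have 2: "pres_eq P (u @ word_inv v @ v) u" using uv by simp
  show ?thesis by (rule pres_eq.trans[OF pres_eq.sym[OF 2] 1])
 qed
 have cls: "pres_rel P `` {u} = pres_rel P `` {v} \<longleftrightarrow> e u = e v" if "u \<in> words (fst P)" "v \<in> words (fst P)" for u v
 proof -
  have "pres_rel P `` {u} = pres_rel P `` {v} \<longleftrightarrow> pres_eq P u v"
   using eq_equiv_class_iff[OF equiv_pres_rel[OF sP] that] by (simp add: pres_rel_def)
  then show ?thesis using pe1[of u v] pe2[OF that] by argo
 qed
 let ?Q = "presented_group P"
 have car: "carrier ?Q = (%w. pres_rel P `` {w}) ` words (fst P)"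
  by (auto simp: presented_group_def quotient_def)
 define \<Phi> where "\<Phi> A = e (SOME w. w \<in> words (fst P) & A = pres_rel P `` {w})" for A
 have \<Phi>: "\<Phi> (pres_rel P `` {w}) = e w" if "w \<in> words (fst P)" for w
 proof -
  have "(SOME v. v \<in> words (fst P) & pres_rel P `` {w} = pres_rel P `` {v}) \<in> words (fst P) &
   pres_rel P `` {w} = pres_rel P `` {SOME v. v \<in> words (fst P) & pres_rel P `` {w} = pres_rel P `` {v}}"
   by (rule someI[of _ w]) (use that in auto)
  then show ?thesis using cls[OF that] by (auto simp: \<Phi>_def)
 qed
 have "\<Phi> \<in> hom ?Q (G\<lparr>carrier := H\<rparr>)"
 proof (rule homI)
  show "\<Phi> A \<in> carrier (G\<lparr>carrier := H\<rparr>)" if "A \<in> carrier ?Q" for A using that \<Phi> eH by (auto simp: car)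
  show "\<Phi> (A \<otimes>\<^bsub>?Q\<^esub> B) = \<Phi> A \<otimes>\<^bsub>G\<lparr>carrier := H\<rparr>\<^esub> \<Phi> B" if "A \<in> carrier ?Q" "B \<in> carrier ?Q" for A B
   using that \<Phi> mult_presented_group[OF sP] e_hom by (auto simp: car)
 qed
 moreover have "bij_betw \<Phi> (carrier ?Q) H"
 proof (rule bij_betw_imageI)
  show "inj_on \<Phi> (carrier ?Q)" using \<Phi> cls by (auto simp: car inj_on_def)
  show "\<Phi> ` carrier ?Q = H"
  proof
   show "\<Phi> ` carrier ?Q <= H" using \<Phi> eH by (auto simp: car)
   show "H <= \<Phi> ` carrier ?Q"
   proof
    fix h assume "h \<in> H"
    then obtain w where w: "w \<in> words S" "ev w = h" using S by (auto simp: gens_def)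
    have "map_letters f w \<in> words (fst P)" using words_map_letters[OF w(1) subset_refl] by (simp add: P_def)
    moreover from this have "\<Phi> (pres_rel P `` {map_letters f w}) = h" using \<Phi> kfw[OF w(1)] w(2) by (simp add: e_def)
    ultimately show "h \<in> \<Phi> ` carrier ?Q" by (auto simp: car)
   qed
  qed
 qed
 ultimately have "presented_group P \<cong> G\<lparr>carrier := H\<rparr>" by (auto simp: is_iso_def iso_def)
 then have fpo: "finite_presentation_of P (G\<lparr>carrier := H\<rparr>)" using fP by (simp add: finite_presentation_of_def)
 have nh: "null_homotopic P w \<longleftrightarrow> w \<in> words (fst P) & e w = \<one>" for w
  using cls[of w "[]"] by (auto simp: null_homotopic_def presented_group_def e_def)
 have area: "word_area P w <= C * a L" if w: "null_homotopic P w" "C * length w + C <= L" for w L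
 proof -
  have w': "w \<in> words (fst P)" "e w = \<one>" using w nh by auto
  obtain E where E: "set E <= words S \<times> (coarse_relators G S N \<union> word_inv ` coarse_relators G S N)" "length E <= C * a L"
   "freely_equal S (map_letters k w) (conj_product E @ [])"
   using fill_imp_area_le[OF null[OF w' w(2)]] by (auto simp: area_le_def)
  define E' where "E' = map (%(x, r). (map_letters f x, map_letters f r)) E"
  have "freely_equal (f ` S) w (conj_product E')"
   using E(3) pres_eq_map_letters[of S "{}" "map_letters k w" "conj_product E" f] fkw[OF w'(1)]
   by (simp add: freely_equal_def map_letters_conj_product E'_def)
  moreover have "set E' <= words (fst P) \<times> (R \<union> word_inv ` R)"
  proof
   fix y assume "y \<in> set E'"
   then obtain x r where y: "y = (map_letters f x, map_letters f r)" "(x, r) \<in> set E" by (auto simp: E'_def)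
   then have x: "x \<in> words S" "r \<in> coarse_relators G S N \<union> word_inv ` coarse_relators G S N" using E(1) by auto
   then have "map_letters f r \<in> R \<union> word_inv ` R"
    by (auto simp: R_def word_inv_map_letters[symmetric])
   then show "y \<in> words (fst P) \<times> (R \<union> word_inv ` R)"
    using y(1) words_map_letters[OF x(1), of f] by (auto simp: P_def)
  qed
  ultimately have "expression_for P E' w" by (simp add: expression_for_def conj_product_def P_def)
  moreover have "expr_area E' = length E" by (simp add: expr_area_def E'_def)
  ultimately have "\<exists>F. expression_for P F w & expr_area F = length E" by blast
  then have "word_area P w <= length E" unfolding word_area_def by (rule Least_le)
  then show ?thesis using E(2) by simp
 qed
 \<comment> \<open>The single choice \<open>L = C * l + C\<close> serves all words of length at most
   \<open>l\<close>, so the maximum is bounded by one value of \<open>a\<close>, monotone or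
   not.\<close>
 have "dehn_function P l <= C * a (C * l + C)" for l
 proof -
  let ?A = "{word_area P w |w. null_homotopic P w & length w <= l}"
  have "?A <= word_area P ` {w \<in> words (fst P). length w <= l}" by (auto simp: nh)
  moreover have "finite {w \<in> words (fst P). length w <= l}"
   using finite_words_bounded[of "fst P" l] fP by (simp add: finite_presentation_def)
  ultimately have "finite ?A" using finite_subset by blast
  moreover have "word_area P [] \<in> ?A" using nh[of "[]"] by (auto simp: e_def)
  moreover have "x <= C * a (C * l + C)" if "x \<in> ?A" for x using that area[of _ "C * l + C"] by auto
  ultimately show ?thesis unfolding dehn_function_def by (subst Max_le_iff) auto
 qed
 then show ?thesis using fpo by blast
qed

lemma pres_eq_imp_fill0:
 assumes "pres_eq (X, {}) u v" "e ` X <= S"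
 shows "fill G S N V g 0 (map_letters e u) (map_letters e v)"
 using assms(1)
proof (induction rule: pres_eq.induct)
 case (refl w)
 then show ?case by (intro fill.refl) (use words_map_letters[OF _ assms(2)] in auto)
next
 case (sym u v)
 show ?case by (rule fill.sym[OF sym(2)])
next
 case (trans u v w)
 show ?case using fill.trans[OF trans(3,4)] by simp
next
 case (cancel u v x b)
 have "fill G S N V g 0 (map_letters e u @ [(e x, b), (e x, \<not> b)] @ map_letters e v) (map_letters e u @ map_letters e v)"
  by (rule fill.cancel) (use cancel assms(2) words_map_letters[OF _ assms(2)] in auto)
 then show ?case by simp
qed simp

text \<open>The conjugate of \<open>r\<close> by \<open>x\<close> is the loop \<open>r\<close> based
  at the end of \<open>x\<close>. Conjugates are removed from the left, so each of them starts at
  \<open>g\<close>, and bounds on the \<open>x\<close> become bounds on the base vertices.\<close>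

lemma conj_product_fill:
 assumes "set E <= words S \<times> {r \<in> words S. length r <= N & ev r = \<one>}"
  "!!x r. (x, r) \<in> set E ==> g \<otimes> ev x \<in> V" "S <= carrier G" "g \<in> carrier G"
 shows "fill G S N V g (length E) (conj_product E) []"
 using assms(1,2)
proof (induction E)
 case Nil
 then show ?case by (simp add: fill.refl)
next
 case (Cons p E)
 obtain x r where p: "p = (x, r)" by (cases p)
 have xr: "x \<in> words S" "r \<in> words S" "length r <= N" "ev r = \<one>" "g \<otimes> ev x \<in> V" using Cons.prems p by auto
 have E: "conj_product E \<in> words S" by (rule conj_product_words[where R = "{r \<in> words S. length r <= N & ev r = \<one>}"]) (use Cons.prems in auto)
 have "fill G S N V g 1 (x @ r @ word_inv x @ conj_product E) (x @ word_inv x @ conj_product E)"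
  by (rule fill.relator) (use xr E in auto)
 moreover have "fill G S N V g 0 (x @ word_inv x @ conj_product E) (conj_product E)"
  by (rule fill_inv_right[OF E xr(1)])
 ultimately have "fill G S N V g (1 + 0) (x @ r @ word_inv x @ conj_product E) (conj_product E)"
  by (rule fill.trans)
 moreover have "fill G S N V g (length E) (conj_product E) []" by (rule Cons.IH) (use Cons.prems in auto)
 ultimately show ?case using fill.trans by (fastforce simp: p)
qed

text \<open>Here a given area-radius pair enters: the radius becomes the size of a word ball
  containing all base vertices. The embedding \<open>\<psi>\<close> places the presented group
  inside the ambient \<open>G\<close>, as one factor or as a block of factors.\<close>

lemma isop_of_presentation:
 fixes P :: "'x presentation" and Q :: "('c, 'd) monoid_scheme"
 assumes PQ: "finite_presentation_of P Q" and Q: "group Q" and \<psi>: "\<psi> \<in> hom Q G" "inj_on \<psi> (carrier Q)"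
  and ar: "area_radius_pair P \<alpha> \<rho>" and le: "!!L. \<alpha> L <= a L & \<rho> L <= b L" and ab: "!!L. L <= a L & L <= b L"
 shows "isop (\<psi> ` carrier Q) word_ball a b"
proof -
 interpret Q: group Q by fact
 interpret \<psi>: group_hom Q G \<psi> by unfold_locales (rule \<psi>(1))
 have fP: "finite (fst P)" "finite (snd P)" "snd P <= words (fst P)"
  using PQ by (auto simp: finite_presentation_of_def finite_presentation_def)
 interpret PG: group "presented_group P" by (rule group_presented_group[OF fP(3)])
 obtain h where h: "h \<in> iso (presented_group P) Q" using PQ by (auto simp: finite_presentation_of_def is_iso_def)
 then interpret h: group_hom "presented_group P" Q h by unfold_locales (auto simp: iso_def)
 have hb: "bij_betw h (carrier (presented_group P)) (carrier Q)" using h by (auto simp: iso_def)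
 let ?c = "%w. pres_rel P `` {w}"
 have car: "carrier (presented_group P) = ?c ` words (fst P)"
  by (auto simp: presented_group_def quotient_def)
 have one: "\<one>\<^bsub>presented_group P\<^esub> = ?c []" by (simp add: presented_group_def)
 define k where "k w = \<psi> (h (?c w))" for w
 have cP: "?c w \<in> carrier (presented_group P)" if "w \<in> words (fst P)" for w using that car by auto
 have k_app: "k (u @ v) = k u \<otimes> k v" if "u \<in> words (fst P)" "v \<in> words (fst P)" for u v
  unfolding k_def mult_presented_group[OF fP(3) that, symmetric] using cP that by simp
 have k_c: "k w \<in> carrier G" if "w \<in> words (fst P)" for w using cP[OF that] by (simp add: k_def)
 have k_nil: "k [] = \<one>" by (simp add: k_def one[symmetric])
 define e where "e x = k [(x, True)]" for x
 have eF: "k [(x, False)] = inv (e x)" if "x \<in> fst P" for x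
 proof -
  have "pres_eq P (word_inv [(x, True)] @ [(x, True)]) []" by (rule pres_eq_word_inv) (use that in auto)
  then have "?c ([(x, False)] @ [(x, True)]) = ?c []"
   using equiv_class_eq[OF equiv_pres_rel[OF fP(3)]] by (auto simp: pres_rel_def)
  then have "k ([(x, False)] @ [(x, True)]) = k []" by (simp only: k_def)
  then have "k [(x, False)] \<otimes> e x = \<one>" using k_app[of "[(x, False)]" "[(x, True)]"] that k_nil by (simp add: e_def)
  then show ?thesis using inv_equality[of "k [(x, False)]" "e x"] k_c that by (simp add: e_def)
 qed
 define S where "S = e ` fst P"
 have Sc: "S <= carrier G" using k_c by (auto simp: S_def e_def)
 have ek: "ev (map_letters e w) = k w" if "w \<in> words (fst P)" for w
  using that
 proof (induction w)
  case (Cons l w)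
  obtain x b where l: "l = (x, b)" by (cases l)
  have "k (l # w) = k [l] \<otimes> k w" using k_app[of "[l]" w] Cons by simp
  moreover have "k [l] = letter_val G (e x, b)" using eF Cons.prems l by (auto simp: letter_val_def e_def)
  ultimately show ?case using Cons l by (simp add: eval_word_Cons)
 qed (simp add: k_nil)
 have Ssub: "S <= \<psi> ` carrier Q" using cP h.hom_closed by (auto simp: S_def e_def k_def)
 have gS: "gens (\<psi> ` carrier Q) S"
  unfolding gens_def
 proof (intro conjI ballI)
  show "finite S" using fP by (simp add: S_def)
  show "subgroup (\<psi> ` carrier Q) G" by (rule \<psi>.img_is_subgroup)
  fix y assume "y \<in> \<psi> ` carrier Q"
  then obtain q where q: "q \<in> carrier Q" "y = \<psi> q" by auto
  have "q \<in> h ` (?c ` words (fst P))" using hb car q(1) by (simp add: bij_betw_def)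
  then obtain w where w: "w \<in> words (fst P)" "q = h (?c w)" by blast
  have "ev (map_letters e w) = y" using ek[OF w(1)] w q by (simp add: k_def)
  moreover have "map_letters e w \<in> words S" using words_map_letters[OF w(1) subset_refl] by (simp add: S_def)
  ultimately show "\<exists>w\<in>words S. ev w = y" by blast
 qed (rule Ssub)
 obtain N where N: "\<forall>r\<in>snd P. length r <= N" using finite_bound[OF fP(2), of length] by blast
 have rel0: "ev (map_letters e r) = \<one>" if "r \<in> snd P" for r
 proof -
  have r: "r \<in> words (fst P)" using that fP by auto
  have "pres_eq P ([] @ r @ []) ([] @ [])" by (rule pres_eq.relator) (use that in auto)
  then have "?c r = ?c []" using equiv_class_eq[OF equiv_pres_rel[OF fP(3)]] by (auto simp: pres_rel_def)
  then show ?thesis using ek[OF r] k_nil by (simp add: k_def)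
 qed
 have "isop_wrt S (word_ball S) a b"
 proof (rule isop_wrtI[where N = N and C = 1])
  fix L w assume w: "w \<in> words S" "ev w = \<one>" "1 * length w + 1 <= L"
  \<comment> \<open>Different generators of \<open>P\<close> may have the same image, so a word over
    \<open>S\<close> is lifted letter by letter to some word over \<open>fst P\<close> of the same
    length.\<close>
  have "\<exists>v\<in>words (fst P). map_letters e v = w" using w(1)
  proof (induction w)
   case (Cons l w)
   then obtain v x where "v \<in> words (fst P)" "map_letters e v = w" "x \<in> fst P" "fst l = e x" by (auto simp: S_def)
   then show ?case by (intro bexI[of _ "(x, snd l) # v"]) (auto simp: prod_eq_iff)
  qed (auto intro!: bexI[of _ "[]"])
  then obtain v where v: "v \<in> words (fst P)" "map_letters e v = w" by blast
  have "\<psi> (h (?c v)) = \<psi> (h (\<one>\<^bsub>presented_group P\<^esub>))" using ek[OF v(1)] v(2) w(2) by (simp add: k_def)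
  then have "h (?c v) = h \<one>\<^bsub>presented_group P\<^esub>" using \<psi>(2) cP[OF v(1)] by (auto simp: inj_on_def)
  then have "?c v = \<one>\<^bsub>presented_group P\<^esub>" using hb cP[OF v(1)] by (auto simp: bij_betw_def inj_on_def)
  then have "null_homotopic P v" using v by (simp add: null_homotopic_def)
  moreover have "length v <= L" using v w by auto
  ultimately obtain E where E: "expression_for P E v" "expr_area E <= \<alpha> L" "expr_radius E <= \<rho> L"
   using ar unfolding area_radius_pair_def by blast
  have Es: "set E <= words (fst P) \<times> (snd P \<union> word_inv ` snd P)"
   and Ef: "pres_eq (fst P, {}) v (conj_product E)"
   using E(1) by (auto simp: expression_for_def freely_equal_def conj_product_def)
  define F where "F = map (%(x, r). (map_letters e x, map_letters e r)) E"
  have 1: "fill G S N (word_ball S (1 * b L)) \<one> 0 w (conj_product F)"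
   using pres_eq_imp_fill0[OF Ef, of e S] by (simp add: S_def v(2) F_def map_letters_conj_product)
  have xr: "x \<in> words S & length x <= \<rho> L & r \<in> words S & length r <= N & ev r = \<one>" if "(x, r) \<in> set F" for x r
  proof -
   obtain x' r' where x': "x = map_letters e x'" "r = map_letters e r'" "(x', r') \<in> set E" using \<open>(x, r) \<in> set F\<close> by (auto simp: F_def)
   have "length x' \<in> (%(x, r). length x) ` set E" using x'(3) by force
   then have "length x' <= expr_radius E" unfolding expr_radius_def by (intro Max_ge) auto
   then have lx: "length x <= \<rho> L" using E(3) x' by simp
   have xw: "x' \<in> words (fst P)" "r' \<in> snd P \<union> word_inv ` snd P" using Es x'(3) by auto
   then obtain r0 where r0: "r0 \<in> snd P" "r' = r0 \<or> r' = word_inv r0" by auto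
   have w0: "map_letters e r0 \<in> words S" using words_map_letters[of r0 "fst P" e S] r0 fP(3) by (auto simp: S_def)
   have "r \<in> words S & length r <= N & ev r = \<one>"
    using r0(2) w0 N r0(1) rel0[OF r0(1)] words_carrier[OF Sc w0] by (auto simp: x'(2) word_inv_map_letters[symmetric])
   then show ?thesis using lx words_map_letters[OF xw(1), of e S] by (auto simp: x'(1) S_def)
  qed
  have 2: "fill G S N (word_ball S (1 * b L)) \<one> (length F) (conj_product F) []"
  proof (rule conj_product_fill[OF _ _ Sc])
   show "\<one> \<otimes> ev x \<in> word_ball S (1 * b L)" if "(x, r) \<in> set F" for x r
    using xr[OF that] le[of L] words_carrier[OF Sc] by (auto simp: word_ball_def intro!: exI[of _ x])
  qed (use xr in auto)
  have "length F <= 1 * a L" using E(2) le[of L] by (simp add: F_def expr_area_def)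
  then show "fill G S N (word_ball S (1 * b L)) \<one> (1 * a L) w []"
   using fill_weaken[OF fill.trans[OF 1 2]] by simp
 qed
 then show ?thesis by (rule isop_ballI[OF gS _ ab])
qed

end

text \<open>Each null-homotopic word receives an expression of minimal area. Only finitely many
  words have length at most \<open>l\<close>, so the sum of the radii of their expressions is a
  radius bound.\<close>

lemma dehn_area_radius_pair:
 assumes P: "finite_presentation P"
 shows "\<exists>\<rho>. area_radius_pair P (dehn_function P) \<rho>"
proof -
 have sP: "snd P <= words (fst P)" using P by (simp add: finite_presentation_def)
 have ex: "\<exists>E. expression_for P E w" if "null_homotopic P w" for w
 proof -
  have w: "w \<in> words (fst P)" "pres_rel P `` {w} = pres_rel P `` {[]}"
   using that by (auto simp: null_homotopic_def presented_group_def)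
  then have "pres_eq P w []"
   using eq_equiv_class_iff[OF equiv_pres_rel[OF sP] w(1), of "[]"] by (simp add: pres_rel_def)
  then obtain m where "area_le (fst P) (snd P) m w []" using pres_eq_imp_area_le[OF _ sP] by blast
  then show ?thesis by (auto simp: area_le_def expression_for_def conj_product_def)
 qed
 have opt: "\<exists>E. expression_for P E w & expr_area E = word_area P w" if w: "null_homotopic P w" for w
 proof -
  obtain E where "expression_for P E w" using ex[OF w] by blast
  then have "\<exists>F. expression_for P F w & expr_area F = expr_area E" by blast
  then show ?thesis unfolding word_area_def by (rule LeastI)
 qed
 then obtain F where F: "!!w. null_homotopic P w ==> expression_for P (F w) w & expr_area (F w) = word_area P w"
  by metis
 define W where "W l = {w. null_homotopic P w & length w <= l}" for l
 have finW: "finite (W l)" for l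
  by (rule finite_subset[OF _ finite_words_bounded[of "fst P" l]])
   (use P in \<open>auto simp: W_def null_homotopic_def finite_presentation_def\<close>)
 define \<rho> where "\<rho> l = (\<Sum>w\<in>W l. expr_radius (F w))" for l
 have "word_area P w <= dehn_function P l" if "w \<in> W l" for w l
 proof -
  have e: "{word_area P w |w. null_homotopic P w & length w <= l} = word_area P ` W l" by (auto simp: W_def)
  show ?thesis unfolding dehn_function_def e using finW that by (intro Max_ge) auto
 qed
 moreover have "expr_radius (F w) <= \<rho> l" if "w \<in> W l" for w l
  unfolding \<rho>_def by (rule member_le_sum[OF that]) (use finW in auto)
 ultimately have "area_radius_pair P (dehn_function P) \<rho>"
  unfolding area_radius_pair_def using F by (auto simp: W_def intro!: exI[of _ "F _"])
 then show ?thesis by blast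
qed

section \<open>Moving and splitting powers of letters\<close>

section \<open>Powers of letters\<close>

text \<open>The word \<open>a^m\<close> for an integer exponent \<open>m\<close>.\<close>

definition pw :: "'a => int => 'a gword" where
 "pw a m = replicate (nat \<bar>m\<bar>) (a, 0 <= m)"

lemma length_pw [simp]: "length (pw a m) = nat \<bar>m\<bar>" by (simp add: pw_def)

lemma pw_0 [simp]: "pw a 0 = []" by (simp add: pw_def)

lemma words_replicate [simp]: "replicate n l \<in> words S \<longleftrightarrow> n = 0 \<or> fst l \<in> S"
 by (induction n) auto

lemma words_pw [simp]: "a \<in> S ==> pw a m \<in> words S" by (simp add: pw_def)

lemma pw_uminus: "pw a (- m) = word_inv (pw a m)"
proof -
 have "word_inv (replicate n (a, b)) = replicate n (a, \<not> b)" for n b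
  by (induction n) (auto simp: replicate_append_same)
 then show ?thesis by (cases "m = 0") (auto simp: pw_def)
qed

lemma pw_Suc_nat: "pw a (1 + int n) = (a, True) # pw a (int n)" "pw a (1 + int n) = pw a (int n) @ [(a, True)]"
 by (simp_all add: pw_def nat_add_distrib replicate_append_same)

context group
begin

lemma inv_cancel_left:
 "x \<in> carrier G ==> y \<in> carrier G ==> x \<otimes> (inv x \<otimes> y) = y"
 "x \<in> carrier G ==> y \<in> carrier G ==> inv x \<otimes> (x \<otimes> y) = y"
 by (simp_all add: m_assoc[symmetric])

lemmas group_simps = m_assoc inv_mult_group inv_cancel_left

lemma commute_swap_inv:
 assumes "w \<in> carrier G" "a \<in> carrier G" "b \<in> carrier G" "w \<otimes> a = b \<otimes> w"
 shows "w \<otimes> inv a = inv b \<otimes> w"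
proof -
 have "w \<otimes> inv a = inv b \<otimes> (b \<otimes> w) \<otimes> inv a" using assms(1-3) by (simp add: group_simps)
 also have "... = inv b \<otimes> w" using assms(1-3) by (simp add: group_simps flip: assms(4))
 finally show ?thesis .
qed

lemma fill_pw_Suc:
 assumes "a \<in> S"
 shows "fill G S N V g 0 (pw a (m + 1)) ((a, True) # pw a m)"
proof (cases "0 <= m")
 case True
 then have "pw a (m + 1) = (a, True) # pw a m" using pw_Suc_nat(1)[of a "nat m"] by (simp add: add.commute)
 then show ?thesis using assms by (simp add: fill.refl)
next
 case False
 then have "pw a m = (a, False) # pw a (m + 1)"
  by (cases "m = -1") (auto simp: pw_def nat_diff_distrib' Suc_diff_Suc simp flip: replicate_Suc, simp)
 moreover have "fill G S N V g 0 ([] @ [(a, True), (a, \<not> True)] @ pw a (m + 1)) ([] @ pw a (m + 1))"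
  by (rule fill.cancel) (use assms in auto)
 ultimately show ?thesis using fill.sym by fastforce
qed

lemma ev_pw: "a \<in> carrier G ==> ev (pw a m) = a [^] m"
proof -
 assume a: "a \<in> carrier G"
 have "ev (replicate n (a, True)) = a [^] n & ev (replicate n (a, False)) = inv (a [^] n)" for n
 proof (induction n)
  case (Suc n)
  have "a [^] Suc n = a \<otimes> a [^] n" using a by (rule nat_pow_Suc2)
  moreover have "inv (a [^] Suc n) = inv a \<otimes> inv (a [^] n)" using a by (simp add: inv_mult_group)
  ultimately show ?case using Suc a by (auto simp: eval_word_Cons letter_val_def)
 qed simp
 note * = this
 show ?thesis
 proof (cases m rule: int_cases2)
  case (nonneg n)
  then show ?thesis using *[of n] by (simp add: pw_def int_pow_int)
 next
  case (nonpos n)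
  have "pw a m = replicate n (a, False)" using nonpos by (cases "n = 0") (simp_all add: pw_def)
  then show ?thesis using *[of n] a nonpos by (simp add: int_pow_neg_int)
 qed
qed

text \<open>Closedness under right multiplication by \<open>Z\<close>. It is applied to heights,
  with \<open>Z\<close> the common kernel of the coordinates, where prefixes spelled in kernel
  letters do not leave \<open>V\<close>.\<close>

definition saturated :: "'a set => 'a set => bool" where
 "saturated V Z \<longleftrightarrow> subgroup Z G & V <= carrier G & (\<forall>h\<in>V. \<forall>z\<in>Z. h \<otimes> z \<in> V)"

lemma saturated_ev: "saturated V Z ==> h \<in> V ==> w \<in> words Z ==> h \<otimes> ev w \<in> V"
 using ev_in_subgroup by (auto simp: saturated_def)

text \<open>The short word \<open>w\<close> passes the power letter by letter, one loop each. The
  base vertices differ from \<open>g\<close> by powers of \<open>b\<close>, which lies in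
  \<open>Z\<close>.\<close>

lemma fill_conj_replicate:
 assumes sat: "saturated V Z" and S: "S <= carrier G"
  and w: "w \<in> words S" and a: "a \<in> S" and b: "b \<in> S" "b \<in> Z"
  and eq: "ev w \<otimes> a = b \<otimes> ev w" and N: "2 * length w + 2 <= N"
 shows "g \<in> V ==> fill G S N V g n (w @ replicate n (a, \<beta>)) (replicate n (b, \<beta>) @ w)"
proof (induction n arbitrary: g)
 case 0
 then show ?case using w by (simp add: fill.refl)
next
 case (Suc n)
 have gc: "g \<in> carrier G" using Suc sat by (auto simp: saturated_def)
 have c: "a \<in> carrier G" "b \<in> carrier G" "ev w \<in> carrier G" "w \<in> words (carrier G)"
  using a b S words_carrier[OF S w] by auto
 have "inv b \<otimes> ev w = ev w \<otimes> inv a" using commute_swap_inv[OF c(3,1,2) eq] by simp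
 then have e: "ev (w @ [(a, \<beta>)]) = ev ((b, \<beta>) # w)"
  using eq c by (cases \<beta>) (auto simp: eval_word_Cons letter_val_def)
 have "fill G S N V g 1 (w @ [(a, \<beta>)]) ((b, \<beta>) # w)"
  by (rule fill_repl) (use e w a b N Suc.prems S gc in auto)
 then have 1: "fill G S N V g 1 ((w @ [(a, \<beta>)]) @ replicate n (a, \<beta>)) (((b, \<beta>) # w) @ replicate n (a, \<beta>))"
  by (rule fill_append1) (use a S gc in auto)
 have gb: "g \<otimes> ev [(b, \<beta>)] \<in> V" by (rule saturated_ev[OF sat Suc.prems]) (use b in auto)
 have 2: "fill G S N V g n ([(b, \<beta>)] @ (w @ replicate n (a, \<beta>))) ([(b, \<beta>)] @ (replicate n (b, \<beta>) @ w))"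
  by (rule fill_append2[OF Suc.IH[OF gb]]) (use b S gc in auto)
 show ?case by (rule fill_transI[where v = "(b, \<beta>) # w @ replicate n (a, \<beta>)"]) (use 1 2 in auto)
qed

lemma fill_conj_pw:
 assumes "saturated V Z" "S <= carrier G" "w \<in> words S" "a \<in> S" "b \<in> S" "b \<in> Z"
  "ev w \<otimes> a = b \<otimes> ev w" "2 * length w + 2 <= N" "g \<in> V"
 shows "fill G S N V g (nat \<bar>m\<bar>) (w @ pw a m) (pw b m @ w)"
 unfolding pw_def by (rule fill_conj_replicate[OF assms])

text \<open>Each letter \<open>z\<close> that is split off has to be moved past all later letters
  \<open>b\<close>, which makes the area quadratic.\<close>

lemma fill_split_replicate:
 assumes sat: "saturated V Z" and S: "S <= carrier G" and a: "a \<in> S" and b: "b \<in> S" "b \<in> Z" and z: "z \<in> S" "z \<in> Z"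
  and eq: "a = b \<otimes> z" "b \<otimes> z = z \<otimes> b" and N: "4 <= N"
 shows "g \<in> V ==> fill G S N V g (n * n + n) (replicate n (a, \<beta>)) (replicate n (b, \<beta>) @ replicate n (z, \<beta>))"
proof (induction n arbitrary: g)
 case 0
 then show ?case by (simp add: fill.refl)
next
 case (Suc n)
 have gc: "g \<in> carrier G" using Suc sat by (auto simp: saturated_def)
 have c: "a \<in> carrier G" "b \<in> carrier G" "z \<in> carrier G" using a b z S by auto
 have e: "ev [(a, \<beta>)] = ev [(b, \<beta>), (z, \<beta>)]"
  using eq c inv_mult_group[OF c(2,3)] inv_mult_group[OF c(3,2)]
  by (cases \<beta>) (auto simp: eval_word_Cons letter_val_def)
 have "fill G S N V g 1 [(a, \<beta>)] [(b, \<beta>), (z, \<beta>)]"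
  by (rule fill_repl) (use e a b z N Suc.prems S gc in auto)
 then have 1: "fill G S N V g 1 ([(a, \<beta>)] @ replicate n (a, \<beta>)) ([(b, \<beta>), (z, \<beta>)] @ replicate n (a, \<beta>))"
  by (rule fill_append1) (use a S gc in auto)
 have gbz: "g \<otimes> ev [(b, \<beta>), (z, \<beta>)] \<in> V" by (rule saturated_ev[OF sat Suc.prems]) (use b z in auto)
 have 2: "fill G S N V g (n * n + n) ([(b, \<beta>), (z, \<beta>)] @ replicate n (a, \<beta>))
   ([(b, \<beta>), (z, \<beta>)] @ replicate n (b, \<beta>) @ replicate n (z, \<beta>))"
  by (rule fill_append2[OF Suc.IH[OF gbz]]) (use b z S gc in auto)
 have gb: "g \<otimes> ev [(b, \<beta>)] \<in> V" by (rule saturated_ev[OF sat Suc.prems]) (use b in auto)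
 have zb: "ev [(z, \<beta>)] \<otimes> b = b \<otimes> ev [(z, \<beta>)]"
 proof (cases \<beta>)
  case True then show ?thesis using eq c by simp
 next
  case False
  then show ?thesis using commute_swap_inv[OF c(2,3,3) eq(2)] c by simp
 qed
 have "fill G S N V (g \<otimes> ev [(b, \<beta>)]) n ([(z, \<beta>)] @ replicate n (b, \<beta>)) (replicate n (b, \<beta>) @ [(z, \<beta>)])"
  by (rule fill_conj_replicate[OF sat S _ b(1) b zb _ gb]) (use z N in auto)
 then have "fill G S N V (g \<otimes> ev [(b, \<beta>)]) n (([(z, \<beta>)] @ replicate n (b, \<beta>)) @ replicate n (z, \<beta>))
   ((replicate n (b, \<beta>) @ [(z, \<beta>)]) @ replicate n (z, \<beta>))"
  by (rule fill_append1) (use b z S gc c in auto)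
 from fill_append2[OF this]
 have 3: "fill G S N V g n ([(b, \<beta>), (z, \<beta>)] @ replicate n (b, \<beta>) @ replicate n (z, \<beta>))
   (replicate (Suc n) (b, \<beta>) @ replicate (Suc n) (z, \<beta>))"
  using b S gc by (auto simp: replicate_app_Cons_same)
 have "fill G S N V g (1 + (n * n + n) + n) (replicate (Suc n) (a, \<beta>)) (replicate (Suc n) (b, \<beta>) @ replicate (Suc n) (z, \<beta>))"
  using fill.trans[OF fill.trans[OF 1 2] 3] by simp
 then show ?case by (rule fill_weaken) (simp add: algebra_simps)
qed

lemma fill_split_pw:
 assumes "saturated V Z" "S <= carrier G" "a \<in> S" "b \<in> S" "b \<in> Z" "z \<in> S" "z \<in> Z"
  "a = b \<otimes> z" "b \<otimes> z = z \<otimes> b" "4 <= N" "g \<in> V"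
 shows "fill G S N V g (nat \<bar>m\<bar> * nat \<bar>m\<bar> + nat \<bar>m\<bar>) (pw a m) (pw b m @ pw z m)"
 unfolding pw_def by (rule fill_split_replicate[OF assms])

text \<open>A common central factor \<open>z\<close> can be dropped from \<open>c1\<^sup>m c2\<^sup>-\<^sup>m\<close> at quadratic cost.\<close>

lemma fill_drop_central:
 assumes sat: "saturated V Z" and S: "S <= carrier G" and SZ: "{c1, c2, b1, b2, z} <= S" "{b1, b2, z} <= Z"
  and eq: "c1 = b1 \<otimes> z" "c2 = b2 \<otimes> z" "b1 \<otimes> z = z \<otimes> b1" "b2 \<otimes> z = z \<otimes> b2" and N: "4 <= N" and g: "g \<in> V"
 shows "fill G S N V g (2 * (nat \<bar>m\<bar> * nat \<bar>m\<bar> + nat \<bar>m\<bar>)) (pw c1 m @ pw c2 (- m)) (pw b1 m @ pw b2 (- m))"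
proof -
 let ?n = "nat \<bar>m\<bar> * nat \<bar>m\<bar> + nat \<bar>m\<bar>"
 have gc: "g \<in> carrier G" using g sat by (auto simp: saturated_def)
 have ZG: "subgroup Z G" using sat by (simp add: saturated_def)
 have c1Z: "c1 \<in> Z" using eq SZ ZG subgroup.m_closed by (metis insert_subset)
 have 1: "fill G S N V g ?n (pw c1 m) (pw b1 m @ pw z m)"
  by (rule fill_split_pw[OF sat S]) (use SZ eq N g in auto)
 have g': "g \<otimes> ev (pw c1 m) \<in> V" by (rule saturated_ev[OF sat g]) (use c1Z in auto)
 have 2: "fill G S N V (g \<otimes> ev (pw c1 m)) (nat \<bar>- m\<bar> * nat \<bar>- m\<bar> + nat \<bar>- m\<bar>) (pw c2 (- m)) (pw z (- m) @ pw b2 (- m))"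
  by (rule fill_split_pw[OF sat S]) (use SZ eq N g' in auto)
 have 3: "fill G S N V g (?n + ?n) (pw c1 m @ pw c2 (- m)) ((pw b1 m @ pw z m) @ (pw z (- m) @ pw b2 (- m)))"
  by (rule fill_append[OF 1 2 S gc]) simp
 have 4: "fill G S N V g 0 (pw b1 m @ (pw z m @ pw z (- m) @ pw b2 (- m))) (pw b1 m @ pw b2 (- m))"
  by (rule fill_append2[OF _ _ S gc]) (use SZ in \<open>auto simp: pw_uminus[of z] intro!: fill_inv_right\<close>)
 show ?thesis by (rule fill_transI[OF 3[unfolded append_assoc] 4]) simp
qed

lemma conj_int_pow:
 assumes "x \<in> carrier G" "u \<in> carrier G"
 shows "(inv x \<otimes> u \<otimes> x) [^] (m :: int) = inv x \<otimes> u [^] m \<otimes> x"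
proof -
 have n: "(inv x \<otimes> u \<otimes> x) [^] (n :: nat) = inv x \<otimes> u [^] n \<otimes> x" for n
 proof (induction n)
  case (Suc n)
  then show ?case using assms by (simp add: group_simps)
 qed (use assms in simp)
 show ?thesis
  by (cases m rule: int_cases2) (use assms n in \<open>simp_all add: int_pow_int int_pow_neg_int group_simps\<close>)
qed

end

section \<open>Kernels of integral coordinates, one coordinate at a time\<close>

section \<open>Coabelian subgroups\<close>

text \<open>What the filling argument keeps of the direct product: the \<open>\<tau> j\<close> are
  the coordinates of a homomorphism from \<open>M0\<close> to \<open>Z^r\<close>, every index
  \<open>i\<close>, standing for a factor, has a dual family \<open>t i j\<close>, and
  \<open>t_comm\<close> records that the factors are normal and commute with each other.\<close>

locale coab = group G for G (structure) +
 fixes M0 :: "'a set" and \<tau> :: "nat => 'a => int" and r :: nat and t :: "nat => nat => 'a" and I :: "nat set"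
 assumes M0: "subgroup M0 G"
  and tau_mult: "[|j < r; x \<in> M0; y \<in> M0|] ==> \<tau> j (x \<otimes> y) = \<tau> j x + \<tau> j y"
  and t_M0: "[|i \<in> I; j < r|] ==> t i j \<in> M0"
  and tau_t: "[|i \<in> I; j < r; k < r|] ==> \<tau> k (t i j) = (if k = j then 1 else 0)"
  and t_comm: "[|i \<in> I; i' \<in> I; i ~= i'; j < r; j' < r; x \<in> M0; y \<in> M0|] ==>
   (inv x \<otimes> t i j \<otimes> x) \<otimes> (inv y \<otimes> t i' j' \<otimes> y) = (inv y \<otimes> t i' j' \<otimes> y) \<otimes> (inv x \<otimes> t i j \<otimes> x)"
begin

text \<open>A chain from \<open>level 0 = M0\<close> down to the common kernel
  \<open>level r\<close>; each term is the kernel of one further coordinate on its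
  predecessor.\<close>

definition level :: "nat => 'a set" where
 "level k = {g \<in> M0. \<forall>j<k. \<tau> j g = 0}"

text \<open>Heights replace word balls as the control on base vertices. They do not change along
  letters of \<open>level r\<close>, and the bound survives, up to constants, the passage from one
  level to the next.\<close>

definition heights :: "nat => 'a set" where
 "heights B = {g \<in> M0. \<forall>j<r. \<bar>\<tau> j g\<bar> <= int B}"

lemma M0_carrier: "x \<in> M0 ==> x \<in> carrier G"
 using subgroup.subset[OF M0] by auto

lemma M0_closed: "\<one> \<in> M0" "x \<in> M0 ==> y \<in> M0 ==> x \<otimes> y \<in> M0" "x \<in> M0 ==> inv x \<in> M0"
 using subgroup.one_closed[OF M0] subgroup.m_closed[OF M0] subgroup.m_inv_closed[OF M0] by auto

lemma M0_int_pow: "x \<in> M0 ==> x [^] (m :: int) \<in> M0"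
 using M0 subgroup_int_pow_closed by blast

lemma tau_one: "j < r ==> \<tau> j \<one> = 0"
 using tau_mult[of j \<one> \<one>] M0_closed(1) by simp

lemma tau_inv: "j < r ==> x \<in> M0 ==> \<tau> j (inv x) = - \<tau> j x"
 using tau_mult[of j x "inv x"] tau_one[of j] M0_closed M0_carrier by simp

lemma tau_nat_pow: "j < r ==> x \<in> M0 ==> x [^] n \<in> M0 & \<tau> j (x [^] (n :: nat)) = int n * \<tau> j x"
 by (induction n) (auto simp: tau_one tau_mult M0_closed algebra_simps)

lemma tau_int_pow: "j < r ==> x \<in> M0 ==> \<tau> j (x [^] (m :: int)) = m * \<tau> j x"
 by (cases m rule: int_cases2) (use tau_nat_pow[of j x] in \<open>simp_all add: int_pow_int int_pow_neg_int tau_inv M0_carrier\<close>)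

lemma tau_word: "w \<in> words S ==> S <= M0 ==> j < r ==> (!!x. x \<in> S ==> \<bar>\<tau> j x\<bar> <= int c) ==> \<bar>\<tau> j (ev w)\<bar> <= int (c * length w)"
proof (induction w)
 case (Cons l w)
 obtain x b where l: "l = (x, b)" by (cases l)
 have x: "x \<in> S" "x \<in> M0" "w \<in> words S" "letter_val G l \<in> M0"
  using Cons.prems by (auto simp: l letter_val_def M0_closed)
 have w: "ev w \<in> M0" by (rule ev_in_subgroup[OF M0 words_mono[OF Cons.prems(2) x(3)]])
 have "\<bar>\<tau> j (letter_val G l)\<bar> <= int c" using Cons.prems x by (auto simp: l letter_val_def tau_inv)
 moreover have "\<bar>\<tau> j (ev w)\<bar> <= int (c * length w)" using Cons x by simp
 moreover have "\<tau> j (ev (l # w)) = \<tau> j (letter_val G l) + \<tau> j (ev w)"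
  unfolding eval_word_Cons by (rule tau_mult) (use x w Cons in auto)
 ultimately show ?case by (simp add: distrib_left)
qed (simp add: tau_one)

lemma subgroup_level: "k <= r ==> subgroup (level k) G"
 by (rule subgroupI) (auto simp: level_def M0_closed M0_carrier tau_one tau_mult tau_inv intro!: exI[of _ \<one>])

lemma level_M0: "level k <= M0" by (auto simp: level_def)

lemma level_mono: "k <= k' ==> level k' <= level k" by (auto simp: level_def)

lemma heights_mono: "B <= B' ==> heights B <= heights B'"
 by (fastforce simp: heights_def)

lemma heights_mult: "g \<in> heights B ==> h \<in> heights C ==> g \<otimes> h \<in> heights (B + C)"
 by (force simp: heights_def M0_closed tau_mult)

lemma heights_finite: "finite F ==> F <= M0 ==> \<exists>c. F <= heights c"
proof -
 assume F: "finite F" "F <= M0"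
 obtain c where c: "\<forall>f\<in>F. (\<Sum>j<r. nat \<bar>\<tau> j f\<bar>) <= c" using finite_bound[OF F(1), of "%f. \<Sum>j<r. nat \<bar>\<tau> j f\<bar>"] by blast
 have "\<bar>\<tau> j f\<bar> <= int c" if "f \<in> F" "j < r" for f j
 proof -
  have "nat \<bar>\<tau> j f\<bar> <= (\<Sum>j<r. nat \<bar>\<tau> j f\<bar>)" by (rule member_le_sum) (use that in auto)
  then show ?thesis using c that(1) by fastforce
 qed
 then show ?thesis using F(2) by (intro exI[of _ c]) (auto simp: heights_def)
qed

lemma heights_word_bound:
 assumes "finite S" "S <= M0"
 shows "\<exists>c. \<forall>w\<in>words S. ev w \<in> heights (c * length w)"
proof -
 obtain c where c: "S <= heights c" using heights_finite[OF assms] by blast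
 have "ev w \<in> heights (c * length w)" if "w \<in> words S" for w
  using tau_word[OF that assms(2), of _ c] c ev_in_subgroup[OF M0 words_mono[OF assms(2) that]]
  by (auto simp: heights_def)
 then show ?thesis by blast
qed

lemma saturated_heights: "saturated (heights B) (level r)"
 unfolding saturated_def
 using subgroup_level[of r] heights_mult[of _ B _ 0] by (auto simp: heights_def level_def M0_carrier)

end

text \<open>One step: the kernel of the \<open>k\<close>-th coordinate. The three commuting elements \<open>u\<close>, \<open>v\<close>, \<open>s\<close> of height 1
 allow us to express \<open>u\<^sup>m x u\<^sup>-\<^sup>m\<close> as the word \<open>\<omega> m x\<close> of linear length in letters of height 0,
 using \<open>v\<close> or, interchangeably up to quadratic area, \<open>s\<close> to correct the height.\<close>

locale coab_step = coab +
 fixes k :: nat and i1 i2 i3 :: nat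
 assumes k: "k < r" and i: "i1 \<in> I" "i2 \<in> I" "i3 \<in> I" "i1 ~= i2" "i1 ~= i3" "i2 ~= i3"
begin

abbreviation u where "u \<equiv> t i1 k"
abbreviation v where "v \<equiv> t i2 k"
abbreviation s where "s \<equiv> t i3 k"

text \<open>Conjugates of \<open>u\<close> have the same coordinates as \<open>v\<close> and
  \<open>s\<close>, so all these letters lie in \<open>level r\<close>. \<open>A\<close> corrects
  the height by \<open>v\<close>, \<open>B\<close> by \<open>s\<close>, and \<open>Z\<close> is the
  ratio of the two corrections, with \<open>v\<close> conjugated by \<open>y\<close>.\<close>

definition A :: "'a => 'a" where "A y = inv y \<otimes> u \<otimes> y \<otimes> inv v"
definition B :: "'a => 'a" where "B y = inv y \<otimes> u \<otimes> y \<otimes> inv s"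
definition Z :: "'a => 'a" where "Z y = s \<otimes> (inv y \<otimes> inv v \<otimes> y)"

definition \<omega> :: "int => 'a => 'a gword" where
 "\<omega> m x = [(x, True)] @ pw (A x) m @ pw (A \<one>) (- m)"

definition up :: "int => 'a => 'a" where "up j x = u [^] j \<otimes> x \<otimes> u [^] (- j)"

lemma uvs: "u \<in> M0" "v \<in> M0" "s \<in> M0" "u \<in> carrier G" "v \<in> carrier G" "s \<in> carrier G"
 using t_M0 i k M0_carrier by auto

lemma closed: "y \<in> M0 ==> A y \<in> M0" "y \<in> M0 ==> B y \<in> M0" "y \<in> M0 ==> Z y \<in> M0" "y \<in> M0 ==> up j y \<in> M0"
 using uvs by (auto simp: A_def B_def Z_def up_def M0_closed M0_int_pow)

lemma in_level: "y \<in> M0 ==> A y \<in> level r" "y \<in> M0 ==> B y \<in> level r" "y \<in> M0 ==> Z y \<in> level r"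
 using closed uvs i k by (auto simp: level_def A_def B_def Z_def tau_mult tau_inv tau_t M0_closed)

lemma conj_level: "y \<in> level r ==> x \<in> M0 ==> inv x \<otimes> y \<otimes> x \<in> level r"
 by (auto simp: level_def tau_mult tau_inv M0_closed)

lemma comm_uv: "x \<in> M0 ==> y \<in> M0 ==> (inv x \<otimes> u \<otimes> x) \<otimes> (inv y \<otimes> v \<otimes> y) = (inv y \<otimes> v \<otimes> y) \<otimes> (inv x \<otimes> u \<otimes> x)"
 and comm_us: "x \<in> M0 ==> y \<in> M0 ==> (inv x \<otimes> u \<otimes> x) \<otimes> (inv y \<otimes> s \<otimes> y) = (inv y \<otimes> s \<otimes> y) \<otimes> (inv x \<otimes> u \<otimes> x)"
 and comm_vs: "x \<in> M0 ==> y \<in> M0 ==> (inv x \<otimes> v \<otimes> x) \<otimes> (inv y \<otimes> s \<otimes> y) = (inv y \<otimes> s \<otimes> y) \<otimes> (inv x \<otimes> v \<otimes> x)"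
 using t_comm i k by auto

lemma commuting_quotients:
 assumes "p \<in> carrier G" "q \<in> carrier G" "w \<in> carrier G"
  "p \<otimes> q = q \<otimes> p" "p \<otimes> w = w \<otimes> p" "q \<otimes> w = w \<otimes> q"
 shows "(p \<otimes> inv w) \<otimes> (w \<otimes> inv q) = (w \<otimes> inv q) \<otimes> (p \<otimes> inv w)"
proof -
 have "(w \<otimes> inv q) \<otimes> (p \<otimes> inv w) = w \<otimes> (inv q \<otimes> p) \<otimes> inv w" using assms(1-3) by (simp add: m_assoc)
 also have "inv q \<otimes> p = p \<otimes> inv q" using commute_swap_inv[OF assms(1,2,2) assms(4)] by simp
 also have "w \<otimes> (p \<otimes> inv q) \<otimes> inv w = (w \<otimes> p) \<otimes> (inv q \<otimes> inv w)" using assms(1-3) by (simp add: m_assoc)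
 also have "... = (p \<otimes> w) \<otimes> (inv w \<otimes> inv q)"
  using assms inv_mult_group[of q w] inv_mult_group[of w q] by simp
 also have "... = (p \<otimes> inv w) \<otimes> (w \<otimes> inv q)" using assms(1-3) by (simp add: group_simps)
 finally show ?thesis by simp
qed

text \<open>Both sides are built from a conjugate of \<open>u\<close>, a conjugate of
  \<open>v\<close> and the element \<open>s\<close>; these come from three different factors and
  commute pairwise.\<close>

lemma B_Z_comm: "y \<in> M0 ==> x \<in> M0 ==> B y \<otimes> Z x = Z x \<otimes> B y"
proof -
 assume yx: "y \<in> M0" "x \<in> M0"
 have "Z x = s \<otimes> inv (inv x \<otimes> v \<otimes> x)" using yx uvs M0_carrier by (simp add: Z_def group_simps)
 then show ?thesis unfolding B_def
  using commuting_quotients[of "inv y \<otimes> u \<otimes> y" "inv x \<otimes> v \<otimes> x" s] yx uvs M0_carrier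
   comm_uv[OF yx] comm_us[OF yx(1) M0_closed(1)] comm_vs[OF yx(2) M0_closed(1)] by simp
qed

lemma A_eq: "y \<in> M0 ==> A y = B y \<otimes> Z \<one>"
 using uvs M0_carrier by (simp add: A_def B_def Z_def group_simps)

text \<open>Once \<open>v\<close> is traded for \<open>s\<close>, the conjugation by
  \<open>x\<close> disappears into the argument of \<open>B\<close>. The price \<open>Z x\<close>
  does not depend on \<open>y\<close> and commutes with all \<open>B\<close>, so it cancels between
  powers of opposite exponents.\<close>

lemma A_conj_eq: "y \<in> M0 ==> x \<in> M0 ==> inv x \<otimes> A y \<otimes> x = B (y \<otimes> x) \<otimes> Z x"
 using uvs M0_carrier by (simp add: A_def B_def Z_def group_simps)

text \<open>Conjugates of \<open>u\<close> commute with \<open>v\<close>, so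
  \<open>A x [^] m\<close> splits into a conjugate of \<open>u [^] m\<close> and a power of
  \<open>v\<close>; the powers of \<open>v\<close> in the two halves of \<open>\<omega> m x\<close>
  cancel.\<close>

lemma ev_\<omega>:
 assumes "x \<in> M0" shows "ev (\<omega> m x) = up m x"
proof -
 have c: "x \<in> carrier G" "A x \<in> carrier G" "A \<one> \<in> carrier G" using assms closed M0_carrier M0_closed by auto
 have pow: "A y [^] m = inv y \<otimes> u [^] m \<otimes> y \<otimes> inv v [^] m" if "y \<in> M0" for y and m :: int
 proof -
  have yc: "y \<in> carrier G" using that M0_carrier by auto
  have "(inv y \<otimes> u \<otimes> y) \<otimes> v = v \<otimes> (inv y \<otimes> u \<otimes> y)" using comm_uv[OF that M0_closed(1)] uvs yc by simp
  then have "(inv y \<otimes> u \<otimes> y) \<otimes> inv v = inv v \<otimes> (inv y \<otimes> u \<otimes> y)"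
   using commute_swap_inv[of "inv y \<otimes> u \<otimes> y" v v] uvs yc by simp
  then show ?thesis unfolding A_def using int_pow_mult_distrib[of "inv y \<otimes> u \<otimes> y" "inv v" m] uvs yc conj_int_pow by simp
 qed
 have m: "inv v [^] m \<otimes> (u [^] (- m) \<otimes> inv v [^] (- m)) = u [^] (- m)"
 proof -
  have "u [^] (- m) \<otimes> inv v [^] (- m) = inv v [^] (- m) \<otimes> u [^] (- m)"
  proof -
   have "u \<otimes> v = v \<otimes> u" using comm_uv[OF M0_closed(1) M0_closed(1)] uvs by simp
   then have uv: "u \<otimes> inv v = inv v \<otimes> u" using commute_swap_inv uvs by simp
   have "(u \<otimes> inv v) [^] (- m) = u [^] (- m) \<otimes> inv v [^] (- m)" using uv uvs by (intro int_pow_mult_distrib) auto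
   moreover have "(inv v \<otimes> u) [^] (- m) = inv v [^] (- m) \<otimes> u [^] (- m)" using uv uvs by (intro int_pow_mult_distrib) auto
   ultimately show ?thesis using uv by simp
  qed
  then show ?thesis using uvs by (simp add: m_assoc[symmetric] int_pow_mult[symmetric])
 qed
 have "ev (\<omega> m x) = x \<otimes> (A x [^] m \<otimes> A \<one> [^] (- m))" using c by (simp add: \<omega>_def eval_word_Cons letter_val_def ev_pw)
 also have "... = x \<otimes> (inv x \<otimes> u [^] m \<otimes> x \<otimes> inv v [^] m \<otimes> (u [^] (- m) \<otimes> inv v [^] (- m)))"
  using pow[OF assms] pow[OF M0_closed(1)] uvs by simp
 also have "... = u [^] m \<otimes> x \<otimes> (inv v [^] m \<otimes> (u [^] (- m) \<otimes> inv v [^] (- m)))"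
  using uvs c by (simp add: group_simps)
 also have "... = up m x" unfolding m up_def ..
 finally show ?thesis .
qed

definition letters :: "'a set => 'a set" where
 "letters F = F \<union> A ` F \<union> B ` F \<union> Z ` F \<union> (%(y, x). inv x \<otimes> A y \<otimes> x) ` (F \<times> F)"

lemma lettersI:
 "y \<in> F ==> y \<in> letters F" "y \<in> F ==> A y \<in> letters F" "y \<in> F ==> B y \<in> letters F" "y \<in> F ==> Z y \<in> letters F"
 "y \<in> F ==> x \<in> F ==> inv x \<otimes> A y \<otimes> x \<in> letters F"
 unfolding letters_def by auto

lemma letters_carrier: "F <= M0 ==> letters F <= carrier G"
 using closed M0_carrier by (auto simp: letters_def subsetD M0_closed)

lemma \<omega>_words: "x \<in> F ==> \<one> \<in> F ==> \<omega> m x \<in> words (letters F)"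
 by (auto simp: \<omega>_def lettersI)

text \<open>Moving the letter \<open>x\<close> to the front conjugates the powers of
  \<open>A y\<close> and \<open>A \<one>\<close> by \<open>x\<close>. After the \<open>Z\<close>
  factors are dropped the word telescopes:
  \<open>B (y \<otimes> x)^m B x^(-m) B x^m B \<one>^(-m)\<close>. Three pairs of powers are
  converted between \<open>A\<close> and \<open>B\<close>, each with area
  \<open>2 * (n * n + n)\<close>; the remaining moves are linear.\<close>

lemma fill_\<omega>_mult:
 assumes F: "F <= M0" "\<one> \<in> F" and yx: "y \<in> F" "x \<in> F" "y \<otimes> x \<in> F" and N: "4 <= N"
  and V: "saturated V (level r)" and g: "g \<in> V" "g \<otimes> y \<in> V" "g \<otimes> (y \<otimes> x) \<in> V" and n: "nat \<bar>m\<bar> <= n"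
 shows "fill G (letters F) N V g (6 * (n * n + n) + 2 * n + 1) (\<omega> m y @ \<omega> m x) (\<omega> m (y \<otimes> x))"
proof -
 let ?S = "letters F" and ?n = "nat \<bar>m\<bar>"
 let ?q = "?n * ?n + ?n"
 have Sc: "?S <= carrier G" by (rule letters_carrier[OF F(1)])
 have M: "y \<in> M0" "x \<in> M0" "y \<otimes> x \<in> M0" "\<one> \<in> M0" using yx F by auto
 have c: "y \<in> carrier G" "x \<in> carrier G" "A y \<in> carrier G" "A x \<in> carrier G" "A \<one> \<in> carrier G" "g \<in> carrier G"
  using M[THEN M0_carrier] M[THEN closed(1), THEN M0_carrier] g(1) V by (simp_all add: saturated_def subset_iff)
 note L = lettersI[where F = F]
 note sat = saturated_ev[OF V]
 define Ay Ao where "Ay = inv x \<otimes> A y \<otimes> x" and "Ao = inv x \<otimes> A \<one> \<otimes> x"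
 have AS: "Ay \<in> ?S" "Ao \<in> ?S" using L(5) yx F by (auto simp: Ay_def Ao_def)
 have AL: "Ay \<in> level r" "Ao \<in> level r" using conj_level in_level M by (auto simp: Ay_def Ao_def)
 have AG: "Ay \<in> carrier G" "Ao \<in> carrier G" using AS Sc by auto
 have e: "g \<otimes> ev [(y, True)] \<in> V" using g c by simp
 have e1: "g \<otimes> ev [(y, True)] \<otimes> ev (pw (A y) m) \<in> V" by (rule sat[OF e]) (use in_level M in auto)
 have 1: "fill G ?S N V (g \<otimes> ev [(y, True)] \<otimes> ev (pw (A y) m)) ?n (pw (A \<one>) (- m) @ [(x, True)]) ([(x, True)] @ pw Ao (- m))"
  using fill.sym[OF fill_conj_pw[OF V Sc _ _ _ _ _ _ e1, of "[(x, True)]" Ao "A \<one>" N "- m"]]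
   AS L yx F in_level M c N by (simp add: Ao_def group_simps)
 have 2: "fill G ?S N V (g \<otimes> ev [(y, True)]) ?n (pw (A y) m @ [(x, True)]) ([(x, True)] @ pw Ay m)"
  using fill.sym[OF fill_conj_pw[OF V Sc _ _ _ _ _ _ e, of "[(x, True)]" Ay "A y" N m]]
   AS L yx F in_level M c N by (simp add: Ay_def group_simps)
 have ge: "g \<otimes> ev [(y, True)] \<in> carrier G" using c by simp
 have 3: "fill G ?S N V (g \<otimes> ev [(y, True)]) ?n (pw (A y) m @ pw (A \<one>) (- m) @ [(x, True)]) (pw (A y) m @ [(x, True)] @ pw Ao (- m))"
  by (rule fill_append2[OF 1 _ Sc ge]) (use L yx in auto)
 have 4: "fill G ?S N V (g \<otimes> ev [(y, True)]) ?n ((pw (A y) m @ [(x, True)]) @ pw Ao (- m)) (([(x, True)] @ pw Ay m) @ pw Ao (- m))"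
  by (rule fill_append1[OF 2 _ Sc ge]) (use AS in auto)
 have 5: "fill G ?S N V (g \<otimes> ev [(y, True)]) (?n + ?n) (pw (A y) m @ pw (A \<one>) (- m) @ [(x, True)]) ([(x, True)] @ pw Ay m @ pw Ao (- m))"
  by (rule fill_transI[OF 3 4[unfolded append_assoc] order_refl])
 have 6: "fill G ?S N V g (?n + ?n) ([(y, True)] @ pw (A y) m @ pw (A \<one>) (- m) @ [(x, True)]) ([(y, True)] @ [(x, True)] @ pw Ay m @ pw Ao (- m))"
  by (rule fill_append2[OF 5 _ Sc c(6)]) (use L yx in auto)
 have 7: "fill G ?S N V g 1 [(y, True), (x, True)] [(y \<otimes> x, True)]"
  by (rule fill_repl) (use L yx N g Sc c in \<open>auto simp: eval_word_Cons letter_val_def\<close>)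
 have 8: "fill G ?S N V g 1 ([(y, True), (x, True)] @ pw Ay m @ pw Ao (- m)) ([(y \<otimes> x, True)] @ pw Ay m @ pw Ao (- m))"
  by (rule fill_append1[OF 7 _ Sc c(6)]) (use AS in auto)
 have 9: "fill G ?S N V g (2 * ?n + 1) ([(y, True)] @ pw (A y) m @ pw (A \<one>) (- m) @ [(x, True)]) ([(y \<otimes> x, True)] @ pw Ay m @ pw Ao (- m))"
  by (rule fill_transI[OF 6]) (use 8 in auto)
 define h where "h = g \<otimes> ev [(y \<otimes> x, True)]"
 have h: "h \<in> V" "h \<in> carrier G" using g c by (auto simp: h_def)
 have Bc: "B y' \<otimes> Z x' = Z x' \<otimes> B y'" if "y' \<in> M0" "x' \<in> M0" for y' x' using B_Z_comm that .
 \<comment> \<open>The two conjugated powers share the factor \<open>Z x\<close>; the unconjugated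
   pairs treated in \<open>dc\<close> share \<open>Z \<one>\<close>.\<close>
 have 10: "fill G ?S N V h (2 * ?q) (pw Ay m @ pw Ao (- m)) (pw (B (y \<otimes> x)) m @ pw (B x) (- m))"
  by (rule fill_drop_central[OF V Sc, of _ _ _ _ "Z x"])
   (use AS L yx F M in_level N h A_conj_eq[of y x] A_conj_eq[of \<one> x] c in \<open>auto simp: Ay_def Ao_def B_Z_comm\<close>)
 have dc: "fill G ?S N V h' (2 * ?q) (pw (A y') m @ pw (A x') (- m)) (pw (B y') m @ pw (B x') (- m))"
  if "y' \<in> F" "x' \<in> F" "h' \<in> V" for y' x' h'
  by (rule fill_drop_central[OF V Sc, of _ _ _ _ "Z \<one>"])
   (use that L F in_level N A_eq in \<open>auto simp: B_Z_comm subsetD\<close>)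
 define h' where "h' = h \<otimes> ev (pw Ay m @ pw Ao (- m))"
 have h': "h' \<in> V" unfolding h'_def by (rule sat[OF h(1)]) (use AL in auto)
 have 11: "fill G ?S N V h (2 * ?q + 2 * ?q) ((pw Ay m @ pw Ao (- m)) @ (pw (A x) m @ pw (A \<one>) (- m)))
   ((pw (B (y \<otimes> x)) m @ pw (B x) (- m)) @ (pw (B x) m @ pw (B \<one>) (- m)))"
  by (rule fill_append[OF 10 dc[OF yx(2) F(2) h', unfolded h'_def] Sc h(2) order_refl])
 \<comment> \<open>The telescoping: the two middle powers of \<open>B x\<close> cancel
   freely.\<close>
 have 12: "fill G ?S N V h 0 (pw (B (y \<otimes> x)) m @ (pw (B x) (- m) @ pw (B x) m @ pw (B \<one>) (- m))) (pw (B (y \<otimes> x)) m @ pw (B \<one>) (- m))"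
  by (rule fill_append2[OF _ _ Sc h(2)])
   (use L yx F in \<open>auto simp: pw_uminus[of "B x"] intro!: fill_inv_left\<close>)
 note 13 = fill.sym[OF dc[OF yx(3) F(2) h(1)]]
 have 14: "fill G ?S N V h (2 * ?q + 2 * ?q + 0 + 2 * ?q) ((pw Ay m @ pw Ao (- m)) @ (pw (A x) m @ pw (A \<one>) (- m)))
   (pw (A (y \<otimes> x)) m @ pw (A \<one>) (- m))"
  by (rule fill.trans[OF fill.trans[OF 11[unfolded append_assoc[of "pw (B (y \<otimes> x)) m"]] 12] 13])
 have 15: "fill G ?S N V g (2 * ?q + 2 * ?q + 0 + 2 * ?q) ([(y \<otimes> x, True)] @ ((pw Ay m @ pw Ao (- m)) @ (pw (A x) m @ pw (A \<one>) (- m))))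
   ([(y \<otimes> x, True)] @ (pw (A (y \<otimes> x)) m @ pw (A \<one>) (- m)))"
  by (rule fill_append2[OF 14[unfolded h_def] _ Sc c(6)]) (use L yx in auto)
 have 16: "fill G ?S N V g (2 * ?n + 1) (([(y, True)] @ pw (A y) m @ pw (A \<one>) (- m) @ [(x, True)]) @ (pw (A x) m @ pw (A \<one>) (- m)))
   (([(y \<otimes> x, True)] @ pw Ay m @ pw Ao (- m)) @ (pw (A x) m @ pw (A \<one>) (- m)))"
  by (rule fill_append1[OF 9 _ Sc c(6)]) (use L yx F in auto)
 have 17: "fill G ?S N V g (2 * ?n + 1 + (2 * ?q + 2 * ?q + 0 + 2 * ?q)) (\<omega> m y @ \<omega> m x) (\<omega> m (y \<otimes> x))"
  using fill.trans[OF 16[unfolded append_assoc] 15[unfolded append_assoc]] by (simp add: \<omega>_def)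
 have "?n * ?n <= n * n" using n by (intro mult_le_mono)
 then show ?thesis by (intro fill_weaken[OF 17]) (use n in simp)
qed

text \<open>By \<open>x \<otimes> A x = up 1 x \<otimes> A \<one>\<close> the first letter of the
  power is traded for \<open>A \<one>\<close>, and
  \<open>A \<one> \<otimes> A x = A (up 1 x) \<otimes> A \<one>\<close> moves this surplus letter
  through the rest, where it shortens the negative power by one.\<close>

lemma fill_\<omega>_shift1:
 assumes F: "F <= M0" "\<one> \<in> F" and x: "x \<in> F" "up 1 x \<in> F" and N: "4 <= N"
  and V: "saturated V (level r)" and g: "g \<in> V" "g \<otimes> up 1 x \<in> V"
 shows "fill G (letters F) N V g (nat \<bar>m\<bar> + 1) (\<omega> (m + 1) x) (\<omega> m (up 1 x))"
proof -
 let ?S = "letters F" and ?n = "nat \<bar>m\<bar>" and ?x = "up 1 x"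
 have Sc: "?S <= carrier G" by (rule letters_carrier[OF F(1)])
 have M: "x \<in> M0" "?x \<in> M0" "\<one> \<in> M0" using x F by auto
 have c: "x \<in> carrier G" "A x \<in> carrier G" "A ?x \<in> carrier G" "A \<one> \<in> carrier G" "g \<in> carrier G" "?x \<in> carrier G"
  using M[THEN M0_carrier] M[THEN closed(1), THEN M0_carrier] g(1) V by (simp_all add: saturated_def subset_iff)
 note L = lettersI[where F = F]
 have ux: "?x = u \<otimes> x \<otimes> inv u" using uvs by (simp add: up_def int_pow_neg)
 have uv: "(inv y \<otimes> u \<otimes> y) \<otimes> inv v = inv v \<otimes> (inv y \<otimes> u \<otimes> y)" if "y \<in> M0" for y
  using commute_swap_inv[of "inv y \<otimes> u \<otimes> y" v v] comm_uv[OF that M0_closed(1)] uvs M0_carrier[OF that] by simp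
 have e1: "x \<otimes> A x = ?x \<otimes> A \<one>" using c uvs by (simp add: ux A_def group_simps)
 have e2: "A \<one> \<otimes> A x = A ?x \<otimes> A \<one>"
 proof -
  have "A \<one> \<otimes> A x = u \<otimes> (inv v \<otimes> (inv x \<otimes> u \<otimes> x)) \<otimes> inv v" using c uvs by (simp add: A_def group_simps)
  also have "... = u \<otimes> (inv x \<otimes> u \<otimes> x \<otimes> inv v) \<otimes> inv v" using uv[OF M(1)] by simp
  also have "... = u \<otimes> inv x \<otimes> u \<otimes> x \<otimes> inv u \<otimes> (u \<otimes> inv v) \<otimes> inv v" using c uvs by (simp add: group_simps)
  also have "u \<otimes> inv v = inv v \<otimes> u" using uv[OF M(3)] uvs by simp
  also have "u \<otimes> inv x \<otimes> u \<otimes> x \<otimes> inv u \<otimes> (inv v \<otimes> u) \<otimes> inv v = A ?x \<otimes> A \<one>" using c uvs by (simp add: A_def ux group_simps)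
  finally show ?thesis .
 qed
 have f1: "fill G ?S N V (g \<otimes> ev [(x, True)]) 0 (pw (A x) (m + 1) @ pw (A \<one>) (- (m + 1))) (((A x, True) # pw (A x) m) @ pw (A \<one>) (- (m + 1)))"
  by (rule fill_append1[OF fill_pw_Suc]) (use L x F Sc c in auto)
 have f2: "fill G ?S N V g 0 (\<omega> (m + 1) x) ([(x, True)] @ (((A x, True) # pw (A x) m) @ pw (A \<one>) (- (m + 1))))"
  unfolding \<omega>_def by (rule fill_append2[OF f1]) (use L x F Sc c in auto)
 have f3: "fill G ?S N V g 1 [(x, True), (A x, True)] [(?x, True), (A \<one>, True)]"
  by (rule fill_repl) (use L x F Sc c g N e1 in \<open>auto simp: eval_word_Cons letter_val_def\<close>)
 have f4: "fill G ?S N V g 1 ([(x, True), (A x, True)] @ pw (A x) m @ pw (A \<one>) (- (m + 1))) ([(?x, True), (A \<one>, True)] @ pw (A x) m @ pw (A \<one>) (- (m + 1)))"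
  by (rule fill_append1[OF f3]) (use L x F Sc c in auto)
 define h where "h = g \<otimes> ev [(?x, True)]"
 have h: "h \<in> V" "h \<in> carrier G" using g c by (auto simp: h_def)
 have f5: "fill G ?S N V h ?n ([(A \<one>, True)] @ pw (A x) m) (pw (A ?x) m @ [(A \<one>, True)])"
  by (rule fill_conj_pw[OF V Sc]) (use L x F c N e2 in_level M h in auto)
 have f6: "fill G ?S N V h ?n ((A \<one>, True) # pw (A x) m @ pw (A \<one>) (- (m + 1))) (pw (A ?x) m @ (A \<one>, True) # pw (A \<one>) (- (m + 1)))"
  using fill_append1[OF f5, of "pw (A \<one>) (- (m + 1))"] L F Sc h by simp
 have "fill G ?S N V (h \<otimes> ev (pw (A ?x) m)) 0 ((A \<one>, True) # pw (A \<one>) (- (m + 1))) (pw (A \<one>) (- m))"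
  using fill.sym[OF fill_pw_Suc[of "A \<one>" ?S N V _ "- (m + 1)"]] L F by simp
 then have f7: "fill G ?S N V h 0 (pw (A ?x) m @ (A \<one>, True) # pw (A \<one>) (- (m + 1))) (pw (A ?x) m @ pw (A \<one>) (- m))"
  by (rule fill_append2) (use L x F Sc h in auto)
 have f8: "fill G ?S N V h (?n + 0) ((A \<one>, True) # pw (A x) m @ pw (A \<one>) (- (m + 1))) (pw (A ?x) m @ pw (A \<one>) (- m))"
  by (rule fill.trans[OF f6 f7])
 have f9: "fill G ?S N V g (?n + 0) ([(?x, True)] @ ((A \<one>, True) # pw (A x) m @ pw (A \<one>) (- (m + 1)))) ([(?x, True)] @ (pw (A ?x) m @ pw (A \<one>) (- m)))"
  by (rule fill_append2[OF f8[unfolded h_def]]) (use L x Sc c in auto)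
 note cons = append_Cons append_Nil
 have f10: "fill G ?S N V g (0 + 1 + (?n + 0)) (\<omega> (m + 1) x) ((?x, True) # (pw (A ?x) m @ pw (A \<one>) (- m)))"
  by (rule fill.trans[OF fill.trans[OF f2[unfolded cons] f4[unfolded cons]] f9[unfolded cons]])
 then show ?thesis by (simp add: \<omega>_def)
qed

end

section \<open>Pushing one level to the next\<close>

context coab_step
begin

lemma up_0 [simp]: "x \<in> M0 ==> up 0 x = x"
 using M0_carrier by (simp add: up_def)

lemma up_up: "x \<in> M0 ==> up i (up j x) = up (i + j) x"
proof -
 assume x: "x \<in> M0"
 have "u [^] (- (i + j)) = u [^] (- j) \<otimes> u [^] (- i)" using int_pow_mult[of u "- j" "- i"] uvs by (simp add: algebra_simps)
 moreover have "u [^] (i + j) = u [^] i \<otimes> u [^] j" using int_pow_mult[of u i j] uvs by simp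
 ultimately show ?thesis using uvs M0_carrier[OF x] by (simp only: up_def) (simp add: m_assoc)
qed

lemma fill_\<omega>_shift_nat:
 assumes F: "F <= M0" "\<one> \<in> F" and N: "4 <= N" and V: "saturated V (level r)" and g: "g \<in> V" "!!f. f \<in> F ==> g \<otimes> f \<in> V"
 shows "[|!!i. 0 <= i ==> i <= int n ==> up i x \<in> F; x \<in> M0; nat \<bar>m\<bar> + n <= c|] ==>
   fill G (letters F) N V g (n * (c + 1)) (\<omega> (m + int n) x) (\<omega> m (up (int n) x))"
  "[|!!i. 0 <= i ==> i <= int n ==> up (- i) x \<in> F; x \<in> M0; nat \<bar>m\<bar> + n <= c|] ==>
   fill G (letters F) N V g (n * (c + 1)) (\<omega> (m - int n) x) (\<omega> m (up (- int n) x))"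
proof (induction n arbitrary: x)
 case 0
 { case 1 from 1(1)[of 0] 1(2) show ?case using F by (auto intro!: fill.refl \<omega>_words) }
 { case 2 from 2(1)[of 0] 2(2) show ?case using F by (auto intro!: fill.refl \<omega>_words) }
next
 case (Suc n)
 {
  case 1
  have x: "x \<in> F" "up 1 x \<in> F" using 1(1)[of 0] 1(1)[of 1] 1(2) by auto
  have a: "fill G (letters F) N V g (nat \<bar>m + int n\<bar> + 1) (\<omega> (m + int n + 1) x) (\<omega> (m + int n) (up 1 x))"
   by (rule fill_\<omega>_shift1[OF F x N V g(1) g(2)[OF x(2)]])
  have b: "fill G (letters F) N V g (n * (c + 1)) (\<omega> (m + int n) (up 1 x)) (\<omega> m (up (int n) (up 1 x)))"
  proof (rule Suc.IH(1))
   show "up i (up 1 x) \<in> F" if "0 <= i" "i <= int n" for i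
    using 1(1)[of "i + 1"] that up_up[OF 1(2), of i 1] by simp
   show "up 1 x \<in> M0" by (rule closed(4)[OF 1(2)])
  qed (use 1(3) in simp)
  have "up (int n) (up 1 x) = up (int (Suc n)) x" using up_up[OF 1(2)] by (simp add: add.commute)
  moreover have "m + int n + 1 = m + int (Suc n)" by simp
  moreover have "nat \<bar>m + int n\<bar> + 1 + n * (c + 1) <= Suc n * (c + 1)" using 1(3) by simp
  ultimately show ?case using fill_transI[OF a b] by metis
 }
 {
  case 2
  define y where "y = up (- 1) x"
  have yM: "y \<in> M0" using 2(2) closed by (simp add: y_def)
  have yx: "up 1 y = x" using up_up[OF 2(2), of 1 "-1"] 2(2) by (simp add: y_def)
  have x: "y \<in> F" "up 1 y \<in> F" using 2(1)[of 0] 2(1)[of 1] 2(2) yx by (auto simp: y_def)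
  have "m - int (Suc n) + 1 = m - int n" by simp
  then have a: "fill G (letters F) N V g (nat \<bar>m - int (Suc n)\<bar> + 1) (\<omega> (m - int n) y) (\<omega> (m - int (Suc n)) x)"
   using fill_\<omega>_shift1[OF F x N V g(1) g(2)[OF x(2)], of "m - int (Suc n)"] yx by simp
  have b: "fill G (letters F) N V g (n * (c + 1)) (\<omega> (m - int n) y) (\<omega> m (up (- int n) y))"
  proof (rule Suc.IH(2)[OF _ yM])
   show "up (- i) y \<in> F" if "0 <= i" "i <= int n" for i
    using 2(1)[of "i + 1"] that up_up[OF 2(2), of "- i" "-1"] by (simp add: y_def algebra_simps)
  qed (use 2 in auto)
  have "- int n + - 1 = - int (Suc n)" by simp
  then have e: "up (- int n) y = up (- int (Suc n)) x" using up_up[OF 2(2), of "- int n" "- 1"] unfolding y_def by metis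
  have "nat \<bar>m - int (Suc n)\<bar> + 1 + n * (c + 1) <= Suc n * (c + 1)" using 2(3) by simp
  then show ?case using fill_transI[OF fill.sym[OF a] b] unfolding e by blast
 }
qed

lemma fill_\<omega>_shift:
 assumes F: "F <= M0" "\<one> \<in> F" and N: "4 <= N" and V: "saturated V (level r)" and g: "g \<in> V" "!!f. f \<in> F ==> g \<otimes> f \<in> V"
  and x: "x \<in> M0" "!!i. \<bar>i\<bar> <= int J ==> up i x \<in> F" and j: "\<bar>j\<bar> <= int J"
 shows "fill G (letters F) N V g (J * (nat \<bar>m\<bar> + J + 1)) (\<omega> (m + j) x) (\<omega> m (up j x))"
proof (cases "0 <= j")
 case True
 have f: "fill G (letters F) N V g (nat j * (nat \<bar>m\<bar> + J + 1)) (\<omega> (m + int (nat j)) x) (\<omega> m (up (int (nat j)) x))"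
  by (rule fill_\<omega>_shift_nat(1)[OF F N V g]) (use x j True in auto)
 have "fill G (letters F) N V g (nat j * (nat \<bar>m\<bar> + J + 1)) (\<omega> (m + j) x) (\<omega> m (up j x))" using f True by simp
 then show ?thesis by (rule fill_weaken) (use j True in \<open>intro mult_le_mono1, simp\<close>)
next
 case False
 have f: "fill G (letters F) N V g (nat (- j) * (nat \<bar>m\<bar> + J + 1)) (\<omega> (m - int (nat (- j))) x) (\<omega> m (up (- int (nat (- j))) x))"
  by (rule fill_\<omega>_shift_nat(2)[OF F N V g]) (use x j False in auto)
 have "fill G (letters F) N V g (nat (- j) * (nat \<bar>m\<bar> + J + 1)) (\<omega> (m + j) x) (\<omega> m (up j x))" using f False by simp
 then show ?thesis by (rule fill_weaken) (use j False in \<open>intro mult_le_mono1, simp\<close>)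
qed

text \<open>Slides \<open>x\<close> along powers of \<open>u\<close> to height zero in coordinate
  \<open>k\<close>, keeping the other coordinates. This is a map of vertices, in general not a
  homomorphism.\<close>

definition bar :: "'a => 'a" where "bar x = x \<otimes> u [^] (- \<tau> k x)"

lemma tau_u: "j < r ==> \<tau> j u = (if j = k then 1 else 0)"
 using tau_t[of i1 k j] i k by simp

lemma bar_M0: "x \<in> M0 ==> bar x \<in> M0"
 using uvs M0_closed M0_int_pow by (simp add: bar_def)

lemma tau_bar: "x \<in> M0 ==> j < r ==> \<tau> j (bar x) = (if j = k then 0 else \<tau> j x)"
 using uvs M0_int_pow k by (simp add: bar_def tau_mult tau_int_pow tau_u)

lemma tau_up: "x \<in> M0 ==> j < r ==> \<tau> j (up i x) = \<tau> j x"
 using uvs M0_int_pow M0_closed k by (simp add: up_def tau_mult tau_int_pow)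

lemma bar_heights: "x \<in> heights b ==> bar x \<in> heights b"
 using tau_bar bar_M0 by (auto simp: heights_def)

lemma bar_level: "x \<in> level k ==> bar x \<in> level (Suc k)"
 using tau_bar bar_M0 k by (auto simp: level_def less_Suc_eq)

lemma bar_id: "x \<in> level (Suc k) ==> bar x = x"
 using M0_carrier by (auto simp: bar_def level_def)

lemma up_level: "x \<in> level (Suc k) ==> up i x \<in> level (Suc k)"
 using tau_up closed k by (auto simp: level_def)

text \<open>The cocycle rule behind the push: an edge \<open>x\<close> starting at height
  \<open>m = \<tau> k q\<close> goes to \<open>bar x\<close> conjugated by \<open>u^m\<close>, which
  is the value of \<open>\<omega> m (bar x)\<close>.\<close>

lemma bar_mult:
 assumes "q \<in> M0" "x \<in> M0"
 shows "bar (q \<otimes> x) = bar q \<otimes> up (\<tau> k q) (bar x)"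
proof -
 have c: "q \<in> carrier G" "x \<in> carrier G" using assms M0_carrier by auto
 have "u [^] (- \<tau> k (q \<otimes> x)) = u [^] (- \<tau> k x) \<otimes> u [^] (- \<tau> k q)"
  using int_pow_mult[of u "- \<tau> k x" "- \<tau> k q"] uvs tau_mult[OF k assms] by (simp add: algebra_simps)
 moreover have "u [^] (- \<tau> k q) \<otimes> (u [^] \<tau> k q \<otimes> w) = w" if "w \<in> carrier G" for w
  using int_pow_mult[of u "- \<tau> k q" "\<tau> k q"] uvs that by (simp add: m_assoc[symmetric])
 ultimately show ?thesis using uvs c by (simp only: bar_def up_def) (simp add: m_assoc)
qed

lemma pushes_bar:
 assumes S: "S <= level k" and F: "F <= M0" "\<one> \<in> F" "!!x. x \<in> S ==> bar x \<in> F"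
 shows "pushes (%g x. \<omega> (\<tau> k g) (bar x)) bar (level k) S (letters F)"
 unfolding pushes_def
proof (intro conjI ballI)
 show "subgroup (level k) G" using subgroup_level k by simp
 fix g x assume gx: "g \<in> level k" "x \<in> S"
 then have M: "g \<in> M0" "x \<in> M0" using S level_M0 by auto
 have c: "bar g \<in> carrier G" "up (\<tau> k g) (bar x) \<in> carrier G" using M bar_M0 closed M0_carrier by auto
 show "\<omega> (\<tau> k g) (bar x) \<in> words (letters F)" using \<omega>_words F gx by simp
 show "ev (\<omega> (\<tau> k g) (bar x)) = inv (bar g) \<otimes> bar (g \<otimes> x)"
  using ev_\<omega>[OF bar_M0[OF M(2)]] bar_mult[OF M] c by (simp add: inv_cancel_left)
next
 fix g assume "g \<in> level k"
 then show "bar g \<in> carrier G" using level_M0[THEN subsetD, THEN bar_M0, THEN M0_carrier] by blast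
qed (use S letters_carrier[OF F(1)] in auto)

text \<open>Induction over the prefixes of a relator, with the height of the base vertex
  \<open>h\<close> fixed. The next edge starts at height
  \<open>\<tau> k h + \<tau> k (ev q)\<close>; shifting it to the height of \<open>h\<close> costs
  \<open>J * (n + J + 1)\<close>, because \<open>J\<close> bounds the change of height inside a
  relator, and merging it with the prefix costs the quadratic amount. Base vertices exceed the
  heights of \<open>h\<close> by at most \<open>2 * c\<close>: once \<open>c\<close> for the prefix
  and once for a letter of \<open>F\<close>.\<close>

lemma fill_push_relator:
 assumes S: "S <= level k" and F: "F <= M0" "\<one> \<in> F" "F <= heights c"
  and Fbar: "!!q. q \<in> words S ==> length q <= N ==> bar (ev q) \<in> F"
  and Fup: "!!x i. x \<in> S ==> \<bar>i\<bar> <= int J ==> up i (bar x) \<in> F"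
  and J: "!!q. q \<in> words S ==> length q <= N ==> \<bar>\<tau> k (ev q)\<bar> <= int J & ev q \<in> heights c"
  and h: "h \<in> level k" "h \<in> heights b" and n: "nat \<bar>\<tau> k h\<bar> <= n" and N': "4 <= N'"
 shows "q \<in> words S ==> length q <= N ==>
  fill G (letters F) N' (heights (b + 2 * c)) (bar h) (1 + length q * ((6 * (n * n + n) + 2 * n + 1) + J * (n + J + 1)))
   (push (%g x. \<omega> (\<tau> k g) (bar x)) h q) (\<omega> (\<tau> k h) (bar (ev q)))"
proof (induction q rule: rev_induct)
 let ?S = "letters F" and ?V = "heights (b + 2 * c)" and ?\<sigma> = "%g x. \<omega> (\<tau> k g) (bar x)" and ?m = "\<tau> k h"
 have Sc: "?S <= carrier G" by (rule letters_carrier[OF F(1)])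
 note L = lettersI[where F = F]
 have hM: "h \<in> M0" using h level_M0 by auto
 have bh: "bar h \<in> heights b" "bar h \<in> M0" "bar h \<in> carrier G" using bar_heights h bar_M0[OF hM] M0_carrier by auto
 have V: "saturated ?V (level r)" by (rule saturated_heights)
 have bhV: "bar h \<in> ?V" using heights_mono[of b "b + 2 * c"] bh by auto
 have bhf: "bar h \<otimes> f \<in> ?V" if "f \<in> F" for f
  using heights_mult[OF bh(1), of f c] that F(3) heights_mono[of "b + c" "b + 2 * c"] by auto
 {
  case Nil
  have "bar \<one> = \<one>" using tau_one[OF k] by (simp add: bar_def)
  \<comment> \<open>The two powers of \<open>A \<one>\<close> cancel freely; what remains is the
    letter \<open>\<one>\<close>, removed by one loop.\<close>
  moreover have "fill G ?S N' ?V (bar h) 1 (\<omega> ?m \<one>) []"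
  proof -
   have "fill G ?S N' ?V (bar h) 0 ([(\<one>, True)] @ (pw (A \<one>) ?m @ pw (A \<one>) (- ?m) @ [])) ([(\<one>, True)] @ [])"
    by (rule fill_append2[OF _ _ Sc bh(3)]) (use L F in \<open>auto simp only: pw_uminus words_Cons words_Nil fst_conv intro!: fill_inv_right words_pw\<close>)
   moreover have "fill G ?S N' ?V (bar h) 1 ([(\<one>, True)] @ []) []"
    by (rule fill_repl) (use L F N' bhV bh Sc in auto)
   ultimately show ?thesis unfolding \<omega>_def using fill.trans[where m = 0 and n = 1] by fastforce
  qed
  ultimately show ?case using fill.sym by simp
 next
  case (snoc l q)
  obtain x \<beta> where l: "l = (x, \<beta>)" by (cases l)
  have q: "q \<in> words S" "length q <= N" "x \<in> S" "length q + 1 <= N" using snoc.prems l by auto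
  have xM: "x \<in> M0" using q S level_M0 by auto
  have SM: "S <= M0" and Scc: "S <= carrier G" using S level_M0 M0_carrier by auto
  have qM: "ev q \<in> M0" by (rule ev_in_subgroup[OF M0 words_mono[OF SM q(1)]])
  have qc: "q \<in> words (carrier G)" "x \<in> carrier G" "h \<in> carrier G" "ev q \<in> carrier G"
   using words_carrier[OF Scc q(1)] xM hM M0_carrier by auto
  have P: "pushes ?\<sigma> bar (level k) S ?S"
   by (rule pushes_bar[OF S F(1,2)]) (use Fup[of _ 0] S level_M0 bar_M0 in force)
  let ?c1 = "6 * (n * n + n) + 2 * n + 1" and ?c2 = "J * (n + J + 1)"
  let ?y = "bar (ev q)"
  have yF: "?y \<in> F" using Fbar q by auto
  note IH = snoc.IH[OF q(1,2)]
  have shift: "fill G ?S N' ?V (bar h \<otimes> up ?m (bar q')) ?c2 (\<omega> (?m + \<tau> k q') (bar x)) (\<omega> ?m (up (\<tau> k q') (bar x)))"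
   if q': "q' \<in> M0" "\<bar>\<tau> k q'\<bar> <= int J" "q' \<in> heights c" for q'
  proof -
   have e: "bar h \<otimes> up ?m (bar q') = bar (h \<otimes> q')" using bar_mult[OF hM q'(1)] by simp
   have hq: "bar (h \<otimes> q') \<in> heights (b + c)" using bar_heights heights_mult[OF h(2) q'(3)] by auto
   have "fill G ?S N' ?V (bar (h \<otimes> q')) (J * (nat \<bar>?m\<bar> + J + 1)) (\<omega> (?m + \<tau> k q') (bar x)) (\<omega> ?m (up (\<tau> k q') (bar x)))"
   proof (rule fill_\<omega>_shift[OF F(1,2) N' V])
    show "bar (h \<otimes> q') \<in> ?V" using hq heights_mono[of "b + c" "b + 2 * c"] by auto
    show "bar (h \<otimes> q') \<otimes> f \<in> ?V" if "f \<in> F" for f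
     using heights_mult[OF hq, of f c] that F(3) by (auto simp: mult_2 add.assoc)
   qed (use bar_M0 xM Fup q q' in auto)
   then show ?thesis unfolding e by (rule fill_weaken) (use n in simp)
  qed
  have KL: "fill G ?S N' ?V (bar h) ?c1 (\<omega> ?m y @ \<omega> ?m x') (\<omega> ?m (y \<otimes> x'))" if "y \<in> F" "x' \<in> F" "y \<otimes> x' \<in> F" for y x'
   by (rule fill_\<omega>_mult[OF F(1,2) that N' V bhV]) (use bhf that n in auto)
  have bq: "bar h \<otimes> ev (push ?\<sigma> h q) = bar h \<otimes> up ?m ?y"
   using push_closed(2)[OF P q(1) h(1)] bar_mult[OF hM qM] bh closed(4)[OF bar_M0[OF qM]] M0_carrier
   by (simp add: inv_cancel_left)
  have pq: "push ?\<sigma> h q \<in> words ?S" by (rule push_closed(1)[OF P q(1) h(1)])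
  show ?case
  proof (cases \<beta>)
   case True
   have 0: "push ?\<sigma> h (q @ [l]) = push ?\<sigma> h q @ \<omega> (?m + \<tau> k (ev q)) (bar x)"
    using push_append[OF q(1) Scc, of "[l]" h ?\<sigma>] qc tau_mult[OF k hM qM] by (simp add: l True)
   let ?x = "up (\<tau> k (ev q)) (bar x)"
   have xF: "?x \<in> F" using Fup q J by auto
   have e: "ev (q @ [l]) = ev q \<otimes> x" using qc by (simp add: l True)
   have yx: "bar (ev (q @ [l])) = ?y \<otimes> ?x" unfolding e by (rule bar_mult[OF qM xM])
   have yxF: "?y \<otimes> ?x \<in> F" unfolding yx[symmetric] using Fbar snoc.prems by blast
   have "fill G ?S N' ?V (bar h) (1 + length q * (?c1 + ?c2) + ?c2) (push ?\<sigma> h q @ \<omega> (?m + \<tau> k (ev q)) (bar x)) (\<omega> ?m ?y @ \<omega> ?m ?x)"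
    by (rule fill_append[OF IH _ Sc bh(3) order_refl]) (use shift[OF qM] J q bq in auto)
   from fill.trans[OF this KL[OF yF xF yxF]] show ?thesis unfolding 0 yx by (rule fill_weaken) simp
  next
   case False
   \<comment> \<open>An inverse letter: \<open>?q\<close> is the value of the longer prefix and
     \<open>ev q = ?q \<otimes> x\<close>. Multiplicativity of \<open>\<omega>\<close> is used from
     right to left, after which the word of the edge cancels against its inverse.\<close>
   let ?q = "ev q \<otimes> inv x"
   have q'M: "?q \<in> M0" using qM xM M0_closed by auto
   have e: "ev (q @ [l]) = ?q" using qc by (simp add: l False)
   have h': "h \<otimes> ev q \<otimes> inv x = h \<otimes> ?q" using qc by (simp add: m_assoc)
   let ?W = "\<omega> (?m + \<tau> k ?q) (bar x)"
   have 0: "push ?\<sigma> h (q @ [l]) = push ?\<sigma> h q @ word_inv ?W"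
    using push_append[OF q(1) Scc, of "[l]" h ?\<sigma>] qc tau_mult[OF k hM q'M] h' by (simp add: l False)
   let ?x = "up (\<tau> k ?q) (bar x)"
   have Jq: "\<bar>\<tau> k ?q\<bar> <= int J" "?q \<in> heights c" "bar ?q \<in> F"
    using J[OF snoc.prems] Fbar[OF snoc.prems] by (auto simp: e)
   have xF: "?x \<in> F" using Fup q Jq by auto
   have "?q \<otimes> x = ev q" using qc by (simp add: m_assoc)
   then have yx: "?y = bar ?q \<otimes> ?x" using bar_mult[OF q'M xM] by simp
   have "fill G ?S N' ?V (bar h \<otimes> ev (\<omega> ?m (bar ?q))) ?c2 ?W (\<omega> ?m ?x)"
    using shift[OF q'M Jq(1,2)] ev_\<omega>[OF bar_M0[OF q'M]] by simp
   from fill_append2[OF this \<omega>_words[OF Jq(3) F(2)] Sc bh(3)]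
   have 1: "fill G ?S N' ?V (bar h) ?c2 (\<omega> ?m (bar ?q) @ ?W) (\<omega> ?m (bar ?q) @ \<omega> ?m ?x)" .
   have 2: "fill G ?S N' ?V (bar h) ?c1 (\<omega> ?m (bar ?q) @ \<omega> ?m ?x) (\<omega> ?m ?y)"
    unfolding yx by (rule KL[OF Jq(3) xF]) (use yF yx in simp)
   note 3 = fill.trans[OF 1 2]
   have W: "?W \<in> words ?S" by (rule \<omega>_words[OF _ F(2)]) (use Fup[of x 0] q bar_M0[OF xM] in auto)
   have "word_inv ?W \<in> words ?S" using W by simp
   note 4 = fill_append1[OF fill.sym[OF 3] this Sc bh(3)]
   have "\<omega> ?m (bar ?q) \<in> words ?S" by (rule \<omega>_words[OF Jq(3) F(2)])
   have "fill G ?S N' ?V (bar h \<otimes> ev (\<omega> ?m (bar ?q))) 0 (?W @ word_inv ?W @ []) []"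
    by (rule fill_inv_right[OF _ W]) simp
   from fill_append2[OF this \<omega>_words[OF Jq(3) F(2)] Sc bh(3)]
   have 5: "fill G ?S N' ?V (bar h) 0 ((\<omega> ?m (bar ?q) @ ?W) @ word_inv ?W) (\<omega> ?m (bar ?q))" by simp
   have 6: "fill G ?S N' ?V (bar h) (1 + length q * (?c1 + ?c2)) (push ?\<sigma> h q @ word_inv ?W) (\<omega> ?m ?y @ word_inv ?W)"
    by (rule fill_append1[OF IH _ Sc bh(3)]) (use W in simp)
   from fill.trans[OF fill.trans[OF 6 4] 5] show ?thesis unfolding 0 e by (rule fill_weaken) simp
  qed
 }
qed

text \<open>The pushed path depends on its starting vertex only through the coordinate
  \<open>\<tau> k\<close>. From vertices of the next level it is thus the path pushed from
  \<open>\<one>\<close>, which bounds the rungs of the ladder uniformly.\<close>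

lemma push_level_cong:
 "[|w \<in> words S; S <= M0; g \<in> M0; g' \<in> M0; \<tau> k g = \<tau> k g'|] ==>
  push (%g x. \<omega> (\<tau> k g) (bar x)) g w = push (%g x. \<omega> (\<tau> k g) (bar x)) g' w"
proof (induction w arbitrary: g g')
 case (Cons l w)
 obtain x b where l: "l = (x, b)" by (cases l)
 have x: "x \<in> M0" "w \<in> words S" using Cons.prems l by auto
 have m: "g \<otimes> x \<in> M0" "g' \<otimes> x \<in> M0" "g \<otimes> inv x \<in> M0" "g' \<otimes> inv x \<in> M0" using x Cons.prems M0_closed by auto
 have t: "\<tau> k (g \<otimes> x) = \<tau> k (g' \<otimes> x)" "\<tau> k (g \<otimes> inv x) = \<tau> k (g' \<otimes> inv x)"
  using Cons.prems x tau_mult[OF k] M0_closed by auto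
 show ?case
  using Cons.IH[OF x(2) Cons.prems(2) m(1,2) t(1)] Cons.IH[OF x(2) Cons.prems(2) m(3,4) t(2)] t Cons.prems(5)
  by (cases b) (simp_all only: l push.simps)
qed simp

text \<open>Each of the \<open>O(a L)\<close> loops is based at height \<open>O(b L)\<close>, and
  its push has area quadratic in that height. The control of heights by \<open>b\<close> survives,
  so the step can be iterated.\<close>

lemma isop_step:
 assumes iso: "isop (level k) (%_. heights) a b" and ab: "!!L. L <= a L & L <= b L"
 shows "isop (level (Suc k)) (%_. heights) (%L. (b L)\<^sup>2 * a L) b"
proof -
 obtain S where S: "gens (level k) S" and Siso: "isop_wrt S heights a b" using iso by (auto simp: isop_def)
 then obtain N C where "isop_at S heights a b N C" by (auto simp: isop_wrt_def)
 note NC = isop_atD[OF this]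
 have fS: "finite S" and Sk: "S <= level k" using S by (auto simp: gens_def)
 have SM: "S <= M0" and Sc: "S <= carrier G" using Sk level_M0 M0_carrier by auto
 define Q where "Q = {q \<in> words S. length q <= N}"
 have fQ: "finite Q" unfolding Q_def by (rule finite_words_bounded[OF fS])
 have Qk: "ev q \<in> level k" if "q \<in> Q" for q using gens_ev[OF S] that by (simp add: Q_def)
 obtain J where J: "\<forall>q\<in>Q. nat \<bar>\<tau> k (ev q)\<bar> <= J" using finite_bound[OF fQ, of "%q. nat \<bar>\<tau> k (ev q)\<bar>"] by blast
 \<comment> \<open>All elements met while a relator is pushed prefix by prefix: the images of short
   words, and the generators shifted by at most \<open>J\<close>.\<close>
 define F where "F = (%q. bar (ev q)) ` Q \<union> (%(i, x). up i (bar x)) ` ({- int J..int J} \<times> S)"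
 have fF: "finite F" using fQ fS by (simp add: F_def)
 have Fk: "F <= level (Suc k)" using Qk bar_level Sk up_level by (auto simp: F_def)
 have FM: "F <= M0" using Fk level_M0 by blast
 have "bar \<one> = \<one>" using tau_one[OF k] by (simp add: bar_def)
 moreover have "bar (ev []) \<in> F" unfolding F_def Q_def by (intro UnI1 imageI) simp
 ultimately have F1: "\<one> \<in> F" by simp
 obtain c where c: "F \<union> ev ` Q <= heights c"
  using heights_finite[of "F \<union> ev ` Q"] fF fQ FM Qk level_M0 by blast
 have Fbar: "bar (ev q) \<in> F" if "q \<in> words S" "length q <= N" for q using that by (auto simp: F_def Q_def)
 have Fup: "up i (bar x) \<in> F" if "x \<in> S" "\<bar>i\<bar> <= int J" for x i
  using that by (auto simp: F_def intro!: image_eqI[of _ _ "(i, x)"])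
 have Jc: "\<bar>\<tau> k (ev q)\<bar> <= int J & ev q \<in> heights c" if "q \<in> words S" "length q <= N" for q
 proof -
  have "q \<in> Q" using that by (simp add: Q_def)
  then show ?thesis using J c by force
 qed
 define T where "T = letters F"
 have fT: "finite T" using fF by (simp add: T_def letters_def)
 have lr: "level r <= level (Suc k)" using level_mono k by simp
 have Tk: "T <= level (Suc k)"
  unfolding T_def letters_def using FM Fk lr in_level conj_level by (auto simp: subset_iff)
 have sK: "subgroup (level (Suc k)) G" and sk: "subgroup (level k) G" using subgroup_level k by simp_all
 have kk: "level (Suc k) <= level k" by (rule level_mono) simp
 let ?\<sigma> = "%g x. \<omega> (\<tau> k g) (bar x)"
 have bS: "bar x \<in> F" if "x \<in> S" for x
  using Fup[OF that, of 0] up_0[OF bar_M0] that SM by auto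
 have P: "pushes ?\<sigma> bar (level k) S T" unfolding T_def by (rule pushes_bar[OF Sk FM F1 bS])
 have one: "\<one> \<in> level k" "\<one> \<in> level (Suc k)" using sk sK subgroup.one_closed by auto
 have gT: "gens (level (Suc k)) T"
  unfolding gens_def
 proof (intro conjI ballI)
  fix g assume g: "g \<in> level (Suc k)"
  then have "g \<in> level k" using kk by blast
  then obtain w where w: "w \<in> words S" "ev w = g" using S unfolding gens_def by blast
  have "g \<in> carrier G" using g level_M0 M0_carrier by blast
  then have "ev (push ?\<sigma> \<one> w) = g" using push_closed(2)[OF P w(1) one(1)] bar_id[OF g] bar_id[OF one(2)] w(2) by simp
  then show "\<exists>w\<in>words T. ev w = g" using push_closed(1)[OF P w(1) one(1)] by blast
 qed (use fT Tk sK in auto)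
 have Tk': "T <= level k" using Tk kk by blast
 obtain \<iota> c2 where \<iota>: "!!x. x \<in> T ==> \<iota> x \<in> words S & ev (\<iota> x) = x & length (\<iota> x) <= c2"
  using gens_bounded[OF S fT Tk'] by metis
 obtain c3 where c3: "\<forall>x\<in>T. length (push ?\<sigma> \<one> (\<iota> x)) <= c3"
  using finite_bound[OF fT, of "%x. length (push ?\<sigma> \<one> (\<iota> x))"] by blast
 define N' where "N' = c3 + 4"
 have TM: "T <= M0" using Tk level_M0 by blast
 obtain c4 where c4: "\<forall>w\<in>words T. ev w \<in> heights (c4 * length w)" using heights_word_bound[OF fT TM] by blast
 \<comment> \<open>The cost of a pushed relator at \<open>n = C * \<beta>\<close>, as a multiple of
   \<open>\<beta>^2\<close>; the summand 2 pays for passing between \<open>[]\<close> and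
   \<open>\<omega> m \<one>\<close> at the start and at the end.\<close>
 define c5 where "c5 = 2 + N * (6 * (C * C) + 8 * C + 1 + J * C + J * J + J)"
 define C' where "C' = C * c2 + C + 1 + c5 * C + 2 * c + c4"
 have "isop_wrt T heights (%L. (b L)\<^sup>2 * a L) b"
 proof (rule isop_wrtI[where N = N' and C = C'])
  fix L w assume w: "w \<in> words T" "ev w = \<one>" "C' * length w + C' <= L"
  have C1: "1 <= C'" "length w <= C' * length w" by (auto simp: C'_def)
  then have L1: "1 <= L" "length w <= L" using w(3) by linarith+
  define \<beta> where "\<beta> = b L"
  have bL: "L <= \<beta>" "1 <= \<beta>" using ab[of L] L1 by (auto simp: \<beta>_def)
  let ?u = "push (%_. \<iota>) \<one> w"
  have Tc: "T <= carrier G" using TM M0_carrier by auto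
  note u = push_const_closed[OF \<iota> w(1) Sc Tc, of \<one>]
  have "C * length ?u <= C * (c2 * length w)" using u(3) by (rule mult_le_mono2)
  also have "C * (c2 * length w) <= C' * length w" by (simp add: C'_def distrib_right)
  finally have "C * length ?u + C <= L" using w(3) by (simp add: C'_def)
  then have f: "fill G S N (heights (C * \<beta>)) \<one> (C * a L) ?u []" unfolding \<beta>_def using NC u w by auto
  define n where "n = C * \<beta>"
  let ?K = "1 + N * ((6 * (n * n + n) + 2 * n + 1) + J * (n + J + 1)) + 1"
  have K: "?K <= c5 * \<beta>\<^sup>2"
  proof -
   have b1: "1 <= \<beta>\<^sup>2" "\<beta> <= \<beta>\<^sup>2" using bL by (auto simp: power2_eq_square)
   have n2: "n * n = C * C * \<beta>\<^sup>2" by (simp add: n_def power2_eq_square)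
   have nb: "n <= C * \<beta>\<^sup>2" using b1 by (simp add: n_def)
   have "6 * (n * n + n) + 2 * n + 1 <= (6 * (C * C) + 8 * C + 1) * \<beta>\<^sup>2"
    using n2 nb b1 by (simp add: algebra_simps)
   moreover have "J * (n + J + 1) <= J * (C * \<beta>\<^sup>2 + J * \<beta>\<^sup>2 + \<beta>\<^sup>2)"
    using nb b1 by (intro mult_le_mono2 add_mono) auto
   ultimately have "(6 * (n * n + n) + 2 * n + 1) + J * (n + J + 1) <= (6 * (C * C) + 8 * C + 1 + J * C + J * J + J) * \<beta>\<^sup>2"
    by (simp add: algebra_simps)
   then have "N * ((6 * (n * n + n) + 2 * n + 1) + J * (n + J + 1)) <= N * ((6 * (C * C) + 8 * C + 1 + J * C + J * J + J) * \<beta>\<^sup>2)"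
    by (rule mult_le_mono2)
   moreover have "c5 * \<beta>\<^sup>2 = 2 * \<beta>\<^sup>2 + N * ((6 * (C * C) + 8 * C + 1 + J * C + J * J + J) * \<beta>\<^sup>2)"
    unfolding c5_def by (simp only: add_mult_distrib mult.assoc)
   ultimately show ?thesis using b1 by linarith
  qed
  \<comment> \<open>\<open>n + 2 * c\<close> is the height reached by pushed relators,
    \<open>c4 * L\<close> bounds that of the vertices on \<open>w\<close>.\<close>
  define B' where "B' = n + 2 * c + c4 * L"
  have f1: "fill G T N' (heights B') \<one> (length w + ?K * (C * a L)) w []"
  proof (rule fill_transfer[OF P Tk kk sK bar_id _ _ _ w(1) f])
   show "\<iota> x \<in> words S & ev (\<iota> x) = x" if "x \<in> T" for x using \<iota>[OF that] by simp
   show "length (push ?\<sigma> g (\<iota> x)) < N'" if "g \<in> level (Suc k)" "x \<in> T" for g x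
   proof -
    have "g \<in> M0" "\<tau> k g = \<tau> k \<one>" using that(1) tau_one[OF k] by (auto simp: level_def)
    then have "push ?\<sigma> g (\<iota> x) = push ?\<sigma> \<one> (\<iota> x)"
     using push_level_cong[OF _ SM _ M0_closed(1)] \<iota>[OF that(2)] by blast
    then show ?thesis using c3 that(2) by (auto simp: N'_def less_Suc_eq_le)
   qed
   show "fill G T N' (heights B') (bar h) ?K (push ?\<sigma> h q) []"
    if h: "h \<in> heights (C * \<beta>)" "h \<in> level k" and q: "q \<in> words S" "length q <= N" "ev q = \<one>" for h q
   proof -
    have n: "nat \<bar>\<tau> k h\<bar> <= n" 
    proof -
     have "\<bar>\<tau> k h\<bar> <= int n" using h(1) k unfolding heights_def n_def by blast
     then show ?thesis by linarith
    qed
    have N4: "4 <= N'" by (simp add: N'_def)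
    have F3: "F <= heights c" using c by auto
    have R: "fill G (letters F) N' (heights (C * \<beta> + 2 * c)) (bar h) (1 + length q0 * ((6 * (n * n + n) + 2 * n + 1) + J * (n + J + 1)))
      (push ?\<sigma> h q0) (\<omega> (\<tau> k h) (bar (ev q0)))" if "q0 \<in> words S" "length q0 <= N" for q0
     by (rule fill_push_relator[where N = N and J = J, OF Sk FM F1 F3 _ _ _ h(2,1) n N4 that])
      (simp_all add: Fbar Fup Jc)
    have 1: "fill G T N' (heights (C * \<beta> + 2 * c)) (bar h) (1 + length q * ((6 * (n * n + n) + 2 * n + 1) + J * (n + J + 1)))
      (push ?\<sigma> h q) (\<omega> (\<tau> k h) (bar \<one>))"
     using R[OF q(1,2)] q(3) by (simp add: T_def)
    have 2: "fill G T N' (heights (C * \<beta> + 2 * c)) (bar h) 1 [] (\<omega> (\<tau> k h) (bar \<one>))"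
     using R[of "[]"] by (simp add: T_def)
    have 3: "fill G T N' (heights (C * \<beta> + 2 * c)) (bar h) ?K (push ?\<sigma> h q) []"
     by (rule fill_transI[OF 1 fill.sym[OF 2]]) (intro add_mono mult_le_mono1 q(2) order_refl)
    show ?thesis by (rule fill_mono[OF 3]) (auto intro!: heights_mono simp: B'_def n_def)
   qed
   show "ev v \<in> heights B'" if "v \<in> words T" "length v <= length w" for v
   proof -
    have "c4 * length v <= c4 * L" using that(2) L1 by simp
    then have "c4 * length v <= B'" unfolding B'_def by (rule trans_le_add2)
    then show ?thesis using c4 that(1) heights_mono by blast
   qed
  qed
  have f2: "B' <= C' * \<beta>"
  proof -
   have "c4 * L <= c4 * \<beta>" "2 * c * 1 <= 2 * c * \<beta>" by (intro mult_le_mono2 bL)+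
   moreover have "C' * \<beta> = C * \<beta> + 2 * c * \<beta> + c4 * \<beta> + (C * c2 + 1 + c5 * C) * \<beta>"
    by (simp add: C'_def algebra_simps)
   ultimately show ?thesis unfolding B'_def n_def by linarith
  qed
  have f3: "length w + ?K * (C * a L) <= C' * (\<beta>\<^sup>2 * a L)"
  proof -
   have "1 <= \<beta>\<^sup>2" using bL by (simp add: power2_eq_square)
   then have "1 * a L <= \<beta>\<^sup>2 * a L" by (rule mult_le_mono1)
   then have "length w <= \<beta>\<^sup>2 * a L" using L1(2) ab[of L] by linarith
   moreover have "?K * (C * a L) <= (c5 * \<beta>\<^sup>2) * (C * a L)" by (rule mult_le_mono1[OF K])
   moreover have "C' * (\<beta>\<^sup>2 * a L) = (C * c2 + C + 2 * c + c4) * (\<beta>\<^sup>2 * a L) + \<beta>\<^sup>2 * a L + (c5 * \<beta>\<^sup>2) * (C * a L)"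
    by (simp add: C'_def algebra_simps)
   ultimately show ?thesis by linarith
  qed
  show "fill G T N' (heights (C' * b L)) \<one> (C' * ((b L)\<^sup>2 * a L)) w []"
   using fill_mono[OF f1 order_refl order_refl heights_mono[OF f2] f3] unfolding \<beta>_def .
 qed
 then show ?thesis
 proof (rule isopI[OF gT])
  show "L <= (b L)\<^sup>2 * a L & L <= b L" for L
  proof (cases "L = 0")
   case False
   then have "1 <= (b L)\<^sup>2" using ab[of L] by (simp add: power2_eq_square)
   then have "1 * a L <= (b L)\<^sup>2 * a L" by (rule mult_le_mono1)
   then show ?thesis using ab[of L] by linarith
  qed simp
  show "\<exists>c. \<forall>B g y. g \<in> heights B & g \<in> level (Suc k) & y \<in> R --> g \<otimes> y \<in> heights (c * B + c)"
   if R: "finite R" "R <= level (Suc k)" for R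
  proof -
   obtain d where d: "R <= heights d" using heights_finite[OF R(1)] R(2) level_M0 by blast
   have "g \<otimes> y \<in> heights ((d + 1) * B + (d + 1))" if "g \<in> heights B" "y \<in> R" for B g y
   proof -
    have "g \<otimes> y \<in> heights (B + d)" using heights_mult that d by blast
    then show ?thesis by (rule heights_mono[THEN subsetD, rotated]) simp
   qed
   then show ?thesis by blast
  qed
  show "\<exists>c. \<forall>w\<in>words T. ev w \<in> heights (c * length w + c)" if T: "gens (level (Suc k)) T" for T
  proof -
   have "finite T" "T <= M0" using T level_M0 by (auto simp: gens_def)
   then obtain d where d: "\<forall>w\<in>words T. ev w \<in> heights (d * length w)" using heights_word_bound by blast
   have "ev w \<in> heights (d * length w + d)" if "w \<in> words T" for w
    using d that heights_mono[of "d * length w" "d * length w + d"] by auto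
   then show ?thesis by blast
  qed
 qed (rule heights_mono)
qed

end

section \<open>Quadratic distortion of the common kernel\<close>

section \<open>Distortion\<close>

lemma words_map_lettersI: "w \<in> words S ==> (!!x. x \<in> S ==> f x \<in> T) ==> map_letters f w \<in> words T"
 by (rule words_map_letters) auto

context group
begin

lemma commute_ev:
 assumes "!!j. j \<in> J ==> f j \<in> carrier G & f j \<otimes> z = z \<otimes> f j" "z \<in> carrier G" "u \<in> words J"
 shows "ev (map_letters f u) \<in> carrier G & ev (map_letters f u) \<otimes> z = z \<otimes> ev (map_letters f u)"
 using assms(3)
proof (induction u)
 case (Cons l u)
 obtain j b where l: "l = (j, b)" by (cases l)
 have j: "f j \<in> carrier G" "f j \<otimes> z = z \<otimes> f j" using Cons.prems assms(1) l by auto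
 define y where "y = letter_val G (f j, b)"
 have y: "y \<in> carrier G" "y \<otimes> z = z \<otimes> y"
  using j commute_swap_inv[of z "f j" "f j"] assms(2) by (auto simp: y_def letter_val_def)
 have IH: "ev (map_letters f u) \<in> carrier G" "ev (map_letters f u) \<otimes> z = z \<otimes> ev (map_letters f u)"
  using Cons by auto
 have "y \<otimes> ev (map_letters f u) \<otimes> z = (y \<otimes> z) \<otimes> ev (map_letters f u)" using y(1) IH assms(2) by (simp add: m_assoc)
 also have "... = z \<otimes> (y \<otimes> ev (map_letters f u))" using y IH assms(2) by (simp add: m_assoc)
 finally show ?case using y IH by (simp add: l eval_word_Cons y_def)
qed (use assms(2) in simp)

lemma ev_conj:
 assumes "!!j. j \<in> J ==> f j \<in> carrier G" "x \<in> carrier G" "u \<in> words J"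
 shows "ev (map_letters (%j. inv x \<otimes> f j \<otimes> x) u) = inv x \<otimes> ev (map_letters f u) \<otimes> x"
 using assms(3)
proof (induction u)
 case (Cons l u)
 have "fst l \<in> J" "u \<in> words J" using Cons.prems by auto
 moreover have "map_letters f u \<in> words (carrier G)" using assms(1) words_map_letters[of u J f "carrier G"] calculation by auto
 ultimately show ?case using Cons.IH assms by (auto simp: eval_word_Cons letter_val_def group_simps)
qed (use assms in simp)

lemma ev_mult_letters:
 assumes fg: "!!j. j \<in> J ==> f j \<in> carrier G & g j \<in> carrier G"
  "!!i j. i \<in> J ==> j \<in> J ==> f i \<otimes> g j = g j \<otimes> f i" and u: "u \<in> words J"
 shows "ev (map_letters (%j. f j \<otimes> g j) u) = ev (map_letters f u) \<otimes> ev (map_letters g u)"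
 using u
proof (induction u)
 case (Cons l u)
 obtain j b where l: "l = (j, b)" by (cases l)
 have j: "j \<in> J" "u \<in> words J" using Cons.prems l by auto
 define F H where "F = ev (map_letters f u)" and "H = ev (map_letters g u)"
 have F: "F \<in> carrier G" "F \<otimes> g j = g j \<otimes> F" using commute_ev[of J f "g j" u] fg j by (auto simp: F_def)
 have H: "H \<in> carrier G" unfolding H_def by (intro ev_closed words_map_lettersI[OF j(2)]) (use fg in auto)
 have c: "f j \<in> carrier G" "g j \<in> carrier G" using fg j by auto
 have Fi: "F \<otimes> inv (g j) = inv (g j) \<otimes> F" using commute_swap_inv[of F "g j" "g j"] F c by simp
 have IH: "ev (map_letters (%j. f j \<otimes> g j) u) = F \<otimes> H" using Cons j by (simp add: F_def H_def)
 show ?case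
 proof (cases b)
  case True
  have "g j \<otimes> (F \<otimes> H) = F \<otimes> (g j \<otimes> H)"
   using F(2) m_assoc[OF F(1) c(2) H] m_assoc[OF c(2) F(1) H] by simp
  then show ?thesis using F(1) c H IH True by (simp add: l eval_word_Cons letter_val_def m_assoc F_def[symmetric] H_def[symmetric])
 next
  case False
  have "inv (f j \<otimes> g j) = inv (f j) \<otimes> inv (g j)" using inv_mult_group[of "g j" "f j"] fg(2)[OF j(1) j(1)] c by simp
  moreover have "inv (g j) \<otimes> (F \<otimes> H) = F \<otimes> (inv (g j) \<otimes> H)"
   using Fi m_assoc[OF F(1) inv_closed[OF c(2)] H] m_assoc[OF inv_closed[OF c(2)] F(1) H] by simp
  ultimately show ?thesis using F(1) c H IH False by (simp add: l eval_word_Cons letter_val_def m_assoc F_def[symmetric] H_def[symmetric])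
 qed
qed simp

end

locale coab_pair = coab +
 fixes i1 i2 :: nat
 assumes i12: "i1 \<in> I" "i2 \<in> I" "i1 ~= i2"
begin

definition U :: "nat gword => 'a" where "U u = ev (map_letters (t i1) u)"

definition AA :: "'a => nat => 'a" where "AA x j = inv x \<otimes> t i1 j \<otimes> x \<otimes> inv (t i2 j)"

text \<open>The commutator \<open>inv x \<otimes> U u \<otimes> x \<otimes> inv (U u)\<close>,
  spelled by \<open>2 * length u\<close> letters of \<open>level r\<close>.\<close>

definition swap_word :: "'a => nat gword => 'a gword" where
 "swap_word x u = map_letters (AA x) u @ word_inv (map_letters (AA \<one>) u)"

lemma t12: "j < r ==> t i1 j \<in> M0" "j < r ==> t i2 j \<in> M0" "j < r ==> t i1 j \<in> carrier G" "j < r ==> t i2 j \<in> carrier G"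
 using t_M0 i12 M0_carrier by auto

lemma U_words: "u \<in> words {..<r} ==> map_letters (t i1) u \<in> words M0"
 using words_map_letters[of u "{..<r}" "t i1" M0] t12 by auto

lemma U_M0: "u \<in> words {..<r} ==> U u \<in> M0"
 unfolding U_def by (rule ev_in_subgroup[OF M0 U_words])

lemma U_append: "u \<in> words {..<r} ==> v \<in> words {..<r} ==> U (u @ v) = U u \<otimes> U v"
 using U_words words_carrier[OF subgroup.subset[OF M0]] by (simp add: U_def)

lemma AA_level: "x \<in> M0 ==> j < r ==> AA x j \<in> level r"
 using t12 i12 by (auto simp: level_def AA_def tau_mult tau_inv tau_t M0_closed)

lemma AA_carrier: "x \<in> M0 ==> j < r ==> AA x j \<in> carrier G"
 using AA_level level_M0 M0_carrier by blast

text \<open>The corrections from the factor \<open>i2\<close> commute with all conjugates of the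
  \<open>t i1 j\<close>, so both halves of the word split off the same factor \<open>W\<close>,
  which cancels.\<close>

lemma ev_swap_word:
 assumes x: "x \<in> M0" and u: "u \<in> words {..<r}"
 shows "ev (swap_word x u) = inv x \<otimes> U u \<otimes> x \<otimes> inv (U u)"
proof -
 define W where "W = ev (map_letters (%j. inv (t i2 j)) u)"
 have W: "W \<in> carrier G"
  unfolding W_def by (intro ev_closed words_map_lettersI[OF u]) (use t12 in auto)
 have e: "ev (map_letters (AA y) u) = (inv y \<otimes> U u \<otimes> y) \<otimes> W" if y: "y \<in> M0" for y
 proof -
  have yc: "y \<in> carrier G" using y M0_carrier by auto
  have "ev (map_letters (%j. (inv y \<otimes> t i1 j \<otimes> y) \<otimes> inv (t i2 j)) u) =
   ev (map_letters (%j. inv y \<otimes> t i1 j \<otimes> y) u) \<otimes> W"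
   unfolding W_def
  proof (rule ev_mult_letters[OF _ _ u])
   fix i j assume ij: "i \<in> {..<r}" "j \<in> {..<r}"
   have "(inv y \<otimes> t i1 i \<otimes> y) \<otimes> t i2 j = t i2 j \<otimes> (inv y \<otimes> t i1 i \<otimes> y)"
    using t_comm[OF i12 _ _ y M0_closed(1), of i j] ij t12 by simp
   then show "(inv y \<otimes> t i1 i \<otimes> y) \<otimes> inv (t i2 j) = inv (t i2 j) \<otimes> (inv y \<otimes> t i1 i \<otimes> y)"
    using commute_swap_inv ij t12 yc by simp
  qed (use t12 yc in auto)
  also have "ev (map_letters (%j. inv y \<otimes> t i1 j \<otimes> y) u) = inv y \<otimes> U u \<otimes> y"
   unfolding U_def by (rule ev_conj[OF _ yc u]) (use t12 in auto)
  finally show ?thesis by (simp add: AA_def[abs_def])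
 qed
 have cw: "map_letters (AA y) u \<in> words (carrier G)" if "y \<in> M0" for y
  using words_map_letters[OF u, of "AA y" "carrier G"] AA_carrier[OF that] by auto
 have Uc: "U u \<in> carrier G" using U_M0[OF u] M0_carrier by auto
 have xc: "x \<in> carrier G" using x M0_carrier by auto
 have "ev (swap_word x u) = (inv x \<otimes> U u \<otimes> x \<otimes> W) \<otimes> inv (U u \<otimes> W)"
  using cw[OF x] cw[OF M0_closed(1)] e[OF x] e[OF M0_closed(1)] Uc by (simp add: swap_word_def)
 then show ?thesis using Uc xc W by (simp add: group_simps)
qed

text \<open>Used in contrapositive form: when a word of exponent sum zero begins with a letter, the
  inverse of that letter occurs in the rest.\<close>

lemma tau_U_mono:
 assumes "u \<in> words {..<r}" "j < r"
 shows "(j, False) \<notin> set u ==> 0 <= \<tau> j (U u)" "(j, True) \<notin> set u ==> \<tau> j (U u) <= 0"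
proof -
 have "((j, False) \<notin> set u --> 0 <= \<tau> j (U u)) & ((j, True) \<notin> set u --> \<tau> j (U u) <= 0)"
  using assms(1)
 proof (induction u)
  case (Cons l u)
  obtain i b where l: "l = (i, b)" by (cases l)
  have i: "i < r" "u \<in> words {..<r}" using Cons.prems l by auto
  have "U (l # u) = letter_val G (t i1 i, b) \<otimes> U u" by (simp add: U_def l eval_word_Cons)
  moreover have "letter_val G (t i1 i, b) \<in> M0" using t12 i by (auto simp: letter_val_def M0_closed)
  ultimately have "\<tau> j (U (l # u)) = (if i = j then (if b then 1 else -1) else 0) + \<tau> j (U u)"
   using tau_mult[OF assms(2) _ U_M0[OF i(2)]] tau_t[OF i12(1) i(1) assms(2)] t12 i assms(2)
   by (auto simp: letter_val_def tau_inv)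
  then show ?case using Cons.IH[OF i(2)] by (cases b) (auto simp: l)
 qed (simp add: U_def tau_one assms(2))
 then show "(j, False) \<notin> set u ==> 0 <= \<tau> j (U u)" "(j, True) \<notin> set u ==> \<tau> j (U u) <= 0" by auto
qed

definition swap_letters :: "'a set => 'a set" where
 "swap_letters X = X \<union> (%(x, j). AA x j) ` ((X \<union> {\<one>} \<union> t i1 ` {..<r} \<union> (%j. inv (t i1 j)) ` {..<r}) \<times> {..<r})"

lemma swap_letters_carrier: "X <= M0 ==> swap_letters X <= carrier G"
 using AA_carrier M0_carrier t12 M0_closed by (auto simp: swap_letters_def subset_iff)

lemma swap_word_words:
 assumes "x \<in> X \<union> {\<one>} \<union> t i1 ` {..<r} \<union> (%j. inv (t i1 j)) ` {..<r}" "u \<in> words {..<r}"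
 shows "swap_word x u \<in> words (swap_letters X)"
proof -
 have "AA y j \<in> swap_letters X" if "y \<in> {x, \<one>}" "j < r" for y j
  unfolding swap_letters_def using assms(1) that by (intro UnI2 image_eqI[of _ _ "(y, j)"]) auto
 then show ?thesis using words_map_letters[OF assms(2), of "AA x" "swap_letters X"]
   words_map_letters[OF assms(2), of "AA \<one>" "swap_letters X"]
  by (auto simp: swap_word_def)
qed

text \<open>Cancelling the first letter \<open>y\<close> against a later \<open>y\<^sup>-\<^sup>1\<close> costs a commutator \<open>[y, v]\<close> of linear length.\<close>

lemma zero_sum_word:
 assumes X: "X <= M0"
 shows "u \<in> words {..<r} ==> \<forall>j<r. \<tau> j (U u) = 0 ==>
  \<exists>s\<in>words (swap_letters X). ev s = U u & length s <= 2 * (length u * length u)"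
proof (induction "length u" arbitrary: u rule: less_induct)
 case less
 show ?case
 proof (cases u)
  case Nil
  then show ?thesis by (intro bexI[of _ "[]"]) (auto simp: U_def)
 next
  case (Cons l u')
  obtain j b where l: "l = (j, b)" by (cases l)
  have j: "j < r" and u': "u' \<in> words {..<r}" using less.prems Cons l by auto
  define y where "y = letter_val G (t i1 j, b)"
  have y: "y \<in> M0" "y \<in> carrier G" using t12 j by (auto simp: y_def letter_val_def M0_closed)
  have Uu: "U u = y \<otimes> U u'" by (simp add: U_def Cons l eval_word_Cons y_def)
  have "\<tau> j y = (if b then 1 else -1)"
   using t12 j tau_t[OF i12(1) j j] by (auto simp: y_def letter_val_def tau_inv)
  then have "\<tau> j (U u') = (if b then -1 else 1)"
   using less.prems(2) j tau_mult[OF j y(1) U_M0[OF u']] by (auto simp: Uu)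
  then have "(j, \<not> b) \<in> set u'" using tau_U_mono[OF u' j] by (cases b) force+
  then obtain v post where vp: "u' = v @ (j, \<not> b) # post" by (meson split_list)
  have w: "v \<in> words {..<r}" "post \<in> words {..<r}" "v @ post \<in> words {..<r}" using u' vp by auto
  have M: "U v \<in> M0" "U post \<in> M0" using U_M0 w by auto
  have c: "U v \<in> carrier G" "U post \<in> carrier G" using M M0_carrier by auto
  have "U ([(j, \<not> b)] @ post) = inv y \<otimes> U post"
   using t12 j by (cases b) (auto simp: U_def eval_word_Cons letter_val_def y_def)
  then have "U u' = U v \<otimes> (inv y \<otimes> U post)" using U_append[of v "[(j, \<not> b)] @ post"] w j by (simp add: vp)
  \<comment> \<open>\<open>y v y^(-1) post\<close> is the commutator of \<open>y\<close> and
    \<open>v\<close> times \<open>v post\<close>, a word shorter by two with the same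
    coordinates.\<close>
  then have e: "U u = (y \<otimes> U v \<otimes> inv y \<otimes> inv (U v)) \<otimes> U (v @ post)"
   using c y by (simp add: Uu U_append[OF w(1,2)] group_simps)
  have "\<tau> i (U (v @ post)) = 0" if "i < r" for i
   using less.prems(2) that M y by (simp add: e U_append[OF w(1,2)] tau_mult tau_inv M0_closed)
  moreover have lt: "length (v @ post) < length u" by (simp add: Cons vp)
  ultimately obtain s where s: "s \<in> words (swap_letters X)" "ev s = U (v @ post)"
   "length s <= 2 * (length (v @ post) * length (v @ post))"
   using less.hyps w(3) by blast
  have iy: "inv y \<in> X \<union> {\<one>} \<union> t i1 ` {..<r} \<union> (%j. inv (t i1 j)) ` {..<r}"
   using j t12 by (cases b) (auto simp: y_def letter_val_def)
  have sw: "swap_word (inv y) v \<in> words (swap_letters X)" by (rule swap_word_words[OF iy w(1)])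
  have esw: "ev (swap_word (inv y) v) = y \<otimes> U v \<otimes> inv y \<otimes> inv (U v)"
   using ev_swap_word[OF _ w(1), of "inv y"] y M0_closed by simp
  have "swap_letters X <= carrier G" by (rule swap_letters_carrier[OF X])
  then have "ev (swap_word (inv y) v @ s) = U u" using words_carrier sw s(1) esw s(2) e by simp
  moreover have "length (swap_word (inv y) v @ s) <= 2 * (length u * length u)"
  proof -
   have "length u = length (v @ post) + 2" by (simp add: Cons vp)
   moreover have "length (swap_word (inv y) v) <= 2 * length (v @ post)" by (simp add: swap_word_def)
   ultimately show ?thesis using s(3) by (simp add: algebra_simps)
  qed
  ultimately show ?thesis using sw s(1) by (intro bexI[of _ "swap_word (inv y) v @ s"]) auto
 qed
qed

lemma tau_word_exists:
 assumes "y \<in> M0"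
 shows "\<exists>u\<in>words {..<r}. \<forall>j<r. \<tau> j (U u) = \<tau> j y"
proof -
 have "\<exists>u\<in>words {..<r}. \<forall>j<r. \<tau> j (U u) = (if j < n then \<tau> j y else 0)" if "n <= r" for n
  using that
 proof (induction n)
  case 0
  then show ?case by (intro bexI[of _ "[]"]) (auto simp: U_def tau_one)
 next
  case (Suc n)
  then obtain u where u: "u \<in> words {..<r}" "\<forall>j<r. \<tau> j (U u) = (if j < n then \<tau> j y else 0)" by auto
  define b m where "b = (0 <= \<tau> n y)" and "m = nat \<bar>\<tau> n y\<bar>"
  have n: "n < r" using Suc by simp
  have rep: "replicate k (n, b) \<in> words {..<r} & (\<forall>j<r. \<tau> j (U (replicate k (n, b))) = (if j = n then (if b then int k else - int k) else 0))" for k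
  proof (induction k)
   case (Suc k)
   have w: "replicate k (n, b) \<in> words {..<r}" "[(n, b)] \<in> words {..<r}" using Suc n by auto
   have "U (replicate (Suc k) (n, b)) = U [(n, b)] \<otimes> U (replicate k (n, b))"
    using U_append[OF w(2,1)] by simp
   moreover have "\<tau> j (U [(n, b)]) = (if j = n then (if b then 1 else -1) else 0)" if "j < r" for j
    using tau_t[OF i12(1) n that] t12 n that by (auto simp: U_def tau_inv)
   ultimately show ?case using Suc U_M0[OF w(1)] U_M0[OF w(2)] w by (auto simp: tau_mult)
  qed (auto simp: U_def tau_one)
  have w: "replicate m (n, b) \<in> words {..<r}" using rep by blast
  have "\<tau> j (U (u @ replicate m (n, b))) = (if j < Suc n then \<tau> j y else 0)" if "j < r" for j
  proof -
   have "\<tau> j (U (u @ replicate m (n, b))) = (if j < n then \<tau> j y else 0) + (if j = n then (if b then int m else - int m) else 0)"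
    using conjunct2[OF rep[of m]] u that U_M0[OF u(1)] U_M0[OF w] by (simp add: U_append[OF u(1) w] tau_mult)
   moreover have "(if b then int m else - int m) = \<tau> n y" by (simp add: b_def m_def)
   ultimately show ?thesis by auto
  qed
  then show ?case using u(1) w by (intro bexI[of _ "u @ replicate m (n, b)"]) auto
 qed
 from this[of r] show ?thesis by auto
qed

text \<open>Every generator is a kernel element times a word in the \<open>t i1 j\<close>. These
  words are collected on the right; passing a kernel letter costs a commutator of length linear in
  what has been collected, so the total is quadratic. When the value of \<open>w\<close> lies in the
  kernel, the collected word has all exponent sums zero.\<close>

lemma level_word_length:
 assumes S: "finite S" "S <= M0"
 shows "\<exists>T C. finite T & T <= level r & (\<forall>w\<in>words S. ev w \<in> level r -->
  (\<exists>s\<in>words T. ev s = ev w & length s <= C * (length w * length w)))"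
proof -
 have sr: "subgroup (level r) G" by (rule subgroup_level) simp
 define Y where "Y = letter_val G ` (S \<times> UNIV)"
 have Y: "finite Y" "Y <= M0" using S by (auto simp: Y_def letter_val_def M0_closed)
 have "\<forall>y\<in>Y. \<exists>u. u \<in> words {..<r} & (\<forall>j<r. \<tau> j (U u) = \<tau> j y)" using tau_word_exists Y by blast
 then obtain tw where tw: "\<forall>y\<in>Y. tw y \<in> words {..<r} & (\<forall>j<r. \<tau> j (U (tw y)) = \<tau> j y)" by metis
 obtain c where c: "\<forall>y\<in>Y. length (tw y) <= c" using finite_bound[OF Y(1), of "%y. length (tw y)"] by blast
 define nb where "nb y = y \<otimes> inv (U (tw y))" for y
 define X where "X = nb ` Y"
 define T where "T = swap_letters X"
 have X: "finite X" "X <= level r"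
  using Y tw U_M0 by (auto simp: X_def nb_def level_def M0_closed tau_mult tau_inv subset_iff)
 have XM: "X <= M0" using X level_M0 by blast
 have T: "finite T" "T <= level r"
  using X XM AA_level t12 M0_closed by (auto simp: T_def swap_letters_def)
 have Tc: "T <= carrier G" using T(2) level_M0 M0_carrier by blast
 \<comment> \<open>\<open>u0\<close> is the word collected before \<open>w\<close> is read,
   \<open>u\<close> the one carried out on the right; only the latter's growth by \<open>c\<close>
   per letter enters the length of \<open>s\<close>.\<close>
 have main: "\<exists>s u. s \<in> words T & u \<in> words {..<r} & U u0 \<otimes> ev w = ev s \<otimes> U u &
   length u <= length u0 + c * length w & length s <= length w * (1 + 2 * (length u0 + c * length w))"
  if "w \<in> words S" "u0 \<in> words {..<r}" for w u0
  using that
 proof (induction w arbitrary: u0)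
  case Nil
  then show ?case using U_M0[OF Nil(2)] M0_carrier by (intro exI[of _ "[]"] exI[of _ u0]) auto
 next
  case (Cons l w)
  have wS: "w \<in> words S" and wc: "ev w \<in> carrier G" and lY: "letter_val G l \<in> Y"
   using Cons.prems ev_in_subgroup[OF M0 words_mono[OF S(2)]] M0_carrier by (auto simp: Y_def mem_Times_iff)
  define y where "y = letter_val G l"
  have y: "y \<in> Y" "y \<in> M0" "y \<in> carrier G" using lY Y(2) M0_carrier unfolding y_def by blast+
  define x where "x = nb y"
  have x: "x \<in> X" "x \<in> M0" "x \<in> carrier G" "x \<in> T" using y XM M0_carrier by (auto simp: x_def X_def T_def swap_letters_def)
  have t: "tw y \<in> words {..<r}" "length (tw y) <= c" using tw y c by auto
  let ?u = "u0 @ tw y"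
  have u: "?u \<in> words {..<r}" using Cons.prems t by auto
  obtain s u where IH: "s \<in> words T" "u \<in> words {..<r}" "U ?u \<otimes> ev w = ev s \<otimes> U u"
   "length u <= length ?u + c * length w" "length s <= length w * (1 + 2 * (length ?u + c * length w))"
   using Cons.IH[OF wS u] by blast
  let ?s = "[(x, True)] @ swap_word x u0 @ s"
  have sw: "swap_word x u0 \<in> words T" unfolding T_def by (rule swap_word_words) (use x Cons.prems in auto)
  have cs: "swap_word x u0 \<in> words (carrier G)" "s \<in> words (carrier G)" using sw IH words_carrier[OF Tc] by auto
  have Uc: "U u0 \<in> carrier G" "U (tw y) \<in> carrier G" "U u \<in> carrier G" using U_M0 Cons.prems t IH M0_carrier by auto
  have yx: "y = x \<otimes> U (tw y)" using y Uc by (simp add: x_def nb_def m_assoc)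
  have "ev ?s \<otimes> U u = x \<otimes> (ev (swap_word x u0) \<otimes> (ev s \<otimes> U u))"
   using cs x Uc by (simp add: eval_word_Cons letter_val_def m_assoc)
  also have "... = x \<otimes> (inv x \<otimes> U u0 \<otimes> x \<otimes> inv (U u0) \<otimes> (U u0 \<otimes> U (tw y) \<otimes> ev w))"
   using ev_swap_word[OF x(2) Cons.prems(2)] IH(3) U_append[OF Cons.prems(2) t(1)] by simp
  also have "... = U u0 \<otimes> (x \<otimes> U (tw y)) \<otimes> ev w" using x Uc wc by (simp add: group_simps)
  finally have e: "U u0 \<otimes> ev (l # w) = ev ?s \<otimes> U u"
   using yx y wc Uc by (simp add: eval_word_Cons y_def[symmetric] m_assoc)
  have "length u <= length u0 + c * length (l # w)" using IH(4) t(2) by simp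
  moreover have "length ?s <= length (l # w) * (1 + 2 * (length u0 + c * length (l # w)))"
  proof -
   have "length s <= length w * (1 + 2 * (length u0 + c * length (l # w)))"
    using IH(5) t(2) by (elim order_trans) (intro mult_le_mono2, simp)
   moreover have "length (swap_word x u0) = 2 * length u0" by (simp add: swap_word_def)
   ultimately show ?thesis by (simp add: algebra_simps)
  qed
  ultimately show ?case using e IH sw x by (intro exI[of _ ?s] exI[of _ u]) auto
 qed
 define C where "C = 1 + 2 * c + 2 * (c * c)"
 have "\<exists>s\<in>words T. ev s = ev w & length s <= C * (length w * length w)" if w: "w \<in> words S" "ev w \<in> level r" for w
 proof -
  obtain s u where su: "s \<in> words T" "u \<in> words {..<r}" "U [] \<otimes> ev w = ev s \<otimes> U u"
   "length u <= c * length w" "length s <= length w * (1 + 2 * (c * length w))"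
   using main[OF w(1), of "[]"] by auto
  have wc: "ev w \<in> carrier G" using w(2) level_M0 M0_carrier by blast
  have es: "ev s \<in> level r" by (rule ev_in_subgroup[OF sr words_mono[OF T(2) su(1)]])
  have e: "ev w = ev s \<otimes> U u" using su(3) wc by (simp add: U_def)
  have "\<tau> j (U u) = 0" if "j < r" for j
   using w(2) es that U_M0[OF su(2)] by (auto simp: e level_def tau_mult)
  then obtain s' where s': "s' \<in> words T" "ev s' = U u" "length s' <= 2 * (length u * length u)"
   using zero_sum_word[OF XM su(2)] unfolding T_def by blast
  have "ev (s @ s') = ev w" using e s' words_carrier[OF Tc] su by simp
  moreover have "length (s @ s') <= C * (length w * length w)"
  proof -
   define q where "q = length w * length w"
   have "length u * length u <= (c * length w) * (c * length w)" using su(4) by (intro mult_le_mono)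
   moreover have "(c * length w) * (c * length w) = c * c * q" by (simp add: q_def)
   moreover have "length w <= q" by (cases w) (auto simp: q_def)
   moreover have "length s <= length w + 2 * c * q" using su(5) by (simp add: q_def algebra_simps)
   moreover have "C * q = q + 2 * c * q + 2 * (c * c * q)" by (simp add: C_def algebra_simps)
   ultimately have "length (s @ s') <= C * q" using s'(3) unfolding length_append by linarith
   then show ?thesis by (simp add: q_def)
  qed
  ultimately show ?thesis using su s' by (intro bexI[of _ "s @ s'"]) auto
 qed
 then show ?thesis using T by blast
qed

lemma gens_level: "gens M0 S ==> \<exists>T. gens (level r) T"
proof -
 assume S: "gens M0 S"
 then obtain T C where T: "finite T" "T <= level r" "\<forall>w\<in>words S. ev w \<in> level r -->
  (\<exists>s\<in>words T. ev s = ev w & length s <= C * (length w * length w))"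
  using level_word_length[of S] unfolding gens_def by blast
 have "\<exists>w\<in>words T. ev w = g" if "g \<in> level r" for g
 proof -
  have "g \<in> M0" using that level_M0 by auto
  then obtain w where "w \<in> words S" "ev w = g" using S unfolding gens_def by blast
  then show ?thesis using T(3) that by blast
 qed
 then show ?thesis using T subgroup_level[of r] by (auto simp: gens_def)
qed

text \<open>A word of bounded length closes \<open>w\<close> up to an element of
  \<open>level r\<close>. The result is pushed to generators of \<open>M0\<close>, rewritten with
  quadratic length, and translated to \<open>T\<close>.\<close>

lemma quadratic_distortion:
 assumes H: "fin_idx (level r) H" and M: "fin_idx M0 (carrier G)" and S: "gens (carrier G) S" and T: "gens H T"
 shows "\<exists>C. \<forall>w\<in>words S. ev w \<in> H --> (\<exists>s\<in>words T. ev s = ev w & length s <= C * (length w + 1)\<^sup>2)"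
proof -
 have fS: "finite S" "S <= carrier G" using S by (auto simp: gens_def)
 obtain SM where SM: "gens M0 SM" using gens_fin_idx[OF M S] by blast
 then have fSM: "finite SM" "SM <= M0" by (auto simp: gens_def)
 obtain T0 C0 where T0: "finite T0" "T0 <= level r" "\<forall>w\<in>words SM. ev w \<in> level r -->
  (\<exists>s\<in>words T0. ev s = ev w & length s <= C0 * (length w * length w))"
  using level_word_length[OF fSM] by blast
 have HsG: "subgroup H G" and lH: "level r <= H" using H by (auto simp: fin_idx_def)
 have Hc: "H <= carrier G" using HsG subgroup.subset by blast
 obtain c where c: "finite (c ` H)" "!!g. g \<in> H ==> c g \<in> H & g \<otimes> inv (c g) \<in> level r"
  "!!k. k \<in> level r ==> c k = \<one>" "!!k g. k \<in> level r ==> g \<in> H ==> c (k \<otimes> g) = c g"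
  using fin_idx_reps[OF H] by metis
 obtain \<sigma> p c1 R where P: "pushes \<sigma> p (carrier G) S SM" and p: "\<forall>k\<in>M0. p k = k"
  and c1: "\<forall>g\<in>carrier G. \<forall>x\<in>S. length (\<sigma> g x) <= c1"
  using fin_idx_push[OF M fS SM] by blast
 have cH: "c ` H <= H" using c(2) by auto
 then have cG: "c ` H <= carrier G" using Hc by auto
 obtain \<phi> b where \<phi>: "!!f. f \<in> c ` H ==> \<phi> f \<in> words S & ev (\<phi> f) = f & length (\<phi> f) <= b"
  using gens_bounded[OF S c(1) cG] by metis
 obtain \<psi> b' where \<psi>: "!!f. f \<in> c ` H ==> \<psi> f \<in> words T & ev (\<psi> f) = f & length (\<psi> f) <= b'"
  using gens_bounded[OF T c(1) cH] by metis
 have T0H: "T0 <= H" using T0(2) lH by auto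
 obtain \<iota> b'' where \<iota>: "!!f. f \<in> T0 ==> \<iota> f \<in> words T & ev (\<iota> f) = f & length (\<iota> f) <= b''"
  using gens_bounded[OF T T0(1) T0H] by metis
 define C where "C = b'' * (C0 * ((c1 * (1 + b)) * (c1 * (1 + b)))) + b'"
 have "\<exists>s\<in>words T. ev s = ev w & length s <= C * (length w + 1)\<^sup>2" if w: "w \<in> words S" "ev w \<in> H" for w
 proof -
  let ?c = "c (ev w)"
  have cc: "?c \<in> c ` H" "?c \<in> carrier G" "ev w \<in> carrier G" using w c(2) Hc by auto
  let ?w = "w @ word_inv (\<phi> ?c)"
  have w': "?w \<in> words S" "?w \<in> words (carrier G)" using w \<phi>[OF cc(1)] gens_words[OF S] by auto
  have ew: "ev ?w = ev w \<otimes> inv ?c" using w'(2) \<phi>[OF cc(1)] by simp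
  have wl: "ev ?w \<in> level r" unfolding ew using c(2)[OF w(2)] by simp
  have wM: "ev ?w \<in> M0" using wl level_M0 by auto
  let ?v = "push \<sigma> \<one> ?w"
  have v: "?v \<in> words SM" "ev ?v = ev ?w"
   using push_closed[OF P w'(1) one_closed] p wM M0_closed(1) w'(2) by auto
  have "length ?v <= c1 * length ?w"
   by (rule push_length[OF _ _ fS(2) w'(1) one_closed]) (use c1 subgroup_self in auto)
  also have "... <= c1 * (length w + b)" using \<phi>[OF cc(1)] by (intro mult_le_mono2) simp
  also have "... <= c1 * (1 + b) * (length w + 1)" by (simp add: algebra_simps)
  finally have lv: "length ?v <= c1 * (1 + b) * (length w + 1)" .
  obtain s where s: "s \<in> words T0" "ev s = ev ?w" "length s <= C0 * (length ?v * length ?v)"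
   using T0(3) v wl by metis
  have T0c: "T0 <= carrier G" "T <= carrier G" using T0H Hc gens_carrier[OF T] by auto
  note i = push_const_closed[OF \<iota> s(1) T0c(2,1), of \<one>]
  let ?s = "push (%_. \<iota>) \<one> s @ \<psi> ?c"
  have sw: "?s \<in> words T" using i \<psi>[OF cc(1)] by auto
  have "ev ?s = ev ?w \<otimes> ?c" using i s(2) \<psi>[OF cc(1)] gens_words[OF T] by simp
  also have "... = ev w" unfolding ew using cc by (simp add: m_assoc)
  finally have es: "ev ?s = ev w" .
  define D where "D = c1 * (1 + b)"
  define q where "q = length w + 1"
  have "length ?v * length ?v <= (D * q) * (D * q)" using lv unfolding D_def q_def by (intro mult_le_mono)
  then have "C0 * (length ?v * length ?v) <= C0 * ((D * q) * (D * q))" by (rule mult_le_mono2)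
  then have "length s <= C0 * ((D * q) * (D * q))" using s(3) by linarith
  then have "b'' * length s <= b'' * (C0 * ((D * q) * (D * q)))" by (rule mult_le_mono2)
  moreover have "b'' * (C0 * ((D * q) * (D * q))) = b'' * (C0 * (D * D)) * q\<^sup>2"
   by (simp only: power2_eq_square ac_simps)
  moreover have "b' * 1 <= b' * q\<^sup>2" by (intro mult_le_mono2) (simp add: power2_eq_square q_def)
  moreover have "C * q\<^sup>2 = b'' * (C0 * (D * D)) * q\<^sup>2 + b' * q\<^sup>2"
   by (simp only: C_def D_def add_mult_distrib)
  moreover have "length (push (%_. \<iota>) \<one> s) <= b'' * length s" "length (\<psi> ?c) <= b'" using i(3) \<psi>[OF cc(1)] by auto
  ultimately have "length ?s <= C * (length w + 1)\<^sup>2" unfolding q_def[symmetric] length_append by linarith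
  then show ?thesis using sw es by (intro bexI[of _ ?s]) auto
 qed
 then show ?thesis by blast
qed

end

section \<open>Rational rank in terms of independent elements\<close>

section \<open>Rational rank of an abelian group\<close>

text \<open>Torsion is detected by homomorphisms \<open>h N\<close> from the free abelian group to
  \<open>A\<close> that send \<open>(b, q)\<close> to the power of \<open>b\<close> whose exponent
  is the floor of \<open>q * N\<close>. A tensor relation involves finitely many denominators, so
  \<open>h M\<close> kills it for all multiples \<open>M\<close> of a suitable \<open>N\<close>, the
  floors then being exact; on \<open>(a, 1)\<close> the value is \<open>a^N\<close>.\<close>

lemma tensor_relation_torsion:
 assumes A: "comm_group A" and c: "frag_of (a, 1 :: rat) \<in> tensor_relations A" and a: "a \<in> carrier A"
 shows "\<exists>n > 0. a [^]\<^bsub>A\<^esub> (n :: nat) = \<one>\<^bsub>A\<^esub>"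
proof -
 interpret A: comm_group A by fact
 let ?S = "carrier A \<times> (UNIV :: rat set)"
 let ?F = "free_Abelian_group ?S"
 have "\<exists>h. h \<in> hom ?F A & (\<forall>x\<in>?S. h (frag_of x) = fst x [^]\<^bsub>A\<^esub> \<lfloor>snd x * of_nat N\<rfloor>)" for N :: nat
 proof -
  have "(%x. fst x [^]\<^bsub>A\<^esub> \<lfloor>snd x * of_nat N\<rfloor>) ` ?S <= carrier A" by auto
  then obtain h where "h \<in> hom ?F A" "!!x. x \<in> ?S ==> h (frag_of x) = fst x [^]\<^bsub>A\<^esub> \<lfloor>snd x * of_nat N\<rfloor>"
   using A.free_Abelian_group_universal[where f = "%x. fst x [^]\<^bsub>A\<^esub> \<lfloor>snd x * of_nat N\<rfloor>" and S = ?S] by blast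
  then show ?thesis by blast
 qed
 then obtain h where h: "!!N. h N \<in> hom ?F A" "!!N b q. b \<in> carrier A ==> h N (frag_of (b, q)) = b [^]\<^bsub>A\<^esub> \<lfloor>q * of_nat N\<rfloor>"
  by (metis (no_types, lifting) SigmaI UNIV_I fst_conv snd_conv)
 have gF: "group ?F" by simp
 have gh: "group_hom ?F A (h N)" for N
  by (intro group_hom.intro group_hom_axioms.intro) (use h in auto)
 have hadd: "h N (x + y) = h N x \<otimes>\<^bsub>A\<^esub> h N y" if "x \<in> carrier ?F" "y \<in> carrier ?F" for N x y
  using group_hom.hom_mult[OF gh that] by simp
 have hneg: "h N (- x) = inv\<^bsub>A\<^esub> (h N x)" if "x \<in> carrier ?F" for N x
 proof -
  have "inv\<^bsub>?F\<^esub> x = - x" using that by simp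
  then show ?thesis using group_hom.hom_inv[OF gh that] by simp
 qed
 have hc: "h N x \<in> carrier A" if "x \<in> carrier ?F" for N x using group_hom.hom_closed[OF gh that] .
 have fr: "frag_of (b, q) \<in> carrier ?F" if "b \<in> carrier A" for b q using that by simp
 have neg: "- x \<in> carrier ?F" if "x \<in> carrier ?F" for x using that by simp
 have add: "x + y \<in> carrier ?F" if "x \<in> carrier ?F" "y \<in> carrier ?F" for x y
  using group.subgroup_self[OF gF] subgroup.m_closed[of "carrier ?F" ?F x y] that by simp
 have diff3: "x - y - z \<in> carrier ?F" "h N (x - y - z) = h N x \<otimes>\<^bsub>A\<^esub> inv\<^bsub>A\<^esub> h N y \<otimes>\<^bsub>A\<^esub> inv\<^bsub>A\<^esub> h N z"
  if "x \<in> carrier ?F" "y \<in> carrier ?F" "z \<in> carrier ?F" for N x y z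
 proof -
  have e: "x - y - z = (x + (- y)) + (- z)" by simp
  show "x - y - z \<in> carrier ?F" unfolding e by (intro add neg that)
  show "h N (x - y - z) = h N x \<otimes>\<^bsub>A\<^esub> inv\<^bsub>A\<^esub> h N y \<otimes>\<^bsub>A\<^esub> inv\<^bsub>A\<^esub> h N z"
   unfolding e by (simp only: hadd[OF add[OF that(1) neg[OF that(2)]] neg[OF that(3)]] hadd[OF that(1) neg[OF that(2)]] hneg that)
 qed
 have comm1: "p \<otimes>\<^bsub>A\<^esub> q \<otimes>\<^bsub>A\<^esub> inv\<^bsub>A\<^esub> p \<otimes>\<^bsub>A\<^esub> inv\<^bsub>A\<^esub> q = \<one>\<^bsub>A\<^esub>" if "p \<in> carrier A" "q \<in> carrier A" for p q
 proof -
  have "p \<otimes>\<^bsub>A\<^esub> q \<otimes>\<^bsub>A\<^esub> inv\<^bsub>A\<^esub> p \<otimes>\<^bsub>A\<^esub> inv\<^bsub>A\<^esub> q = (p \<otimes>\<^bsub>A\<^esub> q) \<otimes>\<^bsub>A\<^esub> inv\<^bsub>A\<^esub> (q \<otimes>\<^bsub>A\<^esub> p)"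
   using that by (simp only: A.inv_mult_group A.m_assoc A.m_closed A.inv_closed)
  also have "q \<otimes>\<^bsub>A\<^esub> p = p \<otimes>\<^bsub>A\<^esub> q" using that by (rule A.m_comm[rotated])
  finally show ?thesis using that by simp
 qed
 let ?P = "%x. x \<in> carrier ?F & (\<exists>N>0. \<forall>M. N dvd M --> h M x = \<one>\<^bsub>A\<^esub>)"
 have gen: "?P x" if "x \<in> {frag_of (b \<otimes>\<^bsub>A\<^esub> b', q) - frag_of (b, q) - frag_of (b', q) |b b' q. b \<in> carrier A & b' \<in> carrier A} \<union>
    {frag_of (b, q + q') - frag_of (b, q) - frag_of (b, q') |b q q'. b \<in> carrier A}" for x
  using that
 proof
  assume "x \<in> {frag_of (b \<otimes>\<^bsub>A\<^esub> b', q) - frag_of (b, q) - frag_of (b', q) |b b' q. b \<in> carrier A & b' \<in> carrier A}"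
  then obtain b b' q where x: "x = frag_of (b \<otimes>\<^bsub>A\<^esub> b', q) - frag_of (b, q) - frag_of (b', q)" "b \<in> carrier A" "b' \<in> carrier A" by blast
  have "h M x = \<one>\<^bsub>A\<^esub>" for M
   unfolding x(1) diff3(2)[OF fr[OF A.m_closed[OF x(2,3)]] fr[OF x(2)] fr[OF x(3)]]
   using x(2,3) comm1 by (simp add: h(2) A.int_pow_distrib)
  moreover have "x \<in> carrier ?F" unfolding x(1) by (rule diff3(1)) (use x A.m_closed fr in blast)+
  ultimately show ?thesis by (intro conjI exI[of _ 1]) auto
 next
  assume "x \<in> {frag_of (b, q + q') - frag_of (b, q) - frag_of (b, q') |b q q'. b \<in> carrier A}"
  then obtain b q q' where x: "x = frag_of (b, q + q') - frag_of (b, q) - frag_of (b, q')" "b \<in> carrier A" by blast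
  obtain m n where mn: "quotient_of q = (m, n)" by force
  obtain m' n' where mn': "quotient_of q' = (m', n')" by force
  have n: "n > 0" "n' > 0" "q = of_int m / of_int n" "q' = of_int m' / of_int n'"
   using quotient_of_denom_pos[OF mn] quotient_of_denom_pos[OF mn'] quotient_of_div[OF mn] quotient_of_div[OF mn'] by auto
  \<comment> \<open>A common denominator of \<open>q\<close> and \<open>q'\<close>; for its
    multiples \<open>M\<close> the floors of \<open>q * M\<close> and \<open>q' * M\<close> add
    up.\<close>
  define N where "N = nat (n * n')"
  have N: "N > 0" using n by (simp add: N_def)
  have "h M x = \<one>\<^bsub>A\<^esub>" if "N dvd M" for M
  proof -
   obtain k where M: "M = N * k" using \<open>N dvd M\<close> by (auto simp: dvd_def)
   have oM: "(of_nat M :: rat) = of_int (n * n') * of_int (int k)" using n by (simp add: M N_def)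
   have 1: "q * of_nat M = of_int (m * n' * int k)" and 2: "q' * of_nat M = of_int (m' * n * int k)"
    unfolding oM using n by (simp_all add: field_simps)
   then have 3: "(q + q') * of_nat M = of_int (m * n' * int k + m' * n * int k)" by (simp add: distrib_right)
   have "b [^]\<^bsub>A\<^esub> \<lfloor>(q + q') * of_nat M\<rfloor> = b [^]\<^bsub>A\<^esub> \<lfloor>q * of_nat M\<rfloor> \<otimes>\<^bsub>A\<^esub> b [^]\<^bsub>A\<^esub> \<lfloor>q' * of_nat M\<rfloor>"
    unfolding 1 2 3 floor_of_int by (rule A.int_pow_mult[OF x(2)])
   then show ?thesis
    unfolding x(1) diff3(2)[OF fr[OF x(2)] fr[OF x(2)] fr[OF x(2)]] h(2)[OF x(2)]
    using comm1 x(2) by simp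
  qed
  moreover have "x \<in> carrier ?F" unfolding x(1) by (rule diff3(1)) (use x fr in blast)+
  ultimately show ?thesis using N by blast
 qed
 have "?P x" if "x \<in> tensor_relations A" for x
  using that unfolding tensor_relations_def
 proof (induction x rule: generate.induct)
  case one
  have "\<one>\<^bsub>?F\<^esub> \<in> carrier ?F" using gF by (simp add: group.is_monoid)
  moreover have "h M \<one>\<^bsub>?F\<^esub> = \<one>\<^bsub>A\<^esub>" for M using group_hom.hom_one[OF gh] .
  ultimately show ?case by (intro conjI exI[of _ 1]) auto
 next
  case (incl x)
  then show ?case by (rule gen)
 next
  case (inv x)
  note g = gen[OF inv]
  then obtain N where "N > 0" "\<forall>M. N dvd M --> h M x = \<one>\<^bsub>A\<^esub>" by blast
  moreover have "inv\<^bsub>?F\<^esub> x = - x" using g by simp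
  ultimately show ?case using g neg hneg by auto
 next
  case (eng x y)
  then obtain N N' where N: "N > 0" "\<forall>M. N dvd M --> h M x = \<one>\<^bsub>A\<^esub>" "N' > 0" "\<forall>M. N' dvd M --> h M y = \<one>\<^bsub>A\<^esub>" by blast
  have "h M (x + y) = \<one>\<^bsub>A\<^esub>" if "N * N' dvd M" for M
   using N that hadd[of x y M] eng by (metis A.r_one A.one_closed dvd_mult_left dvd_mult_right)
  then have "\<exists>N>0. \<forall>M. N dvd M --> h M (x + y) = \<one>\<^bsub>A\<^esub>" using N by (intro exI[of _ "N * N'"]) auto
  then show ?case using add eng by simp
 qed
 from this[OF c] obtain N where N: "N > 0" "h N (frag_of (a, 1)) = \<one>\<^bsub>A\<^esub>" by auto
 then have "a [^]\<^bsub>A\<^esub> (int N) = \<one>\<^bsub>A\<^esub>" using h(2)[OF a, of N 1] by simp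
 then show ?thesis using N(1) by (auto simp: int_pow_int)
qed

lemma (in abelian_group) finsum_add_hom:
 assumes "comm_group A" "finite I" "!!i. i \<in> I ==> f i \<in> carrier A"
  "!!x. x \<in> carrier A ==> \<psi> x \<in> carrier G"
  "!!x y. x \<in> carrier A ==> y \<in> carrier A ==> \<psi> (x \<otimes>\<^bsub>A\<^esub> y) = \<psi> x \<oplus> \<psi> y"
 shows "\<psi> (finprod A f I) = finsum G (%i. \<psi> (f i)) I"
proof -
 interpret A: comm_group A by fact
 have "\<psi> \<one>\<^bsub>A\<^esub> \<oplus> \<psi> \<one>\<^bsub>A\<^esub> = \<psi> \<one>\<^bsub>A\<^esub>" using assms(5)[of "\<one>\<^bsub>A\<^esub>" "\<one>\<^bsub>A\<^esub>"] by simp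
 then have one: "\<psi> \<one>\<^bsub>A\<^esub> = \<zero>" using assms(4)[OF A.one_closed] add.l_cancel_one by blast
 show ?thesis
  using assms(2,3)
 proof (induction I rule: finite_induct)
  case (insert i I)
  have "f \<in> I \<rightarrow> carrier A" "f i \<in> carrier A" using insert by auto
  then show ?case using insert assms(4,5) by (simp add: Pi_iff)
 qed (simp add: one)
qed

text \<open>In terms of the group itself, rational rank \<open>r\<close> means that there are \<open>r\<close> independent elements modulo
 which everything is torsion.\<close>

lemma rational_dim_independent:
 assumes A: "comm_group A" and dim: "has_rational_dim A r"
 shows "\<exists>a :: nat => 'a. (\<forall>j<r. a j \<in> carrier A) &
  (\<forall>k :: nat => int. finprod A (%j. a j [^]\<^bsub>A\<^esub> k j) {..<r} = \<one>\<^bsub>A\<^esub> --> (\<forall>j<r. k j = 0)) &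
  (\<forall>x\<in>carrier A. \<exists>N > 0. \<exists>k :: nat => int. x [^]\<^bsub>A\<^esub> (N :: nat) = finprod A (%j. a j [^]\<^bsub>A\<^esub> k j) {..<r})"
proof -
 interpret A: comm_group A by fact
 define Q where "Q = (class_ring :: rat ring)"
 define V where "V = rat_tensor A"
 interpret V: vectorspace Q V unfolding Q_def V_def by (rule vectorspace_rat_tensor[OF A])
 have Q: "carrier Q = UNIV" "!!x y. x \<otimes>\<^bsub>Q\<^esub> y = x * y" "!!x y. x \<oplus>\<^bsub>Q\<^esub> y = x + y" "\<one>\<^bsub>Q\<^esub> = 1" "\<zero>\<^bsub>Q\<^esub> = 0" "!!x. \<ominus>\<^bsub>Q\<^esub> x = - x"
  by (simp_all add: Q_def class_ring_simps)
 let ?S = "carrier A \<times> (UNIV :: rat set)"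
 define F where "F = free_Abelian_group ?S"
 define K where "K = tensor_relations A"
 interpret F: comm_group F unfolding F_def by (rule abelian_free_Abelian_group)
 have K: "subgroup K F" unfolding K_def F_def by (rule subgroup_tensor_relations[OF A])
 interpret K: normal K F using F.subgroup_imp_normal K by blast
 have Fm: "x \<otimes>\<^bsub>F\<^esub> y = x + y" for x y by (simp add: F_def)
 have Fc: "carrier F = {c. Poly_Mapping.keys c <= ?S}" by (auto simp: F_def)
 define cls where "cls x = K #>\<^bsub>F\<^esub> x" for x
 have Vc: "carrier V = cls ` carrier F"
  by (auto simp: V_def rat_tensor_def Let_def F_def[symmetric] K_def[symmetric] carrier_FactGroup cls_def)
 have Vadd: "cls x \<oplus>\<^bsub>V\<^esub> cls y = cls (x + y)" if "x \<in> carrier F" "y \<in> carrier F" for x y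
  using K.rcos_sum[OF that]
  by (simp add: V_def rat_tensor_def Let_def F_def[symmetric] K_def[symmetric] cls_def FactGroup_def Fm)
 have V0: "\<zero>\<^bsub>V\<^esub> = K"
  by (simp add: V_def rat_tensor_def Let_def F_def[symmetric] K_def[symmetric] FactGroup_def)
 have clsc: "cls x \<in> carrier V" if "x \<in> carrier F" for x using that by (auto simp: Vc)
 have cls0: "cls x = \<zero>\<^bsub>V\<^esub> \<longleftrightarrow> x \<in> K" if "x \<in> carrier F" for x
  unfolding cls_def V0 using F.coset_join1[OF _ that K] F.coset_join2[OF that K] by blast
 define e where "e b q = cls (frag_of (b, q))" for b and q :: rat
 have fr: "frag_of (b, q) \<in> carrier F" if "b \<in> carrier A" for b q using that by (simp add: Fc)
 have ec: "e b q \<in> carrier V" if "b \<in> carrier A" for b q unfolding e_def by (rule clsc[OF fr[OF that]])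
 have rel: "cls x = cls y \<oplus>\<^bsub>V\<^esub> cls z" if "x - y - z \<in> K" "y \<in> carrier F" "z \<in> carrier F" for x y z
 proof -
  have yz: "y + z \<in> carrier F" using F.m_closed[OF that(2,3)] by (simp add: Fm)
  have dF: "x - y - z \<in> carrier F" using that(1) K.subset by auto
  have "cls (x - y - z) \<oplus>\<^bsub>V\<^esub> cls (y + z) = cls x" using Vadd[OF dF yz] by (simp add: algebra_simps)
  moreover have "cls (x - y - z) = \<zero>\<^bsub>V\<^esub>" using cls0[OF dF] that(1) by simp
  ultimately show ?thesis using Vadd[OF that(2,3)] clsc[OF yz] by simp
 qed
 have eA: "e (b \<otimes>\<^bsub>A\<^esub> b') q = e b q \<oplus>\<^bsub>V\<^esub> e b' q" if "b \<in> carrier A" "b' \<in> carrier A" for b b' q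
  unfolding e_def
 proof (rule rel[OF _ fr[OF that(1)] fr[OF that(2)]])
  show "frag_of (b \<otimes>\<^bsub>A\<^esub> b', q) - frag_of (b, q) - frag_of (b', q) \<in> K"
   unfolding K_def tensor_relations_def using that by (blast intro: generate.incl)
 qed
 have eQ: "e b (q + q') = e b q \<oplus>\<^bsub>V\<^esub> e b q'" if "b \<in> carrier A" for b q q'
  unfolding e_def
 proof (rule rel[OF _ fr[OF that] fr[OF that]])
  show "frag_of (b, q + q') - frag_of (b, q) - frag_of (b, q') \<in> K"
   unfolding K_def tensor_relations_def using that by (blast intro: generate.incl)
 qed
 have sm_nat: "of_nat (Suc n) \<odot>\<^bsub>V\<^esub> v = v \<oplus>\<^bsub>V\<^esub> (of_nat n \<odot>\<^bsub>V\<^esub> v)" if "v \<in> carrier V" for n v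
  using V.smult_l_distr[of 1 "of_nat n" v] that V.smult_one[OF that] by (simp add: Q)
 have sm0: "0 \<odot>\<^bsub>V\<^esub> v = \<zero>\<^bsub>V\<^esub>" if "v \<in> carrier V" for v using V.lmult_0[OF that] by (simp add: Q)
 have smm: "x \<odot>\<^bsub>V\<^esub> (y \<odot>\<^bsub>V\<^esub> v) = (x * y) \<odot>\<^bsub>V\<^esub> v" if "v \<in> carrier V" for x y v
  using V.smult_assoc1[of x y v] that by (simp add: Q)
 have smc: "x \<odot>\<^bsub>V\<^esub> v \<in> carrier V" if "v \<in> carrier V" for x v using V.smult_closed[of x v] that by (simp add: Q)
 have sm1: "1 \<odot>\<^bsub>V\<^esub> v = v" if "v \<in> carrier V" for v using V.smult_one[OF that] by (simp add: Q)
 have smneg: "(- x) \<odot>\<^bsub>V\<^esub> v = \<ominus>\<^bsub>V\<^esub> (x \<odot>\<^bsub>V\<^esub> v)" if "v \<in> carrier V" for x v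
  using V.smult_l_minus[of x v] that by (simp add: Q)
 have cancel0: "v = \<zero>\<^bsub>V\<^esub>" if "v = v \<oplus>\<^bsub>V\<^esub> v" "v \<in> carrier V" for v
  using that by (metis V.add.l_cancel_one)
 have e0: "e b 0 = \<zero>\<^bsub>V\<^esub>" if "b \<in> carrier A" for b using cancel0[OF _ ec[OF that]] eQ[OF that, of 0 0] by simp
 have en: "of_nat n \<odot>\<^bsub>V\<^esub> e b q = e b (of_nat n * q)" if "b \<in> carrier A" for n b q
 proof (induction n)
  case 0
  then show ?case using sm0[OF ec[OF that]] e0[OF that] by simp
 next
  case (Suc n)
  then show ?case using sm_nat[OF ec[OF that], of n q] eQ[OF that, of q "of_nat n * q"] by (simp add: algebra_simps)
 qed
 have eneg: "e b (- q) = \<ominus>\<^bsub>V\<^esub> e b q" if "b \<in> carrier A" for b q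
 proof -
  have "e b (- q) \<oplus>\<^bsub>V\<^esub> e b q = \<zero>\<^bsub>V\<^esub>" using eQ[OF that, of "- q" q] e0[OF that] by simp
  then show ?thesis using V.minus_equality ec[OF that] by metis
 qed
 have epos: "e b q = q \<odot>\<^bsub>V\<^esub> e b 1" if "b \<in> carrier A" "q \<ge> 0" for b q
 proof -
  obtain m n where mn: "quotient_of q = (m, n)" by force
  have n: "n > 0" "q = of_int m / of_int n" using quotient_of_denom_pos[OF mn] quotient_of_div[OF mn] by auto
  have m: "m \<ge> 0" using that(2) n by (simp add: zero_le_divide_iff)
  have on: "(of_nat (nat n) :: rat) = of_int n" "(of_nat (nat m) :: rat) = of_int m" using n m by auto
  have "of_int n \<odot>\<^bsub>V\<^esub> e b q = of_int m \<odot>\<^bsub>V\<^esub> e b 1"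
   using en[OF that(1), of "nat n" q] en[OF that(1), of "nat m" 1] n unfolding on by simp
  then have "(1 / of_int n) \<odot>\<^bsub>V\<^esub> (of_int n \<odot>\<^bsub>V\<^esub> e b q) = (1 / of_int n) \<odot>\<^bsub>V\<^esub> (of_int m \<odot>\<^bsub>V\<^esub> e b 1)" by simp
  then show ?thesis using n ec[OF that(1)] by (simp add: smm sm1)
 qed
 \<comment> \<open>Additivity determines the scalar action, so the elements \<open>e b 1\<close>
   span the rational space.\<close>
 have eq: "e b q = q \<odot>\<^bsub>V\<^esub> e b 1" if "b \<in> carrier A" for b q
 proof (cases "q \<ge> 0")
  case False
  then show ?thesis using epos[OF that, of "- q"] eneg[OF that, of "- q"] smneg[OF ec[OF that], of "- q" 1] by simp
 qed (rule epos[OF that])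
 define \<psi> where "\<psi> b = e b 1" for b
 have \<psi>c: "\<psi> b \<in> carrier V" if "b \<in> carrier A" for b using ec[OF that] by (simp add: \<psi>_def)
 have \<psi>m: "\<psi> (b \<otimes>\<^bsub>A\<^esub> b') = \<psi> b \<oplus>\<^bsub>V\<^esub> \<psi> b'" if "b \<in> carrier A" "b' \<in> carrier A" for b b' using eA[OF that] by (simp add: \<psi>_def)
 have \<psi>1: "\<psi> \<one>\<^bsub>A\<^esub> = \<zero>\<^bsub>V\<^esub>" using cancel0[OF _ \<psi>c] \<psi>m[of "\<one>\<^bsub>A\<^esub>" "\<one>\<^bsub>A\<^esub>"] by simp
 have \<psi>n: "\<psi> (b [^]\<^bsub>A\<^esub> n) = of_nat n \<odot>\<^bsub>V\<^esub> \<psi> b" if "b \<in> carrier A" for b and n :: nat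
 proof (induction n)
  case 0
  then show ?case using \<psi>1 sm0[OF \<psi>c[OF that]] by simp
 next
  case (Suc n)
  then show ?case using \<psi>m[of b "b [^]\<^bsub>A\<^esub> n"] that sm_nat[OF \<psi>c[OF that]] A.nat_pow_Suc2[OF that] by simp
 qed
 have \<psi>inv: "\<psi> (inv\<^bsub>A\<^esub> b) = \<ominus>\<^bsub>V\<^esub> \<psi> b" if "b \<in> carrier A" for b
  using \<psi>m[of "inv\<^bsub>A\<^esub> b" b] that \<psi>1 V.minus_equality \<psi>c by (metis A.inv_closed A.l_inv)
 have \<psi>i: "\<psi> (b [^]\<^bsub>A\<^esub> k) = of_int k \<odot>\<^bsub>V\<^esub> \<psi> b" if "b \<in> carrier A" for b and k :: int
  by (cases k rule: int_cases2)
   (use \<psi>n[OF that] \<psi>inv smneg[OF \<psi>c[OF that]] that in \<open>simp_all add: int_pow_int A.int_pow_neg_int\<close>)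
 have tors: "\<exists>n>0. b [^]\<^bsub>A\<^esub> (n :: nat) = \<one>\<^bsub>A\<^esub>" if "b \<in> carrier A" "\<psi> b = \<zero>\<^bsub>V\<^esub>" for b
  using tensor_relation_torsion[OF A _ that(1)] cls0[OF fr[OF that(1), of 1]] that(2) by (simp add: \<psi>_def e_def K_def)
 have fd: "V.fin_dim" and Vr: "V.dim = r" using dim by (auto simp: has_rational_dim_def Q_def V_def)
 define T where "T = \<psi> ` carrier A"
 have Tc: "T <= carrier V" using \<psi>c by (auto simp: T_def)
 have "V.lin_indpt {}" unfolding V.lin_dep_def by auto
 then have P0: "{} <= T & V.lin_indpt {}" by simp
 have "finite X & card X <= V.dim" if "X <= T & V.lin_indpt X" for X
 proof -
  have "X <= carrier V" "V.lin_indpt X" using that Tc by auto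
  then show ?thesis using V.li_le_dim[OF fd] by blast
 qed
 \<comment> \<open>A maximal independent subset of the image of \<open>A\<close>. Since this image
   spans, the subset is a basis and has \<open>r\<close> elements.\<close>
 from maximal_exists[where P = "%X. X <= T & V.lin_indpt X", OF this P0]
 obtain B where B: "finite B" "maximal B (%X. X <= T & V.lin_indpt X)" by blast
 have BT: "B <= T" "V.lin_indpt B" "!!X. B <= X ==> X <= T ==> V.lin_indpt X ==> X = B"
  using B(2) by (auto simp: maximal_def)
 have Bc: "B <= carrier V" using BT Tc by auto
 have sub: "submodule Q (V.span B) V" by (rule V.span_is_submodule[OF Bc])
 have sadd: "v \<oplus>\<^bsub>V\<^esub> w \<in> V.span B" if "v \<in> V.span B" "w \<in> V.span B" for v w
  using sub that by (simp add: submodule_def)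
 have ssm: "x \<odot>\<^bsub>V\<^esub> v \<in> V.span B" if "v \<in> V.span B" for x v
  using sub that by (simp add: submodule_def Q)
 have Tspan: "v \<in> V.span B" if "v \<in> T" for v
 proof (cases "v \<in> B")
  case True
  then show ?thesis using V.in_own_span[OF Bc] by auto
 next
  case False
  then have "V.lin_dep (B \<union> {v})" using BT(3)[of "B \<union> {v}"] BT(1) that by auto
  then show ?thesis using V.lin_dep_iff_in_span[OF Bc BT(2) _ False] that Tc by auto
 qed
 have "x \<in> carrier F & cls x \<in> V.span B" if "x \<in> carrier F" for x
  using that unfolding Fc mem_Collect_eq
 proof (induction x rule: frag_induction)
  case zero
  have "\<psi> \<one>\<^bsub>A\<^esub> \<in> T" unfolding T_def by (rule imageI) simp
  then have "\<zero>\<^bsub>V\<^esub> \<in> V.span B" using Tspan unfolding \<psi>1 by blast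
  moreover have "cls 0 = \<zero>\<^bsub>V\<^esub>" using cls0[of 0] K.one_closed by (simp add: Fc F_def)
  ultimately show ?case by simp
 next
  case (one x)
  then obtain b q where "x = (b, q)" "b \<in> carrier A" by auto
  then show ?case using eq[of b q] ssm[OF Tspan[of "\<psi> b"]] by (auto simp: e_def[symmetric] T_def \<psi>_def[symmetric])
 next
  case (diff x y)
  then have xy: "x \<in> carrier F" "y \<in> carrier F" by (auto simp: Fc)
  have "inv\<^bsub>F\<^esub> y = - y" using xy by (simp add: F_def)
  then have d: "x - y \<in> carrier F" using F.m_closed[OF xy(1) F.inv_closed[OF xy(2)]] by (simp add: Fm)
  have "cls (x - y) \<oplus>\<^bsub>V\<^esub> cls y = cls x" using Vadd[OF d xy(2)] by simp
  then have "cls (x - y) = cls x \<oplus>\<^bsub>V\<^esub> (\<ominus>\<^bsub>V\<^esub> cls y)"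
   using clsc[OF d] clsc[OF xy(2)] by (metis V.add.inv_solve_right clsc xy(1))
  also have "\<ominus>\<^bsub>V\<^esub> cls y = (- 1) \<odot>\<^bsub>V\<^esub> cls y" using smneg[OF clsc[OF xy(2)], of 1] sm1[OF clsc[OF xy(2)]] by simp
  finally show ?case using diff sadd ssm d by (simp add: Fc)
 qed
 then have gen: "V.span B = carrier V" using V.span_is_subset2[OF Bc] by (auto simp: Vc)
 have "V.basis B" using gen BT Bc by (simp add: V.basis_def)
 then have cB: "card B = r" using V.dim_basis[OF B(1)] Vr by simp
 obtain \<beta> where \<beta>: "bij_betw \<beta> {..<r} B" using ex_bij_betw_nat_finite[OF B(1)] cB by (auto simp: lessThan_atLeast0)
 have "\<exists>a. a \<in> carrier A & \<psi> a = \<beta> j" if "j \<in> {..<r}" for j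
 proof -
  have "\<beta> j \<in> \<psi> ` carrier A" using BT(1) \<beta> that unfolding T_def bij_betw_def by blast
  then show ?thesis by force
 qed
 then have "\<forall>j\<in>{..<r}. \<exists>a. a \<in> carrier A & \<psi> a = \<beta> j" by blast
 then obtain a where a: "!!j. j < r ==> a j \<in> carrier A" "!!j. j < r ==> \<psi> (a j) = \<beta> j" by (metis lessThan_iff)
 have \<beta>c: "\<beta> j \<in> carrier V" if "j < r" for j using a[OF that] \<psi>c by metis
 define \<gamma> where "\<gamma> = inv_into {..<r} \<beta>"
 have \<gamma>: "\<gamma> (\<beta> j) = j" if "j < r" for j using \<beta> that by (simp add: \<gamma>_def bij_betw_def)
 have ab: "abelian_group V" by unfold_locales
 have prodV: "\<psi> (finprod A (%j. a j [^]\<^bsub>A\<^esub> k j) {..<r}) = V.lincomb (%v. of_int (k (\<gamma> v))) B" for k :: "nat => int"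
 proof -
  have "\<psi> (finprod A (%j. a j [^]\<^bsub>A\<^esub> k j) {..<r}) = finsum V (%j. \<psi> (a j [^]\<^bsub>A\<^esub> k j)) {..<r}"
   by (rule abelian_group.finsum_add_hom[OF ab A]) (use a \<psi>c \<psi>m in auto)
  also have "... = finsum V (%j. of_int (k (\<gamma> (\<beta> j))) \<odot>\<^bsub>V\<^esub> \<beta> j) {..<r}"
   by (rule V.finsum_cong') (use a \<psi>i \<gamma> smc \<beta>c in auto)
  also have "... = finsum V (%v. of_int (k (\<gamma> v)) \<odot>\<^bsub>V\<^esub> v) (\<beta> ` {..<r})"
   by (rule V.add.finprod_reindex[symmetric]) (use \<beta> \<beta>c smc in \<open>auto simp: bij_betw_def\<close>)
  finally show ?thesis using \<beta> by (simp add: V.lincomb_def bij_betw_def)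
 qed
 have indep: "\<forall>j<r. k j = 0" if "finprod A (%j. a j [^]\<^bsub>A\<^esub> k j) {..<r} = \<one>\<^bsub>A\<^esub>" for k :: "nat => int"
 proof (rule ccontr)
  assume "\<not> ?thesis"
  then obtain j where j: "j < r" "k j ~= 0" by auto
  have "V.lincomb (%v. of_int (k (\<gamma> v))) B = \<zero>\<^bsub>V\<^esub>" using prodV[of k] that \<psi>1 by simp
  then have "V.lin_dep B"
   by (intro V.lin_dep_crit[OF B(1) subset_refl, of "%v. of_int (k (\<gamma> v))" "\<beta> j"]) (use j \<gamma> \<beta> in \<open>auto simp: Q bij_betw_def\<close>)
  then show False using BT(2) by simp
 qed
 have cofin: "\<exists>N > 0. \<exists>k :: nat => int. x [^]\<^bsub>A\<^esub> (N :: nat) = finprod A (%j. a j [^]\<^bsub>A\<^esub> k j) {..<r}" if x: "x \<in> carrier A" for x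
 proof -
  have "\<psi> x \<in> V.span B" using Tspan x unfolding T_def by blast
  then obtain c where c: "V.lincomb c B = \<psi> x" using V.finite_in_span[OF B(1) Bc] by blast
  \<comment> \<open>Clears the denominators of the coordinates of \<open>\<psi> x\<close>.\<close>
  define N where "N = (\<Prod>v\<in>B. nat (snd (quotient_of (c v))))"
  have qp: "snd (quotient_of (c v)) > 0" for v by (metis quotient_of_denom_pos prod.collapse)
  have N: "N > 0" unfolding N_def using qp by (intro prod_pos) auto
  have int: "\<exists>k. of_nat N * c v = of_int k" if "v \<in> B" for v
  proof -
   obtain m n where mn: "quotient_of (c v) = (m, n)" by force
   have n: "n > 0" "c v = of_int m / of_int n" using quotient_of_denom_pos[OF mn] quotient_of_div[OF mn] by auto
   have "nat n dvd N" unfolding N_def using dvd_prodI[OF B(1) that, of "%v. nat (snd (quotient_of (c v)))"] mn by simp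
   then obtain d where d: "N = nat n * d" by (auto simp: dvd_def)
   have "of_nat N * c v = of_int (m * int d)" using n by (simp add: d field_simps)
   then show ?thesis by blast
  qed
  then obtain k0 where k0: "!!v. v \<in> B ==> of_nat N * c v = of_int (k0 v)" by metis
  define k where "k j = k0 (\<beta> j)" for j
  have kk: "of_int (k (\<gamma> v)) = of_nat N * c v" if "v \<in> B" for v
  proof -
   obtain j where "j < r" "v = \<beta> j" using \<beta> \<open>v \<in> B\<close> by (auto simp: bij_betw_def)
   then show ?thesis using \<gamma> k0 \<open>v \<in> B\<close> by (simp add: k_def)
  qed
  let ?p = "finprod A (%j. a j [^]\<^bsub>A\<^esub> k j) {..<r}"
  have pc: "?p \<in> carrier A" using a by (intro A.finprod_closed) auto
  have "\<psi> ?p = V.lincomb (%v. of_nat N * c v) B"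
   unfolding prodV by (rule V.lincomb_cong[OF HOL.refl Bc]) (use kk in \<open>auto simp: Q\<close>)
  also have "... = of_nat N \<odot>\<^bsub>V\<^esub> \<psi> x" using V.lincomb_smult[OF Bc, of c "of_nat N"] c by (simp add: Q)
  also have "... = \<psi> (x [^]\<^bsub>A\<^esub> N)" using \<psi>n[OF x] by simp
  \<comment> \<open>Over the rationals \<open>x^N\<close> agrees with the integral combination, so
    in \<open>A\<close> they differ by torsion, which a further power removes.\<close>
  finally have "\<psi> (x [^]\<^bsub>A\<^esub> N \<otimes>\<^bsub>A\<^esub> inv\<^bsub>A\<^esub> ?p) = \<zero>\<^bsub>V\<^esub>"
   using \<psi>m[of "x [^]\<^bsub>A\<^esub> N" "inv\<^bsub>A\<^esub> ?p"] x pc \<psi>inv[OF pc] \<psi>c[OF pc] V.r_neg by simp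
  then obtain n where n: "n > 0" "(x [^]\<^bsub>A\<^esub> N \<otimes>\<^bsub>A\<^esub> inv\<^bsub>A\<^esub> ?p) [^]\<^bsub>A\<^esub> (n :: nat) = \<one>\<^bsub>A\<^esub>"
   using tors[of "x [^]\<^bsub>A\<^esub> N \<otimes>\<^bsub>A\<^esub> inv\<^bsub>A\<^esub> ?p"] x pc by auto
  then have "(x [^]\<^bsub>A\<^esub> N) [^]\<^bsub>A\<^esub> n \<otimes>\<^bsub>A\<^esub> inv\<^bsub>A\<^esub> (?p [^]\<^bsub>A\<^esub> n) = \<one>\<^bsub>A\<^esub>"
   using x pc by (simp add: A.nat_pow_distrib A.nat_pow_inv)
  then have "((x [^]\<^bsub>A\<^esub> N) [^]\<^bsub>A\<^esub> n \<otimes>\<^bsub>A\<^esub> inv\<^bsub>A\<^esub> (?p [^]\<^bsub>A\<^esub> n)) \<otimes>\<^bsub>A\<^esub> ?p [^]\<^bsub>A\<^esub> n = ?p [^]\<^bsub>A\<^esub> n"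
   using pc by simp
  then have "x [^]\<^bsub>A\<^esub> (N * n) = ?p [^]\<^bsub>A\<^esub> n"
   using x pc by (simp add: A.m_assoc A.nat_pow_pow)
  moreover have "finprod A f {..<q} [^]\<^bsub>A\<^esub> n = finprod A (%j. f j [^]\<^bsub>A\<^esub> n) {..<q}" if "!!j. j < q ==> f j \<in> carrier A" for f and q :: nat
   using that
  proof (induction q)
   case (Suc q)
   have "finprod A f {..<q} \<in> carrier A" "(%j. f j [^]\<^bsub>A\<^esub> n) \<in> {..<q} \<rightarrow> carrier A" "f \<in> {..<q} \<rightarrow> carrier A" using Suc by auto
   then show ?case using Suc by (simp add: lessThan_Suc A.nat_pow_distrib)
  qed simp
  then have "?p [^]\<^bsub>A\<^esub> n = finprod A (%j. (a j [^]\<^bsub>A\<^esub> k j) [^]\<^bsub>A\<^esub> n) {..<r}" using a by simp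
  moreover have "finprod A (%j. (a j [^]\<^bsub>A\<^esub> k j) [^]\<^bsub>A\<^esub> n) {..<r} = finprod A (%j. a j [^]\<^bsub>A\<^esub> (k j * int n)) {..<r}"
   by (rule A.finprod_cong') (use a in \<open>auto simp: A.int_pow_pow[symmetric] int_pow_int\<close>)
  ultimately show ?thesis using N n(1) by (intro exI[of _ "N * n"] conjI exI[of _ "%j. k j * int n"]) auto
 qed
 show ?thesis using a(1) indep cofin by (intro exI[of _ a]) blast
qed

section \<open>Finite index: powers, intersections and chains\<close>

section \<open>Finite index subgroups\<close>

context group
begin

lemma coset_eq_iff:
 assumes "subgroup K G" "x \<in> carrier G" "y \<in> carrier G"
 shows "K #> x = K #> y \<longleftrightarrow> x \<otimes> inv y \<in> K"
proof
 assume "K #> x = K #> y"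
 then have "x \<in> K #> y" using rcos_self[OF assms(2,1)] by simp
 then obtain k where "k \<in> K" "x = k \<otimes> y" by (auto simp: r_coset_def)
 then show "x \<otimes> inv y \<in> K" using assms subgroup.subset[OF assms(1)] by (auto simp: m_assoc subsetD)
next
 assume k: "x \<otimes> inv y \<in> K"
 have "x = (x \<otimes> inv y) \<otimes> y" using assms by (simp add: m_assoc)
 moreover have "K #> ((x \<otimes> inv y) \<otimes> y) = K #> (x \<otimes> inv y) #> y"
  using coset_mult_assoc[OF subgroup.subset[OF assms(1)], of "x \<otimes> inv y" y] assms by simp
 moreover have "K #> (x \<otimes> inv y) = K" using coset_join2[OF _ assms(1) k] assms by simp
 ultimately show "K #> x = K #> y" by simp
qed

text \<open>Two different powers of \<open>g\<close> lie in the same coset, and their quotient lies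
  in \<open>K\<close>.\<close>

lemma fin_idx_power:
 assumes "fin_idx K M" "g \<in> M"
 shows "\<exists>n > 0. g [^] (n :: nat) \<in> K"
proof -
 have K: "subgroup K G" and M: "subgroup M G" and fin: "finite ((%g. K #> g) ` M)"
  using assms(1) by (auto simp: fin_idx_def)
 have gc: "g \<in> carrier G" using assms(2) M subgroup.subset by blast
 have gn: "g [^] (n :: nat) \<in> M" for n using M assms(2) by (induction n) (auto simp: subgroup.one_closed subgroup.m_closed)
 have "finite (range (%n :: nat. K #> (g [^] n)))" by (rule finite_subset[OF _ fin]) (use gn in auto)
 then have "\<not> inj (%n :: nat. K #> (g [^] n))" using finite_imageD infinite_UNIV_nat by blast
 then obtain m n :: nat where mn: "m ~= n" "K #> (g [^] m) = K #> (g [^] n)" by (auto simp: inj_on_def)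
 have "\<exists>m n :: nat. m < n & K #> (g [^] n) = K #> (g [^] m)"
  using mn by (metis linorder_neqE_nat)
 then obtain m n :: nat where mn: "m < n" "K #> (g [^] n) = K #> (g [^] m)" by blast
 have "g [^] n \<otimes> inv (g [^] m) \<in> K" using mn(2) coset_eq_iff[OF K] gc by simp
 moreover have "g [^] n = g [^] (n - m) \<otimes> g [^] m" using nat_pow_mult[OF gc, of "n - m" m] mn(1) by simp
 ultimately have "g [^] (n - m) \<in> K" using gc by (simp add: m_assoc)
 then show ?thesis using mn(1) by (intro exI[of _ "n - m"]) simp
qed

lemma subgroup_inter: "subgroup K G ==> subgroup H G ==> subgroup (K \<inter> H) G"
 by (rule subgroups_Inter_pair)

lemma fin_idx_inter:
 assumes KM: "fin_idx K M" and H: "subgroup H G" "H <= M"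
 shows "fin_idx (K \<inter> H) H"
proof -
 have K: "subgroup K G" and fin: "finite ((%g. K #> g) ` M)" using KM by (auto simp: fin_idx_def)
 have Hc: "H <= carrier G" and Kc: "K <= carrier G" using H K subgroup.subset by auto
 have "(K \<inter> H) #> h = (K #> h) \<inter> H" if h: "h \<in> H" for h
 proof (intro equalityI subsetI)
  fix x assume "x \<in> (K \<inter> H) #> h"
  then show "x \<in> (K #> h) \<inter> H" using h H(1) by (auto simp: r_coset_def subgroup.m_closed)
 next
  fix x assume x: "x \<in> (K #> h) \<inter> H"
  then obtain k where k: "k \<in> K" "x = k \<otimes> h" by (auto simp: r_coset_def)
  then have "k = x \<otimes> inv h" using h Hc Kc by (auto simp: m_assoc subsetD)
  then have "k \<in> H" using x h H(1) by (simp add: subgroup.m_closed subgroup.m_inv_closed)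
  then show "x \<in> (K \<inter> H) #> h" using k by (auto simp: r_coset_def)
 qed
 then have "(%h. (K \<inter> H) #> h) ` H <= (%X. X \<inter> H) ` ((%g. K #> g) ` M)"
  using H(2) by (intro image_subsetI) (metis (no_types, lifting) image_eqI subsetD)
 then have "finite ((%h. (K \<inter> H) #> h) ` H)" by (rule finite_subset) (rule finite_imageI[OF fin])
 then show ?thesis using subgroup_inter[OF K H(1)] H by (auto simp: fin_idx_def)
qed

lemma fin_idx_trans:
 assumes KM: "fin_idx K M" and kML: "fin_idx M L"
 shows "fin_idx K L"
proof -
 obtain c where c: "finite (c ` M)" "!!g. g \<in> M ==> c g \<in> M & g \<otimes> inv (c g) \<in> K"
  using fin_idx_reps[OF KM] by metis
 obtain d where d: "finite (d ` L)" "!!g. g \<in> L ==> d g \<in> L & g \<otimes> inv (d g) \<in> M"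
  using fin_idx_reps[OF kML] by metis
 have K: "subgroup K G" and L: "subgroup L G" and KL: "K <= L" and mL: "M <= L" using KM kML by (auto simp: fin_idx_def)
 have Lc: "L <= carrier G" using L subgroup.subset by auto
 have "(%g. K #> g) ` L <= (%(x, y). K #> (x \<otimes> y)) ` (c ` M \<times> d ` L)"
 proof
  fix X assume "X \<in> (%g. K #> g) ` L"
  then obtain g where g: "g \<in> L" "X = K #> g" by auto
  define m where "m = g \<otimes> inv (d g)"
  have m: "m \<in> M" "d g \<in> L" using d(2)[OF g(1)] by (auto simp: m_def)
  have cc: "g \<in> carrier G" "d g \<in> carrier G" "c m \<in> carrier G" "m \<in> carrier G" using g m Lc mL c(2)[OF m(1)] by auto
  have "g \<otimes> inv (c m \<otimes> d g) = m \<otimes> inv (c m)" using cc by (simp add: m_def inv_mult_group m_assoc)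
  then have "X = K #> (c m \<otimes> d g)" using g(2) coset_eq_iff[OF K, of g "c m \<otimes> d g"] c(2)[OF m(1)] cc by simp
  then show "X \<in> (%(x, y). K #> (x \<otimes> y)) ` (c ` M \<times> d ` L)"
   using m(1) g(1) by (intro image_eqI[of _ _ "(c m, d g)"]) simp_all
 qed
 then have "finite ((%g. K #> g) ` L)" by (rule finite_subset) (use c(1) d(1) in simp)
 then show ?thesis using K L KL by (simp add: fin_idx_def)
qed

lemma fin_idx_between:
 assumes KM: "fin_idx K M" and K': "subgroup K' G" "K <= K'" "K' <= M"
 shows "fin_idx K' M"
proof -
 have K: "subgroup K G" and M: "subgroup M G" and fin: "finite ((%g. K #> g) ` M)" using KM by (auto simp: fin_idx_def)
 have Mc: "M <= carrier G" using M subgroup.subset by auto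
 have "K' #> g = (\<Union>x\<in>K #> g. K' #> x)" if g: "g \<in> M" for g
 proof -
  have "K' #> x = K' #> g" if "x \<in> K #> g" for x
  proof -
   obtain k where k: "k \<in> K" "x = k \<otimes> g" using \<open>x \<in> K #> g\<close> by (auto simp: r_coset_def)
   then have c: "k \<in> carrier G" "g \<in> carrier G" using K' g Mc by auto
   then have "x \<otimes> inv g = k" using k by (simp add: m_assoc)
   then show ?thesis using coset_eq_iff[OF K'(1), of x g] k c K' by auto
  qed
  moreover have "g \<in> K #> g" using rcos_self[OF _ K] g Mc by auto
  ultimately show ?thesis by blast
 qed
 then have "(%g. K' #> g) ` M <= (%X. \<Union>x\<in>X. K' #> x) ` ((%g. K #> g) ` M)" by auto
 then have "finite ((%g. K' #> g) ` M)" by (rule finite_subset) (rule finite_imageI[OF fin])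
 then show ?thesis using K' M by (simp add: fin_idx_def)
qed

lemma finite_index_iff: "finite_index G K \<longleftrightarrow> fin_idx K (carrier G)"
proof -
 have "rcosets K = (%g. K #> g) ` carrier G" by (auto simp: RCOSETS_def)
 then show ?thesis using subgroup_self subgroup.subset[of K G] by (auto simp: finite_index_def fin_idx_def)
qed

end

lemma (in comm_group) finite_generate_torsion:
 assumes "finite S" "S <= carrier G" "!!x. x \<in> S ==> \<exists>n > 0. x [^] (n :: nat) = \<one>"
 shows "finite (generate G S)"
 using assms
proof (induction S rule: finite_induct)
 case empty
 then show ?case by (simp add: generate_empty)
next
 case (insert x S)
 have S: "S <= carrier G" "x \<in> carrier G" using insert by auto
 obtain n :: nat where n: "n > 0" "x [^] n = \<one>" using insert.prems by auto
 have gS: "subgroup (generate G S) G" by (rule generate_is_subgroup[OF S(1)])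
 have gc: "generate G S <= carrier G" using gS subgroup.subset by auto
 define X where "X = {x [^] (i :: nat) \<otimes> y | i y. y \<in> generate G S}"
 have XI: "x [^] (i :: nat) \<otimes> y \<in> X" if "y \<in> generate G S" for i y using that by (auto simp: X_def)
 have mod: "x [^] (i :: nat) = x [^] (i mod n)" for i
 proof -
  have "x [^] i = x [^] (n * (i div n)) \<otimes> x [^] (i mod n)" using nat_pow_mult[OF S(2), of "n * (i div n)" "i mod n"] by simp
  moreover have "x [^] (n * (i div n)) = \<one>" using nat_pow_pow[OF S(2), of n "i div n"] n(2) by simp
  ultimately show ?thesis using S by simp
 qed
 have "X <= (%(i, y). x [^] i \<otimes> y) ` ({..<n} \<times> generate G S)"
 proof
  fix z assume "z \<in> X"
  then obtain i y where z: "z = x [^] (i :: nat) \<otimes> y" "y \<in> generate G S" by (auto simp: X_def)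
  then have "z = x [^] (i mod n) \<otimes> y" using mod by metis
  then show "z \<in> (%(i, y). x [^] i \<otimes> y) ` ({..<n} \<times> generate G S)" using z(2) n(1) by (intro image_eqI[of _ _ "(i mod n, y)"]) auto
 qed
 moreover have "finite (generate G S)" using insert by auto
 ultimately have fX: "finite X" using finite_subset by blast
 have gen1: "h \<in> X" if "h \<in> insert x S" for h
 proof (cases "h = x")
  case True
  then show ?thesis using XI[OF generate.one, where i = 1] S by simp
 next
  case False
  then have hS: "h \<in> S" using that by simp
  then show ?thesis using XI[OF generate.incl[where G = G and H = S, OF hS], where i = 0] S by auto
 qed
 have "generate G (insert x S) <= X"
 proof
  fix z assume "z \<in> generate G (insert x S)"
  then show "z \<in> X"
  proof (induction z rule: generate.induct)
   case one
   show ?case using XI[OF generate.one, where i = 0] by simp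
  next
   case (incl h)
   then show ?case by (rule gen1)
  next
   case (inv h)
   show ?case
   proof (cases "h = x")
    case True
    have "x [^] (n - 1) \<otimes> x = \<one>" using nat_pow_Suc[of x "n - 1"] n by simp
    then have "inv x = x [^] (n - 1)" using S by (intro inv_equality) auto
    then show ?thesis using XI[OF generate.one, where i = "n - 1"] S True by simp
   next
    case False
    then have hS: "h \<in> S" using inv by simp
    then show ?thesis using XI[OF generate.inv[where G = G and H = S, OF hS], where i = 0] S by auto
   qed
  next
   case (eng h1 h2)
   then obtain i j y z where h: "h1 = x [^] (i :: nat) \<otimes> y" "y \<in> generate G S" "h2 = x [^] (j :: nat) \<otimes> z" "z \<in> generate G S"
    by (auto simp: X_def)
   have c: "y \<in> carrier G" "z \<in> carrier G" using h gc by auto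
   have "h1 \<otimes> h2 = x [^] (i + j) \<otimes> (y \<otimes> z)" using h(1,3) c S by (simp add: nat_pow_mult[symmetric] m_ac)
   then show ?case using XI[OF generate.eng[OF h(2,4)]] by simp
  qed
 qed
 then show ?case using fX finite_subset by blast
qed

section \<open>Integral coordinates on a finite index subgroup\<close>

section \<open>Reduction to coordinates on a finite index subgroup\<close>

context group
begin

text \<open>By fullness, a multiple of each independent element of the quotient is represented in
  the single subgroup \<open>NN i\<close>, and a common multiple \<open>M\<close> works for all
  \<open>i\<close> and \<open>j\<close>. \<open>M0\<close> is the preimage of the free abelian group
  spanned by the \<open>M\<close>-fold elements and the \<open>\<tau> j\<close> are its coordinates.
  Its index is finite because a finitely generated torsion abelian group is finite.\<close>

lemma coab_exists:
 fixes NN :: "nat => 'a set"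
 assumes vc: "virtually_coabelian_of_corank G H r" and S: "gens (carrier G) S" and I: "finite I"
  and NN: "!!i. i \<in> I ==> subgroup (NN i) G"
  and nor: "!!i x y. i \<in> I ==> x \<in> carrier G ==> y \<in> NN i ==> inv x \<otimes> y \<otimes> x \<in> NN i"
  and comm: "!!i i' x y. i \<in> I ==> i' \<in> I ==> i ~= i' ==> x \<in> NN i ==> y \<in> NN i' ==> x \<otimes> y = y \<otimes> x"
  and full: "!!i. i \<in> I ==> fin_idx (NN i <#> H) (carrier G)"
 shows "\<exists>M0 \<tau> t. coab G M0 \<tau> r t I & (\<forall>i\<in>I. \<forall>j<r. t i j \<in> NN i) & fin_idx M0 (carrier G) &
  fin_idx (coab.level M0 \<tau> r) H & coab.level M0 \<tau> r = M0 \<inter> H"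
proof -
 obtain G' where H: "subgroup H G" and fi: "fin_idx G' (carrier G)" and der: "derived G G' <= H"
  and dim: "has_rational_dim (G\<lparr>carrier := G'\<rparr> Mod (G' \<inter> H)) r"
  using vc by (auto simp: virtually_coabelian_of_corank_def finite_index_iff)
 have G': "subgroup G' G" using fi by (simp add: fin_idx_def)
 have G'c: "G' <= carrier G" and Hc: "H <= carrier G" using G' H subgroup.subset by auto
 define H0 where "H0 = G' \<inter> H"
 have H0: "subgroup H0 G" unfolding H0_def by (rule subgroup_inter[OF G' H])
 define G1 where "G1 = G\<lparr>carrier := G'\<rparr>"
 interpret G1: group G1 unfolding G1_def by (rule subgroup_imp_group[OF G'])
 have G1s: "carrier G1 = G'" "!!x y. x \<otimes>\<^bsub>G1\<^esub> y = x \<otimes> y" "\<one>\<^bsub>G1\<^esub> = \<one>" by (simp_all add: G1_def)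
 have G1i: "inv\<^bsub>G1\<^esub> x = inv x" if "x \<in> G'" for x unfolding G1_def by (rule m_inv_consistent[OF G' that])
 have G1p: "x [^]\<^bsub>G1\<^esub> (k :: int) = x [^] k" if "x \<in> G'" for x k unfolding G1_def using int_pow_consistent[OF G' that] by simp
 have cm: "x \<otimes> y \<otimes> inv x \<otimes> inv y \<in> H0" if "x \<in> G'" "y \<in> G'" for x y
 proof -
  have "x \<otimes> y \<otimes> inv x \<otimes> inv y \<in> derived G G'"
   unfolding derived_def using that by (intro generate.incl) blast
  moreover have "x \<otimes> y \<otimes> inv x \<otimes> inv y \<in> G'" using that G' by (simp add: subgroup.m_closed subgroup.m_inv_closed)
  ultimately show ?thesis using der by (auto simp: H0_def)
 qed
 have H01: "subgroup H0 G1"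
  unfolding G1_def by (rule subgroup_incl[OF H0 G']) (simp add: H0_def)
 have "H0 \<lhd> G1"
  unfolding G1.normal_inv_iff
 proof (intro conjI ballI H01)
  fix x h assume xh: "x \<in> carrier G1" "h \<in> H0"
  then have m: "x \<in> G'" "h \<in> G'" by (auto simp: G1s H0_def)
  then have c: "x \<in> carrier G" "h \<in> carrier G" using G'c by auto
  have "x \<otimes> h \<otimes> inv x = (x \<otimes> h \<otimes> inv x \<otimes> inv h) \<otimes> h" using c by (simp add: m_assoc)
  also have "... \<in> H0" using cm[OF m] xh(2) H0 subgroup.m_closed by metis
  finally show "x \<otimes>\<^bsub>G1\<^esub> h \<otimes>\<^bsub>G1\<^esub> inv\<^bsub>G1\<^esub> x \<in> H0" using G1i[OF m(1)] by (simp add: G1s)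
 qed
 then interpret N: normal H0 G1 .
 define A where "A = G1 Mod H0"
 define q where "q x = H0 #> x" for x
 have q1: "H0 #>\<^bsub>G1\<^esub> x = q x" for x by (simp add: q_def r_coset_def G1s)
 have Ac: "carrier A = q ` G'" by (auto simp: A_def carrier_FactGroup q1 G1s)
 have qm: "q x \<otimes>\<^bsub>A\<^esub> q y = q (x \<otimes> y)" if "x \<in> G'" "y \<in> G'" for x y
  using N.rcos_sum[of x y] that by (simp add: A_def FactGroup_def q1 G1s)
 have AG: "group A" unfolding A_def by (rule N.factorgroup_is_group)
 have qeq: "q x = q y \<longleftrightarrow> x \<otimes> inv y \<in> H0" if "x \<in> G'" "y \<in> G'" for x y
  unfolding q_def by (rule coset_eq_iff[OF H0]) (use that G'c in auto)
 have A1: "\<one>\<^bsub>A\<^esub> = q \<one>" using coset_mult_one[of H0] subgroup.subset[OF H0] by (simp add: A_def FactGroup_def q_def)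
 have "comm_group A"
 proof (rule group.group_comm_groupI[OF AG])
  fix X Y assume "X \<in> carrier A" "Y \<in> carrier A"
  then obtain x y where xy: "x \<in> G'" "y \<in> G'" "X = q x" "Y = q y" by (auto simp: Ac)
  have c: "x \<in> carrier G" "y \<in> carrier G" using xy G'c by auto
  have "(x \<otimes> y) \<otimes> inv (y \<otimes> x) = x \<otimes> y \<otimes> inv x \<otimes> inv y" using c by (simp add: inv_mult_group m_assoc)
  then show "X \<otimes>\<^bsub>A\<^esub> Y = Y \<otimes>\<^bsub>A\<^esub> X"
   using cm[OF xy(1,2)] xy qm qeq[of "x \<otimes> y" "y \<otimes> x"] subgroup.m_closed[OF G'] by simp
 qed
 then interpret A: comm_group A .
 interpret qh: group_hom G1 A q
  by unfold_locales (auto simp: hom_def Ac G1s qm)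
 have qp: "q (x [^] (k :: int)) = q x [^]\<^bsub>A\<^esub> k" if "x \<in> G'" for x k
  using qh.hom_int_pow[of x k] G1p[OF that] that by (simp add: G1s)
 have pG: "x [^] (k :: int) \<in> G'" if "x \<in> G'" for x k using G' that subgroup_int_pow_closed by blast
 have "has_rational_dim A r" using dim by (simp add: A_def G1_def H0_def)
 from rational_dim_independent[OF A.comm_group_axioms this] obtain a :: "nat => 'a set" where
  a: "\<forall>j<r. a j \<in> carrier A"
  and ind: "\<forall>k :: nat => int. finprod A (%j. a j [^]\<^bsub>A\<^esub> k j) {..<r} = \<one>\<^bsub>A\<^esub> --> (\<forall>j<r. k j = 0)"
  and cof: "\<forall>x\<in>carrier A. \<exists>N > 0. \<exists>k :: nat => int. x [^]\<^bsub>A\<^esub> (N :: nat) = finprod A (%j. a j [^]\<^bsub>A\<^esub> k j) {..<r}"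
  by blast
 have "\<forall>j. \<exists>g. j < r --> g \<in> G' & q g = a j" using a by (fastforce simp: Ac image_iff)
 then obtain g where g: "!!j. j < r ==> g j \<in> G' & q (g j) = a j" by metis
 \<comment> \<open>Some power of \<open>g j\<close> is \<open>\<gamma> \<otimes> h\<close> with
   \<open>\<gamma>\<close> in \<open>NN i\<close> and \<open>h\<close> in \<open>H\<close>. A
   further power brings the \<open>H\<close>-part into \<open>G'\<close>, hence into
   \<open>H0\<close>, while normality keeps the other part in \<open>NN i\<close>; modulo
   \<open>H0\<close> only the latter remains.\<close>
 have "\<exists>m \<gamma>. i \<in> I & j < r --> m > 0 & \<gamma> \<in> NN i & \<gamma> \<in> G' & q \<gamma> = a j [^]\<^bsub>A\<^esub> (int m)" for i j
 proof (cases "i \<in> I & j < r")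
  case True
  then have i: "i \<in> I" and j: "j < r" by auto
  have gc: "g j \<in> carrier G" using g[OF j] G'c by auto
  obtain m1 where m1: "m1 > 0" "g j [^] (m1 :: nat) \<in> NN i <#> H" using fin_idx_power[OF full[OF i] gc] by blast
  then obtain \<gamma> h where gh: "\<gamma> \<in> NN i" "h \<in> H" "g j [^] m1 = \<gamma> \<otimes> h" by (auto simp: set_mult_def)
  have hc: "h \<in> carrier G" and \<gamma>c: "\<gamma> \<in> carrier G" using gh Hc NN[OF i] subgroup.subset by blast+
  obtain m2 where m2: "m2 > 0" "h [^] (m2 :: nat) \<in> G'" using fin_idx_power[OF fi hc] by blast
  have "\<exists>\<gamma>'\<in>NN i. (\<gamma> \<otimes> h) [^] n = \<gamma>' \<otimes> h [^] n" for n :: nat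
  proof (induction n)
   case 0
   show ?case using NN[OF i] subgroup.one_closed by (intro bexI[of _ \<one>]) auto
  next
   case (Suc n)
   then obtain \<gamma>' where g': "\<gamma>' \<in> NN i" "(\<gamma> \<otimes> h) [^] n = \<gamma>' \<otimes> h [^] n" by blast
   have g'c: "\<gamma>' \<in> carrier G" using g' NN[OF i] subgroup.subset by blast
   have n1: "inv (inv (h [^] n)) \<otimes> \<gamma> \<otimes> inv (h [^] n) \<in> NN i" using nor[OF i _ gh(1), of "inv (h [^] n)"] hc by simp
   have "(\<gamma> \<otimes> h) [^] Suc n = \<gamma>' \<otimes> (inv (inv (h [^] n)) \<otimes> \<gamma> \<otimes> inv (h [^] n)) \<otimes> h [^] Suc n"
    using g' g'c hc \<gamma>c by (simp add: group_simps)
   then show ?case using subgroup.m_closed[OF NN[OF i] g'(1) n1] by blast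
  qed
  then obtain \<gamma>' where g': "\<gamma>' \<in> NN i" "(\<gamma> \<otimes> h) [^] m2 = \<gamma>' \<otimes> h [^] m2" by blast
  have g'c: "\<gamma>' \<in> carrier G" using g' NN[OF i] subgroup.subset by blast
  have e: "g j [^] (int (m1 * m2)) = \<gamma>' \<otimes> h [^] m2"
   using g'(2) gh(3) nat_pow_pow[OF gc, of m1 m2] by (simp add: int_pow_int del: of_nat_mult)
  have hm: "h [^] m2 \<in> H0"
  proof -
   have "h [^] n \<in> H" for n :: nat using gh(2) H by (induction n) (auto simp: subgroup.one_closed subgroup.m_closed)
   then show ?thesis using m2 by (simp add: H0_def)
  qed
  have eg: "\<gamma>' = g j [^] (int (m1 * m2)) \<otimes> inv (h [^] m2)" unfolding e using g'c hc by (simp add: m_assoc)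
  have gG: "\<gamma>' \<in> G'" unfolding eg using pG[of "g j" "int (m1 * m2)"] g[OF j] m2(2) G' by (simp add: subgroup.m_closed subgroup.m_inv_closed)
  have "q (g j [^] (int (m1 * m2))) = q \<gamma>'"
  proof -
   have "(g j [^] (int (m1 * m2))) \<otimes> inv \<gamma>' = \<gamma>' \<otimes> h [^] m2 \<otimes> inv \<gamma>' \<otimes> inv (h [^] m2) \<otimes> h [^] m2"
    unfolding e using g'c hc by (simp add: m_assoc)
   also have "... \<in> H0" using cm[OF gG m2(2)] hm H0 subgroup.m_closed by metis
   finally show ?thesis using qeq[OF pG gG] g[OF j] by simp
  qed
  then have "q \<gamma>' = a j [^]\<^bsub>A\<^esub> (int (m1 * m2))" using qp[of "g j"] g[OF j] by simp
  then show ?thesis using m1(1) m2(1) g'(1) gG by (intro exI[of _ "m1 * m2"] exI[of _ \<gamma>']) simp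
 qed auto
 then obtain mm \<gamma> where mg: "!!i j. i \<in> I ==> j < r ==> mm i j > 0 & \<gamma> i j \<in> NN i & \<gamma> i j \<in> G' & q (\<gamma> i j) = a j [^]\<^bsub>A\<^esub> (int (mm i j))"
  by metis
 \<comment> \<open>A common multiple, so that \<open>t i j\<close> represents the same class
   \<open>b j\<close> for every \<open>i\<close>.\<close>
 define M where "M = (\<Prod>x\<in>I \<times> {..<r}. mm (fst x) (snd x))"
 have M: "M > 0" unfolding M_def using mg by (intro prod_pos) auto
 have Md: "mm i j dvd M" if "i \<in> I" "j < r" for i j
  unfolding M_def using dvd_prodI[of "I \<times> {..<r}" "(i, j)" "%x. mm (fst x) (snd x)"] that I by auto
 define t where "t i j = \<gamma> i j [^] (int (M div mm i j))" for i j
 define b where "b j = a j [^]\<^bsub>A\<^esub> (int M)" for j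
 have bc: "b j \<in> carrier A" if "j < r" for j using a that by (simp add: b_def)
 have tN: "t i j \<in> NN i" "t i j \<in> G'" "q (t i j) = b j" if "i \<in> I" "j < r" for i j
 proof -
  show "t i j \<in> NN i" "t i j \<in> G'" using mg[OF that] pG NN[OF that(1)] subgroup_int_pow_closed by (auto simp: t_def)
  have "q (t i j) = (a j [^]\<^bsub>A\<^esub> (int (mm i j))) [^]\<^bsub>A\<^esub> (int (M div mm i j))" using qp mg[OF that] by (simp add: t_def)
  also have "... = a j [^]\<^bsub>A\<^esub> (int (mm i j) * int (M div mm i j))" using a that A.int_pow_pow by simp
  also have "int (mm i j) * int (M div mm i j) = int M" using Md[OF that] by (metis dvd_mult_div_cancel of_nat_mult)
  finally show "q (t i j) = b j" by (simp add: b_def)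
 qed
 \<comment> \<open>The homomorphism from \<open>Z^r\<close> to \<open>A\<close> given by the
   \<open>b j\<close>; independence makes it injective in the entries below
   \<open>r\<close>.\<close>
 define P where "P k = finprod A (%j. b j [^]\<^bsub>A\<^esub> k j) {..<r}" for k :: "nat => int"
 have Pc: "P k \<in> carrier A" for k unfolding P_def using bc by (intro A.finprod_closed) auto
 have Padd: "P (%j. k j + l j) = P k \<otimes>\<^bsub>A\<^esub> P l" for k l
 proof -
  have "P (%j. k j + l j) = finprod A (%j. b j [^]\<^bsub>A\<^esub> k j \<otimes>\<^bsub>A\<^esub> b j [^]\<^bsub>A\<^esub> l j) {..<r}"
   unfolding P_def by (rule A.finprod_cong') (use bc A.int_pow_mult in auto)
  then show ?thesis unfolding P_def using bc by (simp add: A.finprod_multf Pi_iff)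
 qed
 have P0: "P (%_. 0) = \<one>\<^bsub>A\<^esub>" by (simp add: P_def)
 have Pneg: "P (%j. - k j) = inv\<^bsub>A\<^esub> (P k)" for k
 proof -
  have "P (%j. - k j) \<otimes>\<^bsub>A\<^esub> P k = \<one>\<^bsub>A\<^esub>" using Padd[of "%j. - k j" k] P0 by simp
  then show ?thesis using A.inv_equality[OF _ Pc Pc] by simp
 qed
 have Pinj: "\<forall>j<r. k j = l j" if "P k = P l" for k l
 proof -
  have 1: "P (%j. k j + - l j) = \<one>\<^bsub>A\<^esub>" using Padd[of k "%j. - l j"] Pneg[of l] that Pc[of l] by simp
  have 2: "P (%j. k j + - l j) = finprod A (%j. a j [^]\<^bsub>A\<^esub> (int M * (k j + - l j))) {..<r}"
   unfolding P_def by (rule A.finprod_cong') (use a A.int_pow_pow in \<open>auto simp: b_def\<close>)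
  have "\<forall>j<r. int M * (k j + - l j) = 0" by (rule ind[THEN spec, THEN mp, of "%j. int M * (k j + - l j)", OF HOL.trans[OF 2[symmetric] 1]])
  then show ?thesis using M by simp
 qed
 have Pcong: "P k = P l" if "\<forall>j<r. k j = l j" for k l
  unfolding P_def by (rule A.finprod_cong') (use that bc in auto)
 \<comment> \<open>The preimage in \<open>G'\<close> of the image of \<open>P\<close>. The choice
   made in \<open>\<kappa>\<close> is harmless, since \<open>Pinj\<close> determines the entries
   below \<open>r\<close>.\<close>
 define M0 where "M0 = {x \<in> G'. \<exists>k. q x = P k}"
 define \<kappa> where "\<kappa> x = (SOME k. q x = P k)" for x
 define \<tau> where "\<tau> j x = \<kappa> x j" for j x
 have \<kappa>: "q x = P (\<kappa> x)" if "x \<in> M0" for x using someI_ex[of "%k. q x = P k"] that by (auto simp: \<kappa>_def M0_def)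
 have \<tau>I: "\<tau> j x = k j" if "x \<in> M0" "q x = P k" "j < r" for x k j using Pinj[of "\<kappa> x" k] \<kappa>[OF that(1)] that by (simp add: \<tau>_def)
 have M0G: "M0 <= G'" by (auto simp: M0_def)
 have q_inv: "q (inv x) = inv\<^bsub>A\<^esub> (q x)" if "x \<in> G'" for x using qh.hom_inv[of x] that G1i by (simp add: G1s)
 have M0s: "subgroup M0 G"
 proof (rule subgroupI)
  show "M0 <= carrier G" using M0G G'c by auto
  have "\<one> \<in> M0" using A1 P0 G' subgroup.one_closed by (auto simp: M0_def intro!: exI[of _ "%_. 0"])
  then show "M0 ~= {}" by auto
  show "inv x \<in> M0" if "x \<in> M0" for x
  proof -
   have x: "x \<in> G'" using that M0G by auto
   have "q (inv x) = P (%j. - \<kappa> x j)" using q_inv[OF x] \<kappa>[OF that] Pneg by simp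
   then show ?thesis using x G' subgroup.m_inv_closed by (auto simp: M0_def)
  qed
  show "x \<otimes> y \<in> M0" if "x \<in> M0" "y \<in> M0" for x y
  proof -
   have xy: "x \<in> G'" "y \<in> G'" using that M0G by auto
   have "q (x \<otimes> y) = P (%j. \<kappa> x j + \<kappa> y j)" using qm[OF xy] \<kappa>[OF that(1)] \<kappa>[OF that(2)] Padd by simp
   then show ?thesis using xy G' subgroup.m_closed by (auto simp: M0_def)
  qed
 qed
 have tP: "q (t i j) = P (%l. if l = j then 1 else 0)" if "i \<in> I" "j < r" for i j
 proof -
  have "P (%l. if l = j then 1 else 0) = finprod A (%l. if j = l then b l else \<one>\<^bsub>A\<^esub>) {..<r}"
   unfolding P_def by (rule A.finprod_cong') (use bc in auto)
  also have "... = b j" by (rule A.finprod_singleton) (use bc that in auto)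
  finally show ?thesis using tN(3)[OF that] by simp
 qed
 have tM0: "t i j \<in> M0" if "i \<in> I" "j < r" for i j using tP[OF that] tN(2)[OF that] by (auto simp: M0_def)
 have co: "coab G M0 \<tau> r t I"
 proof (rule coab.intro[OF group_axioms], rule coab_axioms.intro)
  show "subgroup M0 G" by (rule M0s)
  show "\<tau> j (x \<otimes> y) = \<tau> j x + \<tau> j y" if "j < r" "x \<in> M0" "y \<in> M0" for j x y
  proof -
   have "q (x \<otimes> y) = P (%j. \<kappa> x j + \<kappa> y j)" using qm[of x y] M0G \<kappa>[OF that(2)] \<kappa>[OF that(3)] Padd that by auto
   then show ?thesis using \<tau>I[of "x \<otimes> y" _ j] subgroup.m_closed[OF M0s that(2,3)] that(1) by (simp add: \<tau>_def)
  qed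
  show "t i j \<in> M0" if "i \<in> I" "j < r" for i j by (rule tM0[OF that])
  show "\<tau> k (t i j) = (if k = j then 1 else 0)" if "i \<in> I" "j < r" "k < r" for i j k
   using \<tau>I[OF tM0[OF that(1,2)] tP[OF that(1,2)] that(3)] by simp
  show "(inv x \<otimes> t i j \<otimes> x) \<otimes> (inv y \<otimes> t i' j' \<otimes> y) = (inv y \<otimes> t i' j' \<otimes> y) \<otimes> (inv x \<otimes> t i j \<otimes> x)"
   if "i \<in> I" "i' \<in> I" "i ~= i'" "j < r" "j' < r" "x \<in> M0" "y \<in> M0" for i i' j j' x y
  proof -
   have c: "x \<in> carrier G" "y \<in> carrier G" using that M0G G'c by auto
   show ?thesis
    by (rule comm[OF that(1-3) nor[OF that(1) c(1) tN(1)[OF that(1,4)]] nor[OF that(2) c(2) tN(1)[OF that(2,5)]]])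
  qed
 qed
 then interpret C: coab G M0 \<tau> r t I .
 have lev: "C.level r = H0"
 proof (intro equalityI subsetI)
  fix x assume x: "x \<in> C.level r"
  then have xM: "x \<in> M0" and x0: "\<forall>j<r. \<tau> j x = 0" by (auto simp: C.level_def)
  have "P (\<kappa> x) = P (%_. 0)" by (rule Pcong) (use x0 in \<open>simp add: \<tau>_def\<close>)
  then have "q x = q \<one>" using \<kappa>[OF xM] P0 A1 by simp
  moreover have xG: "x \<in> G'" using xM M0G by auto
  ultimately have "x \<otimes> inv \<one> \<in> H0" using qeq[OF xG subgroup.one_closed[OF G']] by blast
  then show "x \<in> H0" using xG G'c by (simp add: subsetD)
 next
  fix x assume x: "x \<in> H0"
  then have xG: "x \<in> G'" by (simp add: H0_def)
  have "q x = P (%_. 0)" using qeq[OF xG subgroup.one_closed[OF G']] x xG G'c P0 A1 by auto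
  moreover from this have "x \<in> M0" using xG by (auto simp: M0_def)
  ultimately show "x \<in> C.level r" using \<tau>I by (auto simp: C.level_def)
 qed
 have H0M0: "H0 <= M0" using lev C.level_M0 by auto
 \<comment> \<open>The quotient of \<open>G'\<close> by \<open>M0\<close> is abelian and generated
   by finitely many elements of finite order: a power of each generator lies in the span of the
   \<open>a j\<close>, and the \<open>M\<close>-th power of that lies in the image of
   \<open>P\<close>.\<close>
 have fM0: "fin_idx M0 (carrier G)"
 proof (rule fin_idx_trans[OF _ fi])
  obtain S' where S': "gens G' S'" using gens_fin_idx[OF fi S] by blast
  have S'f: "finite S'" "S' <= G'" using S' by (auto simp: gens_def)
  have M01: "subgroup M0 G1" unfolding G1_def by (rule subgroup_incl[OF M0s G' M0G])
  have "M0 \<lhd> G1"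
   unfolding G1.normal_inv_iff
  proof (intro conjI ballI M01)
   fix x h assume xh: "x \<in> carrier G1" "h \<in> M0"
   then have m: "x \<in> G'" "h \<in> G'" using M0G by (auto simp: G1s)
   then have c: "x \<in> carrier G" "h \<in> carrier G" using G'c by auto
   have "x \<otimes> h \<otimes> inv x = (x \<otimes> h \<otimes> inv x \<otimes> inv h) \<otimes> h" using c by (simp add: m_assoc)
   also have "... \<in> M0" using cm[OF m] xh(2) H0M0 subgroup.m_closed[OF M0s] by blast
   finally show "x \<otimes>\<^bsub>G1\<^esub> h \<otimes>\<^bsub>G1\<^esub> inv\<^bsub>G1\<^esub> x \<in> M0" using G1i[OF m(1)] by (simp add: G1s)
  qed
  then interpret N0: normal M0 G1 .
  define B where "B = G1 Mod M0"
  define p where "p x = M0 #> x" for x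
  have p1: "M0 #>\<^bsub>G1\<^esub> x = p x" for x by (simp add: p_def r_coset_def G1s)
  have Bc: "carrier B = p ` G'" by (auto simp: B_def carrier_FactGroup p1 G1s)
  have pm: "p x \<otimes>\<^bsub>B\<^esub> p y = p (x \<otimes> y)" if "x \<in> G'" "y \<in> G'" for x y
   using N0.rcos_sum[of x y] that by (simp add: B_def FactGroup_def p1 G1s)
  have BG: "group B" unfolding B_def by (rule N0.factorgroup_is_group)
  have peq: "p x = p y \<longleftrightarrow> x \<otimes> inv y \<in> M0" if "x \<in> G'" "y \<in> G'" for x y
   unfolding p_def by (rule coset_eq_iff[OF M0s]) (use that G'c in auto)
  have B1: "\<one>\<^bsub>B\<^esub> = p \<one>" using coset_mult_one[of M0] subgroup.subset[OF M0s] by (simp add: B_def FactGroup_def p_def)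
  have "comm_group B"
  proof (rule group.group_comm_groupI[OF BG])
   fix X Y assume "X \<in> carrier B" "Y \<in> carrier B"
   then obtain x y where xy: "x \<in> G'" "y \<in> G'" "X = p x" "Y = p y" by (auto simp: Bc)
   have c: "x \<in> carrier G" "y \<in> carrier G" using xy G'c by auto
   have "(x \<otimes> y) \<otimes> inv (y \<otimes> x) = x \<otimes> y \<otimes> inv x \<otimes> inv y" using c by (simp add: inv_mult_group m_assoc)
   then show "X \<otimes>\<^bsub>B\<^esub> Y = Y \<otimes>\<^bsub>B\<^esub> X"
    using cm[OF xy(1,2)] xy pm peq[of "x \<otimes> y" "y \<otimes> x"] subgroup.m_closed[OF G'] H0M0 by auto
  qed
  then interpret B: comm_group B .
  interpret ph: group_hom G1 B p
   by unfold_locales (auto simp: hom_def Bc G1s pm)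
  have tor: "\<exists>n>0. X [^]\<^bsub>B\<^esub> (n :: nat) = \<one>\<^bsub>B\<^esub>" if "X \<in> p ` S'" for X
  proof -
   obtain x where x: "x \<in> S'" "X = p x" "x \<in> G'" using \<open>X \<in> p ` S'\<close> S'f by auto
   have "q x \<in> carrier A" using x(3) by (auto simp: Ac)
   from cof[THEN bspec, OF this] obtain N and k :: "nat => int" where N: "N > 0" "q x [^]\<^bsub>A\<^esub> (N :: nat) = finprod A (%j. a j [^]\<^bsub>A\<^esub> k j) {..<r}"
    by blast
   have fc: "(%j. a j [^]\<^bsub>A\<^esub> k j) \<in> {..<r} \<rightarrow> carrier A" by (intro Pi_I A.int_pow_closed) (simp add: a)
   have pw: "finprod A f {..<n} [^]\<^bsub>A\<^esub> M = finprod A (%j. f j [^]\<^bsub>A\<^esub> M) {..<n}" if "f \<in> {..<n} \<rightarrow> carrier A" for f and n :: nat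
    using that
   proof (induction n)
    case (Suc n)
    have "finprod A f {..<n} \<in> carrier A" "(%j. f j [^]\<^bsub>A\<^esub> M) \<in> {..<n} \<rightarrow> carrier A" "f \<in> {..<n} \<rightarrow> carrier A" "f n \<in> carrier A"
     using Suc.prems by (auto simp: Pi_iff)
    then show ?case using Suc.IH by (simp add: lessThan_Suc A.nat_pow_distrib)
   qed simp
   have "q x [^]\<^bsub>A\<^esub> (int (N * M)) = (q x [^]\<^bsub>A\<^esub> N) [^]\<^bsub>A\<^esub> M"
    using x(3) by (simp add: int_pow_int A.nat_pow_pow Ac del: of_nat_mult)
   also have "... = finprod A (%j. (a j [^]\<^bsub>A\<^esub> k j) [^]\<^bsub>A\<^esub> M) {..<r}" unfolding N(2) by (rule pw[OF fc])
   also have "... = P k" unfolding P_def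
   proof (rule A.finprod_cong')
    fix j assume "j \<in> {..<r}"
    then have "a j \<in> carrier A" using a by auto
    then show "(a j [^]\<^bsub>A\<^esub> k j) [^]\<^bsub>A\<^esub> M = b j [^]\<^bsub>A\<^esub> k j"
     by (simp add: b_def A.int_pow_pow int_pow_int[symmetric] mult.commute)
   qed (use bc in auto)
   finally have "q (x [^] int (N * M)) = P k" using qp[OF x(3)] by simp
   then have "x [^] int (N * M) \<in> M0" using pG[OF x(3)] by (auto simp: M0_def)
   then have "p (x [^] int (N * M)) = \<one>\<^bsub>B\<^esub>" using peq[OF pG[OF x(3)] subgroup.one_closed[OF G']] B1 x G'c by auto
   moreover have "p (x [^] int (N * M)) = X [^]\<^bsub>B\<^esub> int (N * M)"
    using ph.hom_int_pow[of x "int (N * M)"] G1p[OF x(3)] x by (simp add: G1s)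
   ultimately have "X [^]\<^bsub>B\<^esub> (N * M) = \<one>\<^bsub>B\<^esub>" by (simp add: int_pow_int del: of_nat_mult)
   then show ?thesis using N(1) M by (intro exI[of _ "N * M"]) simp
  qed
  have fg: "finite (generate B (p ` S'))"
   by (rule B.finite_generate_torsion) (use S'f tor in \<open>auto simp: Bc\<close>)
  have gsub: "subgroup (generate B (p ` S')) B" by (rule B.generate_is_subgroup) (use S'f in \<open>auto simp: Bc\<close>)
  have "p (ev w) \<in> generate B (p ` S')" if "w \<in> words S'" for w
   using that
  proof (induction w)
   case Nil
   then show ?case using B1 generate.one[of B] by simp
  next
   case (Cons l w)
   have l: "fst l \<in> S'" "fst l \<in> G'" "w \<in> words S'" using Cons.prems S'f by auto
   have lv: "letter_val G l \<in> G'" using l G' by (auto simp: letter_val_def subgroup.m_inv_closed)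
   have w: "ev w \<in> G'" by (rule ev_in_subgroup[OF G' words_mono[OF S'f(2) l(3)]])
   have 1: "p (fst l) \<in> generate B (p ` S')" using l by (auto intro: generate.incl)
   have "p (inv (fst l)) = inv\<^bsub>B\<^esub> p (fst l)" using ph.hom_inv[of "fst l"] l G1i by (simp add: G1s)
   then have "p (letter_val G l) \<in> generate B (p ` S')"
    using 1 gsub by (auto simp: letter_val_def subgroup.m_inv_closed)
   then have "p (letter_val G l) \<otimes>\<^bsub>B\<^esub> p (ev w) \<in> generate B (p ` S')"
    by (rule subgroup.m_closed[OF gsub _ Cons.IH[OF l(3)]])
   then show ?case unfolding pm[OF lv w] eval_word_Cons .
  qed
  then have "p ` G' <= generate B (p ` S')" using S' by (auto simp: gens_def)
  then have "finite (p ` G')" by (rule finite_subset[OF _ fg])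
  then show "fin_idx M0 G'" using M0s G' M0G by (simp add: fin_idx_def p_def)
 qed
 have "fin_idx H0 H" using fin_idx_inter[OF fi H Hc] by (simp add: H0_def)
 moreover have "H0 = M0 \<inter> H" using H0M0 M0G by (auto simp: H0_def)
 ultimately show ?thesis using co tN(1) fM0 lev by (intro exI[of _ M0] exI[of _ \<tau>] exI[of _ t]) auto
qed

end

section \<open>Products of commuting subgroups\<close>

section \<open>Commuting products\<close>

context group
begin

lemma gens_overgroup:
 assumes KM: "fin_idx K M" and T: "gens K T"
 shows "\<exists>S. gens M S"
proof -
 have M: "subgroup M G" and KsM: "K <= M" using KM by (auto simp: fin_idx_def)
 have Mc: "M <= carrier G" using M subgroup.subset by auto
 obtain c where c: "finite (c ` M)" "!!g. g \<in> M ==> c g \<in> M & g \<otimes> inv (c g) \<in> K"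
  using fin_idx_reps[OF KM] by metis
 have "\<exists>w\<in>words (T \<union> c ` M). ev w = g" if g: "g \<in> M" for g
 proof -
  obtain w where w: "w \<in> words T" "ev w = g \<otimes> inv (c g)" using T c(2)[OF g] by (auto simp: gens_def)
  have cc: "c g \<in> carrier G" "g \<in> carrier G" "w \<in> words (carrier G)" using c(2)[OF g] g Mc gens_words[OF T w(1)] by auto
  have "ev (w @ [(c g, True)]) = g" using w cc by (simp add: eval_word_Cons letter_val_def m_assoc)
  moreover have "w @ [(c g, True)] \<in> words (T \<union> c ` M)" using words_mono[of T "T \<union> c ` M" w] w g by simp
  ultimately show ?thesis by blast
 qed
 moreover have "finite (T \<union> c ` M)" "T \<union> c ` M <= M" using T c KsM by (auto simp: gens_def)
 ultimately have "gens M (T \<union> c ` M)" using M by (simp add: gens_def)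
 then show ?thesis by blast
qed

lemma finite_generating_set_iff: "subgroup H G ==> finite_generating_set (G\<lparr>carrier := H\<rparr>) S \<longleftrightarrow> gens H S"
proof -
 assume H: "subgroup H G"
 interpret H: group "G\<lparr>carrier := H\<rparr>" by (rule subgroup.subgroup_is_group[OF H is_group])
 have a: "generate (G\<lparr>carrier := H\<rparr>) S = ev ` words S" if "S <= H"
  using H.generate_eq_ev[of S] that eval_word_subgroup[OF H] words_mono[OF that] by (simp add: image_def)
 have b: "ev ` words S <= H" if "S <= H" using ev_in_subgroup[OF H] words_mono[OF that] by blast
 have c: "H <= ev ` words S \<longleftrightarrow> (\<forall>k\<in>H. \<exists>w\<in>words S. ev w = k)"
  by (simp add: subset_iff image_iff Ball_def Bex_def eq_commute)
 have "generate (G\<lparr>carrier := H\<rparr>) S = H \<longleftrightarrow> (\<forall>k\<in>H. \<exists>w\<in>words S. ev w = k)" if "S <= H"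
  unfolding a[OF that] set_eq_subset[of "ev ` words S"] using b[OF that] c by simp
 then show ?thesis using H unfolding finite_generating_set_def gens_def by (cases "S <= H") simp_all
qed

lemma finite_generating_set_carrier: "finite_generating_set G S \<longleftrightarrow> gens (carrier G) S"
 using finite_generating_set_iff[OF subgroup_self, of S] by (simp add: finite_generating_set_def generate_eq_ev
  gens_def subgroup_self)

lemma fill_move_letter:
 assumes "w \<in> words S" "l \<in> set [l]" "fst l \<in> S" "S <= carrier G"
  "!!x. x \<in> set w ==> letter_val G l \<otimes> letter_val G x = letter_val G x \<otimes> letter_val G l"
  "g \<in> carrier G" "!!u. u \<in> words S ==> length u <= length w ==> g \<otimes> ev u \<in> V"
 shows "fill G S 4 V g (length w) (l # w) (w @ [l])"
 using assms(1,5-7)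
proof (induction w arbitrary: g)
 case Nil
 then show ?case using assms(3) by (auto intro: fill.refl)
next
 case (Cons x w)
 have x: "fst x \<in> S" "w \<in> words S" "fst x \<in> carrier G" "fst l \<in> carrier G" using Cons.prems assms(3,4) by auto
 have lc: "letter_val G x \<in> carrier G" "letter_val G l \<in> carrier G" using x by (auto simp: letter_val_def)
 have e: "ev [l, x] = ev [x, l]" using Cons.prems(2)[of x] lc by (simp add: eval_word_Cons)
 have gV: "g \<in> V" using Cons.prems(4)[of "[]"] Cons.prems(3) by simp
 have 1: "fill G S 4 V g 1 [l, x] [x, l]"
  by (rule fill_repl) (use x e gV Cons.prems(3) assms(3,4) in auto)
 have 2: "fill G S 4 V (g \<otimes> ev [x]) (length w) (l # w) (w @ [l])"
 proof (rule Cons.IH[OF x(2)])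
  show "letter_val G l \<otimes> letter_val G y = letter_val G y \<otimes> letter_val G l" if "y \<in> set w" for y using Cons.prems(2)[of y] that by simp
  show "g \<otimes> ev [x] \<in> carrier G" using Cons.prems(3) lc by (simp add: eval_word_Cons)
  show "g \<otimes> ev [x] \<otimes> ev u \<in> V" if "u \<in> words S" "length u <= length w" for u
   using Cons.prems(4)[of "x # u"] that x lc Cons.prems(3) ev_closed[of u] words_carrier[OF assms(4) that(1)]
   by (simp add: eval_word_Cons m_assoc)
 qed
 have 3: "fill G S 4 V g 1 ([l, x] @ w) ([x, l] @ w)" by (rule fill_append1[OF 1 x(2) assms(4) Cons.prems(3)])
 have 4: "fill G S 4 V g (length w) ([x] @ (l # w)) ([x] @ (w @ [l]))"
  by (rule fill_append2[OF 2]) (use x assms(4) Cons.prems(3) in auto)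
 show ?case using fill_transI[OF 3 , of "length w" "[x] @ w @ [l]" "length (x # w)"] 4 by simp
qed

lemma letters_commute:
 assumes "!!x y. x \<in> K1 ==> y \<in> K2 ==> x \<otimes> y = y \<otimes> x" "subgroup K1 G" "subgroup K2 G" "fst x \<in> K1" "fst y \<in> K2"
 shows "letter_val G x \<otimes> letter_val G y = letter_val G y \<otimes> letter_val G x"
 by (rule assms(1)) (use assms(2-5) in \<open>auto simp: letter_val_def subgroup.m_inv_closed\<close>)

text \<open>Each letter of \<open>S2\<close> is moved past at most \<open>length w\<close> letters
  of \<open>S1\<close>, and every exchange is a loop of length four.\<close>

lemma fill_sort:
 assumes com: "!!x y. x \<in> K1 ==> y \<in> K2 ==> x \<otimes> y = y \<otimes> x" and K: "subgroup K1 G" "subgroup K2 G"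
  and S: "S1 <= K1" "S2 <= K2"
 shows "[|w \<in> words (S1 \<union> S2); g \<in> carrier G; !!u. u \<in> words (S1 \<union> S2) ==> length u <= length w ==> g \<otimes> ev u \<in> V|] ==>
  \<exists>w1 w2. w1 \<in> words S1 & w2 \<in> words S2 & length w1 + length w2 = length w &
   fill G (S1 \<union> S2) 4 V g ((length w)\<^sup>2) w (w1 @ w2)"
proof (induction w arbitrary: g)
 case Nil
 then show ?case by (intro exI[of _ "[]"]) (simp add: fill.refl)
next
 case (Cons x w)
 let ?S = "S1 \<union> S2"
 have Sc: "?S <= carrier G" using S K subgroup.subset by blast
 have x: "fst x \<in> ?S" "w \<in> words ?S" "fst x \<in> carrier G" using Cons.prems(1) Sc by auto
 have lc: "letter_val G x \<in> carrier G" using x by (auto simp: letter_val_def)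
 have gx: "g \<otimes> ev [x] \<in> carrier G" using Cons.prems(2) lc by (simp add: eval_word_Cons)
 have V: "g \<otimes> ev [x] \<otimes> ev u \<in> V" if "u \<in> words ?S" "length u <= length w" for u
  using Cons.prems(3)[of "x # u"] that x lc Cons.prems(2) ev_closed[of u] words_carrier[OF Sc that(1)]
  by (simp add: eval_word_Cons m_assoc)
 obtain w1 w2 where w: "w1 \<in> words S1" "w2 \<in> words S2" "length w1 + length w2 = length w"
   "fill G ?S 4 V (g \<otimes> ev [x]) ((length w)\<^sup>2) w (w1 @ w2)"
  using Cons.IH[OF x(2) gx V] by blast
 have wS: "w1 \<in> words ?S" "w2 \<in> words ?S" using w words_mono[of _ ?S] by auto
 have f: "fill G ?S 4 V g ((length w)\<^sup>2) ([x] @ w) ([x] @ (w1 @ w2))"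
  by (rule fill_append2[OF w(4)]) (use x Sc Cons.prems(2) in auto)
 show ?case
 proof (cases "fst x \<in> S1")
  case True
  have "fill G ?S 4 V g ((length (x # w))\<^sup>2) (x # w) ((x # w1) @ w2)"
   using fill_weaken[OF f, of "(length (x # w))\<^sup>2"] by (simp add: power_mono)
  then show ?thesis using w True by (intro exI[of _ "x # w1"] exI[of _ w2]) simp
 next
  case False
  then have x2: "fst x \<in> S2" using x by simp
  have m: "fill G ?S 4 V g (length w1) (x # w1) (w1 @ [x])"
  proof (rule fill_move_letter[OF wS(1) _ x(1) Sc _ Cons.prems(2)])
   show "letter_val G x \<otimes> letter_val G y = letter_val G y \<otimes> letter_val G x" if "y \<in> set w1" for y
   proof -
    have "fst y \<in> K1" "fst x \<in> K2" using that w(1) x2 S by (auto simp: words_iff)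
    then show ?thesis using letters_commute[OF com K, of y x] by simp
   qed
   show "g \<otimes> ev u \<in> V" if "u \<in> words ?S" "length u <= length w1" for u
    using Cons.prems(3)[of u] that w(3) by simp
  qed simp
  have m2: "fill G ?S 4 V g (length w1) ((x # w1) @ w2) ((w1 @ [x]) @ w2)" by (rule fill_append1[OF m wS(2) Sc Cons.prems(2)])
  have "fill G ?S 4 V g ((length (x # w))\<^sup>2) ([x] @ w) ((w1 @ [x]) @ w2)"
   by (rule fill_transI[OF f]) (use m2 w(3) in \<open>auto simp: power2_eq_square\<close>)
  then show ?thesis using w x2 by (intro exI[of _ w1] exI[of _ "x # w2"]) simp
 qed
qed

lemma subgroup_commuting_product:
 assumes com: "!!x y. x \<in> K1 ==> y \<in> K2 ==> x \<otimes> y = y \<otimes> x" and K: "subgroup K1 G" "subgroup K2 G"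
 shows "subgroup (K1 <#> K2) G"
proof -
 have "K1 <#> K2 = K2 <#> K1"
 proof (intro equalityI subsetI)
  show "z \<in> K2 <#> K1" if "z \<in> K1 <#> K2" for z
   using that com unfolding set_mult_def by clarsimp metis
  show "z \<in> K1 <#> K2" if "z \<in> K2 <#> K1" for z
   using that com unfolding set_mult_def by clarsimp metis
 qed
 note sw = this
 show ?thesis
 proof (rule subgroupI)
  show "K1 <#> K2 <= carrier G" using K by (simp add: setmult_subset_G subgroup.subset)
  show "K1 <#> K2 ~= {}" using subgroup.one_closed[OF K(1)] subgroup.one_closed[OF K(2)] unfolding set_mult_def by blast
  show "inv z \<in> K1 <#> K2" if z: "z \<in> K1 <#> K2" for z
  proof -
   obtain x y where xy: "x \<in> K1" "y \<in> K2" "z = x \<otimes> y" using z by (auto simp: set_mult_def)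
   then have "inv z = inv y \<otimes> inv x" using K subgroup.mem_carrier by (metis inv_mult_group)
   then have "inv z \<in> K2 <#> K1" using xy K unfolding set_mult_def by (auto intro: subgroup.m_inv_closed)
   then show ?thesis using sw by simp
  qed
  show "z \<otimes> z' \<in> K1 <#> K2" if z: "z \<in> K1 <#> K2" and z': "z' \<in> K1 <#> K2" for z z'
  proof -
   obtain x y where xy: "x \<in> K1" "y \<in> K2" "z = x \<otimes> y" using z by (auto simp: set_mult_def)
   obtain x' y' where xy': "x' \<in> K1" "y' \<in> K2" "z' = x' \<otimes> y'" using z' by (auto simp: set_mult_def)
   have c: "x \<in> carrier G" "y \<in> carrier G" "x' \<in> carrier G" "y' \<in> carrier G"
    using xy xy' K subgroup.mem_carrier by metis+
   have "z \<otimes> z' = x \<otimes> (y \<otimes> x') \<otimes> y'" using c xy xy' by (simp add: m_assoc)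
   also have "... = (x \<otimes> x') \<otimes> (y \<otimes> y')" using c com[OF xy'(1) xy(2), symmetric] by (simp add: m_assoc)
   finally show ?thesis using subgroup.m_closed[OF K(1) xy(1) xy'(1)] subgroup.m_closed[OF K(2) xy(2) xy'(2)]
    unfolding set_mult_def by blast
  qed
 qed
qed

lemma gens_commuting_product:
 assumes com: "!!x y. x \<in> K1 ==> y \<in> K2 ==> x \<otimes> y = y \<otimes> x" and S: "gens K1 S1" "gens K2 S2"
 shows "gens (K1 <#> K2) (S1 \<union> S2)"
proof -
 have K: "subgroup K1 G" "subgroup K2 G" using S by (auto simp: gens_def)
 have "\<exists>w\<in>words (S1 \<union> S2). ev w = k" if k: "k \<in> K1 <#> K2" for k
 proof -
  obtain x y where xy: "x \<in> K1" "y \<in> K2" "k = x \<otimes> y" using k by (auto simp: set_mult_def)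
  obtain u where u: "u \<in> words S1" "ev u = x" using xy(1) S(1) unfolding gens_def by blast
  obtain v where v: "v \<in> words S2" "ev v = y" using xy(2) S(2) unfolding gens_def by blast
  have "ev (u @ v) = k" using u v xy gens_words[OF S(1) u(1)] gens_words[OF S(2) v(1)] by simp
  moreover have "u @ v \<in> words (S1 \<union> S2)" using u v words_mono[of _ "S1 \<union> S2"] by auto
  ultimately show ?thesis by blast
 qed
 moreover have "S1 \<union> S2 <= K1 <#> K2"
 proof
  fix x assume x: "x \<in> S1 \<union> S2"
  have "x = x \<otimes> \<one>" "x = \<one> \<otimes> x" using x gens_carrier[OF S(1)] gens_carrier[OF S(2)] by auto
  moreover have "x \<in> K1 \<or> x \<in> K2" using x S by (auto simp: gens_def)
  ultimately show "x \<in> K1 <#> K2" using subgroup.one_closed[OF K(1)] subgroup.one_closed[OF K(2)]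
   unfolding set_mult_def by blast
 qed
 ultimately show ?thesis using subgroup_commuting_product[OF com K] S by (simp add: gens_def)
qed

text \<open>Sorting costs \<open>L\<^sup>2\<close>, whence the quadratic requirement on
  \<open>a\<close>. The trivial intersection forces the two sorted halves to be null words of their
  own subgroups.\<close>

lemma isop_commuting_product:
 assumes com: "!!x y. x \<in> K1 ==> y \<in> K2 ==> x \<otimes> y = y \<otimes> x" and int: "K1 \<inter> K2 = {\<one>}"
  and iso: "isop K1 word_ball a b" "isop K2 word_ball a b" and ab: "!!L. L\<^sup>2 <= a L & L <= b L"
 shows "isop (K1 <#> K2) word_ball a b"
proof -
 obtain S1 where S1: "gens K1 S1" "isop_wrt S1 (word_ball S1) a b" using iso(1) by (auto simp: isop_def)
 obtain S2 where S2: "gens K2 S2" "isop_wrt S2 (word_ball S2) a b" using iso(2) by (auto simp: isop_def)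
 obtain N1 C1 where "isop_at S1 (word_ball S1) a b N1 C1" using S1(2) by (auto simp: isop_wrt_def)
 note f1 = isop_atD[OF this]
 obtain N2 C2 where "isop_at S2 (word_ball S2) a b N2 C2" using S2(2) by (auto simp: isop_wrt_def)
 note f2 = isop_atD[OF this]
 have K: "subgroup K1 G" "subgroup K2 G" "S1 <= K1" "S2 <= K2" using S1 S2 by (auto simp: gens_def)
 let ?S = "S1 \<union> S2" and ?N = "N1 + N2 + 4" and ?C = "C1 + C2 + 1"
 have Sc: "?S <= carrier G" using gens_carrier[OF S1(1)] gens_carrier[OF S2(1)] by simp
 have "isop_wrt ?S (word_ball ?S) a b"
 proof (rule isop_wrtI[where N = ?N and C = ?C])
  fix L w assume w: "w \<in> words ?S" "ev w = \<one>" "?C * length w + ?C <= L"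
  let ?V = "word_ball ?S (?C * b L)"
  have bL: "L <= b L" "L\<^sup>2 <= a L" using ab by auto
  have "length w <= ?C * length w" by simp
  then have lw: "length w <= L" using w(3) by linarith
  have "b L <= ?C * b L" by simp
  then have bC: "length w <= ?C * b L" using bL(1) lw by linarith
  have V: "\<one> \<otimes> ev u \<in> ?V" if "u \<in> words ?S" "length u <= length w" for u
   using that bC words_carrier[OF Sc that(1)] by (auto simp: word_ball_def)
  obtain w1 w2 where s: "w1 \<in> words S1" "w2 \<in> words S2" "length w1 + length w2 = length w"
    "fill G ?S 4 ?V \<one> ((length w)\<^sup>2) w (w1 @ w2)"
   using fill_sort[OF com K w(1) one_closed V] by blast
  have c: "w1 \<in> words (carrier G)" "w2 \<in> words (carrier G)" using gens_words[OF S1(1) s(1)] gens_words[OF S2(1) s(2)] by auto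
  have ss: "w1 \<in> words ?S" "w2 \<in> words ?S" using s words_mono[of _ ?S] by auto
  have "ev w = ev (w1 @ w2)" by (rule fill_ev[OF s(4) Sc])
  then have "ev w1 \<otimes> ev w2 = \<one>" using w(2) c by simp
  then have i: "ev w1 = inv (ev w2)" using c by (simp add: inv_equality[symmetric] inv_equality)
  have "ev w1 \<in> K1" "ev w2 \<in> K2" using gens_ev[OF S1(1) s(1)] gens_ev[OF S2(1) s(2)] by auto
  then have "ev w1 \<in> K1 \<inter> K2" using i subgroup.m_inv_closed[OF K(2)] by auto
  then have e1: "ev w1 = \<one>" using int by auto
  then have e2: "ev w2 = \<one>" using i c \<open>ev w1 \<otimes> ev w2 = \<one>\<close> by simp
  have le: "C1 * length w1 + C1 <= L" "C2 * length w2 + C2 <= L"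
  proof -
   have "C1 * length w1 <= ?C * length w" "C2 * length w2 <= ?C * length w" 
    using s(3) mult_le_mono[of C1 ?C "length w1" "length w"] mult_le_mono[of C2 ?C "length w2" "length w"] by linarith+
   then show "C1 * length w1 + C1 <= L" "C2 * length w2 + C2 <= L" using w(3) by linarith+
  qed
  have sub: "word_ball S1 (C1 * b L) <= ?V" "word_ball S2 (C2 * b L) <= ?V"
  proof -
   have cb: "C1 * b L <= ?C * b L" "C2 * b L <= ?C * b L"
    using mult_le_mono[of C1 ?C "b L" "b L"] mult_le_mono[of C2 ?C "b L" "b L"] by linarith+
   show "word_ball S1 (C1 * b L) <= ?V" "word_ball S2 (C2 * b L) <= ?V"
    using words_mono[of S1 ?S] words_mono[of S2 ?S] cb unfolding word_ball_def by (fastforce intro: le_trans)+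
  qed
  have g1: "fill G ?S ?N ?V \<one> (C1 * a L) w1 []"
   by (rule fill_mono[OF f1[OF s(1) e1 le(1)] _ _ sub(1)]) auto
  have g2: "fill G ?S ?N ?V \<one> (C2 * a L) w2 []"
   by (rule fill_mono[OF f2[OF s(2) e2 le(2)] _ _ sub(2)]) auto
  have g0: "fill G ?S ?N ?V \<one> ((length w)\<^sup>2) w (w1 @ w2)" by (rule fill_mono[OF s(4)]) auto
  have h1: "fill G ?S ?N ?V \<one> (C1 * a L) (w1 @ w2) ([] @ w2)" by (rule fill_append1[OF g1 ss(2) Sc one_closed])
  have h2: "fill G ?S ?N ?V \<one> (C1 * a L + C2 * a L) (w1 @ w2) []"
   by (rule fill_transI[OF h1]) (use g2 in auto)
  have "(length w)\<^sup>2 <= a L" using power_mono[OF lw, of 2] bL(2) by linarith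
  then show "fill G ?S ?N ?V \<one> (?C * a L) w []" by (intro fill_transI[OF g0 h2]) (simp add: distrib_right)
 qed
 moreover have "L <= a L & L <= b L" for L using ab[of L] self_le_power[of L 2] le_trans[of L "L\<^sup>2"]
  by (cases "L = 0") (auto simp: power2_eq_square)
 ultimately show ?thesis using isop_ballI[OF gens_commuting_product[OF com S1(1) S2(1)]] by blast
qed

lemma isop_trivial: "(!!L. L <= a L & L <= b L) ==> isop {\<one>} word_ball a b"
proof (rule isop_ballI)
 have "subgroup {\<one>} G" by (rule triv_subgroup)
 then show "gens {\<one>} {}" by (auto simp: gens_def words_iff intro!: bexI[of _ "[]"])
 show "isop_wrt {} (word_ball {}) a b"
  by (rule isop_wrtI[where N = 0 and C = 0]) (auto simp: words_iff intro: fill.refl)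
qed

end

context coab
begin

text \<open>Coordinates are Lipschitz for the word metric, so a ball of radius \<open>O(b L)\<close>
  lies at heights \<open>O(b L)\<close>.\<close>

lemma isop_heights:
 assumes iso: "isop M0 word_ball a b" and ab: "!!L. L <= a L & L <= b L"
 shows "isop M0 (%_. heights) a b"
proof -
 obtain S where S: "gens M0 S" "isop_wrt S (word_ball S) a b" using iso by (auto simp: isop_def)
 obtain N C where "isop_at S (word_ball S) a b N C" using S(2) by (auto simp: isop_wrt_def)
 note f = isop_atD[OF this]
 have fS: "finite S" "S <= M0" using S by (auto simp: gens_def)
 obtain c where c: "\<forall>w\<in>words S. ev w \<in> heights (c * length w)" using heights_word_bound[OF fS] by blast
 have "isop_wrt S heights a b"
 proof (rule isop_wrtI[where N = N and C = "C + c * C"])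
  fix L w assume w: "w \<in> words S" "ev w = \<one>" "(C + c * C) * length w + (C + c * C) <= L"
  have "C * length w <= (C + c * C) * length w" by (rule mult_le_mono1) simp
  then have le: "C * length w + C <= L" using w(3) by linarith
  have "word_ball S (C * b L) <= heights ((C + c * C) * b L)"
  proof
   fix x assume "x \<in> word_ball S (C * b L)"
   then obtain u where u: "u \<in> words S" "length u <= C * b L" "x = ev u" by (auto simp: word_ball_def)
   have "c * length u <= c * (C * b L)" using u(2) by (rule mult_le_mono2)
   also have "c * (C * b L) <= (C + c * C) * b L" by (simp add: distrib_right mult.assoc)
   finally have "c * length u <= (C + c * C) * b L" .
   then show "x \<in> heights ((C + c * C) * b L)" using c u heights_mono by blast
  qed
  then show "fill G S N (heights ((C + c * C) * b L)) \<one> ((C + c * C) * a L) w []"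
   by (intro fill_mono[OF f[OF w(1,2) le]]) auto
 qed
 then show ?thesis
 proof (rule isopI[OF S(1) _ ab heights_mono])
  fix R assume R: "finite R" "R <= M0"
  obtain d where d: "R <= heights d" using heights_finite[OF R] by blast
  have "\<forall>B g y. g \<in> heights B & g \<in> M0 & y \<in> R --> g \<otimes> y \<in> heights ((d + 1) * B + (d + 1))"
  proof (intro allI impI)
   fix B g y assume "g \<in> heights B & g \<in> M0 & y \<in> R"
   then have "g \<otimes> y \<in> heights (B + d)" using heights_mult d by blast
   then show "g \<otimes> y \<in> heights ((d + 1) * B + (d + 1))" by (rule subsetD[OF heights_mono, rotated]) simp
  qed
  then show "\<exists>c. \<forall>B g y. g \<in> heights B & g \<in> M0 & y \<in> R --> g \<otimes> y \<in> heights (c * B + c)" by blast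
 next
  fix T assume "gens M0 T"
  then obtain d where d: "\<forall>w\<in>words T. ev w \<in> heights (d * length w)" using heights_word_bound[of T] by (auto simp: gens_def)
  then show "\<exists>c. \<forall>w\<in>words T. ev w \<in> heights (c * length w + c)"
   by (intro exI[of _ d] ballI) (rule subsetD[OF heights_mono[OF le_add1] bspec[OF d]])
 qed
qed

text \<open>The step is iterated over the coordinates; the same three factors serve for each of
  them.\<close>

lemma isop_level:
 assumes i: "i1 \<in> I" "i2 \<in> I" "i3 \<in> I" "i1 ~= i2" "i1 ~= i3" "i2 ~= i3"
  and iso: "isop M0 word_ball a b" and ab: "!!L. L <= a L & L <= b L"
 shows "k <= r ==> isop (level k) (%_. heights) (%L. b L ^ (2 * k) * a L) b"
proof (induction k)
 case 0
 then show ?case using isop_heights[OF iso ab] by (simp add: level_def)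
next
 case (Suc k)
 interpret st: coab_step G M0 \<tau> r t I k i1 i2 i3 by unfold_locales (use Suc.prems i in auto)
 have "L <= b L ^ (2 * k) * a L & L <= b L" for L
 proof (cases "L = 0")
  case False
  then have "1 <= b L ^ (2 * k)" using ab[of L] by simp
  then have "1 * a L <= b L ^ (2 * k) * a L" by (rule mult_le_mono1)
  then show ?thesis using ab[of L] by linarith
 qed simp
 from st.isop_step[OF _ this] Suc
 have "isop (level (Suc k)) (%_. heights) (%L. (b L)\<^sup>2 * (b L ^ (2 * k) * a L)) b" by simp
 moreover have "(%L. (b L)\<^sup>2 * (b L ^ (2 * k) * a L)) = (%L. b L ^ (2 * Suc k) * a L)"
  by (simp add: fun_eq_iff power_add power2_eq_square mult.assoc)
 ultimately show ?case by simp
qed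

end

section \<open>Direct products: blocks of factors, projections and embeddings\<close>

section \<open>Direct products of finitely many groups\<close>

locale direct_factors = group G for G :: "(nat => 'a) monoid" (structure) +
 fixes \<Gamma> :: "nat => ('a, 'b) monoid_scheme" and n :: nat
 assumes G_def: "G = product_group {1..n} \<Gamma>" and grp: "i \<in> {1..n} ==> group (\<Gamma> i)"
begin

definition block :: "nat set => (nat => 'a) set" where
 "block s = {g \<in> carrier G. \<forall>j\<in>{1..n} - s. g j = \<one>\<^bsub>\<Gamma> j\<^esub>}"

text \<open>Serves both as the embedding of a partial product and, on \<open>G\<close> itself, as
  the projection onto \<open>block s\<close>.\<close>

definition ext :: "nat set => (nat => 'a) => nat => 'a" where
 "ext s x = (\<lambda>j\<in>{1..n}. if j \<in> s then x j else \<one>\<^bsub>\<Gamma> j\<^esub>)"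

lemma one_eq: "\<one> = (\<lambda>j\<in>{1..n}. \<one>\<^bsub>\<Gamma> j\<^esub>)"
 and mult_eq: "x \<otimes> y = (\<lambda>j\<in>{1..n}. x j \<otimes>\<^bsub>\<Gamma> j\<^esub> y j)"
 and carrier_eq: "carrier G = (\<Pi>\<^sub>E j\<in>{1..n}. carrier (\<Gamma> j))"
 by (simp_all add: G_def)

lemma inv_eq: "x \<in> carrier G ==> inv x = (\<lambda>j\<in>{1..n}. inv\<^bsub>\<Gamma> j\<^esub> x j)"
 using inv_product_group[of x "{1..n}" \<Gamma>] grp by (simp add: G_def)

lemma coord_closed: "x \<in> carrier G ==> j \<in> {1..n} ==> x j \<in> carrier (\<Gamma> j)"
 by (auto simp: carrier_eq)

lemma coord_eqI: "x \<in> carrier G ==> y \<in> carrier G ==> (!!j. j \<in> {1..n} ==> x j = y j) ==> x = y"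
 unfolding carrier_eq by (rule PiE_ext)

lemma coord_mult: "j \<in> {1..n} ==> (x \<otimes> y) j = x j \<otimes>\<^bsub>\<Gamma> j\<^esub> y j"
 and coord_one: "j \<in> {1..n} ==> \<one> j = \<one>\<^bsub>\<Gamma> j\<^esub>"
 and coord_inv: "x \<in> carrier G ==> j \<in> {1..n} ==> (inv x) j = inv\<^bsub>\<Gamma> j\<^esub> x j"
 by (simp_all add: mult_eq one_eq inv_eq)

lemma block_carrier: "block s <= carrier G" by (auto simp: block_def)

lemma block_coord: "x \<in> block s ==> j \<in> {1..n} ==> j \<notin> s ==> x j = \<one>\<^bsub>\<Gamma> j\<^esub>" by (auto simp: block_def)

lemma block_mono: "s <= s' ==> block s <= block s'" by (auto simp: block_def)

lemma subgroup_block: "subgroup (block s) G"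
proof (rule subgroupI)
 show "block s ~= {}" using coord_one by (auto simp: block_def intro!: exI[of _ \<one>])
 show "inv x \<in> block s" if "x \<in> block s" for x
  using that coord_inv[of x] grp by (auto simp: block_def group.is_monoid monoid.inv_one)
 show "x \<otimes> y \<in> block s" if "x \<in> block s" "y \<in> block s" for x y
  using that coord_mult[of _ x y] grp by (auto simp: block_def group.is_monoid)
qed (simp add: block_carrier)

lemma block_conj: "x \<in> carrier G ==> y \<in> block s ==> inv x \<otimes> y \<otimes> x \<in> block s"
proof -
 assume x: "x \<in> carrier G" and y: "y \<in> block s"
 have yc: "y \<in> carrier G" using y block_carrier by auto
 have "(inv x \<otimes> y \<otimes> x) j = \<one>\<^bsub>\<Gamma> j\<^esub>" if j: "j \<in> {1..n}" "j \<notin> s" for j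
 proof -
  interpret g: group "\<Gamma> j" by (rule grp[OF j(1)])
  show ?thesis using coord_closed[OF x j(1)] block_coord[OF y j] by (simp only: coord_mult[OF j(1)] coord_inv[OF x j(1)]) simp
 qed
 then show ?thesis using x yc by (auto simp: block_def)
qed

lemma block_commute: "x \<in> block s ==> y \<in> block s' ==> s \<inter> s' = {} ==> x \<otimes> y = y \<otimes> x"
proof (rule coord_eqI)
 assume a: "x \<in> block s" "y \<in> block s'" "s \<inter> s' = {}"
 then have c: "x \<in> carrier G" "y \<in> carrier G" using block_carrier by auto
 then show "x \<otimes> y \<in> carrier G" "y \<otimes> x \<in> carrier G" by auto
 fix j assume j: "j \<in> {1..n}"
 interpret g: group "\<Gamma> j" by (rule grp[OF j])
 have "x j = \<one>\<^bsub>\<Gamma> j\<^esub> \<or> y j = \<one>\<^bsub>\<Gamma> j\<^esub>" using a block_coord[OF a(1) j] block_coord[OF a(2) j] by auto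
 then show "(x \<otimes> y) j = (y \<otimes> x) j" using coord_closed[OF c(1) j] coord_closed[OF c(2) j] j by (auto simp: coord_mult)
qed

lemma block_Int: "s \<inter> s' = {} ==> block s \<inter> block s' = {\<one>}"
proof (intro equalityI subsetI)
 fix x assume "s \<inter> s' = {}" "x \<in> block s \<inter> block s'"
 then have d: "s \<inter> s' = {}" and x: "x \<in> block s" "x \<in> block s'" by auto
 have "x = \<one>"
 proof (rule coord_eqI)
  show "x \<in> carrier G" using x block_carrier by blast
  show "x j = \<one> j" if "j \<in> {1..n}" for j
   using d block_coord[OF x(1) that] block_coord[OF x(2) that] coord_one[OF that] by auto
 qed simp
 then show "x \<in> {\<one>}" by simp
qed (use subgroup.one_closed[OF subgroup_block] in auto)

lemma ext_carrier: "(!!j. j \<in> s ==> j \<in> {1..n} ==> x j \<in> carrier (\<Gamma> j)) ==> ext s x \<in> block s"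
 using grp by (auto simp: ext_def block_def carrier_eq group.is_monoid monoid.one_closed)

lemma ext_coord: "j \<in> {1..n} ==> ext s x j = (if j \<in> s then x j else \<one>\<^bsub>\<Gamma> j\<^esub>)" by (simp add: ext_def)

lemma block_Un: "s \<inter> s' = {} ==> block (s \<union> s') = block s <#> block s'"
proof (intro equalityI subsetI)
 fix x assume d: "s \<inter> s' = {}" and x: "x \<in> block (s \<union> s')"
 then have xc: "x \<in> carrier G" using block_carrier by auto
 have e: "ext s x \<in> block s" "ext s' x \<in> block s'" using coord_closed[OF xc] by (auto intro!: ext_carrier)
 then have ec: "ext s x \<in> carrier G" "ext s' x \<in> carrier G" using block_carrier by auto
 have "x = ext s x \<otimes> ext s' x"
 proof (rule coord_eqI[OF xc])
  fix j assume j: "j \<in> {1..n}"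
  interpret g: group "\<Gamma> j" by (rule grp[OF j])
  show "x j = (ext s x \<otimes> ext s' x) j"
   using d coord_closed[OF xc j] block_coord[OF x j] by (simp only: coord_mult[OF j] ext_coord[OF j]) auto
 qed (use ec in simp)
 then show "x \<in> block s <#> block s'" using e unfolding set_mult_def by blast
next
 fix x assume "x \<in> block s <#> block s'"
 then show "x \<in> block (s \<union> s')"
  using block_mono[of s "s \<union> s'"] block_mono[of s' "s \<union> s'"] subgroup.m_closed[OF subgroup_block]
  unfolding set_mult_def by blast
qed

lemma block_all: "{1..n} <= s ==> block s = carrier G" by (auto simp: block_def)

lemma block_empty: "block {} = {\<one>}" using block_Int[of "{}" "{}"] by simp

lemma factor_block: "factor_subgroup {1..n} \<Gamma> i = block {i}" 
 unfolding factor_subgroup_def block_def G_def[symmetric] ..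

lemma ext_hom: "s <= {1..n} ==> ext s \<in> hom (product_group s \<Gamma>) G"
proof (rule homI)
 assume s: "s <= {1..n}"
 show c: "ext s x \<in> carrier G" if "x \<in> carrier (product_group s \<Gamma>)" for x
  using ext_carrier[of s x] that block_carrier by auto
 fix x y assume xy: "x \<in> carrier (product_group s \<Gamma>)" "y \<in> carrier (product_group s \<Gamma>)"
 have "x \<otimes>\<^bsub>product_group s \<Gamma>\<^esub> y \<in> carrier (product_group s \<Gamma>)"
  using xy grp s by (auto intro!: monoid.m_closed group.is_monoid)
 then have c': "ext s (x \<otimes>\<^bsub>product_group s \<Gamma>\<^esub> y) \<in> carrier G" by (rule c)
 show "ext s (x \<otimes>\<^bsub>product_group s \<Gamma>\<^esub> y) = ext s x \<otimes> ext s y"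
 proof (rule coord_eqI[OF c'])
  fix j assume j: "j \<in> {1..n}"
  interpret g: group "\<Gamma> j" by (rule grp[OF j])
  show "ext s (x \<otimes>\<^bsub>product_group s \<Gamma>\<^esub> y) j = (ext s x \<otimes> ext s y) j" using j s by (simp add: ext_coord coord_mult)
 qed (use c xy in simp)
qed

lemma ext_inj: "s <= {1..n} ==> inj_on (ext s) (carrier (product_group s \<Gamma>))"
proof (rule inj_onI)
 fix x y assume s: "s <= {1..n}" and xy: "x \<in> carrier (product_group s \<Gamma>)" "y \<in> carrier (product_group s \<Gamma>)" "ext s x = ext s y"
 have "x j = y j" if "j \<in> s" for j using fun_cong[OF xy(3), of j] that s by (auto simp: ext_def)
 then show "x = y" using xy by (auto intro: PiE_ext)
qed

lemma ext_image: "s <= {1..n} ==> ext s ` carrier (product_group s \<Gamma>) = block s"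
proof (intro equalityI subsetI)
 fix x assume s: "s <= {1..n}" and x: "x \<in> block s"
 then have xc: "x \<in> carrier G" using block_carrier by auto
 have "ext s (restrict x s) = x"
  by (rule coord_eqI[OF _ xc]) (use ext_carrier[of s "restrict x s"] block_carrier coord_closed[OF xc] s block_coord[OF x] in \<open>auto simp: ext_coord\<close>)
 moreover have "restrict x s \<in> carrier (product_group s \<Gamma>)" using coord_closed[OF xc] s by auto
 ultimately show "x \<in> ext s ` carrier (product_group s \<Gamma>)" by (metis image_eqI)
qed (use ext_carrier in auto)

definition single :: "nat => 'a => nat => 'a" where "single i x = ext {i} (%_. x)"

lemma single_hom: "i \<in> {1..n} ==> single i \<in> hom (\<Gamma> i) G"
proof (rule homI)
 assume i: "i \<in> {1..n}"
 interpret gi: group "\<Gamma> i" by (rule grp[OF i])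
 show c: "single i x \<in> carrier G" if "x \<in> carrier (\<Gamma> i)" for x
  using ext_carrier[of "{i}" "%_. x"] that block_carrier by (auto simp: single_def)
 fix x y assume xy: "x \<in> carrier (\<Gamma> i)" "y \<in> carrier (\<Gamma> i)"
 show "single i (x \<otimes>\<^bsub>\<Gamma> i\<^esub> y) = single i x \<otimes> single i y"
 proof (rule coord_eqI)
  fix j assume j: "j \<in> {1..n}"
  interpret g: group "\<Gamma> j" by (rule grp[OF j])
  show "single i (x \<otimes>\<^bsub>\<Gamma> i\<^esub> y) j = (single i x \<otimes> single i y) j" using j by (simp add: single_def ext_coord coord_mult)
 qed (use c xy in auto)
qed

lemma single_inj: "i \<in> {1..n} ==> inj_on (single i) (carrier (\<Gamma> i))"
 by (rule inj_onI) (auto simp: single_def ext_def dest: fun_cong[of _ _ i])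

lemma single_image: "i \<in> {1..n} ==> single i ` carrier (\<Gamma> i) = block {i}"
proof (intro equalityI subsetI)
 fix x assume i: "i \<in> {1..n}" and x: "x \<in> block {i}"
 then have xc: "x \<in> carrier G" using block_carrier by auto
 have sc: "single i (x i) \<in> carrier G" using single_hom[OF i] coord_closed[OF xc i] by (auto simp: hom_def)
 have "single i (x i) = x"
  by (rule coord_eqI[OF sc xc]) (use block_coord[OF x] in \<open>auto simp: single_def ext_coord\<close>)
 then show "x \<in> single i ` carrier (\<Gamma> i)" using coord_closed[OF xc i] by (metis image_eqI)
qed (auto simp: single_def intro!: ext_carrier)

lemma block_Suc: "block {1..Suc k} = block {1..k} <#> block {Suc k}"
 using block_Un[of "{1..k}" "{Suc k}"] by (simp add: atLeastAtMostSuc_conv)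

lemma gens_block:
 assumes "!!i. i \<in> {1..n} ==> finitely_generated (\<Gamma> i)"
 shows "k <= n ==> \<exists>S. gens (block {1..k}) S"
proof (induction k)
 case 0
 have "gens (block {1..0}) {}" using triv_subgroup by (auto simp: block_empty gens_def words_iff intro!: bexI[of _ "[]"])
 then show ?case by blast
next
 case (Suc k)
 then obtain S where S: "gens (block {1..k}) S" by auto
 have i: "Suc k \<in> {1..n}" using Suc by simp
 interpret gi: group "\<Gamma> (Suc k)" by (rule grp[OF i])
 interpret h: group_hom "\<Gamma> (Suc k)" G "single (Suc k)" by unfold_locales (rule single_hom[OF i])
 obtain T where T: "finite T" "T <= carrier (\<Gamma> (Suc k))" "generate (\<Gamma> (Suc k)) T = carrier (\<Gamma> (Suc k))"
  using assms[OF i] by (auto simp: finitely_generated_def finite_generating_set_def)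
 have Tc: "single (Suc k) ` T <= carrier G" using T(2) by auto
 have "block {Suc k} = ev ` words (single (Suc k) ` T)"
  using generate_eq_ev[OF Tc] h.generate_img[OF T(2)] single_image[OF i] T(3) by simp
 then have "\<forall>x\<in>block {Suc k}. \<exists>w\<in>words (single (Suc k) ` T). ev w = x"
  by (simp add: image_iff Bex_def eq_commute set_eq_iff)
 moreover have "single (Suc k) ` T <= block {Suc k}" using single_image[OF i] T(2) by blast
 ultimately have "gens (block {Suc k}) (single (Suc k) ` T)"
  using T(1) subgroup_block by (simp add: gens_def)
 moreover have "x \<otimes> y = y \<otimes> x" if "x \<in> block {1..k}" "y \<in> block {Suc k}" for x y
  by (rule block_commute[OF that]) simp
 ultimately show ?case unfolding block_Suc using gens_commuting_product[OF _ S, of "block {Suc k}"] by blast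
qed

lemma isop_block:
 assumes "!!i. i \<in> {1..n} ==> finite_presentation_of (P i) (\<Gamma> i) & area_radius_pair (P i) (\<alpha> i) (\<rho> i)"
  and "!!i L. i \<in> {1..n} ==> \<alpha> i L <= a L & \<rho> i L <= b L" and ab: "!!L. L\<^sup>2 <= a L & L <= b L"
 shows "k <= n ==> isop (block {1..k}) word_ball a b"
proof (induction k)
 have ab': "L <= a L & L <= b L" for L using ab[of L] le_trans[of L "L\<^sup>2"] by (cases "L = 0") (auto simp: power2_eq_square)
 {
  case 0
  then show ?case using isop_trivial[OF ab'] by (simp add: block_empty)
 next
  case (Suc k)
  have i: "Suc k \<in> {1..n}" using Suc.prems by simp
  have "isop (single (Suc k) ` carrier (\<Gamma> (Suc k))) word_ball a b"
   by (rule isop_of_presentation[where P = "P (Suc k)" and \<alpha> = "\<alpha> (Suc k)" and \<rho> = "\<rho> (Suc k)"])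
    (use assms(1,2)[OF i] grp[OF i] single_hom[OF i] single_inj[OF i] ab' in auto)
  then have "isop (block {Suc k}) word_ball a b" using single_image[OF i] by simp
  with Suc show ?case unfolding block_Suc
   by (intro isop_commuting_product[OF block_commute block_Int]) (use ab in auto)
 }
qed

lemma coordinates:
 assumes vf: "virtually_full {1..n} \<Gamma> H" and vc: "virtually_coabelian_of_corank G H r" and S: "gens (carrier G) S"
 shows "\<exists>M0 \<tau> t. coab G M0 \<tau> r t {1..n} & (\<forall>i\<in>{1..n}. \<forall>j<r. t i j \<in> block {i}) & fin_idx M0 (carrier G) &
  fin_idx (coab.level M0 \<tau> r) H & coab.level M0 \<tau> r = M0 \<inter> H"
proof (rule coab_exists[OF vc S])
 show "x \<otimes> y = y \<otimes> x" if "i ~= i'" "x \<in> block {i}" "y \<in> block {i'}" for i i' x y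
  by (rule block_commute[OF that(2,3)]) (use that in auto)
 show "fin_idx (block {i} <#> H) (carrier G)" if "i \<in> {1..n}" for i
  using vf that unfolding virtually_full_def factor_block G_def[symmetric] finite_index_iff by blast
qed (auto intro: subgroup_block block_conj)

end

section \<open>Distortion and isoperimetric bounds assembled from the coordinates\<close>

context group
begin

lemma word_metric_le:
 assumes H: "subgroup H G" and T: "T <= H" and s: "s \<in> words T" "ev s = h"
 shows "word_metric (G\<lparr>carrier := H\<rparr>) T \<one> h <= length s"
proof -
 have h: "h \<in> carrier G" using s ev_closed words_carrier[of T] T subgroup.subset[OF H] by blast
 have "inv\<^bsub>G\<lparr>carrier := H\<rparr>\<^esub> \<one> = \<one>" using m_inv_consistent[OF H subgroup.one_closed[OF H]] by simp
 then show ?thesis unfolding word_metric_def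
  using s h eval_word_subgroup[OF H words_mono[OF T s(1)]] by (intro Least_le bexI[OF _ s(1)]) simp
qed

lemma word_metric_attained:
 assumes S: "gens (carrier G) S" and h: "h \<in> carrier G"
 shows "\<exists>w\<in>words S. length w = word_metric G S \<one> h & ev w = h"
proof -
 obtain w where "w \<in> words S" "ev w = h" using S h by (auto simp: gens_def)
 then have "\<exists>k. \<exists>w\<in>words S. length w = k & ev w = inv \<one> \<otimes> h" using h by auto
 from LeastI_ex[OF this] show ?thesis using h by (simp add: word_metric_def)
qed

lemma distortion_le_quadratic:
 assumes H: "subgroup H G" and S: "gens (carrier G) S" and T: "gens H T"
  and C: "\<forall>w\<in>words S. ev w \<in> H --> (\<exists>s\<in>words T. ev s = ev w & length s <= C * (length w + 1)\<^sup>2)"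
 shows "distortion_le (distortion G S H T) (%l. l ^ 2)"
 unfolding distortion_le_def
proof (intro exI[of _ "4 * C + 1"] allI)
 fix l
 let ?F = "{word_metric (G\<lparr>carrier := H\<rparr>) T \<one> h |h. h \<in> H & word_metric G S \<one> h <= l}"
 have TH: "T <= H" and Hc: "H <= carrier G" using T subgroup.subset[OF H] by (auto simp: gens_def)
 have b: "x <= (4 * C + 1) * ((4 * C + 1) * l)\<^sup>2" if "x \<in> ?F" for x
 proof -
  obtain h where h: "x = word_metric (G\<lparr>carrier := H\<rparr>) T \<one> h" "h \<in> H" "word_metric G S \<one> h <= l" using \<open>x \<in> ?F\<close> by blast
  have hc: "h \<in> carrier G" using h(2) Hc by auto
  obtain w where w': "w \<in> words S" "length w = word_metric G S \<one> h" "ev w = h"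
   using word_metric_attained[OF S hc] by blast
  have w: "w \<in> words S" "length w <= l" "ev w = h" using w' h(3) by simp_all
  show ?thesis
  \<comment> \<open>\<open>distortion_le\<close> allows no additive constant. For
    \<open>l = 0\<close> the element is \<open>\<one>\<close>; for \<open>l >= 1\<close> the bound
    \<open>(l + 1)^2 <= (2 * l)^2\<close> is available.\<close>
  proof (cases "l = 0")
   case True
   then have "ev [] = h" using w by simp
   then have "x <= length ([] :: 'a gword)" unfolding h(1) by (intro word_metric_le[OF H TH]) auto
   then show ?thesis by simp
  next
   case False
   obtain s where s: "s \<in> words T" "ev s = h" "length s <= C * (length w + 1)\<^sup>2" using C w h(2) by metis
   have "x <= length s" unfolding h(1) by (rule word_metric_le[OF H TH s(1,2)])
   also have "... <= C * (length w + 1)\<^sup>2" by (rule s(3))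
   also have "... <= C * (2 * l)\<^sup>2" by (intro mult_le_mono2 power_mono) (use w False in auto)
   also have "... = 4 * C * l\<^sup>2" by (simp add: power2_eq_square)
   also have "... <= (4 * C + 1) * ((4 * C + 1) * l)\<^sup>2" by (intro mult_le_mono power_mono) auto
   finally show ?thesis .
  qed
 qed
 have fin: "finite ?F" by (rule finite_subset[of _ "{..(4 * C + 1) * ((4 * C + 1) * l)\<^sup>2}"]) (use b in auto)
 have "word_metric G S \<one> \<one> <= l"
  using word_metric_le[OF subgroup_self, of S "[]" \<one>] gens_carrier[OF S] by simp
 then have "word_metric (G\<lparr>carrier := H\<rparr>) T \<one> \<one> \<in> ?F" using subgroup.one_closed[OF H] by blast
 then have ne: "?F ~= {}" by blast
 show "distortion G S H T l <= (4 * C + 1) * ((4 * C + 1) * l)\<^sup>2"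
  unfolding distortion_def by (rule Max.boundedI[OF fin ne b])
qed

end

context direct_factors
begin

lemma finitely_generated_distortion:
 assumes fg: "!!i. i \<in> {1..n} ==> finitely_generated (\<Gamma> i)" and n: "n \<ge> 2"
  and vf: "virtually_full {1..n} \<Gamma> H" and vc: "virtually_coabelian_of_corank G H r"
 shows "finitely_generated (G\<lparr>carrier := H\<rparr>) &
  (\<forall>S T. finite_generating_set G S & finite_generating_set (G\<lparr>carrier := H\<rparr>) T -->
   distortion_le (distortion G S H T) (%l. l ^ 2))"
proof -
 have H: "subgroup H G" using vc by (simp add: virtually_coabelian_of_corank_def)
 obtain S0 where S0: "gens (carrier G) S0" using gens_block[OF fg, of n] block_all[of "{1..n}"] by auto
 obtain M0 \<tau> t where c: "coab G M0 \<tau> r t {1..n}" "fin_idx M0 (carrier G)" "fin_idx (coab.level M0 \<tau> r) H"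
  using coordinates[OF vf vc S0] by blast
 interpret coab G M0 \<tau> r t "{1..n}" by (rule c(1))
 interpret coab_pair G M0 \<tau> r t "{1..n}" 1 2 by unfold_locales (use n in auto)
 obtain S1 where S1: "gens M0 S1" using gens_fin_idx[OF c(2) S0] by blast
 obtain T1 where T1: "gens (level r) T1" using gens_level[OF S1] by blast
 obtain T2 where T2: "gens H T2" using gens_overgroup[OF c(3) T1] by blast
 have "finitely_generated (G\<lparr>carrier := H\<rparr>)"
  unfolding finitely_generated_def using finite_generating_set_iff[OF H] T2 by blast
 moreover have "distortion_le (distortion G S H T) (%l. l ^ 2)"
  if "finite_generating_set G S" "finite_generating_set (G\<lparr>carrier := H\<rparr>) T" for S T
 proof -
  have S: "gens (carrier G) S" and T: "gens H T"
   using that finite_generating_set_carrier finite_generating_set_iff[OF H] by auto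
  obtain C where "\<forall>w\<in>words S. ev w \<in> H --> (\<exists>s\<in>words T. ev s = ev w & length s <= C * (length w + 1)\<^sup>2)"
   using quadratic_distortion[OF c(3,2) S T] by blast
  then show ?thesis by (rule distortion_le_quadratic[OF H S T])
 qed
 ultimately show ?thesis by blast
qed

text \<open>The pair passes from the factors to their product, to the finite index subgroup
  \<open>M0\<close>, through the \<open>r\<close> levels at the price of a factor
  \<open>(b L)^2\<close> each, and finally from \<open>level r\<close> to its finite index overgroup
  \<open>H\<close>, where only the area is kept.\<close>

lemma presentation_area_radius:
 assumes P: "!!i. i \<in> {1..n} ==> finite_presentation_of (P i) (\<Gamma> i) & area_radius_pair (P i) (\<alpha> i) (\<rho> i)" and n: "n \<ge> 3"
  and vf: "virtually_full {1..n} \<Gamma> H" and vc: "virtually_coabelian_of_corank G H r"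
 shows "isoperimetric_function (G\<lparr>carrier := H\<rparr>)
  (%l. Max ({l} \<union> (%i. \<rho> i l) ` {1..n}) ^ (2 * r) * Max ({l ^ 2} \<union> (%i. \<alpha> i l) ` {1..n}))"
proof -
 define a where "a l = Max ({l ^ 2} \<union> (%i. \<alpha> i l) ` {1..n})" for l :: nat
 define b where "b l = Max ({l} \<union> (%i. \<rho> i l) ` {1..n})" for l :: nat
 have ab2: "L\<^sup>2 <= a L & L <= b L" for L by (simp add: a_def b_def)
 have ab: "L <= a L & L <= b L" for L
  using ab2[of L] le_trans[of L "L\<^sup>2"] by (cases "L = 0") (auto simp: power2_eq_square)
 have "isop (block {1..n}) word_ball a b"
 proof (rule isop_block[OF P _ ab2])
  show "\<alpha> i L <= a L & \<rho> i L <= b L" if "i \<in> {1..n}" for i L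
   unfolding a_def b_def using that by (intro conjI Max_ge) auto
 qed auto
 then have iso: "isop (carrier G) word_ball a b" using block_all[of "{1..n}"] by simp
 obtain S0 where S0: "gens (carrier G) S0" using iso by (auto simp: isop_def)
 obtain M0 \<tau> t where c: "coab G M0 \<tau> r t {1..n}" "fin_idx M0 (carrier G)" "fin_idx (coab.level M0 \<tau> r) H"
  using coordinates[OF vf vc S0] by blast
 interpret coab G M0 \<tau> r t "{1..n}" by (rule c(1))
 have i: "1 \<in> {1..n}" "2 \<in> {1..n}" "3 \<in> {1..n}" using n by auto
 have "isop (level r) (%_. heights) (%L. b L ^ (2 * r) * a L) b"
  by (rule isop_level[OF i _ _ _ isop_ball_fin_idx[OF iso c(2) ab] ab]) auto
 moreover have "L <= b L ^ (2 * r) * a L & L <= b L" for L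
 proof (cases "L = 0")
  case False
  then have "1 <= b L ^ (2 * r)" using ab[of L] by simp
  then have "1 * a L <= b L ^ (2 * r) * a L" by (rule mult_le_mono1)
  then show ?thesis using ab[of L] by linarith
 qed simp
 ultimately have "isop H (%_ _. UNIV) (%L. b L ^ (2 * r) * a L) b" by (rule isop_overgroup[OF _ c(3)])
 from isop_imp_presentation[OF this] obtain P' :: "nat presentation" and C where P':
  "finite_presentation_of P' (G\<lparr>carrier := H\<rparr>)" "\<forall>l. dehn_function P' l <= C * (b (C * l + C) ^ (2 * r) * a (C * l + C))"
  by blast
 have "dehn_le (dehn_function P') (%l. b l ^ (2 * r) * a l)"
  unfolding dehn_le_def by (rule exI[of _ C]) (use P'(2) in \<open>auto intro: trans_le_add1 simp: add.assoc\<close>)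
 then show ?thesis using P'(1) unfolding isoperimetric_function_def a_def b_def by blast
qed

text \<open>Every finite presentation has an area-radius pair whose area is its Dehn function, so
  finite presentability is contained in the quantitative bound.\<close>

lemma finitely_presented_subgroup:
 assumes fp: "!!i. i \<in> {1..n} ==> finitely_presented (\<Gamma> i)" and n: "n \<ge> 3"
  and vf: "virtually_full {1..n} \<Gamma> H" and vc: "virtually_coabelian_of_corank G H r"
 shows "finitely_presented (G\<lparr>carrier := H\<rparr>)"
proof -
 have "\<forall>i. \<exists>P :: nat presentation. i \<in> {1..n} --> finite_presentation_of P (\<Gamma> i)"
  using fp unfolding finitely_presented_def by blast
 then obtain P :: "nat => nat presentation" where P: "\<forall>i. i \<in> {1..n} --> finite_presentation_of (P i) (\<Gamma> i)"
  using choice[of "%i P. i \<in> {1..n} --> finite_presentation_of P (\<Gamma> i)"] by blast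
 have "\<forall>i. \<exists>\<rho>. i \<in> {1..n} --> area_radius_pair (P i) (dehn_function (P i)) \<rho>"
  using P dehn_area_radius_pair unfolding finite_presentation_of_def by blast
 then obtain \<rho> where \<rho>: "\<forall>i. i \<in> {1..n} --> area_radius_pair (P i) (dehn_function (P i)) (\<rho> i)"
  using choice[of "%i \<rho>. i \<in> {1..n} --> area_radius_pair (P i) (dehn_function (P i)) \<rho>"] by blast
 show ?thesis
  using presentation_area_radius[where P = P and \<alpha> = "%i. dehn_function (P i)" and \<rho> = \<rho>, OF _ n vf vc] P \<rho>
  unfolding isoperimetric_function_def finitely_presented_def by blast
qed

end

section \<open>Sorting words into blocks of conjugated letters\<close>

section \<open>Sorting words of a fibre product\<close>

context group
begin

text \<open>Eliminates auxiliary letters: fillings take place over the large alphabet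
  \<open>S\<close>, whereas the word to be sorted should contain letters of \<open>S0\<close>
  only.\<close>

lemma fill_subst:
 assumes \<iota>: "!!x. x \<in> S ==> \<iota> x \<in> words S0 & ev (\<iota> x) = x & length (\<iota> x) <= c"
  and S: "S0 <= S" "S <= carrier G" and N: "c + 1 <= N"
 shows "w \<in> words S ==> g \<in> carrier G ==>
  \<exists>w0. w0 \<in> words S0 & ev w0 = ev w & length w0 <= c * length w & fill G S N (carrier G) g (length w) w w0"
proof (induction w arbitrary: g)
 case Nil
 then show ?case by (intro exI[of _ "[]"]) (simp add: fill.refl)
next
 case (Cons l w)
 obtain x b where l: "l = (x, b)" by (cases l)
 have x: "x \<in> S" "w \<in> words S" "x \<in> carrier G" using Cons.prems l S by auto
 define u where "u = (if b then \<iota> x else word_inv (\<iota> x))"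
 have c: "\<iota> x \<in> words (carrier G)" using \<iota>[OF x(1)] words_mono[of S0 "carrier G"] S by auto
 have u: "u \<in> words S0" "ev u = ev [l]" "length u <= c" using \<iota>[OF x(1)] c x(3) by (auto simp: u_def l eval_word_Cons letter_val_def)
 have uS: "u \<in> words S" "u \<in> words (carrier G)" using words_mono[OF S(1) u(1)] words_carrier[OF S(2)] by auto
 have lc: "ev [l] \<in> carrier G" using x by (auto simp: l eval_word_Cons letter_val_def)
 obtain w0 where w0: "w0 \<in> words S0" "ev w0 = ev w" "length w0 <= c * length w"
   "fill G S N (carrier G) (g \<otimes> ev [l]) (length w) w w0"
  using Cons.IH[OF x(2), of "g \<otimes> ev [l]"] Cons.prems(2) lc by auto
 have w0c: "w0 \<in> words (carrier G)" "w \<in> words (carrier G)" using w0(1) words_mono[of S0 "carrier G"] S words_carrier[OF S(2) x(2)] by auto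
 have f: "fill G S N (carrier G) g 1 [l] u"
  by (rule fill_repl) (use u uS x N S Cons.prems l in auto)
 have "fill G S N (carrier G) g (length (l # w)) ([l] @ w) (u @ w0)"
  by (rule fill_append[OF f w0(4) S(2) Cons.prems(2)]) simp
 moreover have "ev (u @ w0) = ev ([l] @ w)" using u w0 uS w0c x l by (auto simp: eval_word_Cons)
 ultimately show ?case using u w0 by (intro exI[of _ "u @ w0"]) auto
qed

end

text \<open>The rewriting rules extracted from the fibre product: \<open>X\<close> comes from the
  first part of the factors, \<open>Y\<close> from the second, the \<open>\<sigma> i\<close> from
  both. Among the \<open>\<sigma> j\<close>, only \<open>\<sigma> (idx x)\<close> may fail to
  commute with \<open>x\<close>. \<open>sx x\<close> is the conjugate of that letter by
  \<open>x\<close>, and \<open>cx x\<close>, \<open>c1 i\<close> are \<open>sx x\<close>,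
  \<open>\<sigma> i\<close> stripped of a common commuting factor \<open>z\<close>, which makes them
  commute with \<open>Y\<close>.\<close>

locale block_sort = group G for G (structure) +
 fixes X Y S :: "'a set" and \<sigma> :: "nat => 'a" and r :: nat and idx :: "'a => nat" and sx cx :: "'a => 'a"
  and c1 z :: "nat => 'a" and N :: nat
 assumes S: "S <= carrier G" and XYS: "X <= S" "Y <= S" and N: "4 <= N"
  and sS: "i < r ==> \<sigma> i \<in> S & c1 i \<in> S & z i \<in> S" and xS: "x \<in> X ==> inv x \<in> X & sx x \<in> S & cx x \<in> S & idx x < r"
  and conj_x: "x \<in> X ==> x \<otimes> sx x = \<sigma> (idx x) \<otimes> x"
  and sx: "x \<in> X ==> sx x = cx x \<otimes> z (idx x) & cx x \<otimes> z (idx x) = z (idx x) \<otimes> cx x"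
  and sc: "i < r ==> \<sigma> i = c1 i \<otimes> z i & c1 i \<otimes> z i = z i \<otimes> c1 i"
  and yx: "y \<in> Y ==> x \<in> X ==> y \<otimes> x = x \<otimes> y & y \<otimes> cx x = cx x \<otimes> y"
  and yc: "y \<in> Y ==> i < r ==> y \<otimes> c1 i = c1 i \<otimes> y"
  and ss: "i < r ==> j < r ==> \<sigma> i \<otimes> \<sigma> j = \<sigma> j \<otimes> \<sigma> i"
  and s_x: "x \<in> X ==> j < r ==> j ~= idx x ==> \<sigma> j \<otimes> x = x \<otimes> \<sigma> j"
begin

abbreviation F where "F \<equiv> fill G S N (carrier G)"

text \<open>The conjugate of \<open>x\<close> by the \<open>m\<close>-th power of the one letter
  \<open>\<sigma> i\<close> that need not commute with it; conjugation by any other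
  \<open>\<sigma> j\<close> leaves its value unchanged.\<close>

definition blk :: "'a \<times> int => 'a gword" where
 "blk p = pw (\<sigma> (idx (fst p))) (snd p) @ [(fst p, True)] @ pw (\<sigma> (idx (fst p))) (- snd p)"

definition com :: "'a => 'a => bool" where "com x y \<longleftrightarrow> x \<otimes> y = y \<otimes> x"

lemma com_letters: "[|com (fst x) (fst y); fst x \<in> carrier G; fst y \<in> carrier G|] ==>
  letter_val G x \<otimes> letter_val G y = letter_val G y \<otimes> letter_val G x"
proof -
 assume a: "com (fst x) (fst y)" "fst x \<in> carrier G" "fst y \<in> carrier G"
 then have e: "fst x \<otimes> fst y = fst y \<otimes> fst x" by (simp add: com_def)
 have 1: "fst x \<otimes> inv (fst y) = inv (fst y) \<otimes> fst x" using commute_swap_inv[of "fst x" "fst y" "fst y"] a e by simp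
 have 2: "fst y \<otimes> inv (fst x) = inv (fst x) \<otimes> fst y" using commute_swap_inv[of "fst y" "fst x" "fst x"] a e by simp
 have 3: "inv (fst y) \<otimes> inv (fst x) = inv (fst x) \<otimes> inv (fst y)"
  using commute_swap_inv[of "inv (fst y)" "fst x" "fst x"] a 1 by simp
 show ?thesis using e 1 2 3 by (auto simp: letter_val_def)
qed

lemma F_move: "[|w \<in> words S; fst l \<in> S; !!x. x \<in> fst ` set w ==> com (fst l) x; g \<in> carrier G|] ==>
  F g (length w) (l # w) (w @ [l])"
proof -
 assume a: "w \<in> words S" "fst l \<in> S" "!!x. x \<in> fst ` set w ==> com (fst l) x" "g \<in> carrier G"
 have "fill G S 4 (carrier G) g (length w) (l # w) (w @ [l])"
 proof (rule fill_move_letter[OF a(1) _ a(2) S _ a(4)])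
  show "letter_val G l \<otimes> letter_val G x = letter_val G x \<otimes> letter_val G l" if "x \<in> set w" for x
   using com_letters[of l x] a(3)[of "fst x"] that a(1,2) S by (auto simp: words_iff)
  show "g \<otimes> ev u \<in> carrier G" if "u \<in> words S" for u using ev_closed[OF words_carrier[OF S that]] a(4) by simp
 qed simp
 then show ?thesis by (rule fill_mono) (use N in auto)
qed

lemma set_pw: "fst ` set (pw a m) <= {a}" by (auto simp: pw_def)

lemma sat: "saturated (carrier G) (carrier G)" by (simp add: saturated_def subgroup_self)

lemma blk_words: "fst p \<in> X ==> blk p \<in> words S" "fst p \<in> X ==> blk p \<in> words (X \<union> \<sigma> ` {..<r})"
 using xS[of "fst p"] sS XYS by (auto simp: blk_def)

lemma length_blk: "length (blk p) = 2 * nat \<bar>snd p\<bar> + 1" by (simp add: blk_def)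

definition kwd :: "'a \<times> int => 'a gword" where
 "kwd p = [(fst p, True)] @ pw (cx (fst p)) (snd p) @ pw (c1 (idx (fst p))) (- snd p)"

text \<open>Moving \<open>x\<close> to the front turns the block into
  \<open>x (sx x)^m \<sigma>^(-m)\<close>, from which the shared factor \<open>z\<close> drops out.
  All letters of the result commute with \<open>Y\<close>.\<close>

lemma F_blk_kwd:
 assumes x: "fst p \<in> X" and g: "g \<in> carrier G"
 shows "F g (3 * (nat \<bar>snd p\<bar> * nat \<bar>snd p\<bar> + nat \<bar>snd p\<bar>)) (blk p) (kwd p)"
proof -
 obtain a m where p: "p = (a, m)" by (cases p)
 let ?i = "idx a"
 have aX: "a \<in> X" using x p by simp
 have i: "?i < r" using xS[OF aX] by simp
 have c: "a \<in> carrier G" "a \<in> S" using aX XYS S by auto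
 have e: "ev [(a, True)] = a" using c by (simp add: eval_word_Cons letter_val_def)
 have "F g (nat \<bar>m\<bar>) ([(a, True)] @ pw (sx a) m) (pw (\<sigma> ?i) m @ [(a, True)])"
  by (rule fill_conj_pw[OF sat S]) (use e xS[OF aX] sS[OF i] conj_x[OF aX] N g S c in auto)
 then have "F g (nat \<bar>m\<bar>) (pw (\<sigma> ?i) m @ [(a, True)]) ([(a, True)] @ pw (sx a) m)" by (rule fill.sym)
 then have f1: "F g (nat \<bar>m\<bar>) ((pw (\<sigma> ?i) m @ [(a, True)]) @ pw (\<sigma> ?i) (- m)) (([(a, True)] @ pw (sx a) m) @ pw (\<sigma> ?i) (- m))"
  by (rule fill_append1) (use sS[OF i] S g in auto)
 have "F (g \<otimes> ev [(a, True)]) (2 * (nat \<bar>m\<bar> * nat \<bar>m\<bar> + nat \<bar>m\<bar>)) (pw (sx a) m @ pw (\<sigma> ?i) (- m)) (pw (cx a) m @ pw (c1 ?i) (- m))"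
  by (rule fill_drop_central[OF sat S, where z = "z ?i"])
   (use xS[OF aX] sS[OF i] sx[OF aX] sc[OF i] N g S c e in auto)
 then have f2: "F g (2 * (nat \<bar>m\<bar> * nat \<bar>m\<bar> + nat \<bar>m\<bar>)) ([(a, True)] @ (pw (sx a) m @ pw (\<sigma> ?i) (- m))) ([(a, True)] @ (pw (cx a) m @ pw (c1 ?i) (- m)))"
  by (rule fill_append2) (use S g c in auto)
 show ?thesis using fill_transI[OF f1, of _ "[(a, True)] @ (pw (cx a) m @ pw (c1 ?i) (- m))"] f2 by (simp add: blk_def kwd_def p)
qed

text \<open>A letter of \<open>Y\<close> passes while the block has the form \<open>kwd\<close>. A
  letter \<open>\<sigma> j\<close> with \<open>j\<close> different from the index commutes with
  every letter of the block. The letter with the same index is absorbed on the left, changing the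
  exponent by one, and reappears on the right.\<close>

lemma F_move_blk:
 assumes p: "fst p \<in> X" and l: "fst l \<in> Y \<union> \<sigma> ` {..<r}" and g: "g \<in> carrier G"
 shows "\<exists>m'. \<bar>m'\<bar> <= \<bar>snd p\<bar> + 1 & F g (9 * (nat \<bar>snd p\<bar> + 1)\<^sup>2) (l # blk p) (blk (fst p, m') @ [l])"
proof -
 obtain a m where pa: "p = (a, m)" by (cases p)
 let ?i = "idx a" and ?n = "nat \<bar>m\<bar>"
 have aX: "a \<in> X" using p pa by simp
 have i: "?i < r" using xS[OF aX] by simp
 have lS: "fst l \<in> S" using l XYS sS by auto
 have c: "a \<in> carrier G" "a \<in> S" using aX XYS S by auto
 have lc: "ev [l] \<in> carrier G" using lS S by (auto simp: eval_word_Cons letter_val_def)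
 have q: "9 * (?n + 1)\<^sup>2 = 9 * (?n * ?n) + 18 * ?n + 9" by (simp add: power2_eq_square algebra_simps)
 consider "fst l \<in> Y" | j where "j < r" "fst l = \<sigma> j" "j ~= ?i" | "fst l = \<sigma> ?i" using l by auto
 then show ?thesis
 proof cases
  case 1
  have kS: "kwd p \<in> words S" using xS[OF aX] sS[OF i] c by (simp add: kwd_def pa)
  have "fst ` set (kwd p) <= {a, cx a, c1 ?i}" using set_pw by (fastforce simp: kwd_def pa)
  then have "com (fst l) x" if "x \<in> fst ` set (kwd p)" for x
   using that yx[OF 1 aX] yc[OF 1 i] by (auto simp: com_def)
  then have f2: "F g (length (kwd p)) (l # kwd p) (kwd p @ [l])" by (intro F_move[OF kS lS _ g])
  have f1: "F g (3 * (?n * ?n + ?n)) ([l] @ blk p) ([l] @ kwd p)"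
   using F_blk_kwd[OF p, of "g \<otimes> ev [l]"] lc g lS S by (intro fill_append2) (auto simp: pa)
  have "F g (3 * (?n * ?n + ?n)) (kwd p) (blk p)" using F_blk_kwd[OF p g] by (auto simp: pa intro: fill.sym)
  then have f3: "F g (3 * (?n * ?n + ?n)) (kwd p @ [l]) (blk p @ [l])" by (rule fill_append1) (use lS S g in auto)
  have lk: "length (kwd p) = 2 * ?n + 1" by (simp add: kwd_def pa)
  have f4: "F g (3 * (?n * ?n + ?n) + (2 * ?n + 1)) ([l] @ blk p) (kwd p @ [l])"
   by (rule fill_transI[OF f1]) (use f2 lk in auto)
  have "F g (9 * (?n + 1)\<^sup>2) ([l] @ blk p) (blk p @ [l])"
   by (rule fill_transI[OF f4 f3]) (simp only: q, simp)
  then show ?thesis by (intro exI[of _ m]) (simp add: pa)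
 next
  case 2
  have "fst ` set (blk p) <= {a, \<sigma> ?i}" using set_pw by (fastforce simp: blk_def pa)
  then have "com (fst l) x" if "x \<in> fst ` set (blk p)" for x
   using that ss[OF 2(1) i] s_x[OF aX 2(1,3)] 2 by (auto simp: com_def)
  then have "F g (length (blk p)) (l # blk p) (blk p @ [l])" by (intro F_move[OF blk_words(1)[OF p] lS _ g])
  then have "F g (9 * (?n + 1)\<^sup>2) (l # blk p) (blk p @ [l])"
   by (rule fill_weaken) (simp only: q length_blk, simp add: pa)
  then show ?thesis by (intro exI[of _ m]) (simp add: pa)
 next
  case 3
  let ?s = "\<sigma> ?i"
  have sS': "?s \<in> S" using sS[OF i] by simp
  have pre: "F h 0 ((?s, b) # pw ?s k) (pw ?s (if b then k + 1 else k - 1))" for h b k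
  proof (cases b)
   case True
   then show ?thesis using fill.sym[OF fill_pw_Suc[OF sS', of N "carrier G" h k]] by simp
  next
   case False
   have 1: "F h 0 ([(?s, False)] @ pw ?s k) ([(?s, False)] @ ((?s, True) # pw ?s (k - 1)))"
   \<comment> \<open>\<open>pre\<close> is stated for every \<open>h\<close>; outside the carrier
     \<open>fill_append2\<close> does not apply, and the claim is read off the shape of the
     words.\<close>
   proof (cases "h \<in> carrier G")
    case True
    show ?thesis by (rule fill_append2[OF _ _ S True]) (use fill_pw_Suc[OF sS', of N "carrier G" _ "k - 1"] sS' in auto)
   next
    case hf: False
    show ?thesis
    proof (cases "0 < k")
     case True
     then have "pw ?s k = (?s, True) # pw ?s (k - 1)" using pw_Suc_nat(1)[of ?s "nat (k - 1)"] by simp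
     then show ?thesis using sS' by (auto intro: fill.refl)
    next
     case False
     have "pw ?s (k - 1) = (?s, False) # pw ?s k"
     proof -
      have "nat \<bar>k - 1\<bar> = Suc (nat \<bar>k\<bar>)" using False by simp
      then show ?thesis using False by (cases "k = 0") (auto simp: pw_def)
     qed
     then show ?thesis using fill.sym[OF fill.cancel[where G = G and u = "[(?s, False)]" and v = "pw ?s k" and x = ?s and b = True and g = h and V = "carrier G" and N = N and S = S]] sS' by simp
    qed
   qed
   have 2: "F h 0 ((?s, False) # (?s, True) # pw ?s (k - 1)) (pw ?s (k - 1))"
    using fill.cancel[where G = G and u = "[]" and v = "pw ?s (k - 1)" and x = ?s and b = False and g = h and V = "carrier G" and N = N and S = S] sS' by simp
   show ?thesis using fill.trans[OF 1, of 0 "pw ?s (k - 1)"] 2 False by simp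
  qed
  obtain b where lb: "l = (?s, b)" using 3 by (cases l) auto
  define m' where "m' = (if b then m + 1 else m - 1)"
  have g1: "F g 0 ((l # pw ?s m) @ ([(a, True)] @ pw ?s (- m))) (pw ?s m' @ ([(a, True)] @ pw ?s (- m)))"
   using pre[of g b m] sS' S g c by (intro fill_append1) (auto simp: lb m'_def)
  have "com (fst l) x" if "x \<in> fst ` set (pw ?s (- m'))" for x using set_pw[of ?s "- m'"] that by (auto simp: com_def lb)
  then have h1: "F h (nat \<bar>m'\<bar>) (l # pw ?s (- m')) (pw ?s (- m') @ [l])" if "h \<in> carrier G" for h
   using F_move[of "pw ?s (- m')" l h] sS' lS that by simp
  have h2: "F h 0 (l # pw ?s (- m')) (pw ?s (- m))" for h
   using pre[of h b "- m'"] by (auto simp: lb m'_def)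
  have h3: "F h (nat \<bar>m'\<bar>) (pw ?s (- m)) (pw ?s (- m') @ [l])" if "h \<in> carrier G" for h
   by (rule fill_transI[OF fill.sym[OF h2] h1[OF that]]) simp
  have pc: "g \<otimes> ev (pw ?s m' @ [(a, True)]) \<in> carrier G"
   using g c sS' S ev_closed[of "pw ?s m' @ [(a, True)]"] by auto
  have "F g (nat \<bar>m'\<bar>) ((pw ?s m' @ [(a, True)]) @ pw ?s (- m)) ((pw ?s m' @ [(a, True)]) @ (pw ?s (- m') @ [l]))"
   by (rule fill_append2[OF h3[OF pc]]) (use sS' c S g in auto)
  then have g2: "F g (nat \<bar>m'\<bar>) (pw ?s m' @ ([(a, True)] @ pw ?s (- m))) (blk (a, m') @ [l])" by (simp add: blk_def)
  have mm: "\<bar>m'\<bar> <= \<bar>m\<bar> + 1" by (cases b) (simp_all add: m'_def)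
  then have "nat \<bar>m'\<bar> <= ?n + 1" by simp
  then have "0 + nat \<bar>m'\<bar> <= 9 * (?n + 1)\<^sup>2" unfolding q by linarith
  then have "F g (9 * (?n + 1)\<^sup>2) ((l # pw ?s m) @ ([(a, True)] @ pw ?s (- m))) (blk (a, m') @ [l])"
   by (rule fill_transI[OF g1 g2])
  then show ?thesis using mm by (intro exI[of _ m']) (simp add: pa blk_def)
 qed
qed

abbreviation bw where "bw bl \<equiv> concat (map blk bl)"

lemma bw_words: "fst ` set bl <= X ==> bw bl \<in> words S & bw bl \<in> words (X \<union> \<sigma> ` {..<r})"
 by (induction bl) (auto simp: blk_words)

lemma length_bw: "(!!p. p \<in> set bl ==> nat \<bar>snd p\<bar> <= B) ==> length (bw bl) <= length bl * (2 * B + 1)"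
proof (induction bl)
 case (Cons p bl)
 have "nat \<bar>snd p\<bar> <= B" "length (bw bl) <= length bl * (2 * B + 1)" using Cons by auto
 then show ?case using length_blk[of p] by simp
qed simp

lemma F_move_bw:
 assumes l: "fst l \<in> Y \<union> \<sigma> ` {..<r}"
 shows "[|fst ` set bl <= X; !!p. p \<in> set bl ==> nat \<bar>snd p\<bar> <= B; g \<in> carrier G|] ==>
  \<exists>bl'. length bl' = length bl & fst ` set bl' <= X & (\<forall>p\<in>set bl'. nat \<bar>snd p\<bar> <= B + 1) &
   F g (length bl * (9 * (B + 1)\<^sup>2)) (l # bw bl) (bw bl' @ [l])"
proof (induction bl arbitrary: g)
 case Nil
 have "[l] \<in> words S" using l XYS sS by auto
 then show ?case by (intro exI[of _ "[]"]) (simp add: fill.refl)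
next
 case (Cons p bl)
 have p: "fst p \<in> X" "nat \<bar>snd p\<bar> <= B" using Cons.prems by auto
 have lS: "fst l \<in> S" using l XYS sS by auto
 obtain m' where m': "\<bar>m'\<bar> <= \<bar>snd p\<bar> + 1" "F g (9 * (nat \<bar>snd p\<bar> + 1)\<^sup>2) (l # blk p) (blk (fst p, m') @ [l])"
  using F_move_blk[OF p(1) l Cons.prems(3)] by blast
 have bS: "blk (fst p, m') \<in> words S" "bw bl \<in> words S" using blk_words(1)[of "(fst p, m')"] p bw_words[of bl] Cons.prems(1) by auto
 have gc: "g \<otimes> ev (blk (fst p, m')) \<in> carrier G" using ev_closed[OF words_carrier[OF S bS(1)]] Cons.prems(3) by simp
 obtain bl' where bl': "length bl' = length bl" "fst ` set bl' <= X" "\<forall>p\<in>set bl'. nat \<bar>snd p\<bar> <= B + 1"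
   "F (g \<otimes> ev (blk (fst p, m'))) (length bl * (9 * (B + 1)\<^sup>2)) (l # bw bl) (bw bl' @ [l])"
  using Cons.IH[OF _ _ gc] Cons.prems by auto
 have f1: "F g (9 * (nat \<bar>snd p\<bar> + 1)\<^sup>2) ((l # blk p) @ bw bl) ((blk (fst p, m') @ [l]) @ bw bl)"
  by (rule fill_append1[OF m'(2) bS(2) S Cons.prems(3)])
 have f2: "F g (length bl * (9 * (B + 1)\<^sup>2)) (blk (fst p, m') @ (l # bw bl)) (blk (fst p, m') @ (bw bl' @ [l]))"
  by (rule fill_append2[OF bl'(4) bS(1) S Cons.prems(3)])
 have "9 * (nat \<bar>snd p\<bar> + 1)\<^sup>2 <= 9 * (B + 1)\<^sup>2" using p(2) by (intro mult_le_mono2 power_mono) auto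
 then have "F g (length (p # bl) * (9 * (B + 1)\<^sup>2)) ((l # blk p) @ bw bl) (blk (fst p, m') @ (bw bl' @ [l]))"
  by (intro fill_transI[OF f1]) (use f2 in \<open>auto simp: distrib_right\<close>)
 then show ?case using bl' m' p by (intro exI[of _ "(fst p, m') # bl'"]) auto
qed

text \<open>Letters of \<open>X\<close> become blocks of exponent 0; every other letter is moved
  right past all blocks, changing each exponent by at most one. With \<open>l\<close> letters, at
  most \<open>l\<close> blocks and exponents up to \<open>l\<close>, each passage costs
  \<open>O(l^2)\<close>, in total \<open>O(l^4)\<close>.\<close>

lemma F_sort:
 "[|w \<in> words (X \<union> Y \<union> \<sigma> ` {..<r}); g \<in> carrier G|] ==>
  \<exists>bl w2. length bl <= length w & fst ` set bl <= X & (\<forall>p\<in>set bl. nat \<bar>snd p\<bar> <= length w) &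
   w2 \<in> words (Y \<union> \<sigma> ` {..<r}) & length w2 <= length w & F g (9 * length w ^ 4) w (bw bl @ w2)"
proof (induction w arbitrary: g)
 case Nil
 then show ?case by (intro exI[of _ "[]"]) (simp add: fill.refl)
next
 case (Cons l w)
 let ?n = "length w"
 have lw: "fst l \<in> X \<union> Y \<union> \<sigma> ` {..<r}" "w \<in> words (X \<union> Y \<union> \<sigma> ` {..<r})" using Cons.prems by auto
 have lS: "fst l \<in> S" using lw XYS sS by auto
 have lc: "g \<otimes> ev [l] \<in> carrier G" using lS S Cons.prems(2) by (auto simp: eval_word_Cons letter_val_def)
 obtain bl w2 where I: "length bl <= ?n" "fst ` set bl <= X" "\<forall>p\<in>set bl. nat \<bar>snd p\<bar> <= ?n"
   "w2 \<in> words (Y \<union> \<sigma> ` {..<r})" "length w2 <= ?n" "F (g \<otimes> ev [l]) (9 * ?n ^ 4) w (bw bl @ w2)"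
  using Cons.IH[OF lw(2) lc] by blast
 have w2S: "w2 \<in> words S" by (rule words_mono[OF _ I(4)]) (use XYS sS in auto)
 have f: "F g (9 * ?n ^ 4) ([l] @ w) ([l] @ (bw bl @ w2))" by (rule fill_append2[OF I(6)]) (use lS S Cons.prems in auto)
 have q: "9 * ?n ^ 4 + ?n * (9 * (?n + 1)\<^sup>2) <= 9 * (?n + 1) ^ 4" "9 * ?n ^ 4 + 1 <= 9 * (?n + 1) ^ 4"
  by (simp_all add: power2_eq_square power4_eq_xxxx algebra_simps)
 show ?case
 proof (cases "fst l \<in> X")
  case True
  \<comment> \<open>Blocks contain \<open>x\<close> with positive sign only. As \<open>X\<close> is
    closed under inverses, one loop replaces a negative letter by the inverse generator.\<close>
  define x where "x = (if snd l then fst l else inv (fst l))"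
  have x: "x \<in> X" "x \<in> S" "x \<in> carrier G" "fst l \<in> carrier G" using True xS[OF True] XYS S by (auto simp: x_def)
  have b: "blk (x, 0) = [(x, True)]" by (simp add: blk_def)
  have e: "ev [l] = ev [(x, True)]" using x(4) by (auto simp: x_def eval_word_Cons letter_val_def)
  have "F g 1 [l] [(x, True)]" by (rule fill_repl) (use lS x e N S Cons.prems in auto)
  then have f1: "F g 1 ([l] @ (bw bl @ w2)) ([(x, True)] @ (bw bl @ w2))"
   by (rule fill_append1) (use bw_words[OF I(2)] w2S S Cons.prems in auto)
  have "F g (9 * length (l # w) ^ 4) (l # w) (bw ((x, 0) # bl) @ w2)"
   using fill_transI[OF f f1, of "9 * length (l # w) ^ 4"] q(2) b by simp
  then show ?thesis using I x by (intro exI[of _ "(x, 0) # bl"] exI[of _ w2]) (auto simp: le_SucI)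
 next
  case False
  then have l: "fst l \<in> Y \<union> \<sigma> ` {..<r}" using lw by auto
  obtain bl' where bl': "length bl' = length bl" "fst ` set bl' <= X" "\<forall>p\<in>set bl'. nat \<bar>snd p\<bar> <= ?n + 1"
    "F g (length bl * (9 * (?n + 1)\<^sup>2)) (l # bw bl) (bw bl' @ [l])"
   using F_move_bw[OF l I(2) _ Cons.prems(2), of ?n] I(3) by blast
  have f1: "F g (length bl * (9 * (?n + 1)\<^sup>2)) ((l # bw bl) @ w2) ((bw bl' @ [l]) @ w2)"
   by (rule fill_append1[OF bl'(4) w2S S Cons.prems(2)])
  have "length bl * (9 * (?n + 1)\<^sup>2) <= ?n * (9 * (?n + 1)\<^sup>2)" using I(1) by (rule mult_le_mono1)
  from fill_weaken[OF f1 this] have f2: "F g (?n * (9 * (?n + 1)\<^sup>2)) ([l] @ (bw bl @ w2)) ((bw bl' @ [l]) @ w2)" by simp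
  have "F g (9 * length (l # w) ^ 4) (l # w) (bw bl' @ (l # w2))"
   using fill_transI[OF f f2, of "9 * length (l # w) ^ 4"] q(1) by simp
  then show ?thesis using I bl' l by (intro exI[of _ bl'] exI[of _ "l # w2"]) auto
 qed
qed

end

section \<open>A quadratic lower bound for areas\<close>

context group
begin

lemma ev_map_hom:
 assumes K: "subgroup K G" and f: "!!x. x \<in> K ==> f x \<in> carrier G" "!!x y. x \<in> K ==> y \<in> K ==> f (x \<otimes> y) = f x \<otimes> f y"
 shows "w \<in> words K ==> ev (map_letters f w) = f (ev w)"
proof (induction w)
 have f1: "f \<one> = \<one>"
 proof -
  have "f \<one> \<otimes> f \<one> = f \<one> \<otimes> \<one>" using f(2)[of \<one> \<one>] f(1)[of \<one>] subgroup.one_closed[OF K] by simp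
  then show ?thesis using f(1)[of \<one>] subgroup.one_closed[OF K] by simp
 qed
 have fi: "f (inv x) = inv (f x)" if x: "x \<in> K" for x
 proof -
  have "f (inv x) \<otimes> f x = \<one>" using f(2)[of "inv x" x] x subgroup.m_inv_closed[OF K x] subgroup.mem_carrier[OF K x] f1 by simp
  then show ?thesis using inv_equality f(1) x subgroup.m_inv_closed[OF K x] by simp
 qed
 {
  case Nil
  then show ?case using f1 by simp
 next
  case (Cons l w)
  have l: "fst l \<in> K" "w \<in> words K" using Cons.prems by auto
  have lv: "letter_val G l \<in> K" using l subgroup.m_inv_closed[OF K] by (auto simp: letter_val_def)
  have "letter_val G (f (fst l), snd l) = f (letter_val G l)" using fi[OF l(1)] by (simp add: letter_val_def)
  then show ?case using Cons.IH[OF l(2)] f(2)[OF lv ev_in_subgroup[OF K l(2)]] by (simp add: eval_word_Cons)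
 }
qed

text \<open>The central coordinate of the image of a word in the Heisenberg group. Relators of bounded length
 change it by a bounded amount, whereas it is quadratic on commutators of powers.\<close>

fun heis :: "('a => int) => ('a => int) => 'a gword => int" where
 "heis p q [] = 0"
| "heis p q ((x, b) # w) = (if b then 0 else p x * q x) + (if b then p x else - p x) * q (ev w) + heis p q w"

text \<open>Serves to absorb the \<open>l^4\<close> spent on sorting into the area of words of
  length \<open>l^2\<close> in \<open>A\<close>. The homomorphisms \<open>p\<close> and
  \<open>q\<close> send \<open>u\<close> and \<open>v\<close> to a basis of \<open>Z^2\<close>, and
  the commutator word of \<open>u^m\<close> and \<open>v^m\<close> has central coordinate
  \<open>m^2\<close>.\<close>

lemma quadratic_lower_bound:
 assumes iso: "isop K V a b" and uv: "u \<in> K" "v \<in> K" "u \<otimes> v = v \<otimes> u"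
  and p: "!!x y. x \<in> K ==> y \<in> K ==> p (x \<otimes> y) = p x + (p y :: int)" "p u = 1" "p v = 0"
  and q: "!!x y. x \<in> K ==> y \<in> K ==> q (x \<otimes> y) = q x + (q y :: int)" "q u = 0" "q v = 1"
 shows "\<exists>C. \<forall>m L. C * m + C <= L --> m\<^sup>2 <= C * a L"
proof -
 obtain S0 where S0: "gens K S0" using iso by (auto simp: isop_def)
 define S where "S = insert u (insert v S0)"
 have S: "gens K S" using S0 uv words_mono[of S0 S] unfolding gens_def S_def by blast
 obtain N C where "isop_at S (V S) a b N C" using iso S by (auto simp: isop_def isop_wrt_def)
 note NC = isop_atD[OF this]
 have K: "subgroup K G" and fS: "finite S" "S <= K" using S by (auto simp: gens_def)
 have Kc: "x \<in> carrier G" if "x \<in> K" for x using subgroup.mem_carrier[OF K that] .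
 have Kcl: "\<one> \<in> K" "x \<in> K ==> inv x \<in> K" for x using subgroup.one_closed[OF K] subgroup.m_inv_closed[OF K] by auto
 have h1: "p \<one> = 0" "q \<one> = 0" using p(1)[OF Kcl(1) Kcl(1)] q(1)[OF Kcl(1) Kcl(1)] by simp_all
 have hi: "p (inv x) = - p x" "q (inv x) = - q x" if "x \<in> K" for x
  using p(1)[OF that Kcl(2)[OF that]] q(1)[OF that Kcl(2)[OF that]] h1 Kc[OF that] by simp_all
 have evK: "ev w \<in> K" if "w \<in> words K" for w by (rule ev_in_subgroup[OF K that])
 have lvK: "letter_val G l \<in> K" if "fst l \<in> K" for l using that Kcl by (simp add: letter_val_def)
 have cons: "q (ev ((x, c) # w)) = (if c then q x else - q x) + q (ev w)" "p (ev ((x, c) # w)) = (if c then p x else - p x) + p (ev w)"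
  if "x \<in> K" "w \<in> words K" for x c w
  using q(1)[OF lvK[of "(x, c)"] evK[OF that(2)]] p(1)[OF lvK[of "(x, c)"] evK[OF that(2)]] that hi[OF that(1)]
  by (auto simp: eval_word_Cons letter_val_def)
 have app: "heis p q (x @ y) = heis p q x + p (ev x) * q (ev y) + heis p q y" if "x \<in> words K" "y \<in> words K" for x y
  using that(1)
 proof (induction x)
  case Nil
  then show ?case using h1 by simp
 next
  case (Cons l x)
  obtain g c where l: "l = (g, c)" by (cases l)
  have g: "g \<in> K" "x \<in> words K" "x \<in> words (carrier G)" "y \<in> words (carrier G)"
   using Cons.prems that words_mono[of K "carrier G"] Kc by (auto simp: l)
  have "q (ev (x @ y)) = q (ev x) + q (ev y)" using q(1)[OF evK[OF g(2)] evK[OF that(2)]] g by simp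
  then show ?case using Cons.IH[OF g(2)] cons[OF g(1,2)] by (simp add: l algebra_simps)
 qed
 have SK: "w \<in> words K" if "w \<in> words S" for w using words_mono[OF fS(2) that] .
 obtain M where M: "\<forall>w\<in>{w \<in> words S. length w <= N}. nat \<bar>heis p q w\<bar> <= M"
  using finite_bound[OF finite_words_bounded[OF fS(1), of N], of "%w. nat \<bar>heis p q w\<bar>"] by blast
 \<comment> \<open>A relator has vanishing \<open>p\<close> and \<open>q\<close>, so inserting it
   adds exactly its own central coordinate, which \<open>M\<close> bounds over the finitely many
   short words.\<close>
 have change: "\<bar>heis p q w - heis p q w'\<bar> <= int (M * m)" if "fill G S N V' g m w w'" for V' g m w w'
  using that
 proof (induction rule: fill.induct)
  case (trans x y m z k)
  then show ?case by (simp add: distrib_left)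
 next
  case (sym x y m)
  then show ?case by (simp add: abs_minus_commute)
 next
  case (cancel x y g c)
  have k: "x \<in> words K" "y \<in> words K" "g \<in> K" using cancel SK fS by auto
  have k2: "[(g, c), (g, \<not> c)] \<in> words K" "[(g, c), (g, \<not> c)] @ y \<in> words K" using k by auto
  have z: "q (ev [(g, c), (g, \<not> c)]) = 0" "p (ev [(g, c), (g, \<not> c)]) = 0" "heis p q [(g, c), (g, \<not> c)] = 0"
   using cons[OF k(3), of "[(g, \<not> c)]" c] cons[OF k(3), of "[]" "\<not> c"] k h1 by (auto simp: algebra_simps)
  have "q (ev ([(g, c), (g, \<not> c)] @ y)) = q (ev y)"
   using cons[OF k(3), of "(g, \<not> c) # y" c] cons[OF k(3), of y "\<not> c"] k by auto
  then show ?case using app[OF k(1) k2(2)] app[OF k2(1) k(2)] app[OF k(1,2)] z by simp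
 next
  case (relator x y s)
  have k: "x \<in> words K" "y \<in> words K" "s \<in> words K" using relator SK by auto
  have c: "s \<in> words (carrier G)" "y \<in> words (carrier G)" using k words_mono[of K "carrier G"] Kc by auto
  have "ev (s @ y) = ev y" using c relator by simp
  moreover have "nat \<bar>heis p q s\<bar> <= M" using M relator by auto
  ultimately show ?case using app[OF k(1), of "s @ y"] app[OF k(3,2)] app[OF k(1,2)] k relator h1 by simp
 qed simp
 have uvc: "u \<in> carrier G" "v \<in> carrier G" using uv Kc by auto
 have bound: "m\<^sup>2 <= M * (C * a L)" if L: "C * (4 * m) + C <= L" for m L
 proof -
  have pz: "heis p q (pw x k) = 0 & p (ev (pw x k)) = k * p x & q (ev (pw x k)) = k * q x" if x: "x \<in> K" "p x * q x = 0" for x k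
  proof -
   have "heis p q (replicate i (x, c)) = 0 & p (ev (replicate i (x, c))) = int i * (if c then p x else - p x) &
    q (ev (replicate i (x, c))) = int i * (if c then q x else - q x)" for i c
   proof (induction i)
    case (Suc i)
    have "replicate i (x, c) \<in> words K" using x by simp
    from cons[OF x(1) this, of c] show ?case using Suc x(2) by (auto simp: algebra_simps)
   qed (use h1 in simp)
   then show ?thesis by (auto simp: pw_def)
  qed
  note pu = pz[OF uv(1)] and pv = pz[OF uv(2)]
  let ?m = "int m"
  let ?w = "pw u ?m @ (pw v ?m @ (pw u (- ?m) @ pw v (- ?m)))"
  have pwK: "pw u k \<in> words K" "pw v k \<in> words K" "pw u k \<in> words (carrier G)" "pw v k \<in> words (carrier G)" for k
   using uv uvc by simp_all
  have "ev ?w = u [^] ?m \<otimes> (v [^] ?m \<otimes> (u [^] (- ?m) \<otimes> v [^] (- ?m)))" using pwK uvc by (simp add: ev_pw)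
  also have "... = \<one>"
  proof -
   have pc: "x [^] k \<otimes> y = y \<otimes> x [^] k" if "x \<in> carrier G" "y \<in> carrier G" "x \<otimes> y = y \<otimes> x" for x y and k :: nat
   proof (induction k)
    case (Suc k)
    have "x [^] Suc k \<otimes> y = x [^] k \<otimes> (y \<otimes> x)" using that by (simp add: m_assoc)
    also have "... = (y \<otimes> x [^] k) \<otimes> x" using that Suc by (simp add: m_assoc[symmetric])
    finally show ?case using that by (simp add: m_assoc)
   qed (use that in simp)
   have uvp: "u [^] k \<otimes> v [^] k' = v [^] k' \<otimes> u [^] k" for k k' :: nat
    by (rule pc[OF uvc(1) nat_pow_closed[OF uvc(2)] pc[OF uvc(2,1) uv(3)[symmetric], symmetric]])
   then have "inv (v [^] m \<otimes> u [^] m) = inv (u [^] m \<otimes> v [^] m)" by simp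
   then have "inv (u [^] m) \<otimes> inv (v [^] m) = inv (v [^] m) \<otimes> inv (u [^] m)" using uvc by (simp add: inv_mult_group)
   then show ?thesis using uvc uvp[of m m]
    by (simp add: int_pow_neg_int int_pow_int m_assoc inv_cancel_left)
  qed
  finally have e: "ev ?w = \<one>" .
  have wS: "?w \<in> words S" by (simp add: S_def)
  have "length ?w = 4 * m" by simp
  then have "C * length ?w + C <= L" using L by (simp only:)
  from change[OF NC[OF wS e this]] have 1: "\<bar>heis p q ?w\<bar> <= int (M * (C * a L))" by simp
  have z: "p u * q u = 0" "p v * q v = 0" using p q by simp_all
  have k: "pw u (- ?m) @ pw v (- ?m) \<in> words K" "pw v ?m @ (pw u (- ?m) @ pw v (- ?m)) \<in> words K" using pwK by simp_all
  have q1: "q (ev (pw u (- ?m) @ pw v (- ?m))) = - ?m"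
   using q(1)[OF evK[OF pwK(1)] evK[OF pwK(2)], of "- ?m" "- ?m"] pwK pu[OF z(1)] pv[OF z(2)] q by simp
  have q2: "q (ev (pw v ?m @ (pw u (- ?m) @ pw v (- ?m)))) = 0"
  proof -
   have kc: "pw u (- ?m) @ pw v (- ?m) \<in> words (carrier G)" using pwK by simp
   show ?thesis using q(1)[OF evK[OF pwK(2)[of ?m]] evK[OF k(1)]] q1 pwK kc pv[OF z(2), of ?m] q
    by (simp only: ev_append[OF pwK(4) kc])
  qed
  have "heis p q ?w = ?m * ?m"
   using app[OF pwK(1) k(2), of ?m] app[OF pwK(2) k(1), of ?m] app[OF pwK(1,2), of "- ?m" "- ?m"] q1 q2
    pu[OF z(1)] pv[OF z(2)] p q by simp
  then have "int (m\<^sup>2) <= int (M * (C * a L))" using 1 by (simp add: power2_eq_square)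
  then show ?thesis by linarith
 qed
 show ?thesis
 proof (intro exI[of _ "4 * C + M * C"] allI impI)
  fix m L assume L: "(4 * C + M * C) * m + (4 * C + M * C) <= L"
  have "(4 * C) * m <= (4 * C + M * C) * m" by (rule mult_le_mono1) simp
  then have "C * (4 * m) + C <= L" using L by (simp add: algebra_simps)
  from bound[OF this] have "m\<^sup>2 <= (M * C) * a L" by (simp add: mult.assoc)
  also have "... <= (4 * C + M * C) * a L" by (rule mult_le_mono1) simp
  finally show "m\<^sup>2 <= (4 * C + M * C) * a L" .
 qed
qed

end

section \<open>The fibre product of the first n - r and the last r factors\<close>

section \<open>Splitting off r factors\<close>

context direct_factors
begin

lemma ext_block: "x \<in> carrier G ==> ext s x \<in> block s"
 by (rule ext_carrier) (auto simp: coord_closed)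

lemma ext_closed: "x \<in> carrier G ==> ext s x \<in> carrier G"
 using ext_block block_carrier by blast

lemma ext_mult: "x \<in> carrier G ==> y \<in> carrier G ==> ext s (x \<otimes> y) = ext s x \<otimes> ext s y"
proof (rule coord_eqI)
 fix j assume c: "x \<in> carrier G" "y \<in> carrier G" and j: "j \<in> {1..n}"
 interpret g: group "\<Gamma> j" by (rule grp[OF j])
 show "ext s (x \<otimes> y) j = (ext s x \<otimes> ext s y) j" by (simp only: ext_coord[OF j] coord_mult[OF j]) simp
qed (auto intro: ext_closed)

lemma ext_id: "x \<in> block s ==> ext s x = x"
proof (rule coord_eqI)
 assume x: "x \<in> block s"
 then show xc: "x \<in> carrier G" using block_carrier by blast
 then show "ext s x \<in> carrier G" by (rule ext_closed)
 show "ext s x j = x j" if "j \<in> {1..n}" for j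
  using block_coord[OF x that] by (simp only: ext_coord[OF that]) auto
qed

lemma ext_ext: "x \<in> carrier G ==> ext s (ext s' x) = ext (s \<inter> s') x"
proof (rule coord_eqI)
 fix j assume c: "x \<in> carrier G" and j: "j \<in> {1..n}"
 show "ext s (ext s' x) j = ext (s \<inter> s') x j" by (simp only: ext_coord[OF j]) auto
qed (auto intro: ext_closed)

lemma ext_empty: "x \<in> carrier G ==> ext {} x = \<one>"
 using ext_block[of x "{}"] block_empty by auto

lemma ext_disjoint: "x \<in> block s' ==> s \<inter> s' = {} ==> ext s x = \<one>"
 using ext_ext[of x s s'] ext_id[of x s'] block_carrier ext_empty by force

lemma ext_one: "ext s \<one> = \<one>"
 using ext_mult[of \<one> \<one> s] ext_closed[of \<one> s] by simp

lemma ext_inv: "x \<in> carrier G ==> ext s (inv x) = inv (ext s x)"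
 using ext_mult[of "inv x" x s] ext_one ext_closed[of x s] ext_closed[of "inv x" s] by (simp add: inv_equality)

lemma ext_Un: "x \<in> carrier G ==> s \<inter> s' = {} ==> ext (s \<union> s') x = ext s x \<otimes> ext s' x"
proof (rule coord_eqI)
 fix j assume c: "x \<in> carrier G" "s \<inter> s' = {}" and j: "j \<in> {1..n}"
 interpret g: group "\<Gamma> j" by (rule grp[OF j])
 show "ext (s \<union> s') x j = (ext s x \<otimes> ext s' x) j"
  using c coord_closed[OF c(1) j] by (simp only: coord_mult[OF j] ext_coord[OF j]) auto
qed (auto intro: ext_closed)

lemma ext_all: "x \<in> carrier G ==> {1..n} <= s ==> ext s x = x"
 using ext_id[of x s] block_all[of s] by simp

text \<open>The coset of \<open>g\<close> modulo the preimage is determined by the coset of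
  \<open>ext s g\<close> modulo \<open>M\<close>.\<close>

lemma fin_idx_preimage:
 assumes M: "fin_idx M (carrier G)"
 shows "fin_idx {g \<in> carrier G. ext s g \<in> M} (carrier G)"
proof -
 let ?K = "{g \<in> carrier G. ext s g \<in> M}"
 have Ms: "subgroup M G" and fin: "finite ((%g. M #> g) ` carrier G)" using M by (auto simp: fin_idx_def)
 have K: "subgroup ?K G"
 proof (rule subgroupI)
  show "?K ~= {}" using ext_one subgroup.one_closed[OF Ms] by (metis (mono_tags, lifting) empty_iff mem_Collect_eq one_closed)
 qed (auto simp: ext_inv ext_mult subgroup.m_closed[OF Ms] subgroup.m_inv_closed[OF Ms])
 have "\<exists>f. \<forall>g\<in>carrier G. ?K #> g = f (M #> ext s g)"
 proof (intro exI[of _ "%X. ?K #> (SOME g. g \<in> carrier G & M #> ext s g = X)"] ballI)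
  fix g assume g: "g \<in> carrier G"
  define h where "h = (SOME h. h \<in> carrier G & M #> ext s h = M #> ext s g)"
  have h: "h \<in> carrier G & M #> ext s h = M #> ext s g" unfolding h_def by (rule someI[of _ g]) (use g in simp)
  then have "ext s g \<otimes> inv (ext s h) \<in> M" using coset_eq_iff[OF Ms, of "ext s g" "ext s h"] g ext_closed by simp
  then have "g \<otimes> inv h \<in> ?K" using g h by (simp add: ext_mult ext_inv)
  then show "?K #> g = ?K #> h" using coset_eq_iff[OF K g, of h] h by simp
 qed
 then obtain f where f: "\<forall>g\<in>carrier G. ?K #> g = f (M #> ext s g)" ..
 have "(%g. ?K #> g) ` carrier G <= f ` ((%g. M #> g) ` carrier G)"
 proof (rule image_subsetI)
  fix g assume g: "g \<in> carrier G"
  then show "?K #> g \<in> f ` ((%g. M #> g) ` carrier G)" using f ext_closed[OF g, of s] by simp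
 qed
 then have "finite ((%g. ?K #> g) ` carrier G)" by (rule finite_subset) (rule finite_imageI[OF fin])
 then show ?thesis using K subgroup_self by (auto simp: fin_idx_def)
qed

end

locale split_coab = direct_factors G \<Gamma> n + coab G M0 \<tau> r t "{1..n}"
 for G :: "(nat => 'a) monoid" (structure) and \<Gamma> :: "nat => ('a, 'b) monoid_scheme" and n M0 \<tau> r t +
 assumes t_block: "i \<in> {1..n} ==> j < r ==> t i j \<in> block {i}" and r: "1 <= r" "2 * r <= n" and n3: "3 <= n"
  and fin_M0: "fin_idx M0 (carrier G)"
begin

text \<open>The product of the intersections of \<open>M0\<close> with the factors. It is closed
  under all projections \<open>ext s\<close>, which \<open>M0\<close> need not be.\<close>

definition D1 where "D1 = {g \<in> carrier G. \<forall>i\<in>{1..n}. ext {i} g \<in> M0}"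

lemma D1_carrier: "x \<in> D1 ==> x \<in> carrier G" by (simp add: D1_def)

lemma fin_idx_D1: "fin_idx D1 (carrier G)"
proof -
 have "fin_idx {g \<in> carrier G. \<forall>i\<in>{1..k}. ext {i} g \<in> M0} (carrier G)" for k
 proof (induction k)
  case 0
  then show ?case using fin_idx_refl[OF subgroup_self] by simp
 next
  case (Suc k)
  let ?D = "{g \<in> carrier G. \<forall>i\<in>{1..k}. ext {i} g \<in> M0}"
  have D: "subgroup ?D G" "?D <= carrier G" using Suc by (auto simp: fin_idx_def)
  have e: "{g \<in> carrier G. ext {Suc k} g \<in> M0} \<inter> ?D = {g \<in> carrier G. \<forall>i\<in>{1..Suc k}. ext {i} g \<in> M0}"
   by (auto simp: atLeastAtMostSuc_conv)
  show ?case using fin_idx_trans[OF fin_idx_inter[OF fin_idx_preimage[OF fin_M0, of "{Suc k}"] D] Suc] unfolding e .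
 qed
 from this[of n] show ?thesis by (simp only: D1_def)
qed

lemma subgroup_D1: "subgroup D1 G" using fin_idx_D1 by (simp add: fin_idx_def)

lemma D1_closed: "\<one> \<in> D1" "x \<in> D1 ==> y \<in> D1 ==> x \<otimes> y \<in> D1" "x \<in> D1 ==> inv x \<in> D1"
 using subgroup_D1 subgroup.one_closed subgroup.m_closed subgroup.m_inv_closed by metis+

lemma D1_ext: "x \<in> D1 ==> ext s x \<in> D1"
proof -
 assume x: "x \<in> D1"
 have "ext {i} (ext s x) \<in> M0" if "i \<in> {1..n}" for i
 proof (cases "i \<in> s")
  case True
  then have "{i} \<inter> s = {i}" by auto
  then show ?thesis using x that ext_ext[of x "{i}" s] by (simp add: D1_def)
 next
  case False
  then have "{i} \<inter> s = {}" by auto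
  then show ?thesis using x ext_ext[of x "{i}" s] ext_empty M0_closed(1) by (simp add: D1_def)
 qed
 then show ?thesis using x ext_closed by (simp add: D1_def)
qed

lemma D1_M0: "x \<in> D1 ==> x \<in> M0"
proof -
 assume x: "x \<in> D1"
 have "k <= n ==> ext {1..k} x \<in> M0" for k
 proof (induction k)
  case 0
  then show ?case using ext_empty[OF D1_carrier[OF x]] M0_closed(1) by simp
 next
  case (Suc k)
  have "ext {1..Suc k} x = ext {1..k} x \<otimes> ext {Suc k} x"
   using ext_Un[OF D1_carrier[OF x], of "{1..k}" "{Suc k}"] by (simp add: atLeastAtMostSuc_conv)
  then show ?case using Suc x by (auto simp: D1_def intro: M0_closed)
 qed
 from this[of n] show ?thesis using ext_all[OF D1_carrier[OF x], of "{1..n}"] by simp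
qed

lemma t_D1: "i \<in> {1..n} ==> j < r ==> t i j \<in> D1"
proof -
 assume i: "i \<in> {1..n}" and j: "j < r"
 have "ext {k} (t i j) \<in> M0" for k
  using ext_disjoint[OF t_block[OF i j], of "{k}"] ext_id[OF t_block[OF i j]] t_M0[OF i j] M0_closed(1)
  by (cases "k = i") auto
 then show ?thesis using t_M0[OF i j] M0_carrier by (simp add: D1_def)
qed

abbreviation A where "A \<equiv> D1 \<inter> block {1..n - r}"
abbreviation B where "B \<equiv> D1 \<inter> block {n - r + 1..n}"

lemma subgroup_AB: "subgroup A G" "subgroup B G"
 using subgroup_inter[OF subgroup_D1 subgroup_block] by auto

text \<open>A homomorphic section of the coordinates: the \<open>j\<close>-th unit vector goes to
  \<open>t (p + j + 1) j\<close>. Using a different factor for each \<open>j\<close> makes the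
  values commute and allows a definition coordinate by coordinate.\<close>

definition E :: "nat => (nat => int) => nat => 'a" where
 "E p v = (\<lambda>i\<in>{1..n}. if i \<in> {p + 1..p + r} then t i (i - p - 1) i [^]\<^bsub>\<Gamma> i\<^esub> v (i - p - 1) else \<one>\<^bsub>\<Gamma> i\<^esub>)"

lemma E_block: "E p v \<in> block {p + 1..p + r}"
proof -
 have "E p v i \<in> carrier (\<Gamma> i)" if i: "i \<in> {1..n}" for i
 proof -
  interpret g: group "\<Gamma> i" by (rule grp[OF i])
  have "t i (i - p - 1) i \<in> carrier (\<Gamma> i)" if "i \<in> {p + 1..p + r}"
   by (rule coord_closed[OF M0_carrier[OF t_M0[OF i]] i]) (use that in auto)
  then show ?thesis using i by (auto simp: E_def)
 qed
 then have "E p v \<in> carrier G" unfolding carrier_eq by (auto simp: E_def intro!: PiE_I)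
 moreover have "\<forall>j\<in>{1..n} - {p + 1..p + r}. E p v j = \<one>\<^bsub>\<Gamma> j\<^esub>" unfolding E_def by (intro ballI) (simp only: restrict_apply, auto)
 ultimately show ?thesis by (simp add: block_def)
qed

lemma E_carrier: "E p v \<in> carrier G" using E_block block_carrier by blast

lemma E_add: "E p (%j. v j + w j) = E p v \<otimes> E p w"
proof (rule coord_eqI[OF E_carrier])
 show "E p v \<otimes> E p w \<in> carrier G" using E_carrier by simp
 fix i assume i: "i \<in> {1..n}"
 interpret g: group "\<Gamma> i" by (rule grp[OF i])
 have c: "t i (i - p - 1) i \<in> carrier (\<Gamma> i)" if "i \<in> {p + 1..p + r}"
  by (rule coord_closed[OF M0_carrier[OF t_M0[OF i]] i]) (use that in auto)
 show "E p (%j. v j + w j) i = (E p v \<otimes> E p w) i"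
  unfolding coord_mult[OF i] using c g.int_pow_mult i by (auto simp: E_def)
qed

lemma E_0: "E p (%_. 0) = \<one>"
proof -
 have "E p (%_. 0) \<otimes> E p (%_. 0) = E p (%_. 0) \<otimes> \<one>" using E_add[of p "%_. 0" "%_. 0"] E_carrier by simp
 then show ?thesis using E_carrier by simp
qed

lemma E_neg: "E p (%j. - v j) = inv (E p v)"
 using E_add[of p "%j. - v j" v] E_0 E_carrier by (simp add: inv_equality)

lemma E_cong: "(!!j. j < r ==> v j = w j) ==> E p v = E p w"
 unfolding E_def by (intro restrict_ext) auto

lemma E_unit: "p + r <= n ==> k < r ==> E p (%j. if j = k then 1 else 0) = t (p + k + 1) k"
proof (rule coord_eqI[OF E_carrier])
 assume p: "p + r <= n" and k: "k < r"
 have q: "p + k + 1 \<in> {1..n}" using p k by auto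
 show "t (p + k + 1) k \<in> carrier G" using t_M0[OF q k] M0_carrier by simp
 fix i assume i: "i \<in> {1..n}"
 interpret g: group "\<Gamma> i" by (rule grp[OF i])
 have c: "t i (i - p - 1) i \<in> carrier (\<Gamma> i)" if "i \<in> {p + 1..p + r}"
  by (rule coord_closed[OF M0_carrier[OF t_M0[OF i]] i]) (use that in auto)
 show "E p (%j. if j = k then 1 else 0) i = t (p + k + 1) k i"
 proof (cases "i = p + k + 1")
  case True
  have "t i (i - p - 1) i [^]\<^bsub>\<Gamma> i\<^esub> (1 :: int) = t i (i - p - 1) i" using c True k by (intro g.int_pow_1) auto
  then show ?thesis using True k i by (auto simp: E_def)
 next
  case False
  then have "t (p + k + 1) k i = \<one>\<^bsub>\<Gamma> i\<^esub>" using block_coord[OF t_block[OF q k] i] by auto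
  moreover have "i - p - 1 ~= k" if "i \<in> {p + 1..p + r}" using that False by auto
  ultimately show ?thesis using i by (auto simp: E_def)
 qed
qed

lemma E_unit_pow: "p + r <= n ==> k < r ==> E p (%j. if j = k then c else 0) = t (p + k + 1) k [^] (c :: int)"
proof -
 assume p: "p + r <= n" and k: "k < r"
 have tc: "t (p + k + 1) k \<in> carrier G" by (rule M0_carrier[OF t_M0]) (use p k in auto)
 have nn: "E p (%j. if j = k then int m else 0) = t (p + k + 1) k [^] m" for m
 proof (induction m)
  case 0
  have "E p (%j. if j = k then int 0 else 0) = E p (%_. 0)" by (rule E_cong) simp
  then show ?case using E_0 by simp
 next
  case (Suc m)
  have "E p (%j. if j = k then int (Suc m) else 0) = E p (%j. (if j = k then int m else 0) + (if j = k then 1 else 0))"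
   by (rule E_cong) simp
  then show ?case using E_add[of p "%j. if j = k then int m else 0" "%j. if j = k then 1 else 0"] E_unit[OF p k] Suc tc by simp
 qed
 show ?thesis
 proof (cases c rule: int_cases2)
  case (nonneg m)
  show ?thesis unfolding nonneg using nn[of m] by (simp add: int_pow_int)
 next
  case (nonpos m)
  have "E p (%j. if j = k then c else 0) = E p (%j. - (if j = k then int m else 0))"
   by (rule E_cong) (simp add: nonpos)
  then show ?thesis using nn[of m] E_neg[of p "%j. if j = k then int m else 0"] tc nonpos by (simp add: int_pow_neg_int)
 qed
qed

lemma E_word:
 assumes p: "p + r <= n"
 shows "\<exists>w\<in>words ((%k. t (p + k + 1) k) ` {..<r}). ev w = E p v"
  and "!!l. l < r ==> \<tau> l (E p v) = v l" and "E p v \<in> D1"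
proof -
 let ?T = "(%k. t (p + k + 1) k) ` {..<r}"
 have t1: "t (p + k + 1) k \<in> D1" "t (p + k + 1) k \<in> M0" if "k < r" for k
  using t_D1[of "p + k + 1" k] D1_M0 that p by auto
 have step: "k <= r ==> (\<exists>w\<in>words ?T. ev w = E p (%j. if j < k then v j else 0)) &
  (\<forall>l<r. \<tau> l (E p (%j. if j < k then v j else 0)) = (if l < k then v l else 0)) & E p (%j. if j < k then v j else 0) \<in> D1" for k
 proof (induction k)
  case 0
  then show ?case using E_0 tau_one D1_closed(1) by (auto intro!: bexI[of _ "[]"])
 next
  case (Suc k)
  let ?t = "t (p + k + 1) k"
  have k: "k < r" using Suc.prems by simp
  have tc: "?t \<in> carrier G" using t1[OF k] M0_carrier by simp
  have tp: "?t [^] v k \<in> D1" using subgroup_int_pow_closed[OF subgroup_D1 t1(1)[OF k]] by simp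
  have e: "E p (%j. if j < Suc k then v j else 0) = E p (%j. if j < k then v j else 0) \<otimes> ?t [^] v k"
  proof -
   have "E p (%j. if j < Suc k then v j else 0) = E p (%j. (if j < k then v j else 0) + (if j = k then v k else 0))"
    by (rule E_cong) (auto simp: less_Suc_eq)
   then show ?thesis using E_add[of p "%j. if j < k then v j else 0" "%j. if j = k then v k else 0"] E_unit_pow[OF p k] by simp
  qed
  from Suc k have I: "\<exists>w\<in>words ?T. ev w = E p (%j. if j < k then v j else 0)"
   "\<forall>l<r. \<tau> l (E p (%j. if j < k then v j else 0)) = (if l < k then v l else 0)" "E p (%j. if j < k then v j else 0) \<in> D1" by auto
  obtain w where w: "w \<in> words ?T" "ev w = E p (%j. if j < k then v j else 0)" using I(1) by blast
  have "?T <= carrier G" using t1 M0_carrier by auto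
  then have wc: "w \<in> words (carrier G)" using w(1) words_carrier by blast
  have "w @ pw ?t (v k) \<in> words ?T" using w(1) k by simp
  moreover have "ev (w @ pw ?t (v k)) = E p (%j. if j < Suc k then v j else 0)" using w wc tc by (simp add: e ev_pw)
  moreover have "\<tau> l (E p (%j. if j < Suc k then v j else 0)) = (if l < Suc k then v l else 0)" if l: "l < r" for l
   unfolding e using tau_mult[OF l D1_M0[OF I(3)] D1_M0[OF tp]] I(2) l tau_int_pow[OF l t1(2)[OF k]] tau_t[of "p + k + 1" k l] k p by (auto simp: less_Suc_eq)
  moreover have "E p (%j. if j < Suc k then v j else 0) \<in> D1" unfolding e by (rule D1_closed(2)[OF I(3) tp])
  ultimately show ?case by blast
 qed
 have "E p (%j. if j < r then v j else 0) = E p v" by (rule E_cong) simp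
 with step[of r] show "\<exists>w\<in>words ?T. ev w = E p v" "!!l. l < r ==> \<tau> l (E p v) = v l" "E p v \<in> D1" by auto
qed

end

context group
begin

lemma gens_change:
 assumes G0: "gens K G0" and R: "finite R" "R <= K" "!!g. g \<in> G0 ==> g \<in> generate G R"
 shows "gens K R"
proof -
 have K: "subgroup K G" and c: "G0 <= carrier G" using G0 gens_carrier by (auto simp: gens_def)
 have Rc: "R <= carrier G" using R(2) subgroup.subset[OF K] by auto
 have "generate G G0 <= generate G R"
  by (rule generate_subgroup_incl[OF _ generate_is_subgroup[OF Rc]]) (use R(3) in auto)
 note sub = this
 have "\<exists>w\<in>words R. ev w = k" if k: "k \<in> K" for k
 proof -
  have "\<exists>w\<in>words G0. ev w = k" using G0 k by (simp add: gens_def)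
  then obtain w where w: "w \<in> words G0" "ev w = k" by (elim bexE)
  have "k \<in> generate G G0" unfolding generate_eq_ev[OF c] w(2)[symmetric] by (rule imageI[OF w(1)])
  then have "k \<in> ev ` words R" using subsetD[OF sub] unfolding generate_eq_ev[OF Rc] by simp
  then obtain w' where "k = ev w'" "w' \<in> words R" by (rule imageE)
  then show ?thesis by (intro bexI[of _ w']) simp_all
 qed
 then show ?thesis using R K by (simp add: gens_def)
qed

text \<open>Inserting \<open>\<gamma>\<close> splits a quotient into two commuting ones; this
  supplies the decompositions of \<open>\<sigma> i\<close> and \<open>sx x\<close> asked for in
  \<open>block_sort\<close>.\<close>

lemma central_split:
 assumes c: "a \<in> carrier G" "\<gamma> \<in> carrier G" "\<beta> \<in> carrier G"
  and com: "a \<otimes> \<gamma> = \<gamma> \<otimes> a" "a \<otimes> \<beta> = \<beta> \<otimes> a" "\<gamma> \<otimes> \<beta> = \<beta> \<otimes> \<gamma>"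
 shows "a \<otimes> inv \<beta> = (a \<otimes> inv \<gamma>) \<otimes> (\<gamma> \<otimes> inv \<beta>)"
  and "(a \<otimes> inv \<gamma>) \<otimes> (\<gamma> \<otimes> inv \<beta>) = (\<gamma> \<otimes> inv \<beta>) \<otimes> (a \<otimes> inv \<gamma>)"
proof -
 show 1: "a \<otimes> inv \<beta> = (a \<otimes> inv \<gamma>) \<otimes> (\<gamma> \<otimes> inv \<beta>)" using c by (simp add: m_assoc inv_cancel_left)
 have b: "inv \<beta> \<otimes> a = a \<otimes> inv \<beta>" "inv \<beta> \<otimes> \<gamma> = \<gamma> \<otimes> inv \<beta>"
  using commute_swap_inv[of a \<beta> \<beta>] commute_swap_inv[of \<gamma> \<beta> \<beta>] c com by simp_all
 have bg: "inv \<beta> \<otimes> inv \<gamma> = inv \<gamma> \<otimes> inv \<beta>" using commute_swap_inv[of "inv \<beta>" \<gamma> \<gamma>] c b by simp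
 have "(\<gamma> \<otimes> inv \<beta>) \<otimes> (a \<otimes> inv \<gamma>) = \<gamma> \<otimes> ((inv \<beta> \<otimes> a) \<otimes> inv \<gamma>)" using c by (simp add: m_assoc)
 also have "... = (\<gamma> \<otimes> a) \<otimes> (inv \<beta> \<otimes> inv \<gamma>)" unfolding b using c by (simp add: m_assoc)
 also have "... = a \<otimes> inv \<beta>" unfolding bg com(1)[symmetric] using c by (simp add: m_assoc inv_cancel_left)
 finally show "(a \<otimes> inv \<gamma>) \<otimes> (\<gamma> \<otimes> inv \<beta>) = (\<gamma> \<otimes> inv \<beta>) \<otimes> (a \<otimes> inv \<gamma>)" using 1 by simp
qed

end

lemma map_letters_retract:
 "w \<in> words S ==> (!!x. x \<in> S ==> f (h x) = x) ==> map_letters f (map_letters h w) = w"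
 by (induction w) auto

context split_coab
begin

abbreviation q where "q \<equiv> n - r"

definition alpha where "alpha k = t (k + 1) k"
definition beta where "beta k = t (q + k + 1) k"
definition sg where "sg k = alpha k \<otimes> inv (beta k)"
text \<open>Straightening: the section removes all coordinates of \<open>x\<close>. For
  \<open>p = q\<close> this is a homomorphism on \<open>A\<close> and for \<open>p = 0\<close> on
  \<open>B\<close>, because the section then lives in factors disjoint from the block concerned.
  \<open>Th 0\<close> on \<open>A\<close> and \<open>Th q\<close> on \<open>B\<close> only serve to
  choose generators with vanishing coordinates.\<close>

definition Th where "Th p x = x \<otimes> E p (%j. - \<tau> j x)"
definition H1 where "H1 = D1 \<inter> level r"

lemma q: "r <= q" "q + r = n" "2 <= q" "r <= n" using r n3 by auto

lemma ab_D1: "k < r ==> alpha k \<in> D1" "k < r ==> beta k \<in> D1"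
 using t_D1 q by (auto simp: alpha_def beta_def)

lemma ab_block: "k < r ==> alpha k \<in> block {k + 1}" "k < r ==> beta k \<in> block {q + k + 1}"
 using t_block q by (auto simp: alpha_def beta_def)

lemma ab_AB: "k < r ==> alpha k \<in> A" "k < r ==> beta k \<in> B"
proof -
 assume k: "k < r"
 have "{k + 1} <= {1..q}" "{q + k + 1} <= {q + 1..n}" using k q by auto
 from block_mono[OF this(1)] block_mono[OF this(2)]
 show "alpha k \<in> A" "beta k \<in> B" using ab_D1[OF k] ab_block[OF k] by blast+
qed

lemma ab_carrier: "k < r ==> alpha k \<in> carrier G" "k < r ==> beta k \<in> carrier G"
 using ab_D1 D1_carrier by auto

lemma tau_ab: "k < r ==> j < r ==> \<tau> j (alpha k) = (if j = k then 1 else 0)"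
  "k < r ==> j < r ==> \<tau> j (beta k) = (if j = k then 1 else 0)"
 using tau_t q by (auto simp: alpha_def beta_def)

lemma H1_iff: "x \<in> H1 \<longleftrightarrow> x \<in> D1 & (\<forall>j<r. \<tau> j x = 0)"
 using D1_M0 by (auto simp: H1_def level_def)

lemma subgroup_H1: "subgroup H1 G" unfolding H1_def by (rule subgroup_inter[OF subgroup_D1 subgroup_level[OF order_refl]])

lemma AB_commute: "x \<in> block {1..q} ==> y \<in> block {q + 1..n} ==> x \<otimes> y = y \<otimes> x"
 by (rule block_commute) auto

text \<open>Since \<open>y\<close> commutes with the section, the correction for \<open>x\<close>
  can be moved past \<open>y\<close> and merged with that for \<open>y\<close>.\<close>

lemma Th_mult:
 assumes "x \<in> D1" "y \<in> D1" "y \<in> block s" "s \<inter> {p + 1..p + r} = {}"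
 shows "Th p (x \<otimes> y) = Th p x \<otimes> Th p y"
proof -
 have c: "x \<in> carrier G" "y \<in> carrier G" using assms D1_carrier by auto
 have "E p (%j. - \<tau> j (x \<otimes> y)) = E p (%j. - \<tau> j x + - \<tau> j y)"
  by (rule E_cong) (use tau_mult D1_M0 assms in auto)
 then have e: "E p (%j. - \<tau> j (x \<otimes> y)) = E p (%j. - \<tau> j x) \<otimes> E p (%j. - \<tau> j y)" by (simp only: E_add)
 have "y \<otimes> E p (%j. - \<tau> j x) = E p (%j. - \<tau> j x) \<otimes> y" by (rule block_commute[OF assms(3) E_block assms(4)])
 then have "y \<otimes> (E p (%j. - \<tau> j x) \<otimes> z) = E p (%j. - \<tau> j x) \<otimes> (y \<otimes> z)" if "z \<in> carrier G" for z
  using c E_carrier that by (simp add: m_assoc[symmetric])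
 then show ?thesis unfolding Th_def e using c E_carrier by (simp add: m_assoc)
qed

lemma Th_id: "[|x \<in> D1; !!j. j < r ==> \<tau> j x = 0|] ==> Th p x = x"
 using E_cong[of "%j. - \<tau> j x" "%_. 0" p] E_0 D1_carrier by (simp add: Th_def)

lemma Th_H1: "x \<in> D1 ==> p + r <= n ==> Th p x \<in> H1"
 using E_word(2)[of p _ "%j. - \<tau> j x"] E_word(3)[of p "%j. - \<tau> j x"] tau_mult D1_M0
 by (auto simp: H1_iff Th_def intro: D1_closed)

lemma Th_alpha: "k < r ==> Th q (alpha k) = sg k"
proof -
 assume k: "k < r"
 have "E q (%j. - \<tau> j (alpha k)) = E q (%j. - (if j = k then 1 else 0))" by (rule E_cong) (simp add: tau_ab k)
 then show ?thesis using E_neg[of q "%j. if j = k then 1 else 0"] E_unit[of q k] k q by (simp add: Th_def sg_def beta_def)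
qed

text \<open>Both straightenings reach the same element, \<open>Th q\<close> from
  \<open>alpha k\<close> and \<open>Th 0\<close> from \<open>inv (beta k)\<close>: the letters
  \<open>sg k\<close> are shared by the images of \<open>A\<close> and \<open>B\<close>.\<close>

lemma Th_beta: "k < r ==> Th 0 (inv (beta k)) = sg k"
proof -
 assume k: "k < r"
 have "E 0 (%j. - \<tau> j (inv (beta k))) = E 0 (%j. if j = k then 1 else 0)"
  by (rule E_cong) (simp add: tau_inv D1_M0 ab_D1 tau_ab k)
 then have "Th 0 (inv (beta k)) = inv (beta k) \<otimes> alpha k" using E_unit[of 0 k] k q by (simp add: Th_def alpha_def)
 also have "... = sg k"
  using commute_swap_inv[of "alpha k" "beta k" "beta k"] AB_commute[of "alpha k" "beta k"] ab_AB[OF k] ab_carrier[OF k] by (simp add: sg_def)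
 finally show ?thesis .
qed

lemma sg_H1: "k < r ==> sg k \<in> H1"
 using Th_H1[of "alpha k" q] Th_alpha ab_D1 q by simp

lemma ext_sg: "k < r ==> ext {1..q} (sg k) = alpha k" "k < r ==> ext {q + 1..n} (sg k) = inv (beta k)"
proof -
 assume k: "k < r"
 have a: "alpha k \<in> block {1..q}" "beta k \<in> block {q + 1..n}" using ab_AB[OF k] by auto
 have d: "{1..q} \<inter> {q + 1..n} = {}" "{q + 1..n} \<inter> {1..q} = {}" by auto
 show "ext {1..q} (sg k) = alpha k" "ext {q + 1..n} (sg k) = inv (beta k)"
  using ext_id[OF a(1)] ext_id[OF a(2)] ext_disjoint[OF a(2) d(1)] ext_disjoint[OF a(1) d(2)] ab_carrier[OF k]
  by (simp_all add: sg_def ext_mult ext_inv)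
qed

lemma sg_commute: "i < r ==> j < r ==> sg i \<otimes> sg j = sg j \<otimes> sg i"
proof (cases "i = j")
 case False
 assume ij: "i < r" "j < r"
 have b: "sg k \<in> block {k + 1, q + k + 1}" if "k < r" for k
  using ab_block[OF that] block_mono[of "{k + 1}" "{k + 1, q + k + 1}"] block_mono[of "{q + k + 1}" "{k + 1, q + k + 1}"]
  unfolding sg_def by (intro subgroup.m_closed[OF subgroup_block] subgroup.m_inv_closed[OF subgroup_block]) auto
 show ?thesis by (rule block_commute[OF b[OF ij(1)] b[OF ij(2)]]) (use ij False q in auto)
qed simp

text \<open>Generators supported in single factors are what \<open>straight_index\<close> works
  with: such an element can fail to commute with at most one of the \<open>alpha j\<close>.\<close>

lemma gens_factors:
 assumes SG: "gens (carrier G) SG"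
 shows "k <= n ==> \<exists>G0. gens (D1 \<inter> block {1..k}) G0 & G0 <= (\<Union>i\<in>{1..k}. D1 \<inter> block {i})"
proof (induction k)
 case 0
 have "D1 \<inter> block {1..0} = {\<one>}" using block_empty D1_closed(1) by auto
 then have "gens (D1 \<inter> block {1..0}) {}" using triv_subgroup by (auto simp: gens_def words_iff intro!: bexI[of _ "[]"])
 then show ?case by blast
next
 case (Suc k)
 then obtain G0 where G0: "gens (D1 \<inter> block {1..k}) G0" "G0 <= (\<Union>i\<in>{1..k}. D1 \<inter> block {i})" by auto
 let ?K = "D1 \<inter> block {Suc k}"
 have im: "\<exists>w\<in>words (ext {Suc k} ` SG). ev w = x" if x: "x \<in> block {Suc k}" for x
 proof -
  have "x \<in> carrier G" using x block_carrier by blast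
  then obtain w where w: "w \<in> words SG" "ev w = x" using SG unfolding gens_def by blast
  have "ev (map_letters (ext {Suc k}) w) = ext {Suc k} (ev w)"
   by (rule ev_map_hom[OF subgroup_self]) (use ext_closed ext_mult gens_words[OF SG w(1)] in auto)
  then have "ev (map_letters (ext {Suc k}) w) = x" using ext_id[OF x] w by simp
  moreover have "map_letters (ext {Suc k}) w \<in> words (ext {Suc k} ` SG)" by (rule words_map_letters[OF w(1)]) simp
  ultimately show ?thesis by blast
 qed
 have "ext {Suc k} ` SG <= block {Suc k}" using ext_block gens_carrier[OF SG] by blast
 then have "gens (block {Suc k}) (ext {Suc k} ` SG)" using im SG subgroup_block by (simp add: gens_def)
 then obtain G1 where G1: "gens ?K G1"
  using gens_fin_idx[OF fin_idx_inter[OF fin_idx_D1 subgroup_block block_carrier]] by blast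
 have com: "x \<otimes> y = y \<otimes> x" if "x \<in> D1 \<inter> block {1..k}" "y \<in> ?K" for x y
  by (rule block_commute[of _ "{1..k}" _ "{Suc k}"]) (use that in auto)
 have "D1 \<inter> block {1..Suc k} = (D1 \<inter> block {1..k}) <#> ?K"
 proof (intro equalityI subsetI)
  fix x assume x: "x \<in> D1 \<inter> block {1..Suc k}"
  then have xc: "x \<in> carrier G" using D1_carrier by blast
  have "{1..Suc k} = {1..k} \<union> {Suc k}" by auto
  then have "x = ext {1..k} x \<otimes> ext {Suc k} x" using ext_id[of x "{1..Suc k}"] ext_Un[OF xc, of "{1..k}" "{Suc k}"] x by simp
  moreover have "ext {1..k} x \<in> D1 \<inter> block {1..k}" "ext {Suc k} x \<in> ?K" using x D1_ext ext_block[OF xc] by auto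
  ultimately show "x \<in> (D1 \<inter> block {1..k}) <#> ?K" unfolding set_mult_def by blast
 next
  fix x assume "x \<in> (D1 \<inter> block {1..k}) <#> ?K"
  then obtain u v where uv: "u \<in> D1 \<inter> block {1..k}" "v \<in> ?K" "x = u \<otimes> v" unfolding set_mult_def by blast
  have "u \<in> block {1..Suc k}" "v \<in> block {1..Suc k}"
   using uv block_mono[of "{1..k}" "{1..Suc k}"] block_mono[of "{Suc k}" "{1..Suc k}"] by auto
  then show "x \<in> D1 \<inter> block {1..Suc k}" using uv D1_closed(2) subgroup.m_closed[OF subgroup_block] by auto
 qed
 then have "gens (D1 \<inter> block {1..Suc k}) (G0 \<union> G1)" using gens_commuting_product[OF com G0(1) G1] by simp
 moreover have "G0 \<union> G1 <= (\<Union>i\<in>{1..Suc k}. D1 \<inter> block {i})"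
 proof
  fix x assume "x \<in> G0 \<union> G1"
  then have "(\<exists>i\<in>{1..k}. x \<in> D1 \<inter> block {i}) \<or> x \<in> ?K" using G0(2) G1 by (auto simp: gens_def)
  then show "x \<in> (\<Union>i\<in>{1..Suc k}. D1 \<inter> block {i})" by (elim disjE bexE) auto
 qed
 ultimately show ?case by blast
qed

text \<open>A generator \<open>g\<close> is recovered from \<open>Th p g\<close> and a word in the
  \<open>t (p + k + 1) k\<close>, so it may be replaced by its straightened form.\<close>

lemma gens_straighten:
 assumes K: "gens K G0" "K <= D1" and p: "p + r <= n" and T: "(%k. t (p + k + 1) k) ` {..<r} <= generate G R"
  and R: "finite R" "R <= K" "Th p ` G0 <= R"
 shows "gens K R"
proof (rule gens_change[OF K(1) R(1,2)])
 fix g assume g: "g \<in> G0"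
 have Rc: "R <= carrier G" using R K D1_carrier by blast
 have gD: "g \<in> D1" "g \<in> carrier G" using g K D1_carrier by (auto simp: gens_def)
 have Tc: "(%k. t (p + k + 1) k) ` {..<r} <= carrier G" using t_M0 M0_carrier p by auto
 have sub: "subgroup (generate G R) G" by (rule generate_is_subgroup[OF Rc])
 have "E p (%j. - \<tau> j g) \<in> generate G ((%k. t (p + k + 1) k) ` {..<r})"
 proof -
  obtain w where w: "w \<in> words ((%k. t (p + k + 1) k) ` {..<r})" "ev w = E p (%j. - \<tau> j g)"
   using E_word(1)[OF p, of "%j. - \<tau> j g"] by blast
  show ?thesis unfolding generate_eq_ev[OF Tc] w(2)[symmetric] by (rule imageI[OF w(1)])
 qed
 then have 1: "E p (%j. - \<tau> j g) \<in> generate G R" using generate_subgroup_incl[OF T sub] by blast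
 have 2: "Th p g \<in> generate G R" using R(3) g by (intro generate.incl) auto
 have "g = Th p g \<otimes> inv (E p (%j. - \<tau> j g))" using gD E_carrier by (simp add: Th_def m_assoc)
 then show "g \<in> generate G R" using subgroup.m_closed[OF sub 2 subgroup.m_inv_closed[OF sub 1]] by simp
qed

end

section \<open>Filling null words of the fibre product\<close>

context split_coab
begin

lemma E_commute: "E p v \<otimes> E p w = E p w \<otimes> E p v"
proof -
 have "E p (%j. v j + w j) = E p (%j. w j + v j)" by (rule E_cong) simp
 then show ?thesis by (simp only: E_add)
qed

text \<open>Only the \<open>alpha j\<close> lying in the factor of \<open>g\<close> can fail to
  commute with \<open>g\<close>, and the section \<open>E 0\<close> commutes with every
  \<open>alpha j\<close>. For \<open>f > r\<close> there is no such \<open>j\<close>, and the index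
  0 is a placeholder.\<close>

lemma straight_index:
 assumes f: "f \<in> {1..q}" and g: "g \<in> D1 \<inter> block {f}"
 shows "\<exists>i<r. \<forall>j<r. j ~= i --> alpha j \<otimes> Th 0 g = Th 0 g \<otimes> alpha j"
proof (intro exI[of _ "if f <= r then f - 1 else 0"] conjI allI impI)
 show "(if f <= r then f - 1 else 0) < r" using r f by auto
 fix j assume j: "j < r" "j ~= (if f <= r then f - 1 else 0)"
 have d: "{j + 1} \<inter> {f} = {}" using j f by (auto split: if_splits)
 have 1: "alpha j \<otimes> g = g \<otimes> alpha j" by (rule block_commute[OF ab_block(1)[OF j(1)] _ d]) (use g in simp)
 have 2: "alpha j \<otimes> E 0 v = E 0 v \<otimes> alpha j" for v
  using E_commute[of 0 "%l. if l = j then 1 else 0" v] E_unit[of 0 j] j(1) q by (simp add: alpha_def)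
 have c: "g \<in> carrier G" "alpha j \<in> carrier G" using g D1_carrier ab_carrier j by auto
 let ?e = "E 0 (%l. - \<tau> l g)"
 have "alpha j \<otimes> (g \<otimes> ?e) = (alpha j \<otimes> g) \<otimes> ?e" using c E_carrier by (simp add: m_assoc)
 also have "... = g \<otimes> (alpha j \<otimes> ?e)" unfolding 1 using c E_carrier by (simp add: m_assoc)
 also have "... = (g \<otimes> ?e) \<otimes> alpha j" unfolding 2 using c E_carrier by (simp add: m_assoc)
 finally show "alpha j \<otimes> Th 0 g = Th 0 g \<otimes> alpha j" by (simp add: Th_def)
qed

lemma Th_block: "x \<in> block s ==> {p + 1..p + r} <= s ==> Th p x \<in> block s"
 unfolding Th_def using E_block[of p] block_mono[of "{p + 1..p + r}" s] by (intro subgroup.m_closed[OF subgroup_block]) auto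

text \<open>A null word is rewritten over \<open>S0\<close>, sorted into blocks followed by a word
  in \<open>Y\<close> and the \<open>sg k\<close>, and filled in two pieces. The blocks evaluate in
  the first part of the factors, so projecting to the last \<open>r\<close> factors exhibits the
  tail as the image under \<open>Th 0\<close> of a null word of \<open>B\<close>; the blocks are
  then the image under \<open>Th q\<close> of a null word of \<open>A\<close>. Lengths
  \<open>O(L)\<close> and \<open>O(L^2)\<close> account for \<open>aB L\<close> and
  \<open>aA (L\<^sup>2)\<close>, sorting for \<open>L ^ 4\<close>.\<close>

lemma isop_H1:
 assumes SG: "gens (carrier G) SG" and isoA: "isop A VA aA bA" and isoB: "isop B VB aB bB"
 shows "isop H1 (%_ _. UNIV) (%L. L ^ 4 + aA (L\<^sup>2) + aB L) (%L. L)"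
proof -
 obtain GA where GA: "gens A GA" "GA <= (\<Union>i\<in>{1..q}. D1 \<inter> block {i})" using gens_factors[OF SG, of q] by auto
 obtain GB where GB: "gens B GB" using isoB by (auto simp: isop_def)
 have fGA: "finite GA" "GA <= A" and fGB: "finite GB" "GB <= B" using GA GB by (auto simp: gens_def)
 \<comment> \<open>Here \<open>Th 0\<close> is used inside \<open>A\<close>, and \<open>Th q\<close>
   inside \<open>B\<close> for \<open>Y\<close> below: the coordinates of the generators vanish
   without leaving the block, so that these letters lie in \<open>H1\<close>.\<close>
 define X0 where "X0 = Th 0 ` GA"
 define X where "X = X0 \<union> (%x. inv x) ` X0"
 define Y where "Y = Th q ` GB"
 define Sg where "Sg = sg ` {..<r}"
 have X0: "x \<in> A & x \<in> H1" if "x \<in> X0" for x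
 proof -
  obtain g where g: "g \<in> GA" "x = Th 0 g" using \<open>x \<in> X0\<close> by (auto simp: X0_def)
  have "x \<in> H1" using Th_H1[of g 0] g fGA q by auto
  moreover have "x \<in> block {1..q}" unfolding g(2) by (rule Th_block) (use g fGA q in auto)
  ultimately show ?thesis by (simp add: H1_iff)
 qed
 have X: "x \<in> A" "x \<in> H1" if "x \<in> X" for x
 proof -
  obtain y where y: "y \<in> X0" "x = y \<or> x = inv y" using \<open>x \<in> X\<close> by (auto simp: X_def)
  show "x \<in> A" using y(2) X0[OF y(1)] subgroup.m_inv_closed[OF subgroup_AB(1), of y] by (elim disjE) simp_all
  show "x \<in> H1" using y(2) X0[OF y(1)] subgroup.m_inv_closed[OF subgroup_H1, of y] by (elim disjE) simp_all
 qed
 have Y: "y \<in> B" "y \<in> H1" if "y \<in> Y" for y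
 proof -
  obtain g where g: "g \<in> GB" "y = Th q g" using \<open>y \<in> Y\<close> by (auto simp: Y_def)
  show "y \<in> H1" using Th_H1[of g q] g fGB q by auto
  moreover have "y \<in> block {q + 1..n}" unfolding g(2) by (rule Th_block) (use g fGB q in auto)
  ultimately show "y \<in> B" by (simp add: H1_iff)
 qed
 have Xc: "x \<in> carrier G" if "x \<in> X" for x using X(1)[OF that] D1_carrier by blast
 have Xinv: "inv x \<in> X" if "x \<in> X" for x
 proof -
  have "x \<in> carrier G" if "x \<in> X0" for x using X0[OF that] D1_carrier by blast
  then show ?thesis using that by (auto simp: X_def)
 qed
 have "\<exists>i. i < r & (\<forall>j<r. j ~= i --> alpha j \<otimes> x = x \<otimes> alpha j)" if x: "x \<in> X" for x
 proof -
  have 1: "\<exists>i<r. \<forall>j<r. j ~= i --> alpha j \<otimes> x = x \<otimes> alpha j" if "x \<in> X0" for x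
  proof -
   obtain g where g: "g \<in> GA" "x = Th 0 g" using \<open>x \<in> X0\<close> by (auto simp: X0_def)
   obtain f where f: "f \<in> {1..q}" "g \<in> D1 \<inter> block {f}" using GA(2) g(1) by blast
   show ?thesis using straight_index[OF f] g(2) by simp
  qed
  show ?thesis
  proof (cases "x \<in> X0")
   case True
   then show ?thesis using 1 by blast
  next
   case False
   then obtain y where y: "y \<in> X0" "x = inv y" using x by (auto simp: X_def)
   obtain i where i: "i < r" "\<forall>j<r. j ~= i --> alpha j \<otimes> y = y \<otimes> alpha j" using 1[OF y(1)] by blast
   have yc: "y \<in> carrier G" using X0[OF y(1)] D1_carrier by blast
   have "\<forall>j<r. j ~= i --> alpha j \<otimes> x = x \<otimes> alpha j"
   proof (intro allI impI)
    fix j assume j: "j < r" "j ~= i"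
    have "alpha j \<otimes> y = y \<otimes> alpha j" using i(2) j by simp
    then show "alpha j \<otimes> x = x \<otimes> alpha j" unfolding y(2) by (rule commute_swap_inv[OF ab_carrier(1)[OF j(1)] yc yc])
   qed
   then show ?thesis using i(1) by blast
  qed
 qed
 then obtain idx where idx: "!!x. x \<in> X ==> idx x < r & (\<forall>j<r. j ~= idx x --> alpha j \<otimes> x = x \<otimes> alpha j)" by metis
 \<comment> \<open>A factor among the first \<open>q\<close> other than the factor
   \<open>i + 1\<close> of \<open>alpha i\<close>; it exists as \<open>q >= 2\<close>. Its element
   \<open>gam i\<close> commutes with the conjugates of \<open>alpha i\<close> and replaces
   \<open>beta i\<close> as height correction inside \<open>A\<close>.\<close>
 define gf where "gf i = (if i = 0 then 2 else 1 :: nat)" for i :: nat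
 define gam where "gam i = t (gf i) i" for i
 have gf: "gf i \<in> {1..q}" "gf i \<in> {1..n}" "gf i ~= i + 1" for i using q by (auto simp: gf_def)
 have gD: "gam i \<in> D1" "gam i \<in> block {1..q}" "!!j. j < r ==> \<tau> j (gam i) = (if j = i then 1 else 0)" if "i < r" for i
  using t_D1[OF gf(2) that] t_block[OF gf(2) that] block_mono[of "{gf i}" "{1..q}"] gf[of i] tau_t[OF gf(2) that] by (auto simp: gam_def)
 have conj_gam: "(inv x \<otimes> alpha i \<otimes> x) \<otimes> gam i = gam i \<otimes> (inv x \<otimes> alpha i \<otimes> x)" if "i < r" "x \<in> D1" for i x
 proof -
  have "i + 1 \<in> {1..n}" using that q by auto
  from t_comm[OF this gf(2) gf(3)[symmetric] that(1) that(1) D1_M0[OF that(2)] M0_closed(1)]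
  show ?thesis using gD(1)[OF that(1)] D1_carrier by (simp add: alpha_def gam_def)
 qed
 define sx where "sx x = inv x \<otimes> sg (idx x) \<otimes> x" for x
 define cx where "cx x = (inv x \<otimes> alpha (idx x) \<otimes> x) \<otimes> inv (gam (idx x))" for x
 define c1 where "c1 i = alpha i \<otimes> inv (gam i)" for i
 define z where "z i = gam i \<otimes> inv (beta i)" for i
 define S0 where "S0 = X \<union> Y \<union> Sg"
 define S where "S = S0 \<union> (sx ` X \<union> cx ` X \<union> c1 ` {..<r} \<union> z ` {..<r})"
 have H1D: "x \<in> D1" if "x \<in> H1" for x using that by (simp add: H1_iff)
 note cl = subgroup.m_closed[OF subgroup_H1] subgroup.m_inv_closed[OF subgroup_H1]
 note clA = subgroup.m_closed[OF subgroup_block] subgroup.m_inv_closed[OF subgroup_block]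
 have e1: "sx x \<in> H1" if "x \<in> X" for x unfolding sx_def
  using X(2)[OF that] sg_H1[of "idx x"] idx[OF that] by (intro cl) auto
 have aD: "alpha i \<in> M0" "beta i \<in> M0" "gam i \<in> M0" "alpha i \<in> D1" "beta i \<in> D1" "gam i \<in> D1" if "i < r" for i
  using ab_D1 gD that D1_M0 by auto
 have e2: "cx x \<in> H1" if x: "x \<in> X" for x
 proof -
  have i: "idx x < r" using idx[OF x] by simp
  have m: "x \<in> D1" "x \<in> M0" using X(2)[OF x] H1D D1_M0 by auto
  have "\<tau> j (cx x) = 0" if j: "j < r" for j
   unfolding cx_def using j m aD[OF i] tau_ab(1)[OF i j] gD(3)[OF i j] by (simp add: tau_mult tau_inv M0_closed)
  moreover have "cx x \<in> D1" unfolding cx_def using m aD[OF i] by (intro D1_closed) auto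
  ultimately show ?thesis by (simp add: H1_iff)
 qed
 have e3: "c1 i \<in> H1" "z i \<in> H1" if i: "i < r" for i
  using aD[OF i] tau_ab[OF i] gD(3)[OF i] D1_closed by (auto simp: H1_iff c1_def z_def tau_mult tau_inv M0_closed)
 have SH: "S <= H1" "S0 <= S" unfolding S_def S0_def Sg_def using X(2) Y(2) sg_H1 e1 e2 e3 by auto
 have fS: "finite S" "finite S0" "finite X" "finite Y" using fGA fGB by (auto simp: S_def S0_def X_def X0_def Y_def Sg_def)
 have Sc: "S <= carrier G" "S0 <= carrier G" using SH H1D D1_carrier by blast+
 \<comment> \<open>Generators of \<open>A\<close>, and of \<open>B\<close> in \<open>RB\<close>,
   that \<open>Th q\<close> and \<open>Th 0\<close> map into \<open>S0\<close>: letters of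
   \<open>X\<close> and \<open>Y\<close> are fixed, \<open>alpha k\<close> and
   \<open>inv (beta k)\<close> go to \<open>sg k\<close>.\<close>
 define RA where "RA = X \<union> alpha ` {..<r}"
 define RB where "RB = Y \<union> (%k. inv (beta k)) ` {..<r}"
 have RAA: "RA <= A" using X ab_AB(1) by (auto simp: RA_def)
 have RBB: "RB <= B" using Y ab_AB(2) subgroup.m_inv_closed[OF subgroup_AB(2)] by (auto simp: RB_def)
 have RAg: "gens A RA"
 proof (rule gens_straighten[OF GA(1), of 0])
  show "(%k. t (0 + k + 1) k) ` {..<r} <= generate G RA" by (auto simp: RA_def alpha_def intro!: generate.incl)
  show "Th 0 ` GA <= RA" by (auto simp: RA_def X_def X0_def)
 qed (use q RAA fS in \<open>auto simp: RA_def\<close>)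
 have RBc: "RB <= carrier G" using RBB D1_carrier by blast
 have RBg: "gens B RB"
 proof (rule gens_straighten[OF GB, of q])
  have "beta k \<in> generate G RB" if k: "k < r" for k
  proof -
   have "inv (beta k) \<in> RB" using k by (auto simp: RB_def)
   from generate.inv[OF this, of G] show ?thesis using ab_carrier(2)[OF k] by simp
  qed
  then show "(%k. t (q + k + 1) k) ` {..<r} <= generate G RB" by (auto simp: beta_def)
  show "Th q ` GB <= RB" by (auto simp: RB_def Y_def)
 qed (use q RBB fS in \<open>auto simp: RB_def\<close>)
 have thA: "Th q x \<in> S0" if "x \<in> RA" for x
  using that Th_id[of x q] X(2) Th_alpha by (auto simp: RA_def S0_def Sg_def H1_iff)
 have thB: "Th 0 x \<in> S0" if "x \<in> RB" for x
  using that Th_id[of x 0] Y(2) Th_beta by (auto simp: RB_def S0_def Sg_def H1_iff)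
 have dA: "{1..q} \<inter> {q + 1..q + r} = {}" "{q + 1..n} \<inter> {0 + 1..0 + r} = {}" using q by auto
 have evA: "ev (map_letters (Th q) w) = Th q (ev w)" if "w \<in> words A" for w
 proof (rule ev_map_hom[OF subgroup_AB(1) _ _ that])
  show "Th q x \<in> carrier G" if "x \<in> A" for x using Th_H1[of x q] that q H1D D1_carrier by auto
  show "Th q (x \<otimes> y) = Th q x \<otimes> Th q y" if "x \<in> A" "y \<in> A" for x y
   by (rule Th_mult[OF _ _ _ dA(1)]) (use that in auto)
 qed
 have evB: "ev (map_letters (Th 0) w) = Th 0 (ev w)" if "w \<in> words B" for w
 proof (rule ev_map_hom[OF subgroup_AB(2) _ _ that])
  show "Th 0 x \<in> carrier G" if "x \<in> B" for x using Th_H1[of x 0] that q H1D D1_carrier by auto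
  show "Th 0 (x \<otimes> y) = Th 0 x \<otimes> Th 0 y" if "x \<in> B" "y \<in> B" for x y
   by (rule Th_mult[OF _ _ _ dA(2)]) (use that in auto)
 qed
 have Th1: "Th p \<one> = \<one>" for p using Th_id[of \<one> p] D1_closed(1) tau_one by simp
 \<comment> \<open>\<open>h\<close> is the lift \<open>Th q a\<close> of its \<open>A\<close>-part
   times an element of \<open>H1\<close> lying in \<open>B\<close>; the two homomorphisms spell
   both.\<close>
 have gS0: "\<exists>w\<in>words S0. ev w = h" if h: "h \<in> H1" for h
 proof -
  have hc: "h \<in> carrier G" and hD: "h \<in> D1" using h H1D D1_carrier by auto
  define a where "a = ext {1..q} h"
  have aA: "a \<in> A" using D1_ext[OF hD] ext_block[OF hc] by (simp add: a_def)
  have ac: "a \<in> carrier G" using aA D1_carrier by blast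
  obtain wa where wa: "wa \<in> words RA" "ev wa = a" using RAg aA unfolding gens_def by blast
  have waA: "wa \<in> words A" by (rule words_mono[OF RAA wa(1)])
  have 1: "map_letters (Th q) wa \<in> words S0" by (rule words_map_letters[OF wa(1)]) (use thA in auto)
  have 2: "ev (map_letters (Th q) wa) = Th q a" using evA[OF waA] wa by simp
  have ThH: "Th q a \<in> H1" using Th_H1[of a q] aA q by simp
  define b where "b = inv (Th q a) \<otimes> h"
  have bH: "b \<in> H1" unfolding b_def by (rule cl(1)[OF cl(2)[OF ThH] h])
  have "{1..n} = {1..q} \<union> {q + 1..n}" using q by auto
  then have "h = a \<otimes> ext {q + 1..n} h" using ext_Un[OF hc, of "{1..q}" "{q + 1..n}"] ext_all[OF hc, of "{1..n}"] by (simp add: a_def)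
  then have "b = inv (Th q a) \<otimes> (a \<otimes> ext {q + 1..n} h)" by (simp add: b_def)
  also have "... = inv (E q (%j. - \<tau> j a)) \<otimes> ext {q + 1..n} h"
   using ac E_carrier ext_closed[OF hc] by (simp add: Th_def inv_mult_group m_assoc inv_cancel_left)
  also have "... \<in> block {q + 1..n}"
   using E_block[of q] q ext_block[OF hc] clA by simp
  finally have bB: "b \<in> B" using bH H1D by simp
  obtain wb where wb: "wb \<in> words RB" "ev wb = b" using RBg bB unfolding gens_def by blast
  have wbB: "wb \<in> words B" by (rule words_mono[OF RBB wb(1)])
  have 3: "map_letters (Th 0) wb \<in> words S0" by (rule words_map_letters[OF wb(1)]) (use thB in auto)
  have 4: "ev (map_letters (Th 0) wb) = b" using evB[OF wbB] wb Th_id[of b 0] bH by (simp add: H1_iff)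
  have "ev (map_letters (Th q) wa @ map_letters (Th 0) wb) = Th q a \<otimes> b"
   using 1 2 3 4 words_mono[OF Sc(2)] by simp
  also have "... = h" unfolding b_def using ThH H1D D1_carrier hc by (simp add: inv_cancel_left m_assoc[symmetric])
  finally have "ev (map_letters (Th q) wa @ map_letters (Th 0) wb) = h" .
  moreover have "map_letters (Th q) wa @ map_letters (Th 0) wb \<in> words S0" using 1 3 by simp
  ultimately show ?thesis by blast
 qed
 have "S0 <= H1" using SH by (rule order_trans[rotated])
 then have S0g: "gens H1 S0" using gS0 fS subgroup_H1 by (simp add: gens_def)
 have "\<exists>w\<in>words S. ev w = h" if hH: "h \<in> H1" for h
 proof -
  obtain w where "w \<in> words S0" "ev w = h" using gS0[OF hH] by (elim bexE)
  then show ?thesis using words_mono[OF SH(2)] by (intro bexI[of _ w])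
 qed
 then have Sg: "gens H1 S" using fS SH subgroup_H1 by (simp add: gens_def)
 obtain \<iota> c where \<iota>: "!!x. x \<in> S ==> \<iota> x \<in> words S0 & ev (\<iota> x) = x & length (\<iota> x) <= c"
  using gens_bounded[OF S0g fS(1) SH(1)] by metis
 obtain NA CA where "isop_at RA (VA RA) aA bA NA CA" using isoA RAg by (auto simp: isop_def isop_wrt_def)
 note fA = isop_atD[OF this]
 obtain NB CB where "isop_at RB (VB RB) aB bB NB CB" using isoB RBg by (auto simp: isop_def isop_wrt_def)
 note fB = isop_atD[OF this]
 define N where "N = NA + NB + c + 5"
 have sgS: "sg i \<in> S" if "i < r" for i using that by (simp add: S_def S0_def Sg_def)
 interpret bs: block_sort G X Y S sg r idx sx cx c1 z N
 proof (rule block_sort.intro[OF group_axioms], rule block_sort_axioms.intro)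
  show "S <= carrier G" "X <= S" "Y <= S" "4 <= N" using Sc by (auto simp: S_def S0_def N_def)
  show "sg i \<in> S & c1 i \<in> S & z i \<in> S" if "i < r" for i using that sgS by (auto simp: S_def)
  show "inv x \<in> X & sx x \<in> S & cx x \<in> S & idx x < r" if "x \<in> X" for x using that Xinv idx by (auto simp: S_def)
  show "sg i \<otimes> sg j = sg j \<otimes> sg i" if "i < r" "j < r" for i j by (rule sg_commute[OF that])
  show "x \<otimes> sx x = sg (idx x) \<otimes> x" if "x \<in> X" for x
   using Xc[OF that] sg_H1 idx[OF that] H1D D1_carrier by (simp add: sx_def m_assoc inv_cancel_left)
  show "sg i = c1 i \<otimes> z i & c1 i \<otimes> z i = z i \<otimes> c1 i" if i: "i < r" for i
  proof -
   have g: "alpha i \<otimes> gam i = gam i \<otimes> alpha i" using conj_gam[OF i D1_closed(1)] aD[OF i] D1_carrier by simp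
   have b: "alpha i \<otimes> beta i = beta i \<otimes> alpha i" "gam i \<otimes> beta i = beta i \<otimes> gam i"
    by (rule AB_commute, use ab_AB[OF i] gD(2)[OF i] in auto)+
   show ?thesis unfolding sg_def c1_def z_def
    using central_split[OF _ _ _ g b] aD[OF i] D1_carrier by blast
  qed
  show "sx x = cx x \<otimes> z (idx x) & cx x \<otimes> z (idx x) = z (idx x) \<otimes> cx x" if x: "x \<in> X" for x
  proof -
   have i: "idx x < r" using idx[OF x] by simp
   let ?a = "inv x \<otimes> alpha (idx x) \<otimes> x"
   have xb: "x \<in> D1" "x \<in> block {1..q}" using X(1)[OF x] by auto
   have ab: "?a \<in> block {1..q}" using xb ab_AB(1)[OF i] clA by auto
   have bB: "beta (idx x) \<in> block {q + 1..n}" using ab_AB(2)[OF i] by simp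
   have ac: "?a \<in> carrier G" using ab block_carrier by blast
   note g = conj_gam[OF i xb(1)]
   note b = AB_commute[OF ab bB] AB_commute[OF gD(2)[OF i] bB]
   have xbe: "x \<otimes> beta (idx x) = beta (idx x) \<otimes> x" by (rule AB_commute[OF xb(2) bB])
   have c: "x \<in> carrier G" "alpha (idx x) \<in> carrier G" "beta (idx x) \<in> carrier G" "gam (idx x) \<in> carrier G"
    using Xc[OF x] aD[OF i] D1_carrier by auto
   have "x \<otimes> inv (beta (idx x)) = inv (beta (idx x)) \<otimes> x" by (rule commute_swap_inv[OF c(1,3,3) xbe])
   then have "sx x = ?a \<otimes> inv (beta (idx x))" using c by (simp add: sx_def sg_def m_assoc)
   then show ?thesis unfolding cx_def z_def using central_split[OF ac c(4,3) g b] by simp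
  qed
  show "y \<otimes> x = x \<otimes> y & y \<otimes> cx x = cx x \<otimes> y" if "y \<in> Y" "x \<in> X" for x y
  proof -
   have i: "idx x < r" using idx[OF that(2)] by simp
   have xb: "x \<in> block {1..q}" "y \<in> block {q + 1..n}" using X(1)[OF that(2)] Y(1)[OF that(1)] by auto
   have cxb: "cx x \<in> block {1..q}" unfolding cx_def using xb ab_AB(1)[OF i] gD(2)[OF i] clA by auto
   show ?thesis by (rule conjI[OF HOL.sym[OF AB_commute[OF xb]] HOL.sym[OF AB_commute[OF cxb xb(2)]]])
  qed
  show "y \<otimes> c1 i = c1 i \<otimes> y" if "y \<in> Y" "i < r" for y i
  proof -
   have cb: "c1 i \<in> block {1..q}" unfolding c1_def using ab_AB(1)[OF that(2)] gD(2)[OF that(2)] clA by auto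
   have yb: "y \<in> block {q + 1..n}" using Y(1)[OF that(1)] by simp
   show ?thesis by (rule HOL.sym[OF AB_commute[OF cb yb]])
  qed
  show "sg j \<otimes> x = x \<otimes> sg j" if "x \<in> X" "j < r" "j ~= idx x" for x j
  proof -
   have c: "x \<in> carrier G" "alpha j \<in> carrier G" "beta j \<in> carrier G" using Xc[OF that(1)] ab_carrier[OF that(2)] by auto
   have 1: "alpha j \<otimes> x = x \<otimes> alpha j" using idx[OF that(1)] that by blast
   have 2: "x \<otimes> beta j = beta j \<otimes> x" by (rule AB_commute) (use X(1)[OF that(1)] ab_AB(2)[OF that(2)] in auto)
   have 3: "x \<otimes> inv (beta j) = inv (beta j) \<otimes> x" by (rule commute_swap_inv[OF c(1,3,3) 2])
   have "sg j \<otimes> x = alpha j \<otimes> (x \<otimes> inv (beta j))" unfolding 3 using c by (simp add: sg_def m_assoc)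
   also have "... = (alpha j \<otimes> x) \<otimes> inv (beta j)" using c by (simp add: m_assoc)
   also have "... = x \<otimes> sg j" unfolding 1 using c by (simp add: sg_def m_assoc)
   finally show ?thesis .
  qed
 qed
 have S0eq: "S0 = X \<union> Y \<union> sg ` {..<r}" by (simp add: S0_def Sg_def)
 \<comment> \<open>Each block is a conjugate of an element of \<open>A\<close>, and blocks of
   factors are normal.\<close>
 have blkA: "ev (bs.bw bl) \<in> block {1..q}" if "fst ` set bl <= X" for bl
  using that
 proof (induction bl)
  case Nil
  then show ?case using subgroup.one_closed[OF subgroup_block] by simp
 next
  case (Cons p bl)
  have p: "fst p \<in> X" "fst ` set bl <= X" using Cons.prems by auto
  let ?s = "sg (idx (fst p))"
  have sc: "?s \<in> carrier G" using sgS idx[OF p(1)] Sc by auto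
  have c: "bs.blk p \<in> words (carrier G)" "bs.bw bl \<in> words (carrier G)"
   using bs.blk_words(1)[OF p(1)] bs.bw_words[OF p(2)] words_carrier[OF Sc(1)] by auto
  have "ev (bs.blk p) = ?s [^] snd p \<otimes> (fst p \<otimes> ?s [^] (- snd p))"
   using sc Xc[OF p(1)] by (simp add: bs.blk_def ev_pw eval_word_Cons letter_val_def)
  also have "... = inv (?s [^] (- snd p)) \<otimes> fst p \<otimes> ?s [^] (- snd p)" using sc Xc[OF p(1)] by (simp add: int_pow_neg m_assoc)
  also have "... \<in> block {1..q}" by (rule block_conj) (use sc X(1)[OF p(1)] in auto)
  finally have "ev (bs.blk p) \<in> block {1..q}" .
  then show ?case using Cons.IH[OF p(2)] c clA(1) by simp
 qed
 let ?a = "%L. L ^ 4 + aA (L\<^sup>2) + aB L"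
 define K where "K = (3 * c + 1) * (CA + 1) * (CB + 1)"
 have "isop_wrt S (%_. UNIV) ?a (%L. L)"
 proof (rule isop_wrtI[where N = N and C = "K + CA + CB + 10"])
  fix L w assume w: "w \<in> words S" "ev w = \<one>" "(K + CA + CB + 10) * length w + (K + CA + CB + 10) <= L"
  let ?l = "length w" and ?F = "fill G S N (carrier G) \<one>"
  have KL: "K * ?l + K <= L" "?l <= L"
  proof -
   have "K * ?l <= (K + CA + CB + 10) * ?l" "1 * ?l <= (K + CA + CB + 10) * ?l" by (rule mult_le_mono1, simp)+
   then show "K * ?l + K <= L" "?l <= L" using w(3) by linarith+
  qed
  obtain w0 where w0: "w0 \<in> words S0" "ev w0 = ev w" "length w0 <= c * ?l" "?F ?l w w0"
   using fill_subst[OF \<iota> SH(2) Sc(1) _ w(1) one_closed, where N = N] by (auto simp: N_def)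
  obtain bl w2 where s: "length bl <= length w0" "fst ` set bl <= X" "\<forall>p\<in>set bl. nat \<bar>snd p\<bar> <= length w0"
   "w2 \<in> words (Y \<union> sg ` {..<r})" "length w2 <= length w0" "?F (9 * length w0 ^ 4) w0 (bs.bw bl @ w2)"
   using bs.F_sort[where w = w0 and g = \<one>, OF _ one_closed] w0(1) unfolding S0eq by blast
  have bwS: "bs.bw bl \<in> words S" "bs.bw bl \<in> words (X \<union> sg ` {..<r})" using bs.bw_words[OF s(2)] by auto
  have w2S: "w2 \<in> words S" by (rule words_mono[OF _ s(4)]) (use SH(2) S0eq in auto)
  have c2: "bs.bw bl \<in> words (carrier G)" "w2 \<in> words (carrier G)" using bwS w2S words_carrier[OF Sc(1)] by auto
  have e: "ev (bs.bw bl) \<otimes> ev w2 = \<one>" using fill_ev[OF s(6) Sc(1)] w0(2) w(2) c2 by simp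
  \<comment> \<open>Hence the projection to the last \<open>r\<close> factors sees only
    \<open>w2\<close>.\<close>
  have extB: "ext {q + 1..n} (ev (bs.bw bl)) = \<one>" by (rule ext_disjoint[OF blkA[OF s(2)]]) auto
  have "ext {q + 1..n} (ev (bs.bw bl)) \<otimes> ext {q + 1..n} (ev w2) = \<one>"
   using ext_mult[of "ev (bs.bw bl)" "ev w2" "{q + 1..n}"] c2 e ext_one by simp
  then have ew2: "ext {q + 1..n} (ev w2) = \<one>" using extB ext_closed c2 by simp
  have hom: "ev (map_letters (ext s) v) = ext s (ev v)" if "v \<in> words (carrier G)" for s v
   by (rule ev_map_hom[OF subgroup_self _ _ that]) (use ext_closed ext_mult in auto)
  let ?w2 = "map_letters (ext {q + 1..n}) w2" and ?bw = "map_letters (ext {1..q}) (bs.bw bl)"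
  \<comment> \<open>On the letters occurring in \<open>w2\<close>, projecting and then straightening
    is the identity, so a filling of the projected word maps to a filling of \<open>w2\<close>
    itself; \<open>xA\<close> does the same for the blocks.\<close>
  have xB: "ext {q + 1..n} x \<in> RB & Th 0 (ext {q + 1..n} x) = x" if xY: "x \<in> Y \<union> sg ` {..<r}" for x
  proof (cases "x \<in> Y")
   case True
   then have "ext {q + 1..n} x = x" using Y(1) by (intro ext_id) auto
   then show ?thesis using True Th_id[of x 0] Y(2)[OF True] by (simp add: RB_def H1_iff)
  next
   case False
   then obtain k where k: "k < r" "x = sg k" using xY by auto
   show ?thesis unfolding k(2) ext_sg(2)[OF k(1)] using k Th_beta by (auto simp: RB_def)
  qed
  have xA: "ext {1..q} x \<in> RA & Th q (ext {1..q} x) = x" if xX: "x \<in> X \<union> sg ` {..<r}" for x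
  proof (cases "x \<in> X")
   case True
   then have "ext {1..q} x = x" using X(1) by (intro ext_id) auto
   then show ?thesis using True Th_id[of x q] X(2)[OF True] by (simp add: RA_def H1_iff)
  next
   case False
   then obtain k where k: "k < r" "x = sg k" using xX by auto
   show ?thesis unfolding k(2) ext_sg(1)[OF k(1)] using k Th_alpha by (auto simp: RA_def)
  qed
  have w2': "?w2 \<in> words RB" "map_letters (Th 0) ?w2 = w2" "ev ?w2 = \<one>"
   using words_map_letters[OF s(4), of "ext {q + 1..n}" RB] map_letters_retract[OF s(4), of "Th 0" "ext {q + 1..n}"] xB hom[OF c2(2)] ew2 by auto
  have bw': "?bw \<in> words RA" "map_letters (Th q) ?bw = bs.bw bl"
   using words_map_letters[OF bwS(2), of "ext {1..q}" RA] map_letters_retract[OF bwS(2), of "Th q" "ext {1..q}"] xA by auto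
  have cw: "c * ?l <= L"
  proof -
   have "c <= K" by (simp add: K_def algebra_simps)
   then have "c * ?l <= K * ?l" by (rule mult_le_mono1)
   then show ?thesis using KL by linarith
  qed
  have lB: "CB * length ?w2 + CB <= L"
  proof -
   have "c * CB <= K" "CB <= K" by (simp_all add: K_def algebra_simps)
   moreover have "CB * length w2 <= CB * (c * ?l)" using order_trans[OF s(5) w0(3)] by (rule mult_le_mono2)
   moreover have "c * CB * ?l <= K * ?l" using \<open>c * CB <= K\<close> by (rule mult_le_mono1)
   moreover have "CB * (c * ?l) = c * CB * ?l" by simp
   ultimately show ?thesis using KL(1) by (simp only: length_map_letters)
  qed
  \<comment> \<open>There are at most \<open>c * length w\<close> blocks, each of length at most
    \<open>2 * (c * length w) + 1\<close>; this quadratic length is why \<open>aA\<close> is taken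
    at \<open>L\<^sup>2\<close>.\<close>
  have lA: "CA * length ?bw + CA <= L\<^sup>2"
  proof -
   let ?u = "c * ?l"
   have "length (bs.bw bl) <= length bl * (2 * ?u + 1)"
    by (rule bs.length_bw) (use s(3) w0(3) in fastforce)
   also have "... <= ?u * (2 * ?u + 1)" using order_trans[OF s(1) w0(3)] by (rule mult_le_mono1)
   also have "... <= 3 * ?u\<^sup>2" 
   proof -
    have "v * (2 * v + 1) <= 3 * v\<^sup>2" for v :: nat by (cases v) (auto simp: power2_eq_square)
    then show ?thesis .
   qed
   finally have "CA * length (bs.bw bl) <= CA * (3 * ?u\<^sup>2)" by (rule mult_le_mono2)
   moreover have "CA * (3 * ?u\<^sup>2) + CA <= (K * ?l + K)\<^sup>2"
   proof -
    let ?J = "(3 * c + 1) * (CA + 1)"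
    have "?J <= K" by (simp add: K_def)
    then have "(?J * ?l + ?J)\<^sup>2 <= (K * ?l + K)\<^sup>2" by (intro power_mono add_mono mult_le_mono1) auto
    moreover have "CA * (3 * ?u\<^sup>2) + CA <= (?J * ?l + ?J)\<^sup>2"
    proof -
     have j: "CA <= (CA + 1)\<^sup>2" "3 * c\<^sup>2 <= (3 * c + 1)\<^sup>2" "1 <= (3 * c + 1)\<^sup>2"
      unfolding power2_eq_square distrib_left distrib_right by simp_all
     have "CA * (3 * ?u\<^sup>2) = CA * (3 * c\<^sup>2) * ?l\<^sup>2" by (simp add: power_mult_distrib)
     also have "... <= (CA + 1)\<^sup>2 * (3 * c + 1)\<^sup>2 * ?l\<^sup>2" by (intro mult_le_mono j order_refl)
     also have "... = (?J * ?l)\<^sup>2" by (simp only: power_mult_distrib mult.commute mult.left_commute)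
     finally have 1: "CA * (3 * ?u\<^sup>2) <= (?J * ?l)\<^sup>2" .
     have "CA * 1 <= (CA + 1)\<^sup>2 * (3 * c + 1)\<^sup>2" by (intro mult_le_mono j)
     also have "... = ?J\<^sup>2" by (simp only: power_mult_distrib mult.commute)
     finally have 2: "CA <= ?J\<^sup>2" by simp
     have 3: "(x + y)\<^sup>2 = x\<^sup>2 + y\<^sup>2 + 2 * x * y" for x y :: nat by (rule power2_sum)
     show ?thesis unfolding 3[of "?J * ?l" ?J] using 1 2 by linarith
    qed
    ultimately show ?thesis by linarith
   qed
   moreover have "(K * ?l + K)\<^sup>2 <= L\<^sup>2" using KL(1) by (intro power_mono) auto
   ultimately show ?thesis unfolding length_map_letters by linarith
  qed
  have nB: "ev (map_letters (Th 0) v) = \<one>" if "v \<in> words RB" "ev v = \<one>" for v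
   using evB[OF words_mono[OF RBB that(1)]] that(2) Th1 by simp
  have nA: "ev (map_letters (Th q) v) = \<one>" if "v \<in> words RA" "ev v = \<one>" for v
   using evA[OF words_mono[OF RAA that(1)]] that(2) Th1 by simp
  have mB: "fill G S NB UNIV \<one> (CB * aB L) w2 []"
   using fill_map[OF fB[OF w2'(1,3) lB], where f = "Th 0" and S' = S and g' = \<one>] nB thB SH(2) w2'(2) by (simp add: image_subset_iff subsetD)
  \<comment> \<open>The filled tail is trivial in the whole group, and therefore so is the product
    of the blocks.\<close>
  have "ev w2 = \<one>" using fill_ev[OF mB Sc(1)] by simp
  then have eb: "ev (bs.bw bl) = \<one>" using e c2 by simp
  then have "ev ?bw = \<one>" using hom[OF c2(1)] ext_one by simp
  then have mA: "fill G S NA UNIV \<one> (CA * aA (L\<^sup>2)) (bs.bw bl) []"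
   using fill_map[OF fA[OF bw'(1) _ lA], where f = "Th q" and S' = S and g' = \<one>] nA thA SH(2) bw'(2) by (simp add: image_subset_iff subsetD)
  let ?U = "fill G S N UNIV \<one>"
  have m1: "?U (CB * aB L) w2 []" by (rule fill_mono[OF mB]) (auto simp: N_def)
  have m2: "?U (CA * aA (L\<^sup>2)) (bs.bw bl) []" by (rule fill_mono[OF mA]) (auto simp: N_def)
  have m3: "?U ?l w w0" by (rule fill_mono[OF w0(4)]) auto
  have m4: "?U (9 * length w0 ^ 4) w0 (bs.bw bl @ w2)" by (rule fill_mono[OF s(6)]) auto
  have m5: "?U (CA * aA (L\<^sup>2)) (bs.bw bl @ w2) ([] @ w2)" by (rule fill_append1[OF m2 w2S Sc(1) one_closed])
  have "?U (CA * aA (L\<^sup>2)) (bs.bw bl @ w2) w2" using m5 by simp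
  from fill.trans[OF fill.trans[OF m3 m4] fill.trans[OF this m1]]
  have m6: "?U (?l + 9 * length w0 ^ 4 + (CA * aA (L\<^sup>2) + CB * aB L)) w []" by (simp add: add.assoc)
  have "length w0 <= L" using w0(3) cw by linarith
  then have "length w0 ^ 4 <= L ^ 4" by (rule power_mono) simp
  moreover have "?l <= L ^ 4" using KL(2) self_le_power[of L 4] by (cases "L = 0") auto
  moreover have "10 * L ^ 4 <= (K + CA + CB + 10) * L ^ 4" "CA * aA (L\<^sup>2) <= (K + CA + CB + 10) * aA (L\<^sup>2)"
   "CB * aB L <= (K + CA + CB + 10) * aB L" by (rule mult_le_mono1, simp)+
  ultimately have "?l + 9 * length w0 ^ 4 + (CA * aA (L\<^sup>2) + CB * aB L) <= (K + CA + CB + 10) * ?a L"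
   unfolding distrib_left[of "K + CA + CB + 10"] by linarith
  then show "?U ((K + CA + CB + 10) * ?a L) w []" by (rule fill_weaken[OF m6])
 qed
 then show ?thesis
 proof (rule isop_UNIVI[OF Sg])
  show "L <= ?a L & L <= L" for L using self_le_power[of L 4] by (cases "L = 0") auto
 qed
qed

end

section \<open>The Dehn function of a subgroup of small corank\<close>

section \<open>The Dehn function of a subgroup of small corank\<close>

lemma dehn_function_mono:
 assumes P: "finite_presentation P" and l: "l <= l'"
 shows "dehn_function P l <= dehn_function P l'"
proof -
 let ?F = "%l. {word_area P w |w. null_homotopic P w & length w <= l}"
 have fin: "finite (?F l)" for l
 proof (rule finite_subset)
  show "?F l <= word_area P ` {w \<in> words (fst P). length w <= l}" by (auto simp: null_homotopic_def)
  show "finite (word_area P ` {w \<in> words (fst P). length w <= l})"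
   using finite_words_bounded[of "fst P" l] P by (simp add: finite_presentation_def)
 qed
 have "null_homotopic P []" by (simp add: null_homotopic_def presented_group_def)
 then have "word_area P [] \<in> ?F l" by fastforce
 then have ne: "?F l ~= {}" by blast
 show ?thesis unfolding dehn_function_def by (rule Max_mono[OF _ ne fin]) (use l in fastforce)
qed

context direct_factors
begin

text \<open>Adding \<open>L\<close> to the Dehn function and to a radius bound makes both dominate
  the identity, as the transfer lemmas require.\<close>

lemma isop_block_dehn:
 assumes s: "s <= {1..n}" and P: "finite_presentation_of P (product_group s \<Gamma>)"
 shows "\<exists>b. isop (block s) word_ball (%L. dehn_function P L + L) b & (\<forall>L. L <= b L)"
proof -
 obtain \<rho> where \<rho>: "area_radius_pair P (dehn_function P) \<rho>"
  using dehn_area_radius_pair[of P] P by (auto simp: finite_presentation_of_def)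
 have "group (product_group s \<Gamma>)" using grp s by (intro product_group) auto
 from isop_of_presentation[OF P this ext_hom[OF s] ext_inj[OF s] \<rho>, of "%L. dehn_function P L + L" "%L. \<rho> L + L"]
 have "isop (block s) word_ball (%L. dehn_function P L + L) (%L. \<rho> L + L)" using ext_image[OF s] by simp
 then show ?thesis by (intro exI[of _ "%L. \<rho> L + L"]) simp
qed

text \<open>For positive corank the fibre product has fillings of area \<open>L ^ 4\<close> plus the
  two Dehn functions at \<open>L\<^sup>2\<close> and \<open>L\<close>, up to lower terms. The lower
  bound absorbs \<open>L ^ 4\<close> into the first of these, and the factor \<open>l\<close> only
  enlarges the bound once the argument is positive. For corank 0 the first block is the whole
  product, in which \<open>H\<close> has finite index.\<close>

lemma dehn_splitting:
 assumes n: "n \<ge> max 3 (2 * r)" and P1: "finite_presentation_of P1 (product_group {1..n - r} \<Gamma>)"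
  and P2: "finite_presentation_of P2 (product_group {n - r + 1..n} \<Gamma>)"
  and vf: "virtually_full {1..n} \<Gamma> H" and vc: "virtually_coabelian_of_corank G H r"
 shows "isoperimetric_function (G\<lparr>carrier := H\<rparr>) (%l. l * dehn_function P1 (l ^ 2) + dehn_function P2 l)"
proof -
 have fP1: "finite_presentation P1" using P1 by (simp add: finite_presentation_of_def)
 have fP2: "finite_presentation P2" using P2 by (simp add: finite_presentation_of_def)
 note mono1 = dehn_function_mono[OF fP1] and mono2 = dehn_function_mono[OF fP2]
 let ?b1 = "dehn_function P1" and ?b2 = "dehn_function P2"
 obtain bA where bA: "isop (block {1..n - r}) word_ball (%L. ?b1 L + L) bA" "\<forall>L. L <= bA L"
  using isop_block_dehn[OF _ P1] by auto
 have "{n - r + 1..n} <= {1..n}" by auto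
 from isop_block_dehn[OF this P2]
 obtain bB where bB: "isop (block {n - r + 1..n}) word_ball (%L. ?b2 L + L) bB" "\<forall>L. L <= bB L" by blast
 obtain SA SB where S: "gens (block {1..n - r}) SA" "gens (block {n - r + 1..n}) SB" using bA bB by (auto simp: isop_def)
 have com: "x \<otimes> y = y \<otimes> x" if "x \<in> block {1..n - r}" "y \<in> block {n - r + 1..n}" for x y
  by (rule block_commute[OF that]) auto
 have "{1..n - r} \<union> {n - r + 1..n} = {1..n}" by auto
 then have "carrier G = block {1..n - r} <#> block {n - r + 1..n}"
  using block_Un[of "{1..n - r}" "{n - r + 1..n}"] block_all[of "{1..n}"] by simp
 then have SG: "gens (carrier G) (SA \<union> SB)" using gens_commuting_product[OF com S] by simp
 obtain M0 \<tau> t where c: "coab G M0 \<tau> r t {1..n}" "\<forall>i\<in>{1..n}. \<forall>j<r. t i j \<in> block {i}" "fin_idx M0 (carrier G)"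
   "fin_idx (coab.level M0 \<tau> r) H"
  using coordinates[OF vf vc SG] by blast
 interpret cb: coab G M0 \<tau> r t "{1..n}" by (rule c(1))
 show ?thesis
 proof (cases "r = 0")
  case True
  have "isop (carrier G) word_ball (%L. ?b1 L + L) bA" using bA(1) block_all[of "{1..n}"] True by simp
  then have "isop M0 word_ball (%L. ?b1 L + L) bA" by (rule isop_ball_fin_idx[OF _ c(3)]) (use bA(2) in simp)
  moreover have "cb.level r = M0" using True by (simp add: cb.level_def)
  ultimately have "isop H (%_ _. UNIV) (%L. ?b1 L + L) bA"
   using isop_overgroup[of M0 word_ball "%L. ?b1 L + L" bA H] c(4) bA(2) by simp
  from isop_imp_presentation[OF this] obtain P' :: "nat presentation" and C where P':
   "finite_presentation_of P' (G\<lparr>carrier := H\<rparr>)" "\<forall>l. dehn_function P' l <= C * (?b1 (C * l + C) + (C * l + C))"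
   by blast
  have "dehn_le (dehn_function P') (%l. l * ?b1 (l ^ 2) + ?b2 l)"
   unfolding dehn_le_def
  proof (intro exI[of _ "C + C * C + 1"] allI)
   fix l
   let ?D = "C + C * C + 1"
   let ?m = "?D * l + ?D"
   have "C * l + C <= ?m" by (simp add: distrib_right)
   moreover have "1 <= ?m" by simp
   ultimately have "C * l + C <= ?m ^ 2" using self_le_power[of ?m 2] by linarith
   then have b: "?b1 (C * l + C) <= ?b1 (?m ^ 2)" by (rule mono1)
   have "1 * ?b1 (?m ^ 2) <= ?m * ?b1 (?m ^ 2)" by (rule mult_le_mono1) simp
   then have "C * ?b1 (C * l + C) <= ?D * (?m * ?b1 (?m ^ 2))" using b by (intro mult_le_mono) auto
   moreover have "C * (C * l + C) <= ?D * l + ?D" by (simp add: algebra_simps)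
   moreover have "?D * (?m * ?b1 (?m ^ 2)) <= ?D * (?m * ?b1 (?m ^ 2) + ?b2 ?m)" by (rule mult_le_mono2) simp
   moreover have "dehn_function P' l <= C * ?b1 (C * l + C) + C * (C * l + C)" using P'(2) by (simp add: distrib_left)
   ultimately show "dehn_function P' l <= ?D * (?m * ?b1 (?m ^ 2) + ?b2 ?m) + ?D * l + ?D" by linarith
  qed
  then show ?thesis using P'(1) unfolding isoperimetric_function_def by blast
 next
  case False
  interpret sp: split_coab G \<Gamma> n M0 \<tau> r t
   by (unfold_locales) (use c False n in auto)
  have iA: "isop sp.A word_ball (%L. ?b1 L + L) bA"
   by (rule isop_ball_fin_idx[OF bA(1) fin_idx_inter[OF sp.fin_idx_D1 subgroup_block block_carrier]]) (use bA(2) in simp)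
  have iB: "isop sp.B word_ball (%L. ?b2 L + L) bB"
   by (rule isop_ball_fin_idx[OF bB(1) fin_idx_inter[OF sp.fin_idx_D1 subgroup_block block_carrier]]) (use bB(2) in simp)
  have "fin_idx sp.H1 H"
   unfolding sp.H1_def
   by (rule fin_idx_trans[OF fin_idx_inter[OF sp.fin_idx_D1 cb.subgroup_level[OF order_refl]] c(4)])
    (use cb.level_M0 cb.M0_carrier in auto)
  then have iso: "isop H (%_ _. UNIV) (%L. L ^ 4 + (?b1 (L\<^sup>2) + L\<^sup>2) + (?b2 L + L)) (%L. L)"
   by (rule isop_overgroup[OF sp.isop_H1[OF SG iA iB]]) simp
  \<comment> \<open>Factors 1 and 2 both lie among the first \<open>n - r\<close>. Their elements
    \<open>t 1 0\<close> and \<open>t 2 0\<close> commute and are separated by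
    \<open>\<tau> 0\<close> applied to the projections onto these factors.\<close>
  obtain C0 where C0: "\<forall>m L. C0 * m + C0 <= L --> m\<^sup>2 <= C0 * (?b1 L + L)"
  proof -
   have r0: "0 < r" using False by simp
   have i: "1 \<in> {1..n}" "2 \<in> {1..n}" "{1} <= {1..n - r}" "{2} <= {1..n - r}" using n r0 by auto
   let ?p = "%k x. \<tau> 0 (ext {k :: nat} x)"
   have A: "t 1 0 \<in> sp.A" "t 2 0 \<in> sp.A"
    using sp.t_D1[OF i(1) r0] sp.t_D1[OF i(2) r0] sp.t_block[OF i(1) r0] sp.t_block[OF i(2) r0] block_mono[OF i(3)] block_mono[OF i(4)] by auto
   have co: "t 1 0 \<otimes> t 2 0 = t 2 0 \<otimes> t 1 0"
    by (rule block_commute[OF sp.t_block[OF i(1) r0] sp.t_block[OF i(2) r0]]) simp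
   have pm: "?p k (x \<otimes> y) = ?p k x + ?p k y" if "x \<in> sp.A" "y \<in> sp.A" for k x y
    using that sp.D1_carrier sp.D1_M0[OF sp.D1_ext] cb.tau_mult[OF r0] by (simp add: ext_mult)
   have e: "ext {1} (t 1 0) = t 1 0" "ext {2} (t 2 0) = t 2 0" "ext {1} (t 2 0) = \<one>" "ext {2} (t 1 0) = \<one>"
    using ext_id[OF sp.t_block[OF i(1) r0]] ext_id[OF sp.t_block[OF i(2) r0]]
     ext_disjoint[OF sp.t_block[OF i(1) r0], of "{2}"] ext_disjoint[OF sp.t_block[OF i(2) r0], of "{1}"] by auto
   have v: "?p 1 (t 1 0) = 1" "?p 1 (t 2 0) = 0" "?p 2 (t 1 0) = 0" "?p 2 (t 2 0) = 1"
    unfolding e using cb.tau_t[OF i(1) r0 r0] cb.tau_t[OF i(2) r0 r0] cb.tau_one[OF r0] by auto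
   have "\<exists>C. \<forall>m L. C * m + C <= L --> m\<^sup>2 <= C * (?b1 L + L)"
    by (rule quadratic_lower_bound[OF iA A co pm v(1,2) pm v(3,4)])
   then show ?thesis using that by blast
  qed
  from isop_imp_presentation[OF iso] obtain P' :: "nat presentation" and C where P':
   "finite_presentation_of P' (G\<lparr>carrier := H\<rparr>)"
   "\<forall>l. dehn_function P' l <= C * ((C * l + C) ^ 4 + (?b1 ((C * l + C)\<^sup>2) + (C * l + C)\<^sup>2) + (?b2 (C * l + C) + (C * l + C)))"
   by blast
  \<comment> \<open>Three times the additive constant in the bound for \<open>L ^ 4\<close> below,
    because \<open>L ^ 4 + L\<^sup>2 + L <= 3 * L ^ 4\<close>.\<close>
  define Q where "Q = 3 * C0 ^ 4 + 6 * C0\<^sup>2"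
  \<comment> \<open>The summands secure, in turn, \<open>k <= m\<^sup>2\<close>, the coefficient of
    the first Dehn function, that of the second, and the additive constant.\<close>
  define D where "D = (C0 + 1) * (C + 1) + C * (6 * C0 + 1) + C + C * Q"
  have "dehn_le (dehn_function P') (%l. l * ?b1 (l ^ 2) + ?b2 l)"
   unfolding dehn_le_def
  proof (intro exI[of _ D] allI)
   fix l
   define L where "L = C * l + C"
   define m where "m = D * l + D"
   \<comment> \<open>The least argument at which the lower bound applies to the exponent
     \<open>L\<^sup>2\<close>.\<close>
   define k where "k = C0 * L\<^sup>2 + C0"
   have "(L\<^sup>2)\<^sup>2 <= C0 * (?b1 k + k)" using C0[rule_format, of "L\<^sup>2" k] by (simp add: k_def)
   then have 1: "L ^ 4 <= C0 * ?b1 k + (C0\<^sup>2 * L\<^sup>2 + C0\<^sup>2)"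
    by (simp add: k_def algebra_simps power2_eq_square power4_eq_xxxx)
   \<comment> \<open>The linear term of the lower bound has become
     \<open>C0\<^sup>2 * L\<^sup>2\<close>; the inequality between arithmetic and geometric means
     absorbs it into half of \<open>L ^ 4\<close> and a constant.\<close>
   have 2: "2 * (C0\<^sup>2 * L\<^sup>2) <= C0 ^ 4 + L ^ 4"
   proof -
    have "real (2 * (C0\<^sup>2 * L\<^sup>2)) <= real (C0 ^ 4 + L ^ 4)"
     using sum_squares_bound[of "real (C0\<^sup>2)" "real (L\<^sup>2)"] by (simp add: power2_eq_square power4_eq_xxxx mult.assoc)
    then show ?thesis by (simp only: of_nat_le_iff)
   qed
   have 3: "L ^ 4 <= 2 * (C0 * ?b1 k) + (C0 ^ 4 + 2 * C0\<^sup>2)" using 1 2 by linarith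
   have 4: "L\<^sup>2 <= L ^ 4" "L <= L ^ 4"
    using power_increasing[of 2 4 L] self_le_power[of L 4] by (cases "L = 0"; simp)+
   have J: "(C0 + 1) * (C + 1) <= D" by (simp add: D_def)
   have "((C0 + 1) * (C + 1)) * l + (C0 + 1) * (C + 1) <= m" unfolding m_def using J by (intro add_mono mult_le_mono1) auto
   then have mm: "(C0 + 1) * ((C + 1) * l + (C + 1)) <= m" by (simp add: algebra_simps)
   have Lm: "L <= m" "1 <= m" using mm by (simp_all add: L_def algebra_simps)
   have "k <= ((C0 + 1) * ((C + 1) * l + (C + 1)))\<^sup>2"
    unfolding k_def L_def by (simp add: power2_eq_square algebra_simps)
   also have "... <= m\<^sup>2" using mm by (rule power_mono) simp
   finally have b1: "?b1 k <= ?b1 (m\<^sup>2)" by (rule mono1)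
   have "L\<^sup>2 <= m\<^sup>2" using Lm(1) by (rule power_mono) simp
   then have b2: "?b1 (L\<^sup>2) <= ?b1 (m\<^sup>2)" by (rule mono1)
   have b3: "?b2 L <= ?b2 m" by (rule mono2[OF Lm(1)])
   have b4: "C0 * ?b1 k <= C0 * ?b1 (m\<^sup>2)" using b1 by (rule mult_le_mono2)
   have "L ^ 4 + (?b1 (L\<^sup>2) + L\<^sup>2) + (?b2 L + L) <= 6 * (C0 * ?b1 (m\<^sup>2)) + Q + ?b1 (m\<^sup>2) + ?b2 m"
    unfolding Q_def using 3 4 b2 b3 b4 by linarith
   also have "... = (6 * C0 + 1) * ?b1 (m\<^sup>2) + ?b2 m + Q" by (simp add: algebra_simps)
   finally have "C * (L ^ 4 + (?b1 (L\<^sup>2) + L\<^sup>2) + (?b2 L + L)) <= C * ((6 * C0 + 1) * ?b1 (m\<^sup>2) + ?b2 m + Q)" by (rule mult_le_mono2)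
   also have "... = (C * (6 * C0 + 1)) * ?b1 (m\<^sup>2) + C * ?b2 m + C * Q" by (simp add: algebra_simps)
   also have "... <= D * (m * ?b1 (m\<^sup>2)) + D * ?b2 m + D"
   proof -
    \<comment> \<open>Here \<open>m >= 1\<close> provides the factor in front of the first Dehn
      function.\<close>
    have "1 * ?b1 (m\<^sup>2) <= m * ?b1 (m\<^sup>2)" using Lm(2) by (rule mult_le_mono1)
    then have "(C * (6 * C0 + 1)) * ?b1 (m\<^sup>2) <= D * (m * ?b1 (m\<^sup>2))" by (intro mult_le_mono) (auto simp: D_def)
    moreover have "C * ?b2 m <= D * ?b2 m" by (rule mult_le_mono1) (simp add: D_def)
    moreover have "C * Q <= D" by (simp add: D_def)
    ultimately show ?thesis by linarith
   qed
   finally have "C * (L ^ 4 + (?b1 (L\<^sup>2) + L\<^sup>2) + (?b2 L + L)) <= D * (m * ?b1 (m\<^sup>2) + ?b2 m) + D" by (simp add: distrib_left)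
   then show "dehn_function P' l <= D * ((D * l + D) * ?b1 ((D * l + D)\<^sup>2) + ?b2 (D * l + D)) + D * l + D"
    using P'(2)[rule_format, of l] unfolding L_def[symmetric] m_def[symmetric] by linarith
  qed
  then show ?thesis using P'(1) unfolding isoperimetric_function_def by blast
 qed
qed

end

theorem theorem1:
  fixes \<Gamma> :: "nat \<Rightarrow> ('a, 'b) monoid_scheme" and n r :: nat and H :: "(nat \<Rightarrow> 'a) set"
  defines "D \<equiv> product_group {1..n} \<Gamma>"
  assumes "\<And>i. i \<in> {1..n} \<Longrightarrow> group (\<Gamma> i)"
    and "subgroup H D"
    and "virtually_full {1..n} \<Gamma> H"
    and "virtually_coabelian_of_corank D H r"
  shows
    "((\<forall>i\<in>{1..n}. finitely_generated (\<Gamma> i)) \<and> n \<ge> 2 \<longrightarrow>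
        finitely_generated (D\<lparr>carrier := H\<rparr>) \<and>
        (\<forall>S T. finite_generating_set D S \<and> finite_generating_set (D\<lparr>carrier := H\<rparr>) T \<longrightarrow>
          distortion_le (distortion D S H T) (\<lambda>l. l ^ 2)))
   \<and> ((\<forall>i\<in>{1..n}. finitely_presented (\<Gamma> i)) \<and> n \<ge> 3 \<longrightarrow>
        finitely_presented (D\<lparr>carrier := H\<rparr>))
   \<and> ((\<forall>i\<in>{1..n}. finitely_presented (\<Gamma> i)) \<and> n \<ge> 3 \<longrightarrow>
        (\<forall>(P :: nat \<Rightarrow> 'x presentation) \<alpha> \<rho>.
          (\<forall>i\<in>{1..n}. finite_presentation_of (P i) (\<Gamma> i) \<and> area_radius_pair (P i) (\<alpha> i) (\<rho> i)) \<longrightarrow>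
          isoperimetric_function (D\<lparr>carrier := H\<rparr>)
            (\<lambda>l. Max ({l} \<union> (\<lambda>i. \<rho> i l) ` {1..n}) ^ (2 * r) * Max ({l ^ 2} \<union> (\<lambda>i. \<alpha> i l) ` {1..n}))))
   \<and> ((\<forall>i\<in>{1..n}. finitely_presented (\<Gamma> i)) \<and> n \<ge> max 3 (2 * r) \<longrightarrow>
        (\<forall>(P1 :: 'y presentation) (P2 :: 'z presentation).
          finite_presentation_of P1 (product_group {1..n - r} \<Gamma>) \<and>
          finite_presentation_of P2 (product_group {n - r + 1..n} \<Gamma>) \<longrightarrow>
          isoperimetric_function (D\<lparr>carrier := H\<rparr>)
            (\<lambda>l. l * dehn_function P1 (l ^ 2) + dehn_function P2 l)))"
proof -
  interpret DG: group D unfolding D_def by (rule product_group) (rule assms(2))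
  interpret DF: direct_factors D \<Gamma> n
  proof (rule direct_factors.intro[OF DG.group_axioms], rule direct_factors_axioms.intro)
    show "D = product_group {1..n} \<Gamma>" by (simp add: D_def)
    show "group (\<Gamma> i)" if "i \<in> {1..n}" for i by (rule assms(2)[OF that])
  qed
  show ?thesis
  proof (intro conjI[of "_ \<longrightarrow> _"] impI allI)
    assume a: "(\<forall>i\<in>{1..n}. finitely_generated (\<Gamma> i)) \<and> n \<ge> 2"
    show "finitely_generated (D\<lparr>carrier := H\<rparr>) \<and>
      (\<forall>S T. finite_generating_set D S \<and> finite_generating_set (D\<lparr>carrier := H\<rparr>) T \<longrightarrow>
        distortion_le (distortion D S H T) (\<lambda>l. l ^ 2))"
      by (rule DF.finitely_generated_distortion[OF _ _ assms(4,5)]) (use a in auto)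
  next
    assume a: "(\<forall>i\<in>{1..n}. finitely_presented (\<Gamma> i)) \<and> n \<ge> 3"
    show "finitely_presented (D\<lparr>carrier := H\<rparr>)"
      by (rule DF.finitely_presented_subgroup[OF _ _ assms(4,5)]) (use a in auto)
  next
    fix P :: "nat \<Rightarrow> 'x presentation" and \<alpha> \<rho>
    assume a: "(\<forall>i\<in>{1..n}. finitely_presented (\<Gamma> i)) \<and> n \<ge> 3"
      and b: "\<forall>i\<in>{1..n}. finite_presentation_of (P i) (\<Gamma> i) \<and> area_radius_pair (P i) (\<alpha> i) (\<rho> i)"
    show "isoperimetric_function (D\<lparr>carrier := H\<rparr>)
      (\<lambda>l. Max ({l} \<union> (\<lambda>i. \<rho> i l) ` {1..n}) ^ (2 * r) * Max ({l ^ 2} \<union> (\<lambda>i. \<alpha> i l) ` {1..n}))"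
      by (rule DF.presentation_area_radius[OF bspec[OF b] _ assms(4,5)]) (use a in auto)
  next
    fix P1 :: "'y presentation" and P2 :: "'z presentation"
    assume a: "(\<forall>i\<in>{1..n}. finitely_presented (\<Gamma> i)) \<and> n \<ge> max 3 (2 * r)"
      and b: "finite_presentation_of P1 (product_group {1..n - r} \<Gamma>) \<and> finite_presentation_of P2 (product_group {n - r + 1..n} \<Gamma>)"
    show "isoperimetric_function (D\<lparr>carrier := H\<rparr>) (\<lambda>l. l * dehn_function P1 (l ^ 2) + dehn_function P2 l)"
      by (rule DF.dehn_splitting[OF _ _ _ assms(4,5)]) (use a b in auto)
  qed
qed

end
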